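(* Let $\bar u$ be a strongly stable solution of the problem of minimising $\mathcal E$ locally over $\dot{\mathcal W}^{1,2}$, i.e. $\bar u\in\dot{\mathcal W}^{1,2}$, $\delta\mathcal E(\bar u)=0$, and there is $c_0>0$ with $\langle\delta^2\mathcal E(\bar u)v,v\rangle\ge c_0\|\nabla v\|_{L^2}^2$ for all $v\in\dot{\mathcal W}^{\rm c}$. For each $R$ let $\Omega_R\subset\Lambda$ be a (finite) computational domain with $B_R\cap\Lambda\subset\Omega_R$ and set $\dot{\mathcal W}^0(\Omega_R):=\{v\in\dot{\mathcal W}^{\rm c}: v=0\text{ in }\Lambda\setminus\Omega_R\}$. Then there exist $C,R_0>0$ such that, for all $R\ge R_0$, there exists a strongly stable solution $\bar u_R^0$ of $$\bar u_R^0\in\arg\min\{\mathcal E(u): u\in\dot{\mathcal W}^0(\Omega_R)\}$$ ($\arg\min$ denoting the set of local minimisers) satisfying $$\|\nabla\bar u_R^0-\nabla\bar u\|_{L^2}\le CR^{-d/2}\qquad\text{and}\qquad|\mathcal E(\bar u_R^0)-\mathcal E(\bar u)|\le CR^{-d}.$$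
   Context: Setting (point defect). Let $d\in\{2,3\}$, $A\in\mathbb R^{d\times d}$ nonsingular, $B_r$ the ball of radius $r$ centred at $0$. The reference configuration $\Lambda\subset\mathbb R^d$ satisfies, for some $R_{\rm def}>0$, $\Lambda\setminus B_{R_{\rm def}}=A\mathbb Z^d\setminus B_{R_{\rm def}}$ and $\Lambda\cap B_{R_{\rm def}}$ is finite. $\mathcal T_\Lambda$ is a regular (conforming, shape-regular) partition of $\mathbb R^d$ into triangles ($d=2$) or tetrahedra ($d=3$) with node set $\Lambda$, homogeneous outside $B_{R_{\rm def}}$: if $T\in\mathcal T_\Lambda$, $\rho\in A\mathbb Z^d$ and $T,\rho+T\subset\mathbb R^d\setminus B_{R_{\rm def}}$, then $\rho+T\in\mathcal T_\Lambda$. For $u:\Lambda\to\mathbb R^d$, $Iu$ is its continuous piecewise affine interpolant with respect to $\mathcal T_\Lambda$ and $\nabla u:=\nabla Iu$. Define $\dot{\mathcal W}^{\rm c}:=\{u:\Lambda\to\mathbb R^d:\ \mathrm{supp}(\nabla u)\text{ compact}\}$ and $\dot{\mathcal W}^{1,2}:=\{u:\Lambda\to\mathbb R^d:\ \nabla u\in L^2\}$ (with semi-norm $\|\nabla u\|_{L^2}$). Stencils: for each $\ell\in\Lambda$ a set $\mathcal R_\ell\subset(B_{r_{\rm cut}}\cap(\Lambda-\ell))\setminus\{0\}$ is given, $r_{\rm cut}>0$ fixed; $D_\rho u(\ell):=u(\ell+\rho)-u(\ell)$, $Du(\ell):=(D_\rho u(\ell))_{\rho\in\mathcal R_\ell}$.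 If $(\ell,\ell+\rho)$ is an edge of $\mathcal T_\Lambda$ then $\rho\in\mathcal R_\ell$. Energy: $V_\ell\in C^k((\mathbb R^d)^{\mathcal R_\ell})$, $k\ge4$, with $V_\ell(0)=0$. For $|\ell|\ge R_{\rm def}$: $\mathcal R_\ell\equiv\mathcal R$, $V_\ell\equiv V$, and point symmetry holds: $-\mathcal R=\mathcal R$ and $V((-g_{-\rho})_{\rho\in\mathcal R})=V(g)$ for all $g\in(\mathbb R^d)^{\mathcal R}$. Moreover $Ae_n\in\mathcal R$, $n=1,\dots,d$. $\mathcal E(u):=\sum_{\ell\in\Lambda}V_\ell(Du(\ell))$ for $u\in\dot{\mathcal W}^{\rm c}$; $\mathcal E$ has a unique continuous extension to $\dot{\mathcal W}^{1,2}$, also denoted $\mathcal E$, which is of class $C^k$. A strongly stable solution of the finite-dimensional problem means a critical point of $\mathcal E$ restricted to $\dot{\mathcal W}^0(\Omega_R)$ at which $\delta^2\mathcal E$ is bounded below by $c\|\nabla v\|_{L^2}^2$, for some $c>0$, on $\dot{\mathcal W}^0(\Omega_R)$. The constant $C$ may depend on $\bar u$ and the potentials but not on $R$. *)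

theory Defs
  imports "HOL-Analysis.Analysis"
begin

section \<open>Reference configuration and triangulation\<close>

definition bravais_lattice :: "real^'d^'d \<Rightarrow> (real^'d) set" where
  "bravais_lattice A = (\<lambda>z. A *v z) ` {z. \<forall>i. z $ i \<in> \<int>}"

text \<open>
  The library's \<open>triangulation\<close> only covers finite families.  Distinct cells have disjoint
  interiors because they meet in a common face.  The last conjunct is shape regularity: the ratio
  of the diameter to the radius of an inscribed ball is bounded uniformly over the cells.
\<close>
definition regular_partition :: "(real^'d) set set \<Rightarrow> (real^'d) set \<Rightarrow> bool" where
  "regular_partition \<T> \<Lambda> \<longleftrightarrow>
     (\<forall>T\<in>\<T>. int CARD('d) simplex T) \<and>
     \<Union>\<T> = UNIV \<and>
     (\<forall>T\<in>\<T>. \<forall>T'\<in>\<T>. T \<inter> T' face_of T \<and> T \<inter> T' face_of T') \<and>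
     {x. \<exists>T\<in>\<T>. x extreme_point_of T} = \<Lambda> \<and>
     (\<exists>\<sigma>>0. \<forall>T\<in>\<T>. \<exists>x r. r > 0 \<and> cball x r \<subseteq> T \<and> diameter T \<le> \<sigma> * r)"


section \<open>Displacements and their gradients\<close>

text \<open>
  A displacement on the node set \<open>\<Lambda>\<close> is a function on the whole space whose values outside
  \<open>\<Lambda>\<close> are never inspected.
\<close>
definition interpolant ::
  "(real^'d) set \<Rightarrow> (real^'d) set set \<Rightarrow> (real^'d \<Rightarrow> real^'d) \<Rightarrow> real^'d \<Rightarrow> real^'d" where
  "interpolant \<Lambda> \<T> u = (THE w. continuous_on UNIV w \<and>
     (\<forall>T\<in>\<T>. \<exists>(M::real^'d^'d) b. \<forall>x\<in>T. w x = M *v x + b) \<and>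
     (\<forall>l\<in>\<Lambda>. w l = u l))"

text \<open>
  The value 0 at points of non-differentiability concerns a null set only (points on cell
  boundaries); with it, the closure of the non-zero set is the essential support.  The norm on
  matrices is the Frobenius norm.
\<close>
definition grad ::
  "(real^'d) set \<Rightarrow> (real^'d) set set \<Rightarrow> (real^'d \<Rightarrow> real^'d) \<Rightarrow> real^'d \<Rightarrow> real^'d^'d" where
  "grad \<Lambda> \<T> u x =
     (if interpolant \<Lambda> \<T> u differentiable (at x) then jacobian (interpolant \<Lambda> \<T> u) (at x) else 0)"

definition in_L2 :: "('a::euclidean_space \<Rightarrow> 'b::euclidean_space) \<Rightarrow> bool" where
  "in_L2 f \<longleftrightarrow> f \<in> borel_measurable lebesgue \<and> integrable lebesgue (\<lambda>x. (norm (f x))\<^sup>2)"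

definition L2_norm :: "('a::euclidean_space \<Rightarrow> 'b::euclidean_space) \<Rightarrow> real" where
  "L2_norm f = sqrt (LINT x|lebesgue. (norm (f x))\<^sup>2)"

definition W_c :: "(real^'d) set \<Rightarrow> (real^'d) set set \<Rightarrow> (real^'d \<Rightarrow> real^'d) set" where
  "W_c \<Lambda> \<T> = {u. compact (closure {x. grad \<Lambda> \<T> u x \<noteq> 0})}"

definition W_12 :: "(real^'d) set \<Rightarrow> (real^'d) set set \<Rightarrow> (real^'d \<Rightarrow> real^'d) set" where
  "W_12 \<Lambda> \<T> = {u. in_L2 (grad \<Lambda> \<T> u)}"

definition W_0 ::
  "(real^'d) set \<Rightarrow> (real^'d) set set \<Rightarrow> (real^'d) set \<Rightarrow> (real^'d \<Rightarrow> real^'d) set" where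
  "W_0 \<Lambda> \<T> \<Omega> = {v \<in> W_c \<Lambda> \<T>. \<forall>l \<in> \<Lambda> - \<Omega>. v l = 0}"


section \<open>Stencils and site potentials\<close>

text \<open>
  The space of stencils with index set \<open>\<R>\<close> is represented by the functions vanishing
  outside \<open>\<R>\<close>; for finite \<open>\<R>\<close> the subspace topology inherited from the product topology is
  the Euclidean one.
\<close>
definition stencil_space :: "(real^'d) set \<Rightarrow> (real^'d \<Rightarrow> real^'d) set" where
  "stencil_space \<R> = {g. \<forall>\<rho>. \<rho> \<notin> \<R> \<longrightarrow> g \<rho> = 0}"

definition fd_stencil ::
  "(real^'d) set \<Rightarrow> (real^'d \<Rightarrow> real^'d) \<Rightarrow> real^'d \<Rightarrow> (real^'d \<Rightarrow> real^'d)" where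
  "fd_stencil \<R> u l = (\<lambda>\<rho>. if \<rho> \<in> \<R> then u (l + \<rho>) - u l else 0)"

text \<open>Functions all of whose partial derivatives up to order \<open>n\<close> exist and are continuous.\<close>
primrec Ck_stencil ::
  "nat \<Rightarrow> (real^'d) set \<Rightarrow> ((real^'d \<Rightarrow> real^'d) \<Rightarrow> real) \<Rightarrow> bool" where
  "Ck_stencil 0 \<R> f \<longleftrightarrow> continuous_on (stencil_space \<R>) f"
| "Ck_stencil (Suc n) \<R> f \<longleftrightarrow> continuous_on (stencil_space \<R>) f \<and>
     (\<forall>\<rho>\<in>\<R>. \<forall>i. \<exists>f'.
        (\<forall>g \<in> stencil_space \<R>.
           ((\<lambda>t. f (g(\<rho> := g \<rho> + t *\<^sub>R axis i 1))) has_real_derivative f' g) (at 0)) \<and>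
        Ck_stencil n \<R> f')"


section \<open>The point defect setting\<close>

text \<open>
  \<open>\<R> l\<close> and \<open>V l\<close> are the stencil and the site potential of the atom \<open>l\<close>, while \<open>\<R>hom\<close> and
  \<open>Vhom\<close> are the homogeneous ones.  Balls are open, so the complement of the
  defect core consists of the points of norm at least \<open>Rdef\<close>.
\<close>
locale point_defect =
  fixes A :: "real^'d^'d"
    and Rdef :: real
    and \<Lambda> :: "(real^'d) set"
    and \<T> :: "(real^'d) set set"
    and rcut :: real
    and \<R> :: "real^'d \<Rightarrow> (real^'d) set"
    and \<R>hom :: "(real^'d) set"
    and V :: "real^'d \<Rightarrow> (real^'d \<Rightarrow> real^'d) \<Rightarrow> real"
    and Vhom :: "(real^'d \<Rightarrow> real^'d) \<Rightarrow> real"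
    and k :: nat
  assumes dimension: "CARD('d) \<in> {2, 3}"
    and nonsingular: "invertible A"
    and Rdef_pos: "Rdef > 0"
    and lattice_outside: "\<Lambda> - ball 0 Rdef = bravais_lattice A - ball 0 Rdef"
    and core_finite: "finite (\<Lambda> \<inter> ball 0 Rdef)"
    and partition: "regular_partition \<T> \<Lambda>"
    and partition_homogeneous:
      "\<And>T \<rho>. T \<in> \<T> \<Longrightarrow> \<rho> \<in> bravais_lattice A \<Longrightarrow> T \<subseteq> - ball 0 Rdef \<Longrightarrow>
         (+) \<rho> ` T \<subseteq> - ball 0 Rdef \<Longrightarrow> (+) \<rho> ` T \<in> \<T>"
    and rcut_pos: "rcut > 0"
    and stencils:
      "\<And>l. l \<in> \<Lambda> \<Longrightarrow> \<R> l \<subseteq> (ball 0 rcut \<inter> (\<lambda>m. m - l) ` \<Lambda>) - {0}"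
    and stencil_edges:
      "\<And>l \<rho> T. l \<in> \<Lambda> \<Longrightarrow> T \<in> \<T> \<Longrightarrow> closed_segment l (l + \<rho>) edge_of T \<Longrightarrow> \<rho> \<in> \<R> l"
    and k_ge_4: "k \<ge> 4"
    and potential_Ck: "\<And>l. l \<in> \<Lambda> \<Longrightarrow> Ck_stencil k (\<R> l) (V l)"
    and potential_0: "\<And>l. l \<in> \<Lambda> \<Longrightarrow> V l (\<lambda>_. 0) = 0"
    and stencil_hom: "\<And>l. l \<in> \<Lambda> \<Longrightarrow> norm l \<ge> Rdef \<Longrightarrow> \<R> l = \<R>hom"
    and potential_hom:
      "\<And>l g. l \<in> \<Lambda> \<Longrightarrow> norm l \<ge> Rdef \<Longrightarrow> g \<in> stencil_space \<R>hom \<Longrightarrow> V l g = Vhom g"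
    and stencil_symmetric: "uminus ` \<R>hom = \<R>hom"
    and potential_symmetric:
      "\<And>g. g \<in> stencil_space \<R>hom \<Longrightarrow> Vhom (\<lambda>\<rho>. - g (- \<rho>)) = Vhom g"
    and stencil_basis: "\<And>n. A *v axis n 1 \<in> \<R>hom"


section \<open>Energy\<close>

text \<open>For a displacement in \<open>W_c\<close> only finitely many terms are non-zero.\<close>
definition energy_c ::
  "(real^'d) set \<Rightarrow> (real^'d \<Rightarrow> (real^'d) set) \<Rightarrow> (real^'d \<Rightarrow> (real^'d \<Rightarrow> real^'d) \<Rightarrow> real)
     \<Rightarrow> (real^'d \<Rightarrow> real^'d) \<Rightarrow> real" where
  "energy_c \<Lambda> \<R> V u = (\<Sum>\<^sub>\<infinity>l\<in>\<Lambda>. V l (fd_stencil (\<R> l) u l))"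

text \<open>
  \<open>E\<close> restricts to \<open>E0\<close> on \<open>W_c\<close> and is continuous on \<open>W_12\<close> for the gradient semi-norm.
  As \<open>W_c\<close> is dense in \<open>W_12\<close>, this determines \<open>E\<close> on \<open>W_12\<close>.
\<close>
definition continuous_extension ::
  "(real^'d) set \<Rightarrow> (real^'d) set set \<Rightarrow> ((real^'d \<Rightarrow> real^'d) \<Rightarrow> real)
     \<Rightarrow> ((real^'d \<Rightarrow> real^'d) \<Rightarrow> real) \<Rightarrow> bool" where
  "continuous_extension \<Lambda> \<T> E0 E \<longleftrightarrow>
     (\<forall>u \<in> W_c \<Lambda> \<T>. E u = E0 u) \<and>
     (\<forall>u \<in> W_12 \<Lambda> \<T>. \<forall>\<epsilon>>0. \<exists>\<delta>>0. \<forall>v \<in> W_12 \<Lambda> \<T>.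
        L2_norm (\<lambda>x. grad \<Lambda> \<T> v x - grad \<Lambda> \<T> u x) < \<delta> \<longrightarrow> \<bar>E v - E u\<bar> < \<epsilon>)"


section \<open>Variations, stability and local minimisers\<close>

text \<open>
  Directional derivatives, used only for the energy on \<open>W_12\<close>, which is of class \<open>C\<^sup>k\<close> with
  \<open>k \<ge> 4\<close>; there they exist and agree with the Frechet derivatives.
\<close>
definition first_variation ::
  "(('a \<Rightarrow> 'b::real_vector) \<Rightarrow> real) \<Rightarrow> ('a \<Rightarrow> 'b) \<Rightarrow> ('a \<Rightarrow> 'b) \<Rightarrow> real" where
  "first_variation E u v = deriv (\<lambda>t. E (\<lambda>l. u l + t *\<^sub>R v l)) 0"

definition second_variation ::
  "(('a \<Rightarrow> 'b::real_vector) \<Rightarrow> real) \<Rightarrow> ('a \<Rightarrow> 'b) \<Rightarrow> ('a \<Rightarrow> 'b) \<Rightarrow> ('a \<Rightarrow> 'b) \<Rightarrow> real" where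
  "second_variation E u v w = deriv (\<lambda>s. first_variation E (\<lambda>l. u l + s *\<^sub>R w l) v) 0"

text \<open>
  \<open>X\<close> is the linear space over which \<open>E\<close> is minimised, and \<open>Y \<subseteq> X\<close> is the space of test functions
  on which the second variation is required to be coercive.
\<close>
definition strongly_stable_solution ::
  "(real^'d) set \<Rightarrow> (real^'d) set set \<Rightarrow> ((real^'d \<Rightarrow> real^'d) \<Rightarrow> real)
     \<Rightarrow> (real^'d \<Rightarrow> real^'d) set \<Rightarrow> (real^'d \<Rightarrow> real^'d) set \<Rightarrow> (real^'d \<Rightarrow> real^'d) \<Rightarrow> bool" where
  "strongly_stable_solution \<Lambda> \<T> E X Y u \<longleftrightarrow>
     u \<in> X \<and>
     (\<forall>v\<in>X. first_variation E u v = 0) \<and>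
     (\<exists>c>0. \<forall>v\<in>Y. second_variation E u v v \<ge> c * (L2_norm (grad \<Lambda> \<T> v))\<^sup>2)"

definition local_minimisers ::
  "(real^'d) set \<Rightarrow> (real^'d) set set \<Rightarrow> ((real^'d \<Rightarrow> real^'d) \<Rightarrow> real)
     \<Rightarrow> (real^'d \<Rightarrow> real^'d) set \<Rightarrow> (real^'d \<Rightarrow> real^'d) set" where
  "local_minimisers \<Lambda> \<T> E X =
     {u \<in> X. \<exists>\<epsilon>>0. \<forall>v\<in>X. L2_norm (\<lambda>x. grad \<Lambda> \<T> v x - grad \<Lambda> \<T> u x) < \<epsilon> \<longrightarrow> E u \<le> E v}"

end

theory Submission
  imports Defs
begin

text \<open>
  If \<open>w \<in> W_0 (\<Omega> R)\<close> has distance \<open>\<eta>\<close> from \<open>ubar\<close> in the gradient semi-norm, then strong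
  stability makes \<open>E\<close> uniformly convex near \<open>ubar\<close>, so minimising over a small closed ball
  around \<open>w\<close> in the finite-dimensional space \<open>W_0 (\<Omega> R)\<close> gives an interior minimiser with
  gradient error \<open>O(\<eta>)\<close>, and the energy error is \<open>O(\<eta>\<^sup>2)\<close> because the first variation at \<open>ubar\<close>
  vanishes.  It remains to find \<open>w\<close> with \<open>\<eta> = O(R powr (- d / 2))\<close>.

  Away from the core, \<open>ubar\<close> solves a constant-coefficient difference equation up to a residual
  that is quadratic in the strain, and the constant-coefficient form inherits coercivity from
  the second variation at \<open>ubar\<close> by translating test functions to infinity.  Let \<open>e s\<close> be the
  error of the Galerkin projection of \<open>ubar\<close>, with respect to this form, onto functions
  supported in a cube of size comparable to \<open>s\<close>.  It is discretely harmonic in the cube, so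
  Caccioppoli's inequality for iterated differences and a discrete Sobolev inequality bound its
  differences in an inner cube by \<open>O(s powr (- d / 2))\<close> times its energy norm.  Testing the
  equation with \<open>e s\<close> then bounds the tail \<open>\<phi> s\<close> of the strain outside a cube of size \<open>s\<close> by
  \<open>\<phi> (\<theta> * s) \<le> K * (s powr (- d / 2) + (\<phi> s)\<^sup>2)\<close>, and iterating this inequality gives the rate
  for \<open>\<phi>\<close> and for the energy norm of \<open>e s\<close>.
\<close>


section \<open>Square-summable families\<close>

text \<open>The exponent d/2 comes from one pairing. With \<open>X s\<close> the energy norm of the
  error, its differences are at most \<open>X s\<close> everywhere and at most a multiple of
  \<open>s powr (- d / 2) * X s\<close> in the inner cube. The residual is quadratic in the strain,
  hence a summable family. Pairing the two and cancelling one factor \<open>X s\<close> leaves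
  \<open>s powr (- d / 2)\<close> from the inner cube and the squared tail from its complement; the
  tail at a larger radius is again at most \<open>X s\<close>, because the projection vanishes
  there. Two obstacles shape the rest. Coercivity and the equation are available only against
  finitely supported test functions, whereas the error has infinite support: it is reached as a weak
  limit of differences of two projections. And \<open>E\<close> is known beyond finite supports only
  as a continuous extension, so its variations have to be computed as limits; the density of
  finitely supported displacements that this requires is itself read off from the Galerkin
  projection, for the form that sums inner products of differences.\<close>

lemma summable_on_nonneg_boundedI:
  fixes f :: "'b \<Rightarrow> real"
  assumes "\<And>x. x \<in> A \<Longrightarrow> 0 \<le> f x" "\<And>F. finite F \<Longrightarrow> F \<subseteq> A \<Longrightarrow> sum f F \<le> M"
  shows "f summable_on A" "infsum f A \<le> M"
proof -
  show 1: "f summable_on A"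
    by (rule nonneg_bdd_above_summable_on) (use assms in \<open>auto intro!: bdd_aboveI[of _ M]\<close>)
  show "infsum f A \<le> M"
    by (rule infsum_le_finite_sums[OF 1]) (use assms in auto)
qed

lemma summable_on_le:
  fixes f g :: "'b \<Rightarrow> real"
  assumes "g summable_on A" "\<And>x. x \<in> A \<Longrightarrow> 0 \<le> f x" "\<And>x. x \<in> A \<Longrightarrow> f x \<le> g x"
  shows "f summable_on A"
proof (rule summable_on_nonneg_boundedI(1)[of A f "infsum g A"])
  fix F assume F: "finite F" "F \<subseteq> A"
  have "sum f F \<le> sum g F" using F assms by (intro sum_mono) auto
  also have "\<dots> \<le> infsum g A"
  proof (rule finite_sum_le_infsum[OF assms(1) F])
    show "0 \<le> g x" if "x \<in> A - F" for x using assms(2,3)[of x] that by simp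
  qed
  finally show "sum f F \<le> infsum g A" .
qed (use assms in auto)

lemma Cauchy_Schwarz_infsum:
  fixes f g :: "'b \<Rightarrow> real"
  assumes f: "(\<lambda>x. (f x)\<^sup>2) summable_on A" and g: "(\<lambda>x. (g x)\<^sup>2) summable_on A"
  shows "(\<lambda>x. \<bar>f x * g x\<bar>) summable_on A"
    and "infsum (\<lambda>x. \<bar>f x * g x\<bar>) A \<le> sqrt (infsum (\<lambda>x. (f x)\<^sup>2) A) * sqrt (infsum (\<lambda>x. (g x)\<^sup>2) A)"
proof -
  have *: "sum (\<lambda>x. \<bar>f x * g x\<bar>) F \<le> sqrt (infsum (\<lambda>x. (f x)\<^sup>2) A) * sqrt (infsum (\<lambda>x. (g x)\<^sup>2) A)"
    if F: "finite F" "F \<subseteq> A" for F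
  proof -
    have "sum (\<lambda>x. \<bar>f x * g x\<bar>) F \<le> L2_set f F * L2_set g F"
      unfolding abs_mult by (rule L2_set_mult_ineq)
    also have "\<dots> \<le> sqrt (infsum (\<lambda>x. (f x)\<^sup>2) A) * sqrt (infsum (\<lambda>x. (g x)\<^sup>2) A)"
      unfolding L2_set_def
      by (intro mult_mono real_sqrt_le_mono finite_sum_le_infsum f g F) (auto intro!: sum_nonneg infsum_nonneg)
    finally show ?thesis .
  qed
  show "(\<lambda>x. \<bar>f x * g x\<bar>) summable_on A"
    "infsum (\<lambda>x. \<bar>f x * g x\<bar>) A \<le> sqrt (infsum (\<lambda>x. (f x)\<^sup>2) A) * sqrt (infsum (\<lambda>x. (g x)\<^sup>2) A)"
    using summable_on_nonneg_boundedI[OF _ *] by auto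
qed

lemma infsum_diff_real:
  fixes f g :: "'b \<Rightarrow> real"
  assumes "f summable_on A" "g summable_on A"
  shows "infsum (\<lambda>x. f x - g x) A = infsum f A - infsum g A"
  using infsum_add[of f A "\<lambda>x. - g x"] assms summable_on_uminus[of g A] infsum_uminus[of g A] by simp

lemma infsum_tail_small:
  fixes f :: "'b \<Rightarrow> real"
  assumes "f summable_on A" "\<And>x. x \<in> A \<Longrightarrow> 0 \<le> f x" "0 < \<epsilon>"
  obtains F where "finite F" "F \<subseteq> A" "infsum f (A - F) < \<epsilon>"
proof -
  obtain F where F: "finite F" "F \<subseteq> A" "dist (sum f F) (infsum f A) \<le> \<epsilon> / 2"
    using infsum_finite_approximation[OF assms(1), of "\<epsilon> / 2"] assms(3) by auto
  have "infsum f (A - F) = infsum f A - sum f F"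
    using infsum_Diff[of f A F] assms(1) F summable_on_finite[of F f] by simp
  then have "infsum f (A - F) < \<epsilon>" using F(3) assms(3) unfolding dist_real_def by linarith
  then show ?thesis using that F by blast
qed

lemma sq_summable_add:
  fixes f g :: "'b \<Rightarrow> real"
  assumes "(\<lambda>x. (f x)\<^sup>2) summable_on A" "(\<lambda>x. (g x)\<^sup>2) summable_on A"
    "\<And>x. x \<in> A \<Longrightarrow> \<bar>h x\<bar> \<le> \<bar>f x\<bar> + \<bar>g x\<bar>"
  shows "(\<lambda>x. (h x)\<^sup>2) summable_on A"
    and "infsum (\<lambda>x. (h x)\<^sup>2) A \<le> 2 * infsum (\<lambda>x. (f x)\<^sup>2) A + 2 * infsum (\<lambda>x. (g x)\<^sup>2) A"
proof -
  have pt: "(h x)\<^sup>2 \<le> 2 * (f x)\<^sup>2 + 2 * (g x)\<^sup>2" if "x \<in> A" for x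
  proof -
    have "(h x)\<^sup>2 \<le> (\<bar>f x\<bar> + \<bar>g x\<bar>)\<^sup>2"
      using power_mono[OF assms(3)[OF that], of 2] by simp
    also have "\<dots> \<le> 2 * (f x)\<^sup>2 + 2 * (g x)\<^sup>2"
      using sum_squares_bound[of "\<bar>f x\<bar>" "\<bar>g x\<bar>"] by (simp add: power2_sum)
    finally show ?thesis .
  qed
  have s: "(\<lambda>x. 2 * (f x)\<^sup>2 + 2 * (g x)\<^sup>2) summable_on A"
    by (intro summable_on_add summable_on_cmult_right assms)
  show 1: "(\<lambda>x. (h x)\<^sup>2) summable_on A" by (rule summable_on_le[OF s]) (use pt in auto)
  have "infsum (\<lambda>x. (h x)\<^sup>2) A \<le> infsum (\<lambda>x. 2 * (f x)\<^sup>2 + 2 * (g x)\<^sup>2) A"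
    by (rule infsum_mono[OF 1 s]) (use pt in auto)
  also have "\<dots> = 2 * infsum (\<lambda>x. (f x)\<^sup>2) A + 2 * infsum (\<lambda>x. (g x)\<^sup>2) A"
    by (simp add: infsum_add summable_on_cmult_right assms infsum_cmult_right)
  finally show "infsum (\<lambda>x. (h x)\<^sup>2) A \<le> 2 * infsum (\<lambda>x. (f x)\<^sup>2) A + 2 * infsum (\<lambda>x. (g x)\<^sup>2) A" .
qed

text \<open>Pointwise convergence with bounded square sums is weak convergence in l2: off a finite
  set the square sum of \<open>F\<close> is small and Cauchy-Schwarz applies, on the finite set the
  terms converge. Galerkin errors are at first known to converge only in this sense.\<close>

lemma weak_limit_infsum:
  fixes x :: "nat \<Rightarrow> 'b \<Rightarrow> real"
  assumes lim: "\<And>l. l \<in> A \<Longrightarrow> (\<lambda>n. x n l) \<longlonglongrightarrow> y l"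
    and sx: "\<And>n. (\<lambda>l. (x n l)\<^sup>2) summable_on A" and bx: "\<And>n. infsum (\<lambda>l. (x n l)\<^sup>2) A \<le> M"
    and sF: "(\<lambda>l. (F l)\<^sup>2) summable_on A"
  shows "(\<lambda>l. (y l)\<^sup>2) summable_on A"
    and "(\<lambda>n. infsum (\<lambda>l. F l * x n l) A) \<longlonglongrightarrow> infsum (\<lambda>l. F l * y l) A"
proof -
  have M: "0 \<le> M" using infsum_nonneg[of A "\<lambda>l. (x 0 l)\<^sup>2"] bx[of 0] by auto
  have fin: "sum (\<lambda>l. (y l)\<^sup>2) G \<le> M" if G: "finite G" "G \<subseteq> A" for G
  proof (rule LIMSEQ_le_const2)
    show "(\<lambda>n. sum (\<lambda>l. (x n l)\<^sup>2) G) \<longlonglongrightarrow> sum (\<lambda>l. (y l)\<^sup>2) G"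
      using lim G by (intro tendsto_sum tendsto_power) auto
    show "\<exists>N. \<forall>n\<ge>N. sum (\<lambda>l. (x n l)\<^sup>2) G \<le> M"
    proof (intro exI[of _ 0] allI impI)
      show "sum (\<lambda>l. (x n l)\<^sup>2) G \<le> M" for n
        using finite_sum_le_infsum[OF sx[of n] G] bx[of n] by simp
    qed
  qed
  show sy: "(\<lambda>l. (y l)\<^sup>2) summable_on A"
    by (rule summable_on_nonneg_boundedI(1)[of A _ M]) (use fin in auto)
  have yM: "infsum (\<lambda>l. (y l)\<^sup>2) A \<le> M"
    by (rule summable_on_nonneg_boundedI(2)[of A _ M]) (use fin in auto)
  define d where "d = (\<lambda>n l. x n l - y l)"
  have sd: "(\<lambda>l. (d n l)\<^sup>2) summable_on A" and bd: "infsum (\<lambda>l. (d n l)\<^sup>2) A \<le> 4 * M" for n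
  proof -
    have "\<bar>d n l\<bar> \<le> \<bar>x n l\<bar> + \<bar>y l\<bar>" for l by (simp add: d_def)
    note * = sq_summable_add[OF sx[of n] sy this]
    show "(\<lambda>l. (d n l)\<^sup>2) summable_on A" by (rule *(1))
    show "infsum (\<lambda>l. (d n l)\<^sup>2) A \<le> 4 * M" using *(2) bx[of n] yM by linarith
  qed
  have diff_eq: "infsum (\<lambda>l. F l * x n l) A - infsum (\<lambda>l. F l * y l) A = infsum (\<lambda>l. F l * d n l) A" for n
  proof -
    have "(\<lambda>l. F l * x n l) summable_on A" "(\<lambda>l. F l * y l) summable_on A"
      by (rule abs_summable_summable,
          use Cauchy_Schwarz_infsum(1)[OF sF sx[of n]] Cauchy_Schwarz_infsum(1)[OF sF sy] in simp)+
    then show ?thesis by (simp add: d_def right_diff_distrib infsum_diff_real)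
  qed
  have "(\<lambda>n. infsum (\<lambda>l. F l * d n l) A) \<longlonglongrightarrow> 0"
  proof (rule LIMSEQ_I)
    fix r :: real assume r: "0 < r"
    \<comment> \<open>Chosen so that the tail contributes at most
      \<open>sqrt \<epsilon> * sqrt (4 * M)\<close>, which is below \<open>r / 2\<close>; the
      summand 4 in the denominator covers \<open>M = 0\<close>.\<close>
    define \<epsilon> where "\<epsilon> = (r / (4 * sqrt M + 4))\<^sup>2"
    have M4: "0 < 4 * sqrt M + 4" using M by (simp add: add_nonneg_pos)
    have \<epsilon>: "0 < \<epsilon>" using r M4 by (simp add: \<epsilon>_def)
    obtain G where G: "finite G" "G \<subseteq> A" "infsum (\<lambda>l. (F l)\<^sup>2) (A - G) < \<epsilon>"
      using infsum_tail_small[OF sF _ \<epsilon>] by auto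
    have "(\<lambda>n. sum (\<lambda>l. F l * d n l) G) \<longlonglongrightarrow> sum (\<lambda>l. F l * 0) G"
      using lim G by (intro tendsto_sum tendsto_mult tendsto_const) (auto simp: d_def LIM_zero)
    then have "(\<lambda>n. sum (\<lambda>l. F l * d n l) G) \<longlonglongrightarrow> 0" by simp
    from LIMSEQ_D[OF this, of "r / 2"] r
    obtain N where N: "\<And>n. n \<ge> N \<Longrightarrow> \<bar>sum (\<lambda>l. F l * d n l) G\<bar> < r / 2"
      by auto
    have "norm (infsum (\<lambda>l. F l * d n l) A - 0) < r" if n: "n \<ge> N" for n
    proof -
      have sF': "(\<lambda>l. (F l)\<^sup>2) summable_on (A - G)" and sd': "(\<lambda>l. (d n l)\<^sup>2) summable_on (A - G)"
        using sF sd summable_on_subset_banach by blast+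
      note CS = Cauchy_Schwarz_infsum[OF sF' sd']
      have sAG: "(\<lambda>l. F l * d n l) summable_on (A - G)" by (rule abs_summable_summable) (use CS(1) in simp)
      have "infsum (\<lambda>l. F l * d n l) A = infsum (\<lambda>l. F l * d n l) (A - G) + infsum (\<lambda>l. F l * d n l) G"
      proof -
        have "A - G \<union> G = A" "(A - G) \<inter> G = {}" using G(2) by auto
        then show ?thesis using infsum_Un_disjoint[OF sAG summable_on_finite[OF G(1)]] by metis
      qed
      moreover have "\<bar>infsum (\<lambda>l. F l * d n l) (A - G)\<bar> \<le> infsum (\<lambda>l. \<bar>F l * d n l\<bar>) (A - G)"
        using norm_infsum_bound[of "\<lambda>l. F l * d n l" "A - G"] CS(1) by simp
      moreover have "\<dots> \<le> sqrt \<epsilon> * sqrt (4 * M)"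
      proof -
        have "infsum (\<lambda>l. (d n l)\<^sup>2) (A - G) \<le> infsum (\<lambda>l. (d n l)\<^sup>2) A"
          by (rule infsum_mono_neutral[OF sd' sd]) auto
        then show ?thesis
          using bd[of n] G M \<epsilon>
          by (intro order_trans[OF CS(2)] mult_mono real_sqrt_le_mono) (auto intro!: infsum_nonneg)
      qed
      moreover have "sqrt \<epsilon> * sqrt (4 * M) < r / 2"
      proof -
        have "sqrt \<epsilon> = r / (4 * sqrt M + 4)" using r M4 by (simp add: \<epsilon>_def)
        moreover have "sqrt (4 * M) = 2 * sqrt M" by (simp add: real_sqrt_mult)
        moreover have "r / (4 * sqrt M + 4) * (2 * sqrt M) < r / 2"
          using r M4 by (simp add: field_simps)
        ultimately show ?thesis by simp
      qed
      ultimately show ?thesis using N[OF n] G(1) by simp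
    qed
    then show "\<exists>N. \<forall>n\<ge>N. norm (infsum (\<lambda>l. F l * d n l) A - 0) < r" by blast
  qed
  then show "(\<lambda>n. infsum (\<lambda>l. F l * x n l) A) \<longlonglongrightarrow> infsum (\<lambda>l. F l * y l) A"
    unfolding diff_eq[symmetric] by (simp add: LIM_zero_iff)
qed


section \<open>Elliptic forms on the integer lattice\<close>

definition cube :: "nat \<Rightarrow> (int^'d) set" where
  "cube r = {l. \<forall>i. \<bar>l $ i\<bar> \<le> int r}"

lemma finite_cube [simp]: "finite (cube r :: (int^'d) set)"
proof -
  have "cube r \<subseteq> vec_lambda ` (PiE (UNIV::'d set) (\<lambda>_. {- int r..int r}))"
  proof
    fix l :: "int^'d" assume "l \<in> cube r"
    then have "($) l \<in> PiE UNIV (\<lambda>_. {- int r..int r})"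
      by (auto simp: cube_def abs_le_iff minus_le_iff)
    then have "vec_lambda (($) l) \<in> vec_lambda ` (PiE (UNIV::'d set) (\<lambda>_. {- int r..int r}))"
      by (rule imageI)
    then show "l \<in> vec_lambda ` (PiE (UNIV::'d set) (\<lambda>_. {- int r..int r}))" by simp
  qed
  then show ?thesis by (rule finite_subset) (intro finite_imageI finite_PiE; simp)
qed

lemma cube_mono: "r \<le> s \<Longrightarrow> cube r \<subseteq> cube s"
  unfolding cube_def by (auto intro: order_trans)

lemma cube_add: "x \<in> cube r \<Longrightarrow> y \<in> cube s \<Longrightarrow> x + y \<in> cube (r + s)"
  unfolding cube_def mem_Collect_eq vector_add_component of_nat_add
  by (meson abs_triangle_ineq add_mono order_trans)

lemma cube_uminus: "x \<in> cube r \<Longrightarrow> - x \<in> cube r"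
  by (simp add: cube_def)

lemma cube_diff: "x \<in> cube r \<Longrightarrow> y \<in> cube s \<Longrightarrow> x - y \<in> cube (r + s)"
  using cube_add[of x r "- y" s] cube_uminus[of y s] by simp

lemma axis_in_cube: "axis i 1 \<in> cube 1"
  by (simp add: cube_def axis_def)

definition fd :: "('b::ab_group_add \<Rightarrow> 'a::real_normed_vector) \<Rightarrow> 'b \<Rightarrow> 'b \<Rightarrow> 'a" where
  "fd v l = (\<lambda>\<rho>. v (l + \<rho>) - v l)"

text \<open>Only a semi-norm: values off \<open>S\<close> are ignored. This allows \<open>fd\<close>
  to be indexed by all \<rho>, and a form bounded by it depends on the values on \<open>S\<close>
  alone.\<close>

definition stencil_norm :: "'b set \<Rightarrow> ('b \<Rightarrow> 'a::real_normed_vector) \<Rightarrow> real" where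
  "stencil_norm S g = L2_set (\<lambda>\<rho>. norm (g \<rho>)) S"

lemma stencil_norm_nonneg [simp]: "0 \<le> stencil_norm S g"
  by (simp add: stencil_norm_def L2_set_nonneg)

lemma stencil_norm_sq: "(stencil_norm S g)\<^sup>2 = (\<Sum>\<rho>\<in>S. (norm (g \<rho>))\<^sup>2)"
  by (simp add: stencil_norm_def L2_set_def sum_nonneg)

lemma stencil_norm_triangle: "stencil_norm S (\<lambda>\<rho>. g \<rho> + h \<rho>) \<le> stencil_norm S g + stencil_norm S h"
  unfolding stencil_norm_def
  by (rule order_trans[OF L2_set_mono L2_set_triangle_ineq]) (auto intro: norm_triangle_ineq)

lemma stencil_norm_triangle_diff: "stencil_norm S (\<lambda>\<rho>. g \<rho> - h \<rho>) \<le> stencil_norm S g + stencil_norm S h"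
  using stencil_norm_triangle[of S g "\<lambda>\<rho>. - h \<rho>"] by (simp add: stencil_norm_def)

lemma stencil_norm_0 [simp]: "stencil_norm S (\<lambda>\<rho>. 0) = 0"
  by (simp add: stencil_norm_def L2_set_def)

lemma stencil_norm_scaleR: "stencil_norm S (\<lambda>\<rho>. x *\<^sub>R g \<rho>) = \<bar>x\<bar> * stencil_norm S g"
proof -
  have "(stencil_norm S (\<lambda>\<rho>. x *\<^sub>R g \<rho>))\<^sup>2 = (\<bar>x\<bar> * stencil_norm S g)\<^sup>2"
    by (simp add: stencil_norm_sq power_mult_distrib sum_distrib_left)
  then show ?thesis by (simp add: power2_eq_iff_nonneg)
qed

lemma stencil_norm_mono:
  "(\<And>\<rho>. \<rho> \<in> S \<Longrightarrow> norm (g \<rho>) \<le> norm (h \<rho>)) \<Longrightarrow> stencil_norm S g \<le> stencil_norm S h"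
  unfolding stencil_norm_def by (rule L2_set_mono) auto

lemma norm_le_stencil_norm: "finite S \<Longrightarrow> \<rho> \<in> S \<Longrightarrow> norm (g \<rho>) \<le> stencil_norm S g"
  unfolding stencil_norm_def by (rule member_le_L2_set)

lemma stencil_norm_cong: "(\<And>\<rho>. \<rho> \<in> S \<Longrightarrow> g \<rho> = h \<rho>) \<Longrightarrow> stencil_norm S g = stencil_norm S h"
  unfolding stencil_norm_def by (rule L2_set_cong) auto

lemma fd_add: "fd (\<lambda>l. v l + w l) l = (\<lambda>\<rho>. fd v l \<rho> + fd w l \<rho>)"
  by (simp add: fd_def fun_eq_iff)

lemma fd_diff: "fd (\<lambda>l. v l - w l) l = (\<lambda>\<rho>. fd v l \<rho> - fd w l \<rho>)"
  by (simp add: fd_def fun_eq_iff)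

lemma fd_scaleR: "fd (\<lambda>l. x *\<^sub>R v l) l = (\<lambda>\<rho>. x *\<^sub>R fd v l \<rho>)"
  by (simp add: fd_def fun_eq_iff algebra_simps)

text \<open>Constant coefficients: one form \<open>b\<close> on stencils serves every site.
  \<open>b\<close> itself may fail to be positive; \<open>coercive\<close> speaks only of the sum
  over the lattice and of finitely supported functions. No symmetry is built in, so the two slots
  are kept apart. The instances are the sum of inner products of differences and the second
  derivative of the homogeneous potential at zero strain.\<close>

locale lattice_form =
  fixes S :: "(int^'d) set"
    and b :: "(int^'d \<Rightarrow> 'a::euclidean_space) \<Rightarrow> (int^'d \<Rightarrow> 'a) \<Rightarrow> real"
    and m :: nat and K c :: real
  assumes S_sub: "S \<subseteq> cube m" and m_pos: "0 < m"
    and axis_S: "\<And>i. axis i 1 \<in> S"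
    and b_linear1: "\<And>x g h k. b (\<lambda>\<rho>. x *\<^sub>R g \<rho> + h \<rho>) k = x * b g k + b h k"
    and b_linear2: "\<And>x g h k. b k (\<lambda>\<rho>. x *\<^sub>R g \<rho> + h \<rho>) = x * b k g + b k h"
    and b_bound: "\<And>g h. \<bar>b g h\<bar> \<le> K * stencil_norm S g * stencil_norm S h"
    and K_nonneg: "0 \<le> K" and c_pos: "0 < c"
    and coercive: "\<And>z. finite {l. z l \<noteq> 0} \<Longrightarrow>
      c * (\<Sum>\<^sub>\<infinity>l. (stencil_norm S (fd z l))\<^sup>2) \<le> (\<Sum>\<^sub>\<infinity>l. b (fd z l) (fd z l))"
begin

definition B :: "(int^'d \<Rightarrow> 'a) \<Rightarrow> (int^'d \<Rightarrow> 'a) \<Rightarrow> real" where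
  "B z v = (\<Sum>\<^sub>\<infinity>l. b (fd z l) (fd v l))"

definition supp_in :: "nat \<Rightarrow> (int^'d \<Rightarrow> 'a) \<Rightarrow> bool" where
  "supp_in r z \<longleftrightarrow> (\<forall>l. l \<notin> cube r \<longrightarrow> z l = 0)"

text \<open>The test function occupies the first slot of \<open>B\<close>. There is no growth
  condition on \<open>v\<close>, since a test function of finite support leaves finitely many
  terms.\<close>

definition harmonic :: "nat \<Rightarrow> (int^'d \<Rightarrow> 'a) \<Rightarrow> bool" where
  "harmonic r v \<longleftrightarrow> (\<forall>z. supp_in r z \<longrightarrow> B z v = 0)"

lemma finite_S: "finite S"
  using S_sub finite_cube finite_subset by blast

lemma b_add1: "b (\<lambda>\<rho>. g \<rho> + h \<rho>) k = b g k + b h k"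
  using b_linear1[of 1 g h k] by simp

lemma b_add2: "b k (\<lambda>\<rho>. g \<rho> + h \<rho>) = b k g + b k h"
  using b_linear2[of k 1 g h] by simp

lemma b_zero1 [simp]: "b (\<lambda>\<rho>. 0) k = 0"
  using b_add1[of "\<lambda>_. 0" "\<lambda>_. 0" k] by simp

lemma b_zero2 [simp]: "b k (\<lambda>\<rho>. 0) = 0"
  using b_add2[of k "\<lambda>_. 0" "\<lambda>_. 0"] by simp

lemma b_scale1: "b (\<lambda>\<rho>. x *\<^sub>R g \<rho>) k = x * b g k"
  using b_linear1[of x g "\<lambda>_. 0" k] by simp

lemma b_scale2: "b k (\<lambda>\<rho>. x *\<^sub>R g \<rho>) = x * b k g"
  using b_linear2[of k x g "\<lambda>_. 0"] by simp

lemma b_diff1: "b (\<lambda>\<rho>. g \<rho> - h \<rho>) k = b g k - b h k"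
  using b_linear1[of "-1" h g k] by (simp add: algebra_simps)

lemma b_diff2: "b k (\<lambda>\<rho>. g \<rho> - h \<rho>) = b k g - b k h"
  using b_linear2[of k "-1" h g] by (simp add: algebra_simps)

lemma b_null1: "(\<And>\<rho>. \<rho> \<in> S \<Longrightarrow> g \<rho> = 0) \<Longrightarrow> b g k = 0"
  using b_bound[of g k] stencil_norm_cong[of S g "\<lambda>_. 0"] by simp

lemma supp_in_mono: "supp_in r z \<Longrightarrow> r \<le> s \<Longrightarrow> supp_in s z"
  using cube_mono[of r s] unfolding supp_in_def by blast

lemma harmonic_mono: "harmonic s v \<Longrightarrow> r \<le> s \<Longrightarrow> harmonic r v"
  unfolding harmonic_def using supp_in_mono by blast

lemma fd_outside: "supp_in r z \<Longrightarrow> l \<notin> cube (r + m) \<Longrightarrow> \<rho> \<in> S \<Longrightarrow> fd z l \<rho> = 0"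
proof -
  assume z: "supp_in r z" and l: "l \<notin> cube (r + m)" and \<rho>: "\<rho> \<in> S"
  have "l \<notin> cube r" using l cube_mono[of r "r+m"] by auto
  moreover have "l + \<rho> \<notin> cube r"
  proof
    assume "l + \<rho> \<in> cube r"
    then have "l + \<rho> - \<rho> \<in> cube (r + m)" using \<rho> S_sub by (intro cube_diff) auto
    then show False using l by simp
  qed
  ultimately show "fd z l \<rho> = 0" using z by (simp add: supp_in_def fd_def)
qed

lemma B_finite:
  assumes "supp_in r z" "r + m \<le> R"
  shows "B z v = (\<Sum>l\<in>cube R. b (fd z l) (fd v l))"
proof -
  have "b (fd z l) (fd v l) = 0" if "l \<notin> cube R" for l
    by (rule b_null1, rule fd_outside[OF assms(1)]) (use that cube_mono[OF assms(2)] in auto)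
  then have "B z v = (\<Sum>\<^sub>\<infinity>l\<in>cube R. b (fd z l) (fd v l))"
    unfolding B_def by (intro infsum_cong_neutral) auto
  then show ?thesis by simp
qed

lemma finite_supp_in: "supp_in r z \<Longrightarrow> finite {l. z l \<noteq> 0}"
  by (rule finite_subset[OF _ finite_cube[of r]]) (auto simp: supp_in_def)

lemma coercive_finite:
  assumes "supp_in r z" "r + m \<le> R"
  shows "c * (\<Sum>l\<in>cube R. (stencil_norm S (fd z l))\<^sup>2) \<le> B z z"
proof -
  have "stencil_norm S (fd z l) = 0" if "l \<notin> cube R" for l
    using stencil_norm_cong[of S "fd z l" "\<lambda>_. 0"] fd_outside[OF assms(1)] that cube_mono[OF assms(2)]
    by auto
  then have "(\<Sum>\<^sub>\<infinity>l. (stencil_norm S (fd z l))\<^sup>2) = (\<Sum>\<^sub>\<infinity>l\<in>cube R. (stencil_norm S (fd z l))\<^sup>2)"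
    by (intro infsum_cong_neutral) auto
  then show ?thesis using coercive[OF finite_supp_in[OF assms(1)]] by (simp add: B_def)
qed

text \<open>Because the coefficients are constant, translating \<open>v\<close> amounts to
  translating the test function the other way. The radius drops by \<open>t\<close> to leave room
  for the translate.\<close>

lemma harmonic_fd:
  assumes "harmonic (r + t) v" "\<rho> \<in> cube t"
  shows "harmonic r (\<lambda>l. v (l + \<rho>) - v l)"
  unfolding harmonic_def
proof (intro allI impI)
  fix z assume z: "supp_in r z"
  define z' where "z' = (\<lambda>l. z (l - \<rho>))"
  have z': "supp_in (r + t) z'"
    unfolding supp_in_def
  proof (intro allI impI)
    fix l :: "int^'d" assume l: "l \<notin> cube (r + t)"
    have "l - \<rho> \<notin> cube r"
      using l cube_add[of "l - \<rho>" r \<rho> t] assms(2) by auto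
    then show "z' l = 0" using z by (simp add: supp_in_def z'_def)
  qed
  have "(\<Sum>\<^sub>\<infinity>l. b (fd z l) (fd (\<lambda>l. v (l + \<rho>)) l)) = (\<Sum>\<^sub>\<infinity>l. b (fd z' l) (fd v l))"
    by (rule infsum_reindex_bij_witness[of _ "\<lambda>l. l - \<rho>" "\<lambda>l. l + \<rho>"])
       (auto simp: fd_def z'_def algebra_simps)
  then have 1: "B z (\<lambda>l. v (l + \<rho>)) = B z' v" by (simp add: B_def)
  have "B z (\<lambda>l. v (l + \<rho>) - v l) = B z (\<lambda>l. v (l + \<rho>)) - B z v"
    by (simp add: B_finite[OF z order_refl] fd_diff b_diff2 sum_subtractf)
  also have "\<dots> = 0"
    using assms z z' 1 harmonic_mono[OF assms(1), of r] by (simp add: harmonic_def)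
  finally show "B z (\<lambda>l. v (l + \<rho>) - v l) = 0" .
qed

end

section \<open>Cutoff functions and the Caccioppoli inequality\<close>

definition inf_norm :: "int^'d \<Rightarrow> int" where
  "inf_norm l = Max (range (\<lambda>i. \<bar>l $ i\<bar>))"

lemma inf_norm_le_iff: "inf_norm l \<le> k \<longleftrightarrow> (\<forall>i. \<bar>l $ i\<bar> \<le> k)"
  by (auto simp: inf_norm_def)

lemma cube_inf_norm: "l \<in> cube r \<longleftrightarrow> inf_norm l \<le> int r"
  by (simp add: cube_def inf_norm_le_iff)

lemma inf_norm_add: "inf_norm (l + k) \<le> inf_norm l + inf_norm k"
  unfolding inf_norm_le_iff
proof
  fix i
  have "\<bar>l $ i\<bar> \<le> inf_norm l" "\<bar>k $ i\<bar> \<le> inf_norm k"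
    using inf_norm_le_iff by blast+
  then show "\<bar>(l + k) $ i\<bar> \<le> inf_norm l + inf_norm k" by simp
qed

lemma inf_norm_uminus [simp]: "inf_norm (- l) = inf_norm l"
  by (simp add: inf_norm_def)

definition cutoff :: "nat \<Rightarrow> nat \<Rightarrow> int^'d \<Rightarrow> real" where
  "cutoff r t l = max 0 (min 1 ((real r + real t - real_of_int (inf_norm l)) / real t))"

lemma cutoff_eq_1: "l \<in> cube r \<Longrightarrow> 0 < t \<Longrightarrow> cutoff r t l = 1"
  unfolding cutoff_def cube_inf_norm by (simp add: field_simps)

lemma cutoff_eq_0: "l \<notin> cube (r + t) \<Longrightarrow> cutoff r t l = 0"
proof -
  assume "l \<notin> cube (r + t)"
  then have "real r + real t - real_of_int (inf_norm l) \<le> 0" unfolding cube_inf_norm by linarith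
  then have "(real r + real t - real_of_int (inf_norm l)) / real t \<le> 0" by (simp add: divide_le_0_iff)
  then show ?thesis by (simp add: cutoff_def)
qed

lemma cutoff_lipschitz:
  assumes "\<rho> \<in> cube m" "0 < t"
  shows "\<bar>cutoff r t (l + \<rho>) - cutoff r t l\<bar> \<le> real m / real t"
proof -
  have "inf_norm (l + \<rho>) \<le> inf_norm l + inf_norm \<rho>" "inf_norm l \<le> inf_norm (l + \<rho>) + inf_norm \<rho>"
    using inf_norm_add[of l \<rho>] inf_norm_add[of "l + \<rho>" "- \<rho>"] by auto
  moreover have "inf_norm \<rho> \<le> int m" using assms cube_inf_norm by blast
  ultimately have "\<bar>inf_norm (l + \<rho>) - inf_norm l\<bar> \<le> int m" by linarith
  then have *: "\<bar>real_of_int (inf_norm (l + \<rho>)) - real_of_int (inf_norm l)\<bar> \<le> real m"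
    by linarith
  define x where "x = (real r + real t - real_of_int (inf_norm (l + \<rho>))) / real t"
  define y where "y = (real r + real t - real_of_int (inf_norm l)) / real t"
  have "\<bar>x - y\<bar> = \<bar>real_of_int (inf_norm (l + \<rho>)) - real_of_int (inf_norm l)\<bar> / real t"
    unfolding x_def y_def diff_divide_distrib[symmetric] abs_divide by (simp add: abs_minus_commute)
  also have "\<dots> \<le> real m / real t" using * by (intro divide_right_mono) auto
  finally show ?thesis
    unfolding cutoff_def x_def[symmetric] y_def[symmetric] by linarith
qed

context lattice_form begin

text \<open>Coercivity speaks of sums over functions of finite support, so it is applied to
  \<open>z\<close>, the cutoff times \<open>v\<close>, while the equation is tested with
  \<open>z2\<close>, which carries the squared cutoff. Terms without a difference of the cutoff
  cancel, and each such difference costs a factor \<open>m / t\<close>.\<close>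

lemma caccioppoli:
  "\<exists>K1\<ge>0. \<forall>r s v. harmonic (r + s) v \<longrightarrow> 6 * m \<le> s \<longrightarrow>
     (\<Sum>l\<in>cube r. (stencil_norm S (fd v l))\<^sup>2) \<le> K1 / (real s)\<^sup>2 * (\<Sum>l\<in>cube (r + s). (norm (v l))\<^sup>2)"
proof -
  define K2 where "K2 = 2 * K\<^sup>2 / c + K * (3 + real (card S))"
  define K1 where "K1 = (2 * K2 / c) * (2 * real m)\<^sup>2 * (real (card S) + 1)"
  have K2: "0 \<le> K2" using K_nonneg c_pos by (simp add: K2_def)
  have "(\<Sum>l\<in>cube r. (stencil_norm S (fd v l))\<^sup>2) \<le> K1 / (real s)\<^sup>2 * (\<Sum>l\<in>cube (r + s). (norm (v l))\<^sup>2)"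
    if har: "harmonic (r + s) v" and s: "6 * m \<le> s" for r s v
  proof -
    \<comment> \<open>One \<open>m\<close> lets the cutoff equal 1 on all stencils based in
      \<open>cube r\<close>, one covers the sites beyond the support where \<open>fd z\<close> still
      lives, one the shifted values \<open>v (l + \<rho>)\<close>. The assumption
      \<open>6 * m \<le> s\<close> then gives \<open>s \<le> 2 * t\<close>.\<close>
    define t where "t = s - 3 * m"
    have t: "0 < t" "2 * t \<ge> s" "s = t + 3 * m" using s m_pos by (auto simp: t_def)
    define \<eta> where "\<eta> = (cutoff (r + m) t :: int^'d \<Rightarrow> real)"
    define z where "z = (\<lambda>l. \<eta> l *\<^sub>R v l)"
    define z2 where "z2 = (\<lambda>l. (\<eta> l)\<^sup>2 *\<^sub>R v l)"
    define \<tau> where "\<tau> = (\<lambda>l \<rho>. (\<eta> (l + \<rho>) - \<eta> l) *\<^sub>R v (l + \<rho>))"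
    define \<tau>2 where "\<tau>2 = (\<lambda>l \<rho>. (\<eta> (l + \<rho>) - \<eta> l) *\<^sub>R \<tau> l \<rho>)"
    define P where "P = (\<lambda>l. stencil_norm S (\<lambda>\<rho>. v (l + \<rho>)))"
    define W where "W = (\<lambda>l. (P l)\<^sup>2 + (norm (v l))\<^sup>2)"
    define \<theta> where "\<theta> = real m / real t"
    have \<theta>: "0 \<le> \<theta>" by (simp add: \<theta>_def)
    let ?R = "r + m + t + m"
    have supz: "supp_in (r + m + t) z" "supp_in (r + m + t) z2"
      using cutoff_eq_0[of _ "r + m" t] by (auto simp: supp_in_def z_def z2_def \<eta>_def)
    have fz: "fd z l = (\<lambda>\<rho>. \<eta> l *\<^sub>R fd v l \<rho> + \<tau> l \<rho>)" for l
      by (rule ext) (simp add: fd_def z_def \<tau>_def scaleR_diff_left scaleR_diff_right)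
    have fz2: "fd z2 l = (\<lambda>\<rho>. (\<eta> l)\<^sup>2 *\<^sub>R fd v l \<rho> + ((2 * \<eta> l) *\<^sub>R \<tau> l \<rho> + \<tau>2 l \<rho>))" for l
    proof (rule ext)
      fix \<rho>
      have *: "(\<eta> (l + \<rho>))\<^sup>2 = (\<eta> l)\<^sup>2 + 2 * \<eta> l * (\<eta> (l + \<rho>) - \<eta> l) + (\<eta> (l + \<rho>) - \<eta> l)\<^sup>2"
        by (simp add: power2_eq_square algebra_simps)
      have "(\<eta> (l + \<rho>))\<^sup>2 *\<^sub>R v (l + \<rho>) = (\<eta> l)\<^sup>2 *\<^sub>R v (l + \<rho>) + (2 * \<eta> l * (\<eta> (l + \<rho>) - \<eta> l)) *\<^sub>R v (l + \<rho>)
          + ((\<eta> (l + \<rho>) - \<eta> l) * (\<eta> (l + \<rho>) - \<eta> l)) *\<^sub>R v (l + \<rho>)"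
        unfolding * by (simp add: scaleR_add_left power2_eq_square)
      then show "fd z2 l \<rho> = (\<eta> l)\<^sup>2 *\<^sub>R fd v l \<rho> + ((2 * \<eta> l) *\<^sub>R \<tau> l \<rho> + \<tau>2 l \<rho>)"
        by (simp add: fd_def z2_def \<tau>_def \<tau>2_def scaleR_diff_right)
    qed
    \<comment> \<open>The multiples of \<open>b (fd v l) (fd v l)\<close> cancel, so every remaining
      term carries a factor \<tau> or \<open>\<tau>2\<close>. The first two terms would cancel as
      well for a symmetric \<open>b\<close>.\<close>
    have id: "b (fd z l) (fd z l) - b (fd z2 l) (fd v l)
       = b (fd z l) (\<tau> l) - b (\<tau> l) (fd z l) + b (\<tau> l) (\<tau> l) - b (\<tau>2 l) (fd v l)" for l
      unfolding fz fz2
      by (simp add: b_add1 b_add2 b_scale1 b_scale2 power2_eq_square algebra_simps)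
    have Dle: "\<bar>\<eta> (l + \<rho>) - \<eta> l\<bar> \<le> \<theta>" if "\<rho> \<in> S" for l \<rho>
      unfolding \<eta>_def \<theta>_def using that S_sub t by (intro cutoff_lipschitz) auto
    have N\<tau>: "stencil_norm S (\<tau> l) \<le> \<theta> * P l" for l
    proof -
      have "stencil_norm S (\<tau> l) \<le> stencil_norm S (\<lambda>\<rho>. \<theta> *\<^sub>R v (l + \<rho>))"
        by (rule stencil_norm_mono) (use Dle \<theta> in \<open>auto simp: \<tau>_def intro!: mult_right_mono\<close>)
      then show ?thesis using \<theta> by (simp add: stencil_norm_scaleR P_def)
    qed
    have N\<tau>2: "stencil_norm S (\<tau>2 l) \<le> \<theta> * (\<theta> * P l)" for l
    proof -
      have "stencil_norm S (\<tau>2 l) \<le> stencil_norm S (\<lambda>\<rho>. \<theta> *\<^sub>R \<tau> l \<rho>)"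
        by (rule stencil_norm_mono) (use Dle \<theta> in \<open>auto simp: \<tau>2_def intro!: mult_right_mono\<close>)
      also have "\<dots> = \<theta> * stencil_norm S (\<tau> l)" using \<theta> by (simp add: stencil_norm_scaleR)
      also have "\<dots> \<le> \<theta> * (\<theta> * P l)" using N\<tau> \<theta> by (intro mult_left_mono)
      finally show ?thesis .
    qed
    have Nfv: "stencil_norm S (fd v l) \<le> P l + sqrt (card S) * norm (v l)" for l
    proof -
      have "stencil_norm S (\<lambda>_. v l) = sqrt (card S) * norm (v l)"
        by (simp add: stencil_norm_def L2_set_def real_sqrt_mult)
      then show ?thesis unfolding fd_def P_def
        using stencil_norm_triangle_diff[of S "\<lambda>\<rho>. v (l + \<rho>)" "\<lambda>_. v l"] by simp
    qed
    have pt: "b (fd z l) (fd z l) - b (fd z2 l) (fd v l)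
        \<le> c / 2 * (stencil_norm S (fd z l))\<^sup>2 + K2 * \<theta>\<^sup>2 * W l" for l
    proof -
      define n where "n = stencil_norm S (fd z l)"
      define p where "p = P l"
      define w where "w = norm (v l)"
      define q where "q = sqrt (card S)"
      have nn: "0 \<le> n" "0 \<le> p" "0 \<le> w" "0 \<le> q" by (auto simp: n_def p_def P_def w_def q_def)
      have q2: "q\<^sup>2 = card S" by (simp add: q_def)
      have T: "stencil_norm S (\<tau> l) \<le> \<theta> * p" "stencil_norm S (\<tau>2 l) \<le> \<theta> * (\<theta> * p)"
        "stencil_norm S (fd v l) \<le> p + q * w" using N\<tau> N\<tau>2 Nfv by (auto simp: p_def w_def q_def)
      have 1: "b (fd z l) (\<tau> l) \<le> K * n * (\<theta> * p)"
      proof -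
        have "b (fd z l) (\<tau> l) \<le> K * n * stencil_norm S (\<tau> l)"
          using b_bound[of "fd z l" "\<tau> l"] by (simp add: n_def)
        also have "\<dots> \<le> K * n * (\<theta> * p)" using T nn K_nonneg by (intro mult_left_mono) auto
        finally show ?thesis .
      qed
      have 2: "- b (\<tau> l) (fd z l) \<le> K * (\<theta> * p) * n"
      proof -
        have "- b (\<tau> l) (fd z l) \<le> K * stencil_norm S (\<tau> l) * n"
          using b_bound[of "\<tau> l" "fd z l"] by (simp add: n_def)
        also have "\<dots> \<le> K * (\<theta> * p) * n" using T nn K_nonneg by (intro mult_right_mono mult_left_mono) auto
        finally show ?thesis .
      qed
      have 3: "b (\<tau> l) (\<tau> l) \<le> K * (\<theta> * p) * (\<theta> * p)"
      proof -
        have "b (\<tau> l) (\<tau> l) \<le> K * stencil_norm S (\<tau> l) * stencil_norm S (\<tau> l)"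
          using b_bound[of "\<tau> l" "\<tau> l"] by simp
        also have "\<dots> \<le> K * (\<theta> * p) * (\<theta> * p)" using T nn K_nonneg \<theta>
          by (intro mult_mono) auto
        finally show ?thesis .
      qed
      have 4: "- b (\<tau>2 l) (fd v l) \<le> K * (\<theta> * (\<theta> * p)) * (p + q * w)"
      proof -
        have "- b (\<tau>2 l) (fd v l) \<le> K * stencil_norm S (\<tau>2 l) * stencil_norm S (fd v l)"
          using b_bound[of "\<tau>2 l" "fd v l"] by simp
        also have "\<dots> \<le> K * (\<theta> * (\<theta> * p)) * (p + q * w)" using T nn K_nonneg \<theta>
          by (intro mult_mono) auto
        finally show ?thesis .
      qed
      \<comment> \<open>Weighted so that only half of the coercivity constant is spent; that half is
        absorbed on the left after summation.\<close>
      have 5: "2 * (K * n * (\<theta> * p)) \<le> c / 2 * n\<^sup>2 + 2 * K\<^sup>2 / c * \<theta>\<^sup>2 * p\<^sup>2"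
      proof -
        have "0 \<le> (c * n - 2 * (K * \<theta> * p))\<^sup>2 / (2 * c)" using c_pos by simp
        also have "\<dots> = c / 2 * n\<^sup>2 + 2 * K\<^sup>2 / c * \<theta>\<^sup>2 * p\<^sup>2 - 2 * (K * n * (\<theta> * p))"
          using c_pos by (simp add: field_simps power2_eq_square)
        finally show ?thesis by simp
      qed
      have 6: "p * (p + q * w) \<le> (2 + q\<^sup>2) * (p\<^sup>2 + w\<^sup>2)"
      proof -
        have "2 * p * (q * w) \<le> p\<^sup>2 + (q * w)\<^sup>2" by (rule sum_squares_bound)
        moreover have "0 \<le> p * (q * w)" using nn by simp
        ultimately have "p * (q * w) \<le> p\<^sup>2 + q\<^sup>2 * w\<^sup>2" by (simp add: power_mult_distrib)
        moreover have "0 \<le> q\<^sup>2 * p\<^sup>2" "0 \<le> w\<^sup>2" by auto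
        moreover have "p * (p + q * w) = p\<^sup>2 + p * (q * w)" by (simp add: power2_eq_square algebra_simps)
        moreover have "(2 + q\<^sup>2) * (p\<^sup>2 + w\<^sup>2) = 2 * p\<^sup>2 + 2 * w\<^sup>2 + q\<^sup>2 * p\<^sup>2 + q\<^sup>2 * w\<^sup>2"
          by (simp add: algebra_simps)
        ultimately show ?thesis by linarith
      qed
      have "b (fd z l) (fd z l) - b (fd z2 l) (fd v l)
         \<le> 2 * (K * n * (\<theta> * p)) + K * \<theta>\<^sup>2 * p\<^sup>2 + K * \<theta>\<^sup>2 * (p * (p + q * w))"
        using id[of l] 1 2 3 4 by (simp add: power2_eq_square algebra_simps)
      also have "\<dots> \<le> (c / 2 * n\<^sup>2 + 2 * K\<^sup>2 / c * \<theta>\<^sup>2 * p\<^sup>2) + K * \<theta>\<^sup>2 * p\<^sup>2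
          + K * \<theta>\<^sup>2 * ((2 + q\<^sup>2) * (p\<^sup>2 + w\<^sup>2))"
        by (intro add_mono 5 mult_left_mono 6 order_refl) (use K_nonneg in auto)
      also have "\<dots> \<le> c / 2 * n\<^sup>2 + 2 * K\<^sup>2 / c * \<theta>\<^sup>2 * (p\<^sup>2 + w\<^sup>2) + K * \<theta>\<^sup>2 * (p\<^sup>2 + w\<^sup>2)
          + K * \<theta>\<^sup>2 * ((2 + q\<^sup>2) * (p\<^sup>2 + w\<^sup>2))"
        by (intro add_mono mult_left_mono order_refl) (use K_nonneg c_pos in auto)
      also have "\<dots> = c / 2 * n\<^sup>2 + K2 * \<theta>\<^sup>2 * W l"
        by (simp add: K2_def W_def p_def w_def q2 algebra_simps)
      finally show ?thesis by (simp add: n_def)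
    qed
    have "c * (\<Sum>l\<in>cube ?R. (stencil_norm S (fd z l))\<^sup>2) \<le> B z z"
      by (rule coercive_finite[OF supz(1)]) simp
    also have "\<dots> = B z z - B z2 v"
    proof -
      have "B z2 v = 0"
        using har supp_in_mono[OF supz(2), of "r + s"] t by (simp add: harmonic_def)
      then show ?thesis by simp
    qed
    also have "\<dots> = (\<Sum>l\<in>cube ?R. b (fd z l) (fd z l) - b (fd z2 l) (fd v l))"
      unfolding B_finite[OF supz(1) order_refl] B_finite[OF supz(2) order_refl]
      by (simp add: sum_subtractf)
    also have "\<dots> \<le> (\<Sum>l\<in>cube ?R. c / 2 * (stencil_norm S (fd z l))\<^sup>2 + K2 * \<theta>\<^sup>2 * W l)"
      by (rule sum_mono) (rule pt)
    also have "\<dots> = c / 2 * (\<Sum>l\<in>cube ?R. (stencil_norm S (fd z l))\<^sup>2) + K2 * \<theta>\<^sup>2 * (\<Sum>l\<in>cube ?R. W l)"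
      by (simp add: sum.distrib sum_distrib_left)
    finally have "(\<Sum>l\<in>cube ?R. (stencil_norm S (fd z l))\<^sup>2) \<le> (2 * K2 / c) * \<theta>\<^sup>2 * (\<Sum>l\<in>cube ?R. W l)"
      using c_pos by (simp add: field_simps)
    also have "\<dots> \<le> (2 * K2 / c) * ((2 * real m)\<^sup>2 / (real s)\<^sup>2) * ((real (card S) + 1) * (\<Sum>l\<in>cube (r + s). (norm (v l))\<^sup>2))"
    proof (intro mult_mono mult_left_mono)
      have "\<theta> \<le> 2 * real m / real s"
        using t s m_pos by (simp add: \<theta>_def field_simps)
      then have "\<theta>\<^sup>2 \<le> (2 * real m / real s)\<^sup>2" using \<theta> by (intro power_mono) auto
      then show "\<theta>\<^sup>2 \<le> (2 * real m)\<^sup>2 / (real s)\<^sup>2" by (simp add: power_divide)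
      have 1: "(\<Sum>l\<in>cube ?R. (norm (v (l + \<rho>)))\<^sup>2) \<le> (\<Sum>l\<in>cube (r + s). (norm (v l))\<^sup>2)"
        if "\<rho> \<in> cube m" for \<rho>
      proof -
        have "(\<Sum>l\<in>cube ?R. (norm (v (l + \<rho>)))\<^sup>2) = (\<Sum>l\<in>(\<lambda>l. l + \<rho>) ` cube ?R. (norm (v l))\<^sup>2)"
          by (subst sum.reindex) (auto simp: inj_on_def)
        also have "\<dots> \<le> (\<Sum>l\<in>cube (r + s). (norm (v l))\<^sup>2)"
        proof (rule sum_mono2)
          have "cube (?R + m) \<subseteq> (cube (r + s) :: (int^'d) set)" using t by (intro cube_mono) auto
          then show "(\<lambda>l. l + \<rho>) ` cube ?R \<subseteq> cube (r + s)" using that by (auto intro: cube_add)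
        qed auto
        finally show ?thesis .
      qed
      have "(\<Sum>l\<in>cube ?R. W l) = (\<Sum>\<rho>\<in>S. \<Sum>l\<in>cube ?R. (norm (v (l + \<rho>)))\<^sup>2) + (\<Sum>l\<in>cube ?R. (norm (v (l + 0)))\<^sup>2)"
        unfolding W_def P_def stencil_norm_sq by (simp add: sum.distrib sum.swap[of _ S])
      also have "\<dots> \<le> (\<Sum>\<rho>\<in>S. (\<Sum>l\<in>cube (r + s). (norm (v l))\<^sup>2)) + (\<Sum>l\<in>cube (r + s). (norm (v l))\<^sup>2)"
        by (intro add_mono sum_mono 1) (use S_sub in \<open>auto simp: cube_def\<close>)
      finally show "(\<Sum>l\<in>cube ?R. W l) \<le> (real (card S) + 1) * (\<Sum>l\<in>cube (r + s). (norm (v l))\<^sup>2)"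
        by (simp add: algebra_simps)
    qed (use K2 c_pos in \<open>auto intro!: sum_nonneg simp: W_def\<close>)
    also have "\<dots> = K1 / (real s)\<^sup>2 * (\<Sum>l\<in>cube (r + s). (norm (v l))\<^sup>2)"
      by (simp add: K1_def)
    finally have fin: "(\<Sum>l\<in>cube ?R. (stencil_norm S (fd z l))\<^sup>2) \<le> K1 / (real s)\<^sup>2 * (\<Sum>l\<in>cube (r + s). (norm (v l))\<^sup>2)" .
    have "(\<Sum>l\<in>cube r. (stencil_norm S (fd v l))\<^sup>2) = (\<Sum>l\<in>cube r. (stencil_norm S (fd z l))\<^sup>2)"
    proof (rule sum.cong[OF refl])
      fix l :: "int^'d" assume l: "l \<in> cube r"
      have "fd v l \<rho> = fd z l \<rho>" if "\<rho> \<in> S" for \<rho>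
      proof -
        have "\<eta> (l + \<rho>) = 1" "\<eta> l = 1"
          unfolding \<eta>_def using l that S_sub t cube_add[of l r \<rho> m] cube_mono[of r "r + m"]
          by (auto intro!: cutoff_eq_1)
        then show ?thesis by (simp add: fd_def z_def)
      qed
      then show "(stencil_norm S (fd v l))\<^sup>2 = (stencil_norm S (fd z l))\<^sup>2"
        using stencil_norm_cong[of S "fd v l" "fd z l"] by simp
    qed
    also have "\<dots> \<le> (\<Sum>l\<in>cube ?R. (stencil_norm S (fd z l))\<^sup>2)"
      by (rule sum_mono2) (use cube_mono[of r ?R] in auto)
    finally show ?thesis using fin by linarith
  qed
  moreover have "0 \<le> K1" using K2 c_pos by (simp add: K1_def)
  ultimately show ?thesis by blast
qed

end

section \<open>Discrete Sobolev inequality and interior estimate\<close>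

primrec iter_diff :: "'d list \<Rightarrow> (int^'d \<Rightarrow> 'a::real_normed_vector) \<Rightarrow> int^'d \<Rightarrow> 'a" where
  "iter_diff [] f = f"
| "iter_diff (i # J) f = iter_diff J (\<lambda>l. f (l + axis i 1) - f l)"

text \<open>Iterated one-dimensional sums over a box of side \<open>n\<close>, in this form so that
  the Sobolev inequality can be proved one direction at a time.\<close>

primrec box_sum :: "nat \<Rightarrow> 'd list \<Rightarrow> (int^'d \<Rightarrow> real) \<Rightarrow> int^'d \<Rightarrow> real" where
  "box_sum n [] F x = F x"
| "box_sum n (i # J) F x = (\<Sum>t<n. box_sum n J F (x + axis i (int t)))"

lemma box_sum_add: "box_sum n J (\<lambda>y. F y + G y) x = box_sum n J F x + box_sum n J G x"
  by (induction J arbitrary: x) (auto simp: sum.distrib)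

lemma box_sum_cmult: "box_sum n J (\<lambda>y. a * F y) x = a * box_sum n J F x"
  by (induction J arbitrary: x) (auto simp: sum_distrib_left)

lemma sum_list_sum_swap:
  fixes f :: "'b \<Rightarrow> 'c \<Rightarrow> real"
  shows "(\<Sum>y\<in>Y. \<Sum>J\<leftarrow>js. f J y) = (\<Sum>J\<leftarrow>js. \<Sum>y\<in>Y. f J y)"
  by (induction js) (auto simp: sum.distrib)

lemma length_le_of_subseqs: "J \<in> set (subseqs js) \<Longrightarrow> length J \<le> length js"
  by (induction js arbitrary: J) (auto simp: Let_def le_SucI)

text \<open>The one-dimensional case: \<open>f x\<close> is compared by telescoping with the value
  \<open>t\<close> steps away, and the squares are averaged over \<open>t < n\<close>. Of the weight
  \<open>(real n)\<^sup>2\<close> one factor comes from Cauchy-Schwarz, the other from summing over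
  \<open>t\<close>.\<close>

lemma norm_sq_le_average:
  fixes f :: "int^'d \<Rightarrow> 'a::real_normed_vector"
  assumes "0 < n"
  shows "(norm (f x))\<^sup>2 \<le> 2 / real n *
    (\<Sum>t<n. (norm (f (x + axis i (int t))))\<^sup>2
       + (real n)\<^sup>2 * (norm (f (x + axis i (int t) + axis i 1) - f (x + axis i (int t))))\<^sup>2)"
proof -
  define g where "g = (\<lambda>t. f (x + axis i (int t)))"
  have gS: "f (x + axis i (int t) + axis i 1) = g (Suc t)" for t
    by (simp add: g_def axis_def vec_eq_iff if_distrib[of "\<lambda>z. _ + z"] cong: if_cong)
       (rule arg_cong[of _ _ f], simp add: vec_eq_iff)
  define Y where "Y = (\<Sum>s<n. (norm (g (Suc s) - g s))\<^sup>2)"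
  have pt: "(norm (f x))\<^sup>2 \<le> 2 * (norm (g t))\<^sup>2 + 2 * real n * Y" if t: "t < n" for t
  proof -
    have "g 0 = f x" by (simp add: g_def axis_def) (rule arg_cong[of _ _ f], simp add: vec_eq_iff)
    then have "f x = g t - (\<Sum>s<t. g (Suc s) - g s)"
      by (simp add: sum_lessThan_telescope)
    then have "norm (f x) \<le> norm (g t) + norm (\<Sum>s<t. g (Suc s) - g s)"
      using norm_triangle_ineq4 by metis
    also have "norm (\<Sum>s<t. g (Suc s) - g s) \<le> (\<Sum>s<t. norm (g (Suc s) - g s))" by (rule norm_sum)
    also have "\<dots> \<le> (\<Sum>s<n. norm (g (Suc s) - g s))" using t by (intro sum_mono2) auto
    finally have 1: "norm (f x) \<le> norm (g t) + (\<Sum>s<n. norm (g (Suc s) - g s))" by simp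
    have "(\<Sum>s<n. 1 * norm (g (Suc s) - g s))\<^sup>2 \<le> (\<Sum>s<n. 1\<^sup>2) * (\<Sum>s<n. (norm (g (Suc s) - g s))\<^sup>2)"
      by (rule Cauchy_Schwarz_ineq_sum)
    then have 2: "(\<Sum>s<n. norm (g (Suc s) - g s))\<^sup>2 \<le> real n * Y" by (simp add: Y_def)
    have "(norm (f x))\<^sup>2 \<le> (norm (g t) + (\<Sum>s<n. norm (g (Suc s) - g s)))\<^sup>2"
      using 1 by (intro power_mono) auto
    also have "\<dots> \<le> 2 * (norm (g t))\<^sup>2 + 2 * (\<Sum>s<n. norm (g (Suc s) - g s))\<^sup>2"
      using sum_squares_bound[of "norm (g t)" "\<Sum>s<n. norm (g (Suc s) - g s)"]
      by (simp add: power2_sum)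
    finally show ?thesis using 2 by linarith
  qed
  have "real n * (norm (f x))\<^sup>2 = (\<Sum>t<n. (norm (f x))\<^sup>2)" by simp
  also have "\<dots> \<le> (\<Sum>t<n. 2 * (norm (g t))\<^sup>2 + 2 * real n * Y)"
    by (intro sum_mono pt) simp
  also have "\<dots> = 2 * (\<Sum>t<n. (norm (g t))\<^sup>2 + (real n)\<^sup>2 * (norm (g (Suc t) - g t))\<^sup>2)"
    by (simp add: sum.distrib Y_def power2_eq_square sum_distrib_left[symmetric])
  finally have "(norm (f x))\<^sup>2 \<le> 2 / real n * (\<Sum>t<n. (norm (g t))\<^sup>2 + (real n)\<^sup>2 * (norm (g (Suc t) - g t))\<^sup>2)"
    using assms by (simp add: field_simps)
  then show ?thesis unfolding gS unfolding g_def .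
qed

text \<open>Each direction either keeps \<open>f\<close> or takes its difference, so the terms end
  up indexed by the sublists of \<open>js\<close>. The induction hypothesis is applied to
  \<open>f\<close> and to its difference, hence \<open>f\<close> is arbitrary.\<close>

lemma sobolev_box:
  fixes f :: "int^'d \<Rightarrow> 'a::real_normed_vector"
  assumes n: "0 < n"
  shows "(norm (f x))\<^sup>2 \<le> (2 / real n) ^ length js *
    box_sum n js (\<lambda>y. \<Sum>J\<leftarrow>subseqs js. real n ^ (2 * length J) * (norm (iter_diff J f y))\<^sup>2) x"
proof (induction js arbitrary: f x)
  case Nil
  show ?case by simp
next
  case (Cons i js)
  define D where "D = (\<lambda>l. f (l + axis i 1) - f l)"
  define P where "P = (\<lambda>(f :: int^'d \<Rightarrow> 'a) y. \<Sum>J\<leftarrow>subseqs js. real n ^ (2 * length J) * (norm (iter_diff J f y))\<^sup>2)"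
  have expand: "(\<lambda>y. \<Sum>J\<leftarrow>subseqs (i # js). real n ^ (2 * length J) * (norm (iter_diff J f y))\<^sup>2)
      = (\<lambda>y. (real n)\<^sup>2 * P D y + P f y)"
    by (simp add: fun_eq_iff Let_def P_def D_def o_def sum_list_const_mult[symmetric] power_add
        power2_eq_square mult.assoc)
  have "(norm (f x))\<^sup>2 \<le> 2 / real n *
      (\<Sum>t<n. (norm (f (x + axis i (int t))))\<^sup>2 + (real n)\<^sup>2 * (norm (D (x + axis i (int t))))\<^sup>2)"
    unfolding D_def by (rule norm_sq_le_average[OF n])
  also have "\<dots> \<le> 2 / real n *
      (\<Sum>t<n. (2 / real n) ^ length js * box_sum n js (P f) (x + axis i (int t))
        + (real n)\<^sup>2 * ((2 / real n) ^ length js * box_sum n js (P D) (x + axis i (int t))))"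
    unfolding P_def by (intro mult_left_mono sum_mono add_mono Cons.IH) auto
  also have "\<dots> = (2 / real n) ^ length (i # js) *
      (\<Sum>t<n. box_sum n js (\<lambda>y. (real n)\<^sup>2 * P D y + P f y) (x + axis i (int t)))"
    unfolding box_sum_add box_sum_cmult by (simp add: sum_distrib_left algebra_simps)
  finally show ?case by (simp add: expand del: subseqs.simps)
qed

text \<open>The slices for different \<open>t\<close> are disjoint because, the directions being
  distinct, the later sums leave coordinate \<open>j\<close> fixed; no point is counted
  twice.\<close>

lemma box_sum_le:
  fixes F :: "int^'d \<Rightarrow> real"
  assumes "distinct js" "\<And>y. 0 \<le> F y"
  shows "box_sum n js F x \<le>
    sum F {y. \<forall>i. if i \<in> set js then x $ i \<le> y $ i \<and> y $ i < x $ i + int n else y $ i = x $ i}"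
  using assms(1)
proof (induction js arbitrary: x)
  case Nil
  have "{y. \<forall>i. y $ i = x $ i} = {x}" by (auto simp: vec_eq_iff)
  then show ?case by simp
next
  case (Cons j js)
  let ?X = "\<lambda>js x. {y::int^'d. \<forall>i. if i \<in> set js then x $ i \<le> y $ i \<and> y $ i < x $ i + int n else y $ i = x $ i}"
  have fin: "finite (?X js x)" for js and x :: "int^'d"
  proof -
    obtain r where r: "\<And>i. \<bar>x $ i\<bar> + int n \<le> int r"
    proof -
      have "\<bar>x $ i\<bar> + int n \<le> int (nat (Max (range (\<lambda>i. \<bar>x $ i\<bar> + int n))))" for i
        by (simp add: Max_ge_iff)
      then show ?thesis using that by blast
    qed
    have "?X js x \<subseteq> cube r"
    proof
      fix y assume y: "y \<in> ?X js x"
      have "\<bar>y $ i\<bar> \<le> int r" for i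
        using y r[of i] by (cases "i \<in> set js") (auto dest!: spec[of _ i])
      then show "y \<in> cube r" by (simp add: cube_def)
    qed
    then show ?thesis using finite_cube finite_subset by blast
  qed
  have j: "j \<notin> set js" using Cons.prems by simp
  have "box_sum n (j # js) F x \<le> (\<Sum>t<n. sum F (?X js (x + axis j (int t))))"
    using Cons by (simp add: sum_mono)
  also have "\<dots> = sum F (\<Union>t<n. ?X js (x + axis j (int t)))"
  proof (rule sum.UNION_disjoint[symmetric])
    show "\<forall>t\<in>{..<n}. \<forall>t'\<in>{..<n}. t \<noteq> t' \<longrightarrow> ?X js (x + axis j (int t)) \<inter> ?X js (x + axis j (int t')) = {}"
    proof (intro ballI impI)
      fix t t' :: nat assume "t \<noteq> t'"
      have "y $ j = x $ j + int t" if "y \<in> ?X js (x + axis j (int t))" for y t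
        using that j by (auto dest!: spec[of _ j] simp: axis_def)
      then show "?X js (x + axis j (int t)) \<inter> ?X js (x + axis j (int t')) = {}"
        using \<open>t \<noteq> t'\<close> by (metis (no_types, lifting) add_left_cancel disjoint_iff of_nat_eq_iff)
    qed
  qed (use fin in auto)
  also have "\<dots> \<le> sum F (?X (j # js) x)"
  proof (rule sum_mono2)
    show "(\<Union>t<n. ?X js (x + axis j (int t))) \<subseteq> ?X (j # js) x"
    proof safe
      fix t y i assume t: "t < n" and y: "\<forall>i. if i \<in> set js then (x + axis j (int t)) $ i \<le> y $ i \<and> y $ i < (x + axis j (int t)) $ i + int n else y $ i = (x + axis j (int t)) $ i"
      show "if i \<in> set (j # js) then x $ i \<le> y $ i \<and> y $ i < x $ i + int n else y $ i = x $ i"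
        using spec[OF y, of i] t j by (cases "i = j") (auto simp: axis_def split: if_splits)
    qed
  qed (use fin[of "j # js" x] assms(2) in auto)
  finally show ?case .
qed

context lattice_form begin

text \<open>Differences of a harmonic function are harmonic, so Caccioppoli applies to each of them
  in turn: an iterated difference of order j costs j layers of width \<open>s\<close> and gains the
  power -2j of \<open>s\<close>, which cancels the weight in \<open>sobolev_box\<close>. With d =
  \<open>CARD('d)\<close> the factor \<open>(2 / s) ^ d\<close> remains. Boxes issuing from
  \<open>cube s\<close> stay in \<open>cube (2 * s)\<close>, and up to d layers are added, whence
  the radius \<open>(d + 2) * s\<close>.\<close>

lemma interior_estimate:
  "\<exists>K2\<ge>0. \<forall>s f. 6 * m \<le> s \<longrightarrow> harmonic ((CARD('d) + 2) * s) f \<longrightarrow>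
     (\<forall>x\<in>cube s. (norm (f x))\<^sup>2 \<le> K2 / real s ^ CARD('d) * (\<Sum>l\<in>cube ((CARD('d) + 2) * s). (norm (f l))\<^sup>2))"
proof -
  obtain K1 where K1: "0 \<le> K1" and cacc: "\<And>r s v. harmonic (r + s) v \<Longrightarrow> 6 * m \<le> s \<Longrightarrow>
     (\<Sum>l\<in>cube r. (stencil_norm S (fd v l))\<^sup>2) \<le> K1 / (real s)\<^sup>2 * (\<Sum>l\<in>cube (r + s). (norm (v l))\<^sup>2)"
    using caccioppoli by blast
  have iter: "(\<Sum>l\<in>cube r. (norm (iter_diff J f l))\<^sup>2)
      \<le> (K1 / (real s)\<^sup>2) ^ length J * (\<Sum>l\<in>cube (r + length J * s). (norm (f l))\<^sup>2)"
    if "harmonic (r + length J * s) f" "6 * m \<le> s" for J r s f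
    using that
  proof (induction J arbitrary: f)
    case Nil
    then show ?case by simp
  next
    case (Cons i J)
    define g where "g = (\<lambda>l. f (l + axis i 1) - f l)"
    have s: "1 \<le> s" using Cons.prems m_pos by linarith
    have har: "harmonic ((r + length J * s) + s) f"
      using Cons.prems by (simp add: algebra_simps)
    then have "harmonic ((r + length J * s) + 1) f" by (rule harmonic_mono) (use s in simp)
    then have "harmonic (r + length J * s) g" unfolding g_def
      by (rule harmonic_fd) (rule axis_in_cube)
    then have "(\<Sum>l\<in>cube r. (norm (iter_diff J g l))\<^sup>2)
        \<le> (K1 / (real s)\<^sup>2) ^ length J * (\<Sum>l\<in>cube (r + length J * s). (norm (g l))\<^sup>2)"
      using Cons by blast
    also have "\<dots> \<le> (K1 / (real s)\<^sup>2) ^ length J * (K1 / (real s)\<^sup>2 * (\<Sum>l\<in>cube ((r + length J * s) + s). (norm (f l))\<^sup>2))"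
    proof (rule mult_left_mono)
      have "(\<Sum>l\<in>cube (r + length J * s). (norm (g l))\<^sup>2)
        \<le> (\<Sum>l\<in>cube (r + length J * s). (stencil_norm S (fd f l))\<^sup>2)"
    proof (intro sum_mono power_mono)
      show "norm (g l) \<le> stencil_norm S (fd f l)" for l
        using norm_le_stencil_norm[OF finite_S axis_S[of i], of "fd f l"] by (simp add: fd_def g_def)
    qed auto
      also have "\<dots> \<le> K1 / (real s)\<^sup>2 * (\<Sum>l\<in>cube ((r + length J * s) + s). (norm (f l))\<^sup>2)"
        by (rule cacc[OF har Cons.prems(2)])
      finally show "(\<Sum>l\<in>cube (r + length J * s). (norm (g l))\<^sup>2) \<le> K1 / (real s)\<^sup>2 * (\<Sum>l\<in>cube ((r + length J * s) + s). (norm (f l))\<^sup>2)" .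
    qed (use K1 in auto)
    finally show ?case using K1 by (simp add: g_def algebra_simps)
  qed
  obtain js :: "'d list" where js: "set js = UNIV" "distinct js"
    using finite_distinct_list[of "UNIV :: 'd set"] by auto
  have len: "length js = CARD('d)" using js distinct_card[of js] by simp
  define K2 where "K2 = 2 ^ CARD('d) * (\<Sum>J\<leftarrow>subseqs js. K1 ^ length J)"
  have "0 \<le> K2" unfolding K2_def using K1 by (auto intro!: mult_nonneg_nonneg sum_list_nonneg)
  moreover have "(norm (f x))\<^sup>2 \<le> K2 / real s ^ CARD('d) * (\<Sum>l\<in>cube ((CARD('d) + 2) * s). (norm (f l))\<^sup>2)"
    if s: "6 * m \<le> s" and har: "harmonic ((CARD('d) + 2) * s) f" and x: "x \<in> cube s" for s f x
  proof -
    have s0: "0 < s" using s m_pos by linarith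
    define E where "E = (\<Sum>l\<in>cube ((CARD('d) + 2) * s). (norm (f l))\<^sup>2)"
    have E: "0 \<le> E" by (simp add: E_def sum_nonneg)
    let ?F = "\<lambda>y. \<Sum>J\<leftarrow>subseqs js. real s ^ (2 * length J) * (norm (iter_diff J f y))\<^sup>2"
    have Fnn: "0 \<le> ?F y" for y by (intro sum_list_nonneg) auto
    have "box_sum s js ?F x \<le> sum ?F {y. \<forall>i. if i \<in> set js then x $ i \<le> y $ i \<and> y $ i < x $ i + int s else y $ i = x $ i}"
      by (rule box_sum_le[OF js(2) Fnn])
    also have "\<dots> \<le> sum ?F (cube (2 * s))"
    proof (rule sum_mono2)
      show "{y. \<forall>i. if i \<in> set js then x $ i \<le> y $ i \<and> y $ i < x $ i + int s else y $ i = x $ i} \<subseteq> cube (2 * s)"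
      proof
        fix y assume "y \<in> {y. \<forall>i. if i \<in> set js then x $ i \<le> y $ i \<and> y $ i < x $ i + int s else y $ i = x $ i}"
        then have "x $ i \<le> y $ i" "y $ i < x $ i + int s" for i using js(1) by auto
        moreover have "\<bar>x $ i\<bar> \<le> int s" for i using x by (simp add: cube_def)
        ultimately have "\<bar>y $ i\<bar> \<le> int (2 * s)" for i
          by (smt (verit, best) int_plus mult_2)
        then show "y \<in> cube (2 * s)" by (simp add: cube_def)
      qed
    qed (use Fnn in auto)
    also have "sum ?F (cube (2 * s)) = (\<Sum>J\<leftarrow>subseqs js. real s ^ (2 * length J) * (\<Sum>y\<in>cube (2 * s). (norm (iter_diff J f y))\<^sup>2))"
      by (simp add: sum_list_sum_swap sum_distrib_left)
    also have "\<dots> \<le> (\<Sum>J\<leftarrow>subseqs js. K1 ^ length J * E)"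
    proof (rule sum_list_mono)
      fix J assume "J \<in> set (subseqs js)"
      then have lJ: "length J \<le> CARD('d)"
        using len by (metis length_le_of_subseqs)
      have cub: "2 * s + length J * s \<le> (CARD('d) + 2) * s" using lJ by (simp add: algebra_simps)
      have "(\<Sum>y\<in>cube (2 * s). (norm (iter_diff J f y))\<^sup>2)
         \<le> (K1 / (real s)\<^sup>2) ^ length J * (\<Sum>l\<in>cube (2 * s + length J * s). (norm (f l))\<^sup>2)"
        by (rule iter[OF harmonic_mono[OF har cub] s])
      also have "\<dots> \<le> (K1 / (real s)\<^sup>2) ^ length J * E"
        unfolding E_def using K1 by (intro mult_left_mono sum_mono2 cube_mono[OF cub]) auto
      finally have "real s ^ (2 * length J) * (\<Sum>y\<in>cube (2 * s). (norm (iter_diff J f y))\<^sup>2)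
         \<le> real s ^ (2 * length J) * ((K1 / (real s)\<^sup>2) ^ length J * E)" by (intro mult_left_mono) auto
      also have "\<dots> = K1 ^ length J * E" using s0 by (simp add: power_divide power_mult)
      finally show "real s ^ (2 * length J) * (\<Sum>y\<in>cube (2 * s). (norm (iter_diff J f y))\<^sup>2) \<le> K1 ^ length J * E" .
    qed
    finally have bs: "box_sum s js ?F x \<le> (\<Sum>J\<leftarrow>subseqs js. K1 ^ length J) * E"
      by (simp add: sum_list_mult_const)
    have "(norm (f x))\<^sup>2 \<le> (2 / real s) ^ length js * box_sum s js ?F x"
      by (rule sobolev_box[OF s0])
    also have "\<dots> \<le> (2 / real s) ^ length js * ((\<Sum>J\<leftarrow>subseqs js. K1 ^ length J) * E)"
      by (intro mult_left_mono bs) auto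
    also have "\<dots> = K2 / real s ^ CARD('d) * E"
      by (simp add: K2_def len power_divide)
    finally show ?thesis by (simp add: E_def)
  qed
  ultimately show ?thesis by blast
qed

end

section \<open>Existence of the Galerkin projection\<close>

definition delta :: "'b \<Rightarrow> 'a::zero \<Rightarrow> 'b \<Rightarrow> 'a" where
  "delta p i l = (if l = p then i else 0)"

context lattice_form begin

lemma supp_in_lin: "supp_in r z \<Longrightarrow> supp_in r z' \<Longrightarrow> supp_in r (\<lambda>l. x *\<^sub>R z l + z' l)"
  by (simp add: supp_in_def)

lemma B_linear2: "supp_in r z \<Longrightarrow> B z (\<lambda>l. x *\<^sub>R v l + w l) = x * B z v + B z w"
  by (simp add: B_finite[OF _ order_refl] fd_add fd_scaleR b_linear2 sum.distrib sum_distrib_left)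

lemma B_linear1:
  assumes "supp_in r z" "supp_in r z'"
  shows "B (\<lambda>l. x *\<^sub>R z l + z' l) v = x * B z v + B z' v"
  using assms supp_in_lin[OF assms, of x]
  by (simp add: B_finite[OF _ order_refl] fd_add fd_scaleR b_linear1 sum.distrib sum_distrib_left)

lemma B_diff2: "supp_in r z \<Longrightarrow> B z (\<lambda>l. v l - w l) = B z v - B z w"
  using B_linear2[of r z "-1" w v] by (simp add: algebra_simps)

lemma B_diff1: "supp_in r z \<Longrightarrow> supp_in r z' \<Longrightarrow> B (\<lambda>l. z l - z' l) v = B z v - B z' v"
  using B_linear1[of r z' z "-1" v] by (simp add: algebra_simps)

lemma B_sum1:
  assumes "finite I" "\<And>k. k \<in> I \<Longrightarrow> supp_in r (f k)"
  shows "B (\<lambda>l. \<Sum>k\<in>I. x k *\<^sub>R f k l) v = (\<Sum>k\<in>I. x k * B (f k) v)"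
    and "supp_in r (\<lambda>l. \<Sum>k\<in>I. x k *\<^sub>R f k l)"
proof -
  have "B (\<lambda>l. \<Sum>k\<in>I. x k *\<^sub>R f k l) v = (\<Sum>k\<in>I. x k * B (f k) v) \<and> supp_in r (\<lambda>l. \<Sum>k\<in>I. x k *\<^sub>R f k l)"
    using assms
  proof (induction I rule: finite_induct)
    case empty
    show ?case by (simp add: B_def fd_def supp_in_def)
  next
    case (insert k I)
    then show ?case
      using B_linear1[of r "f k" "\<lambda>l. \<Sum>k\<in>I. x k *\<^sub>R f k l" "x k" v] supp_in_lin[of r "f k" "\<lambda>l. \<Sum>k\<in>I. x k *\<^sub>R f k l" "x k"]
      by simp
  qed
  then show "B (\<lambda>l. \<Sum>k\<in>I. x k *\<^sub>R f k l) v = (\<Sum>k\<in>I. x k * B (f k) v)"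
    "supp_in r (\<lambda>l. \<Sum>k\<in>I. x k *\<^sub>R f k l)" by auto
qed

text \<open>Were \<open>B z z\<close> not positive, coercivity would make all differences of
  \<open>z\<close> vanish, in particular along an axis; walking along that axis out of the support
  would give \<open>z p = 0\<close>.\<close>

lemma B_positive:
  assumes z: "supp_in r z" and p: "z p \<noteq> 0"
  shows "0 < B z z"
proof (rule ccontr)
  assume "\<not> 0 < B z z"
  then have "c * (\<Sum>l\<in>cube (r + m). (stencil_norm S (fd z l))\<^sup>2) \<le> 0"
    using coercive_finite[OF z order_refl] by linarith
  then have "(\<Sum>l\<in>cube (r + m). (stencil_norm S (fd z l))\<^sup>2) = 0"
    using c_pos by (intro antisym sum_nonneg) (auto simp: mult_le_0_iff)
  then have 0: "stencil_norm S (fd z l) = 0" if "l \<in> cube (r + m)" for l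
    using that by (subst (asm) sum_nonneg_eq_0_iff) auto
  define i :: 'd where "i = undefined"
  have inv: "z (l + axis i 1) = z l" for l
  proof (cases "l \<in> cube (r + m)")
    case True
    then show ?thesis
      using 0[OF True] norm_le_stencil_norm[OF finite_S axis_S[of i], of "fd z l"] by (simp add: fd_def)
  next
    case False
    then show ?thesis using fd_outside[OF z False axis_S[of i]] by (simp add: fd_def)
  qed
  have "z (p + axis i (int n)) = z p" for n
  proof (induction n)
    case 0
    have "axis i 0 = (0::int^'d)" by (simp add: vec_eq_iff axis_def)
    then show ?case by (simp only: of_nat_0 add_0_right)
  next
    case (Suc n)
    have *: "p + axis i (int (Suc n)) = (p + axis i (int n)) + axis i 1"
      by (simp add: vec_eq_iff axis_def)
    show ?case unfolding * inv by (rule Suc)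
  qed
  moreover have "p + axis i (int (r + nat \<bar>p $ i\<bar> + 1)) \<notin> cube r"
    by (auto simp: cube_def axis_def intro!: exI[of _ i])
  ultimately show False using z p unfolding supp_in_def by metis
qed

text \<open>A linear system solved by adding one unknown at a time. \<psi> is the new unit vector
  corrected so that the earlier tests vanish on it, and the pivot
  \<open>B (delta p0 i0) \<psi>\<close> equals \<open>B \<psi> \<psi>\<close>, which is positive.
  The right-hand side \<open>F\<close> is arbitrary since the induction hypothesis yields both the
  old solution \<open>w0\<close> and the correction \<open>w1\<close>.\<close>

lemma galerkin_aux:
  fixes I :: "((int^'d) \<times> 'a) set"
  assumes "finite I" "I \<subseteq> cube r \<times> Basis"
  shows "\<exists>w. (\<forall>l. \<forall>i\<in>Basis. (l, i) \<notin> I \<longrightarrow> w l \<bullet> i = 0) \<and> (\<forall>(p, i)\<in>I. B (delta p i) w = F (p, i))"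
  using assms
proof (induction I arbitrary: F rule: finite_induct)
  case empty
  show ?case by (intro exI[of _ "\<lambda>_. 0"]) simp
next
  case (insert j I)
  obtain p0 i0 where j: "j = (p0, i0)" by force
  have i0: "i0 \<in> Basis" "p0 \<in> cube r" and I: "I \<subseteq> cube r \<times> Basis" using insert.prems j by auto
  let ?\<delta> = "delta p0 i0 :: int^'d \<Rightarrow> 'a"
  obtain w0 where w0: "\<And>l i. i \<in> Basis \<Longrightarrow> (l, i) \<notin> I \<Longrightarrow> w0 l \<bullet> i = 0"
    "\<And>p i. (p, i) \<in> I \<Longrightarrow> B (delta p i) w0 = F (p, i)"
    using insert.IH[OF I, of F] by fast
  obtain w1 where w1: "\<And>l i. i \<in> Basis \<Longrightarrow> (l, i) \<notin> I \<Longrightarrow> w1 l \<bullet> i = 0"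
    "\<And>p i. (p, i) \<in> I \<Longrightarrow> B (delta p i) w1 = B (delta p i) ?\<delta>"
    using insert.IH[OF I, of "\<lambda>(p, i). B (delta p i) ?\<delta>"] by fast
  define \<psi> where "\<psi> = (\<lambda>l. ?\<delta> l - w1 l)"
  have supp\<delta>: "supp_in r (delta p i)" if "p \<in> cube r" for p and i :: 'a
    using that by (auto simp: supp_in_def delta_def)
  have \<psi>0: "B (delta p i) \<psi> = 0" if "(p, i) \<in> I" for p i
    unfolding \<psi>_def using that I w1(2)[OF that] by (subst B_diff2[OF supp\<delta>]) auto
  have exp: "w1 = (\<lambda>l. \<Sum>k\<in>I. (w1 (fst k) \<bullet> snd k) *\<^sub>R delta (fst k) (snd k) l)"
  proof
    fix l
    have "(\<Sum>k\<in>I. (w1 (fst k) \<bullet> snd k) *\<^sub>R delta (fst k) (snd k) l)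
        = (\<Sum>k\<in>Pair l ` Basis. (w1 (fst k) \<bullet> snd k) *\<^sub>R delta (fst k) (snd k) l)"
      by (rule sum.mono_neutral_cong) (use insert.hyps w1 I in \<open>auto simp: delta_def split: if_splits\<close>)
    also have "\<dots> = (\<Sum>i\<in>Basis. (w1 l \<bullet> i) *\<^sub>R i)"
      by (subst sum.reindex) (auto simp: inj_on_def delta_def)
    also have "\<dots> = w1 l" by (rule euclidean_representation)
    finally show "w1 l = (\<Sum>k\<in>I. (w1 (fst k) \<bullet> snd k) *\<^sub>R delta (fst k) (snd k) l)" by simp
  qed
  have suppI: "supp_in r (delta (fst k) (snd k))" if "k \<in> I" for k
    using that I by (intro supp\<delta>) auto
  have suppw1: "supp_in r w1" by (subst exp) (rule B_sum1(2)[OF insert.hyps(1) suppI])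
  have "B w1 \<psi> = 0"
    by (subst exp, subst B_sum1(1)[OF insert.hyps(1) suppI])
       (use \<psi>0 in \<open>auto intro!: sum.neutral\<close>)
  then have B\<psi>: "B \<psi> \<psi> = B ?\<delta> \<psi>"
    using B_diff1[OF supp\<delta>[OF i0(2)] suppw1, of i0 \<psi>] by (simp add: \<psi>_def[symmetric])
  have supp\<psi>: "supp_in r \<psi>" using supp\<delta>[OF i0(2), of i0] suppw1 by (simp add: supp_in_def \<psi>_def)
  have "\<psi> p0 \<bullet> i0 = 1"
    using w1(1)[of i0 p0] insert.hyps(2) i0 j by (simp add: \<psi>_def delta_def inner_diff_left)
  then have "\<psi> p0 \<noteq> 0" by auto
  then have pos: "0 < B ?\<delta> \<psi>" using B_positive[OF supp\<psi>] B\<psi> by metis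
  define t where "t = (F j - B ?\<delta> w0) / B ?\<delta> \<psi>"
  define w where "w = (\<lambda>l. t *\<^sub>R \<psi> l + w0 l)"
  have "w l \<bullet> i = 0" if "i \<in> Basis" "(l, i) \<notin> insert j I" for l i
    using w0(1)[of i l] w1(1)[of i l] that j i0
    by (auto simp: w_def \<psi>_def delta_def inner_add_left inner_diff_left inner_Basis)
  moreover have "B (delta p i) w = F (p, i)" if "(p, i) \<in> insert j I" for p i
  proof (cases "(p, i) \<in> I")
    case True
    then show ?thesis using \<psi>0 w0(2) I unfolding w_def by (subst B_linear2[OF supp\<delta>]) auto
  next
    case False
    then have pi: "p = p0" "i = i0" using that j by auto
    show ?thesis unfolding w_def pi
      using pos j by (subst B_linear2[OF supp\<delta>[OF i0(2)]]) (simp add: t_def)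
  qed
  ultimately show ?case by (intro exI[of _ w]) auto
qed

lemma galerkin_projection:
  "\<exists>w. supp_in r w \<and> harmonic r (\<lambda>l. u l - w l)"
proof -
  let ?I = "cube r \<times> Basis :: ((int^'d) \<times> 'a) set"
  have fin: "finite ?I" by simp
  obtain w where w: "\<And>l i. i \<in> Basis \<Longrightarrow> (l, i) \<notin> ?I \<Longrightarrow> w l \<bullet> i = 0"
    "\<And>p i. (p, i) \<in> ?I \<Longrightarrow> B (delta p i) w = B (delta p i) u"
    using galerkin_aux[OF fin order_refl, of "\<lambda>(p, i). B (delta p i) u"] by fast
  have suppw: "supp_in r w"
    unfolding supp_in_def
  proof (intro allI impI)
    fix l :: "int^'d" assume "l \<notin> cube r"
    then have "w l \<bullet> i = 0 \<bullet> i" if "i \<in> Basis" for i using w(1)[of i l] that by auto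
    then show "w l = 0" by (rule euclidean_eqI)
  qed
  have suppI: "supp_in r (delta (fst k) (snd k))" if "k \<in> ?I" for k
    using that by (auto simp: supp_in_def delta_def)
  have "harmonic r (\<lambda>l. u l - w l)"
    unfolding harmonic_def
  proof (intro allI impI)
    fix z assume z: "supp_in r z"
    have exp: "z = (\<lambda>l. \<Sum>k\<in>?I. (z (fst k) \<bullet> snd k) *\<^sub>R delta (fst k) (snd k) l)"
    proof
      fix l
      have "(\<Sum>k\<in>?I. (z (fst k) \<bullet> snd k) *\<^sub>R delta (fst k) (snd k) l)
          = (\<Sum>k\<in>Pair l ` Basis. (z (fst k) \<bullet> snd k) *\<^sub>R delta (fst k) (snd k) l)"
        by (rule sum.mono_neutral_cong) (use z in \<open>auto simp: delta_def supp_in_def split: if_splits\<close>)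
      also have "\<dots> = (\<Sum>i\<in>Basis. (z l \<bullet> i) *\<^sub>R i)"
        by (subst sum.reindex) (auto simp: inj_on_def delta_def)
      also have "\<dots> = z l" by (rule euclidean_representation)
      finally show "z l = (\<Sum>k\<in>?I. (z (fst k) \<bullet> snd k) *\<^sub>R delta (fst k) (snd k) l)" by simp
    qed
    show "B z (\<lambda>l. u l - w l) = 0"
    proof (subst exp, subst B_sum1(1)[OF fin suppI])
      show "(\<Sum>k\<in>?I. (z (fst k) \<bullet> snd k) * B (delta (fst k) (snd k)) (\<lambda>l. u l - w l)) = 0"
      proof (rule sum.neutral, rule ballI)
        fix k assume k: "k \<in> ?I"
        show "z (fst k) \<bullet> snd k * B (delta (fst k) (snd k)) (\<lambda>l. u l - w l) = 0"
          using w(2)[of "fst k" "snd k"] k by (subst B_diff2[OF suppI[OF k]]) auto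
      qed
    qed auto
  qed
  then show ?thesis using suppw by blast
qed

end

text \<open>In terms of \<open>a s = sqrt (s ^ d) * \<phi> s\<close> the hypothesis is a recursion
  that is linear up to a factor proportional to \<phi>. As \<phi> tends to 0, at whatever rate, this
  factor drops below 1/2 and the bound \<open>C\<close> reproduces itself.\<close>

lemma quadratic_decay:
  fixes \<phi> :: "nat \<Rightarrow> real" and \<theta> d s0 :: nat
  assumes mono: "\<And>r s. r \<le> s \<Longrightarrow> \<phi> s \<le> \<phi> r" and nonneg: "\<And>s. 0 \<le> \<phi> s" and lim: "\<phi> \<longlonglongrightarrow> 0"
    and \<theta>: "1 < \<theta>" and K: "0 \<le> K"
    and step: "\<And>s. s0 \<le> s \<Longrightarrow> \<phi> (\<theta> * s) \<le> K * (1 / sqrt (real s ^ d) + (\<phi> s)\<^sup>2)"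
  shows "\<exists>C\<ge>0. \<forall>s\<ge>1. \<phi> s \<le> C / sqrt (real s ^ d)"
proof -
  define w where "w = (\<lambda>s::nat. sqrt (real s ^ d))"
  define a where "a = (\<lambda>s. w s * \<phi> s)"
  \<comment> \<open>Price of passing from \<open>s\<close> to \<open>s' = s div \<theta>\<close>:
    rounding yields only \<open>s \<le> 2 * \<theta> * s'\<close>.\<close>
  define P where "P = w (2 * \<theta>)"
  have P: "0 < P" using \<theta> by (simp add: P_def w_def)
  have "0 < 1 / (2 * (K * P) + 1)" using K P by (simp add: add_nonneg_pos)
  from LIMSEQ_D[OF lim this] obtain s2 where s2: "\<And>s. s \<ge> s2 \<Longrightarrow> \<phi> s < 1 / (2 * (K * P) + 1)"
    using nonneg by auto
  define s1 where "s1 = max (max s0 s2) 1"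
  have small: "P * K * \<phi> s \<le> 1 / 2" if "s \<ge> s1" for s
  proof -
    have "\<phi> s \<le> 1 / (2 * (K * P) + 1)" using s2[of s] that by (simp add: s1_def)
    then have "P * K * \<phi> s \<le> P * K * (1 / (2 * (K * P) + 1))" using P K by (intro mult_left_mono) auto
    also have "\<dots> \<le> 1 / 2"
    proof -
      have "0 < 2 * (K * P) + 1" using K P by (simp add: add_nonneg_pos)
      then show ?thesis by (simp add: pos_divide_le_eq)
    qed
    finally show ?thesis .
  qed
  \<comment> \<open>The first summand closes the recursion with factor 1/2; the second covers the
    initial range \<open>s < \<theta> * s1\<close>, where monotonicity gives
    \<open>\<phi> s \<le> \<phi> 0\<close>.\<close>
  define C where "C = 2 * (P * K) + w (\<theta> * s1) * \<phi> 0"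
  have w_mono: "w r \<le> w s" if "r \<le> s" for r s using that by (simp add: w_def power_mono)
  have C: "0 \<le> C" using K P nonneg by (simp add: C_def w_def)
  have "a s \<le> C" for s
  proof (induction s rule: less_induct)
    case (less s)
    show ?case
    proof (cases "s < \<theta> * s1")
      case True
      have "a s \<le> w (\<theta> * s1) * \<phi> 0"
        unfolding a_def by (intro mult_mono w_mono mono) (use True nonneg in \<open>auto simp: w_def\<close>)
      moreover have "0 \<le> 2 * (P * K)" using K P by simp
      ultimately show ?thesis unfolding C_def by linarith
    next
      case False
      define s' where "s' = s div \<theta>"
      have s': "s1 \<le> s'" using False \<theta> by (simp add: s'_def less_eq_div_iff_mult_less_eq mult.commute)
      have s'1: "1 \<le> s'" using s' by (simp add: s1_def)
      have le: "\<theta> * s' \<le> s" by (simp add: s'_def)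
      have "s = \<theta> * s' + s mod \<theta>" unfolding s'_def by simp
      also have "\<dots> \<le> \<theta> * s' + \<theta> * s'"
      proof (rule add_left_mono)
        have "s mod \<theta> < \<theta>" using \<theta> by simp
        also have "\<theta> \<le> \<theta> * s'" using s'1 by simp
        finally show "s mod \<theta> \<le> \<theta> * s'" by simp
      qed
      finally have up: "s \<le> 2 * \<theta> * s'" by simp
      have wm: "w (2 * \<theta> * s') = P * w s'"
        by (simp add: P_def w_def power_mult_distrib real_sqrt_mult)
      have lt: "s' < s"
      proof -
        have "0 < s" using \<theta> le s'1 by (auto intro: gr0I)
        then show ?thesis unfolding s'_def by (intro div_less_dividend \<theta>)
      qed
      have "a s \<le> w (2 * \<theta> * s') * (K * (1 / w s' + (\<phi> s')\<^sup>2))"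
        unfolding a_def
      proof (intro mult_mono w_mono up)
        show "\<phi> s \<le> K * (1 / w s' + (\<phi> s')\<^sup>2)"
          using mono[OF le] step[of s'] s' by (auto simp: w_def s1_def)
      qed (use nonneg in \<open>auto simp: w_def\<close>)
      also have "\<dots> = P * K + (P * K * \<phi> s') * a s'"
        using s'1 wm by (simp add: a_def w_def field_simps power2_eq_square)
      also have "\<dots> \<le> P * K + 1 / 2 * a s'"
        using small[OF s'] nonneg by (intro add_left_mono mult_right_mono) (auto simp: a_def w_def)
      also have "\<dots> \<le> P * K + 1 / 2 * C" using less.IH[OF lt] by simp
      also have "\<dots> \<le> C" using nonneg by (simp add: C_def w_def field_simps)
      finally show ?thesis .
    qed
  qed
  then have "\<phi> s \<le> C / sqrt (real s ^ d)" if "s \<ge> 1" for s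
    using that by (simp add: a_def w_def field_simps)
  then show ?thesis using C by blast
qed

section \<open>Convergence and decay of the Galerkin error\<close>

context lattice_form begin

definition D :: "(int^'d \<Rightarrow> 'a) \<Rightarrow> int^'d \<Rightarrow> real" where
  "D v l = stencil_norm S (fd v l)"

lemma D_nonneg [simp]: "0 \<le> D v l"
  by (simp add: D_def)

lemma abs_D [simp]: "\<bar>D v l\<bar> = D v l"
  by simp

lemma D_diff_le: "D (\<lambda>l. v l - w l) l \<le> D v l + D w l"
  unfolding D_def fd_diff by (rule stencil_norm_triangle_diff)

lemma D_eq_0: "supp_in r z \<Longrightarrow> l \<notin> cube (r + m) \<Longrightarrow> D z l = 0"
  using stencil_norm_cong[of S "fd z l" "\<lambda>_. 0"] fd_outside[of r z l] by (simp add: D_def)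

lemma D_summable_supp: "supp_in r z \<Longrightarrow> (\<lambda>l. (D z l)\<^sup>2) summable_on UNIV"
  by (rule finite_nonzero_values_imp_summable_on, rule finite_subset[OF _ finite_cube[of "r + m"]])
     (auto intro: ccontr dest: D_eq_0)

lemma D_summable_diff:
  assumes "(\<lambda>l. (D v l)\<^sup>2) summable_on UNIV" "(\<lambda>l. (D w l)\<^sup>2) summable_on UNIV"
  shows "(\<lambda>l. (D (\<lambda>l. v l - w l) l)\<^sup>2) summable_on UNIV"
    and "(\<Sum>\<^sub>\<infinity>l. (D (\<lambda>l. v l - w l) l)\<^sup>2) \<le> 2 * (\<Sum>\<^sub>\<infinity>l. (D v l)\<^sup>2) + 2 * (\<Sum>\<^sub>\<infinity>l. (D w l)\<^sup>2)"
  by (rule sq_summable_add[OF assms]; simp add: D_diff_le)+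

lemma B_summable:
  assumes "(\<lambda>l. (D v l)\<^sup>2) summable_on UNIV" "(\<lambda>l. (D w l)\<^sup>2) summable_on UNIV"
  shows "(\<lambda>l. b (fd v l) (fd w l)) summable_on UNIV"
    and "\<bar>B v w\<bar> \<le> K * (\<Sum>\<^sub>\<infinity>l. D v l * D w l)"
proof -
  have CS: "(\<lambda>l. D v l * D w l) summable_on UNIV"
    using Cauchy_Schwarz_infsum(1)[OF assms] by (simp add: abs_mult)
  then have sK: "(\<lambda>l. K * (D v l * D w l)) summable_on UNIV" by (rule summable_on_cmult_right)
  have pt: "\<bar>b (fd v l) (fd w l)\<bar> \<le> K * (D v l * D w l)" for l
    using b_bound[of "fd v l" "fd w l"] by (simp add: D_def mult.assoc)
  have abs: "(\<lambda>l. \<bar>b (fd v l) (fd w l)\<bar>) summable_on UNIV"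
    by (rule summable_on_le[OF sK]) (use pt in auto)
  then show "(\<lambda>l. b (fd v l) (fd w l)) summable_on UNIV"
    by (subst summable_on_iff_abs_summable_on_real) simp
  have "\<bar>B v w\<bar> \<le> (\<Sum>\<^sub>\<infinity>l. \<bar>b (fd v l) (fd w l)\<bar>)"
    using norm_infsum_bound[of "\<lambda>l. b (fd v l) (fd w l)" UNIV] abs by (simp add: B_def)
  also have "\<dots> \<le> (\<Sum>\<^sub>\<infinity>l. K * (D v l * D w l))"
    by (rule infsum_mono[OF abs sK pt])
  also have "\<dots> = K * (\<Sum>\<^sub>\<infinity>l. D v l * D w l)" by (rule infsum_cmult_right')
  finally show "\<bar>B v w\<bar> \<le> K * (\<Sum>\<^sub>\<infinity>l. D v l * D w l)" .
qed

lemma B_diff2':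
  assumes "(\<lambda>l. (D u l)\<^sup>2) summable_on UNIV" "(\<lambda>l. (D v l)\<^sup>2) summable_on UNIV" "(\<lambda>l. (D w l)\<^sup>2) summable_on UNIV"
  shows "B u (\<lambda>l. v l - w l) = B u v - B u w"
  unfolding B_def fd_diff b_diff2 by (rule infsum_diff_real; rule B_summable(1)[OF assms(1)]; fact)

lemma B_diff1':
  assumes "(\<lambda>l. (D u l)\<^sup>2) summable_on UNIV" "(\<lambda>l. (D v l)\<^sup>2) summable_on UNIV" "(\<lambda>l. (D w l)\<^sup>2) summable_on UNIV"
  shows "B (\<lambda>l. v l - w l) u = B v u - B w u"
  unfolding B_def fd_diff b_diff1 by (rule infsum_diff_real; rule B_summable(1)[OF _ assms(1)]; fact)

lemma coercive_supp: "supp_in r z \<Longrightarrow> c * (\<Sum>\<^sub>\<infinity>l. (D z l)\<^sup>2) \<le> B z z"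
  using coercive[OF finite_supp_in] by (simp add: D_def B_def)

lemma D_tendsto_0I:
  assumes "\<And>\<rho>. \<rho> \<in> S \<Longrightarrow> (\<lambda>n. fd (v n) l \<rho>) \<longlonglongrightarrow> fd w l \<rho>"
  shows "(\<lambda>n. D (v n) l) \<longlonglongrightarrow> D w l"
  unfolding D_def stencil_norm_def L2_set_def
  by (intro tendsto_real_sqrt tendsto_sum tendsto_power tendsto_norm assms)

text \<open>\<open>K2\<close> will depend on the form only, \<open>M0\<close> on \<open>u\<close> as
  well. With d = \<open>CARD('d)\<close>, the radius is \<open>(d + 3) * s\<close> because the
  interior estimate consumes \<open>(d + 2) * s\<close> and one more layer is needed to difference
  the error along the stencil. The last conjunct is coercivity for the error, with
  \<open>B u\<close> of the error in place of \<open>B\<close> of the error with itself.\<close>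

definition galerkin :: "real \<Rightarrow> (int^'d \<Rightarrow> 'a) \<Rightarrow> (nat \<Rightarrow> int^'d \<Rightarrow> 'a) \<Rightarrow> real \<Rightarrow> bool" where
  "galerkin K2 u w M0 \<longleftrightarrow>
       (\<forall>s. supp_in ((CARD('d) + 3) * s) (w s)) \<and>
       (\<forall>s. (\<lambda>l. (D (\<lambda>l. u l - w s l) l)\<^sup>2) summable_on UNIV) \<and>
       (\<forall>s. (\<Sum>\<^sub>\<infinity>l. (D (\<lambda>l. u l - w s l) l)\<^sup>2) \<le> M0) \<and>
       (\<forall>s. (\<Sum>\<^sub>\<infinity>l. (D (w s) l)\<^sup>2) \<le> M0) \<and>
       (\<forall>s x. 6 * m \<le> s \<longrightarrow> x \<in> cube s \<longrightarrow>
          (D (\<lambda>l. u l - w s l) x)\<^sup>2 \<le> K2 / real s ^ CARD('d) * (\<Sum>\<^sub>\<infinity>l. (D (\<lambda>l. u l - w s l) l)\<^sup>2)) \<and>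
       (\<forall>l. \<forall>\<rho>\<in>S. (\<lambda>n. fd (\<lambda>l. u l - w n l) l \<rho>) \<longlonglongrightarrow> 0) \<and>
       (\<forall>v. (\<lambda>l. (D v l)\<^sup>2) summable_on UNIV \<longrightarrow> (\<lambda>n. B v (\<lambda>l. u l - w n l)) \<longlonglongrightarrow> 0) \<and>
       (\<forall>s. c * (\<Sum>\<^sub>\<infinity>l. (D (\<lambda>l. u l - w s l) l)\<^sup>2) \<le> B u (\<lambda>l. u l - w s l))"

text \<open>Bounded energy and the interior estimate force the differences of the errors to 0 at
  every site, so the errors tend weakly to 0. This weak convergence is what carries coercivity over
  to the error, whose support is infinite.\<close>

lemma galerkin_error:
  "\<exists>K2\<ge>0. \<forall>u. (\<lambda>l. (D u l)\<^sup>2) summable_on UNIV \<longrightarrow>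
     (\<exists>w M0. galerkin K2 u w M0)"
proof -
  let ?d = "CARD('d)"
  obtain K2 where K2: "0 \<le> K2" and int_est: "\<And>s f x. 6 * m \<le> s \<Longrightarrow> harmonic ((?d + 2) * s) f \<Longrightarrow> x \<in> cube s \<Longrightarrow>
     (norm (f x))\<^sup>2 \<le> K2 / real s ^ ?d * (\<Sum>l\<in>cube ((?d + 2) * s). (norm (f l))\<^sup>2)"
    using interior_estimate by blast
  have "\<exists>w M0. galerkin K2 u w M0" if u: "(\<lambda>l. (D u l)\<^sup>2) summable_on UNIV" for u
  proof -
  define U where "U = (\<Sum>\<^sub>\<infinity>l. (D u l)\<^sup>2)"
  have U: "0 \<le> U" by (simp add: U_def infsum_nonneg)
  have "\<forall>s. \<exists>w. supp_in ((?d + 3) * s) w \<and> harmonic ((?d + 3) * s) (\<lambda>l. u l - w l)"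
    using galerkin_projection by blast
  then obtain w where w: "\<And>s. supp_in ((?d + 3) * s) (w s)"
    "\<And>s. harmonic ((?d + 3) * s) (\<lambda>l. u l - w s l)" by metis
  define e where "e = (\<lambda>s l. u l - w s l)"
  have harm_e: "harmonic ((?d + 3) * s) (e s)" for s using w(2) by (simp add: e_def)
  have sw: "(\<lambda>l. (D (w s) l)\<^sup>2) summable_on UNIV" for s by (rule D_summable_supp[OF w(1)])
  have se: "(\<lambda>l. (D (e s) l)\<^sup>2) summable_on UNIV" for s
    unfolding e_def by (rule D_summable_diff[OF u sw])
  define X where "X = (\<lambda>s. sqrt (\<Sum>\<^sub>\<infinity>l. (D (e s) l)\<^sup>2))"
  have X: "0 \<le> X s" "(X s)\<^sup>2 = (\<Sum>\<^sub>\<infinity>l. (D (e s) l)\<^sup>2)" for s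
    by (auto simp: X_def infsum_nonneg)
  \<comment> \<open>Stability of the projection: the equation for the error is tested with
    \<open>w s\<close> itself, and one factor of its norm is cancelled.\<close>
  have w_bound: "(\<Sum>\<^sub>\<infinity>l. (D (w s) l)\<^sup>2) \<le> (K / c)\<^sup>2 * U" for s
  proof -
    define y where "y = sqrt (\<Sum>\<^sub>\<infinity>l. (D (w s) l)\<^sup>2)"
    have y: "0 \<le> y" "y\<^sup>2 = (\<Sum>\<^sub>\<infinity>l. (D (w s) l)\<^sup>2)" by (auto simp: y_def infsum_nonneg)
    have "c * y\<^sup>2 \<le> B (w s) (w s)" using coercive_supp[OF w(1)[of s]] y by simp
    also have "\<dots> = B (w s) u"
      using w(2)[of s] w(1)[of s] B_diff2[OF w(1)[of s], of u "w s"] by (simp add: harmonic_def)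
    also have "\<dots> \<le> K * (\<Sum>\<^sub>\<infinity>l. D (w s) l * D u l)" using B_summable(2)[OF sw[of s] u] by simp
    also have "\<dots> \<le> K * (y * sqrt U)"
      using Cauchy_Schwarz_infsum(2)[OF sw[of s] u] K_nonneg
      by (intro mult_left_mono) (auto simp: abs_mult y_def U_def)
    finally have "c * y * y \<le> K * sqrt U * y" by (simp add: power2_eq_square algebra_simps)
    then have "c * y \<le> K * sqrt U"
    proof (cases "y = 0")
      case False
      then show ?thesis using \<open>c * y * y \<le> _\<close> y by (intro mult_right_le_imp_le[of "c * y" y]) auto
    qed (use K_nonneg U in auto)
    then have "y \<le> K / c * sqrt U" using c_pos by (simp add: field_simps)
    then have "y\<^sup>2 \<le> (K / c * sqrt U)\<^sup>2" using y by (intro power_mono) auto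
    then show ?thesis using y U by (simp add: power_mult_distrib power_divide)
  qed
  define M0 where "M0 = 2 * U + 2 * ((K / c)\<^sup>2 * U)"
  have e_bound: "(\<Sum>\<^sub>\<infinity>l. (D (e s) l)\<^sup>2) \<le> M0" for s
    unfolding e_def using D_summable_diff(2)[OF u sw[of s]] w_bound[of s] by (simp add: M0_def U_def)
  have interior: "(D (e s) x)\<^sup>2 \<le> K2 / real s ^ ?d * (X s)\<^sup>2" if s: "6 * m \<le> s" and x: "x \<in> cube s" for s x
  proof -
    have "harmonic ((?d + 2) * s + m) (e s)"
      by (rule harmonic_mono[OF harm_e]) (use s in \<open>simp add: algebra_simps\<close>)
    then have har: "harmonic ((?d + 2) * s) (\<lambda>l. e s (l + \<rho>) - e s l)" if "\<rho> \<in> S" for \<rho>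
      using that S_sub by (intro harmonic_fd[of _ m]) auto
    have "(D (e s) x)\<^sup>2 = (\<Sum>\<rho>\<in>S. (norm (e s (x + \<rho>) - e s x))\<^sup>2)"
      by (simp add: D_def stencil_norm_sq fd_def)
    also have "\<dots> \<le> (\<Sum>\<rho>\<in>S. K2 / real s ^ ?d * (\<Sum>l\<in>cube ((?d + 2) * s). (norm (e s (l + \<rho>) - e s l))\<^sup>2))"
      by (intro sum_mono int_est[OF s har x])
    also have "\<dots> = K2 / real s ^ ?d * (\<Sum>l\<in>cube ((?d + 2) * s). (D (e s) l)\<^sup>2)"
      by (simp add: D_def stencil_norm_sq fd_def sum_distrib_left sum.swap[of _ S])
    also have "\<dots> \<le> K2 / real s ^ ?d * (X s)\<^sup>2"
      unfolding X(2) using K2 by (intro mult_left_mono finite_sum_le_infsum se) auto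
    finally show ?thesis .
  qed
  have d_pos: "1 \<le> ?d" using zero_less_card_finite[where 'a='d] by linarith
  have pow0: "(\<lambda>s. K2 / real s ^ ?d * M0) \<longlonglongrightarrow> 0"
  proof -
    have "filterlim (\<lambda>s. real s ^ ?d) at_top sequentially"
      using d_pos by (intro filterlim_pow_at_top filterlim_real_sequentially) auto
    then have "(\<lambda>s. K2 / real s ^ ?d) \<longlonglongrightarrow> 0"
      by (intro tendsto_divide_0[OF tendsto_const] filterlim_at_top_imp_at_infinity)
    then show ?thesis by (rule tendsto_mult_left_zero)
  qed
  have De0: "(\<lambda>n. D (e n) l) \<longlonglongrightarrow> 0" for l
  proof -
    have "(\<lambda>n. (D (e n) l)\<^sup>2) \<longlonglongrightarrow> 0"
    proof (rule tendsto_sandwich[OF _ _ tendsto_const pow0])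
      define N where "N = max (6 * m) (nat (inf_norm l))"
      show "\<forall>\<^sub>F n in sequentially. (D (e n) l)\<^sup>2 \<le> K2 / real n ^ ?d * M0"
      proof (rule eventually_sequentiallyI)
        fix n assume n: "N \<le> n"
        have "l \<in> cube n" unfolding cube_inf_norm using n by (auto simp: N_def)
        then have "(D (e n) l)\<^sup>2 \<le> K2 / real n ^ ?d * (X n)\<^sup>2" using n by (intro interior) (auto simp: N_def)
        also have "\<dots> \<le> K2 / real n ^ ?d * M0" using e_bound[of n] K2 X(2)[of n] by (intro mult_left_mono) auto
        finally show "(D (e n) l)\<^sup>2 \<le> K2 / real n ^ ?d * M0" .
      qed
    qed auto
    then have "(\<lambda>n. sqrt ((D (e n) l)\<^sup>2)) \<longlonglongrightarrow> sqrt 0" by (rule tendsto_real_sqrt)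
    then show ?thesis by simp
  qed
  have fde0: "(\<lambda>n. fd (e n) l \<rho>) \<longlonglongrightarrow> 0" if "\<rho> \<in> S" for l \<rho>
    by (rule Lim_null_comparison[OF _ De0[of l]])
       (auto simp: D_def intro!: always_eventually norm_le_stencil_norm finite_S that)
  have B_e_lim: "(\<lambda>n. B v (e n)) \<longlonglongrightarrow> 0" "(\<lambda>n. B (e n) v) \<longlonglongrightarrow> 0"
    if v: "(\<lambda>l. (D v l)\<^sup>2) summable_on UNIV" for v
  proof -
    have lim: "(\<lambda>n. K * (\<Sum>\<^sub>\<infinity>l. D v l * D (e n) l)) \<longlonglongrightarrow> 0"
      using tendsto_mult_right_zero[OF weak_limit_infsum(2)[OF De0 se e_bound v, simplified]] by simp
    show "(\<lambda>n. B v (e n)) \<longlonglongrightarrow> 0"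
      by (rule Lim_null_comparison[OF _ lim], rule always_eventually) (use B_summable(2)[OF v se] in auto)
    show "(\<lambda>n. B (e n) v) \<longlonglongrightarrow> 0"
      by (rule Lim_null_comparison[OF _ lim], rule always_eventually)
        (use B_summable(2)[OF se v] in \<open>auto simp: mult.commute\<close>)
  qed
  \<comment> \<open>\<open>e s\<close> is the limit of \<open>a n = w (s + n) - w s\<close>, to
    which coercivity applies. Orthogonality at both levels turns \<open>B (a n) (a n)\<close> into
    \<open>B (w (s + n)) (e s)\<close>, which tends to \<open>B u (e s)\<close>; on the left it is
    enough to pass to the limit in finite partial sums.\<close>
  have key: "c * (X s)\<^sup>2 \<le> B u (e s)" for s
  proof -
    define a where "a = (\<lambda>n l. w (s + n) l - w s l)"
    have suppa: "supp_in ((?d + 3) * (s + n)) (a n)" for n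
      using w(1)[of "s + n"] supp_in_mono[OF w(1)[of s], of "(?d + 3) * (s + n)"]
      by (simp add: a_def supp_in_def)
    have sa: "(\<lambda>l. (D (a n) l)\<^sup>2) summable_on UNIV" for n by (rule D_summable_supp[OF suppa])
    have ba: "(\<Sum>\<^sub>\<infinity>l. (D (a n) l)\<^sup>2) \<le> 4 * ((K / c)\<^sup>2 * U)" for n
      unfolding a_def using D_summable_diff(2)[OF sw[of "s + n"] sw[of s]] w_bound[of s] w_bound[of "s + n"] by simp
    have Da: "(\<lambda>n. D (a n) l) \<longlonglongrightarrow> D (e s) l" for l
    proof (rule D_tendsto_0I)
      fix \<rho> assume \<rho>: "\<rho> \<in> S"
      have "fd (a n) l \<rho> = fd (e s) l \<rho> - fd (e (n + s)) l \<rho>" for n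
        by (simp add: a_def e_def fd_def algebra_simps)
      then show "(\<lambda>n. fd (a n) l \<rho>) \<longlonglongrightarrow> fd (e s) l \<rho>"
        using tendsto_diff[OF tendsto_const LIMSEQ_ignore_initial_segment[OF fde0[OF \<rho>, of l], of s], of "fd (e s) l \<rho>"]
        by simp
    qed
    have "B (w (s + n)) (e s) = B u (e s) - B (e (n + s)) (e s)" for n
    proof -
      have "w (s + n) = (\<lambda>l. u l - e (n + s) l)" by (simp add: e_def add.commute)
      then show ?thesis using B_diff1'[OF se[of s] u se[of "n + s"]] by metis
    qed
    then have limBw: "(\<lambda>n. B (w (s + n)) (e s)) \<longlonglongrightarrow> B u (e s)"
      using tendsto_diff[OF tendsto_const LIMSEQ_ignore_initial_segment[OF B_e_lim(2)[OF se[of s]], of s], of "B u (e s)"]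
      by simp
    have en: "c * (\<Sum>\<^sub>\<infinity>l. (D (a n) l)\<^sup>2) \<le> B (w (s + n)) (e s)" for n
    proof -
      have 1: "c * (\<Sum>\<^sub>\<infinity>l. (D (a n) l)\<^sup>2) \<le> B (a n) (a n)" by (rule coercive_supp[OF suppa])
      have 2: "B (a n) (a n) = B (a n) (w (s + n)) - B (a n) (w s)"
        unfolding a_def by (rule B_diff2[OF suppa[unfolded a_def]])
      have 3: "B (a n) (w (s + n)) = B (a n) u"
        using harm_e[of "s + n"] suppa[of n] B_diff2[OF suppa, of n u "w (s + n)"]
        by (simp add: harmonic_def e_def)
      have 4: "B (a n) (e s) = B (a n) u - B (a n) (w s)"
        unfolding e_def by (rule B_diff2[OF suppa])
      have 5: "B (a n) (e s) = B (w (s + n)) (e s) - B (w s) (e s)"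
        unfolding a_def by (rule B_diff1[OF w(1) supp_in_mono[OF w(1)[of s]]]) simp
      have 6: "B (w s) (e s) = 0" using harm_e[of s] w(1)[of s] by (simp add: harmonic_def)
      show ?thesis using 1 2 3 4 5 6 by linarith
    qed
    have "(\<Sum>l\<in>F. (D (e s) l)\<^sup>2) \<le> B u (e s) / c" if "finite F" for F
    proof (rule LIMSEQ_le)
      show "(\<lambda>n. \<Sum>l\<in>F. (D (a n) l)\<^sup>2) \<longlonglongrightarrow> (\<Sum>l\<in>F. (D (e s) l)\<^sup>2)"
        by (intro tendsto_sum tendsto_power Da)
      show "(\<lambda>n. B (w (s + n)) (e s) / c) \<longlonglongrightarrow> B u (e s) / c"
        by (intro tendsto_divide limBw tendsto_const) (use c_pos in auto)
      show "\<exists>N. \<forall>n\<ge>N. (\<Sum>l\<in>F. (D (a n) l)\<^sup>2) \<le> B (w (s + n)) (e s) / c"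
      proof (intro exI[of _ 0] allI impI)
        fix n
        have "(\<Sum>l\<in>F. (D (a n) l)\<^sup>2) \<le> (\<Sum>\<^sub>\<infinity>l. (D (a n) l)\<^sup>2)"
          by (rule finite_sum_le_infsum[OF sa that]) auto
        also have "\<dots> \<le> B (w (s + n)) (e s) / c" using en[of n] c_pos by (simp add: field_simps)
        finally show "(\<Sum>l\<in>F. (D (a n) l)\<^sup>2) \<le> B (w (s + n)) (e s) / c" .
      qed
    qed
    then have "(X s)\<^sup>2 \<le> B u (e s) / c"
      unfolding X(2) by (intro infsum_le_finite_sums[OF se]) auto
    then show ?thesis using c_pos by (simp add: field_simps)
  qed
  have "(\<Sum>\<^sub>\<infinity>l. (D (w s) l)\<^sup>2) \<le> M0" for s
    using w_bound[of s] U unfolding M0_def by (smt (verit) mult_nonneg_nonneg zero_le_power2)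
  then show ?thesis
    using w(1) se e_bound interior fde0 B_e_lim(1) key unfolding e_def X(2)[unfolded e_def]
    by (intro exI[of _ w] exI[of _ M0], unfold galerkin_def) (intro conjI allI impI ballI)
  qed
  then show ?thesis using K2 by blast
qed

text \<open>Weak convergence upgrades itself to strong convergence: the energy of the error is
  bounded by a multiple of \<open>B u\<close> applied to the error, which is linear in it.\<close>

corollary galerkin_density:
  assumes u: "(\<lambda>l. (D u l)\<^sup>2) summable_on UNIV"
  shows "\<exists>w. (\<forall>n. finite {l. w n l \<noteq> 0}) \<and> (\<forall>n. (\<lambda>l. (D (\<lambda>l. u l - w n l) l)\<^sup>2) summable_on UNIV) \<and>
    (\<lambda>n. \<Sum>\<^sub>\<infinity>l. (D (\<lambda>l. u l - w n l) l)\<^sup>2) \<longlonglongrightarrow> 0"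
proof -
  obtain K2 w M0 where g: "galerkin K2 u w M0" using galerkin_error u by blast
  have w: "\<And>s. supp_in ((CARD('d) + 3) * s) (w s)"
    "\<And>s. (\<lambda>l. (D (\<lambda>l. u l - w s l) l)\<^sup>2) summable_on UNIV"
    "(\<lambda>n. B u (\<lambda>l. u l - w n l)) \<longlonglongrightarrow> 0"
    "\<And>s. c * (\<Sum>\<^sub>\<infinity>l. (D (\<lambda>l. u l - w s l) l)\<^sup>2) \<le> B u (\<lambda>l. u l - w s l)"
    using g u unfolding galerkin_def by blast+
  have "(\<lambda>n. \<Sum>\<^sub>\<infinity>l. (D (\<lambda>l. u l - w n l) l)\<^sup>2) \<longlonglongrightarrow> 0"
  proof (rule tendsto_sandwich[OF _ _ tendsto_const])
    show "(\<lambda>n. B u (\<lambda>l. u l - w n l) / c) \<longlonglongrightarrow> 0"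
      using tendsto_divide[OF w(3) tendsto_const, of c] c_pos by simp
    show "\<forall>\<^sub>F n in sequentially. (\<Sum>\<^sub>\<infinity>l. (D (\<lambda>l. u l - w n l) l)\<^sup>2) \<le> B u (\<lambda>l. u l - w n l) / c"
      using w(4) c_pos by (intro always_eventually allI) (simp add: field_simps)
    show "\<forall>\<^sub>F n in sequentially. 0 \<le> (\<Sum>\<^sub>\<infinity>l. (D (\<lambda>l. u l - w n l) l)\<^sup>2)"
      by (intro always_eventually allI infsum_nonneg) simp
  qed
  then show ?thesis using w(1,2) finite_supp_in by blast
qed

text \<open>In \<open>res\<close> the function \<open>u\<close> stands in the first slot, where
  \<open>harmonic\<close> has its test function: up to the residual, \<open>u\<close> solves the
  equation of the transposed form. This is the right pairing, since coercivity of the error produces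
  \<open>B u\<close> tested with the error. The indicator of \<open>cube q\<close> stands for the
  defect, where no smallness of the residual is claimed.\<close>

theorem galerkin_decay:
  assumes u: "(\<lambda>l. (D u l)\<^sup>2) summable_on UNIV"
    and K3: "0 \<le> K3"
    and res: "\<And>z. finite {l. z l \<noteq> 0} \<Longrightarrow>
      \<bar>B u z\<bar> \<le> (\<Sum>\<^sub>\<infinity>l. K3 * ((D u l)\<^sup>2 + (if l \<in> cube q then 1 else 0)) * D z l)"
  shows "\<exists>K4\<ge>0. \<exists>s0. \<forall>s\<ge>s0. \<exists>w. supp_in ((CARD('d) + 3) * s) w \<and>
    (\<lambda>l. (D (\<lambda>l. u l - w l) l)\<^sup>2) summable_on UNIV \<and>
    (\<Sum>\<^sub>\<infinity>l. (D (\<lambda>l. u l - w l) l)\<^sup>2) \<le> K4 / real s ^ CARD('d)"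
proof -
  let ?d = "CARD('d)"
  obtain K2 w M0 where K2: "0 \<le> K2" and g: "galerkin K2 u w M0" using galerkin_error u by blast
  have w: "\<And>s. supp_in ((?d + 3) * s) (w s)"
    and se': "\<And>s. (\<lambda>l. (D (\<lambda>l. u l - w s l) l)\<^sup>2) summable_on UNIV"
    and ew: "\<And>s. (\<Sum>\<^sub>\<infinity>l. (D (w s) l)\<^sup>2) \<le> M0"
    and interior': "\<And>s x. 6 * m \<le> s \<Longrightarrow> x \<in> cube s \<Longrightarrow>
          (D (\<lambda>l. u l - w s l) x)\<^sup>2 \<le> K2 / real s ^ ?d * (\<Sum>\<^sub>\<infinity>l. (D (\<lambda>l. u l - w s l) l)\<^sup>2)"
    and fde0': "\<And>l \<rho>. \<rho> \<in> S \<Longrightarrow> (\<lambda>n. fd (\<lambda>l. u l - w n l) l \<rho>) \<longlonglongrightarrow> 0"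
    and B_e_lim': "\<And>v. (\<lambda>l. (D v l)\<^sup>2) summable_on UNIV \<Longrightarrow> (\<lambda>n. B v (\<lambda>l. u l - w n l)) \<longlonglongrightarrow> 0"
    and key': "\<And>s. c * (\<Sum>\<^sub>\<infinity>l. (D (\<lambda>l. u l - w s l) l)\<^sup>2) \<le> B u (\<lambda>l. u l - w s l)"
    using g unfolding galerkin_def by blast+
  define e where "e = (\<lambda>s l. u l - w s l)"
  have e_eq: "(\<lambda>l. u l - w s l) = e s" for s by (simp add: e_def)
  note se = se'[unfolded e_eq] and interior0 = interior'[unfolded e_eq] and fde0 = fde0'[unfolded e_eq]
    and B_e_lim = B_e_lim'[unfolded e_eq] and key0 = key'[unfolded e_eq]
  have sw: "(\<lambda>l. (D (w s) l)\<^sup>2) summable_on UNIV" for s by (rule D_summable_supp[OF w])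
  define X where "X = (\<lambda>s. sqrt (\<Sum>\<^sub>\<infinity>l. (D (e s) l)\<^sup>2))"
  have X: "0 \<le> X s" "(X s)\<^sup>2 = (\<Sum>\<^sub>\<infinity>l. (D (e s) l)\<^sup>2)" for s
    by (auto simp: X_def infsum_nonneg)
  note interior = interior0[folded X(2)]
  define G where "G = (\<lambda>l. K3 * ((D u l)\<^sup>2 + (if l \<in> cube q then 1 else 0)))"
  have G0: "0 \<le> G l" for l using K3 by (simp add: G_def)
  have ind: "(\<lambda>l::int^'d. if l \<in> cube q then 1 else 0 :: real) summable_on UNIV"
    by (rule finite_nonzero_values_imp_summable_on) (rule finite_subset[OF _ finite_cube[of q]], auto)
  have sG: "G summable_on UNIV"
    unfolding G_def by (rule summable_on_cmult_right, rule summable_on_add, rule u, rule ind)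
  \<comment> \<open>A summable non-negative family is bounded by its sum, hence square summable;
    this makes \<open>G\<close> admissible in weak limits.\<close>
  have sG2: "(\<lambda>l. (G l)\<^sup>2) summable_on UNIV"
  proof (rule summable_on_le)
    show "(\<lambda>l. infsum G UNIV * G l) summable_on UNIV" by (rule summable_on_cmult_right[OF sG])
    show "(G l)\<^sup>2 \<le> infsum G UNIV * G l" for l
      using finite_sum_le_infsum[OF sG, of "{l}"] G0 by (auto simp: power2_eq_square intro!: mult_right_mono)
  qed auto
  text \<open>Testing the equation for \<open>u\<close> with the error itself.\<close>
  have key: "c * (X s)\<^sup>2 \<le> (\<Sum>\<^sub>\<infinity>l. G l * D (e s) l)" for s
  proof -
    define a where "a = (\<lambda>n l. w (s + n) l - w s l)"
    have suppa: "supp_in ((?d + 3) * (s + n)) (a n)" for n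
      using w[of "s + n"] supp_in_mono[OF w[of s], of "(?d + 3) * (s + n)"]
      by (simp add: a_def supp_in_def)
    have sa: "(\<lambda>l. (D (a n) l)\<^sup>2) summable_on UNIV" for n by (rule D_summable_supp[OF suppa])
    have ba: "(\<Sum>\<^sub>\<infinity>l. (D (a n) l)\<^sup>2) \<le> 4 * M0" for n
      unfolding a_def using D_summable_diff(2)[OF sw[of "s + n"] sw[of s]] ew[of s] ew[of "s + n"] by simp
    have Da: "(\<lambda>n. D (a n) l) \<longlonglongrightarrow> D (e s) l" for l
    proof (rule D_tendsto_0I)
      fix \<rho> assume \<rho>: "\<rho> \<in> S"
      have "fd (a n) l \<rho> = fd (e s) l \<rho> - fd (e (n + s)) l \<rho>" for n
        by (simp add: a_def e_def fd_def algebra_simps)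
      then show "(\<lambda>n. fd (a n) l \<rho>) \<longlonglongrightarrow> fd (e s) l \<rho>"
        using tendsto_diff[OF tendsto_const LIMSEQ_ignore_initial_segment[OF fde0[OF \<rho>, of l], of s], of "fd (e s) l \<rho>"]
        by simp
    qed
    have limG: "(\<lambda>n. \<Sum>\<^sub>\<infinity>l. G l * D (a n) l) \<longlonglongrightarrow> (\<Sum>\<^sub>\<infinity>l. G l * D (e s) l)"
      by (rule weak_limit_infsum(2)[OF Da sa ba sG2])
    have "B u (a n) = B u (e s) - B u (e (n + s))" for n
    proof -
      have "a n = (\<lambda>l. e s l - e (n + s) l)" by (simp add: a_def e_def add.commute fun_eq_iff)
      then show ?thesis using B_diff2'[OF u se[of s] se[of "n + s"]] by metis
    qed
    then have limBu: "(\<lambda>n. B u (a n)) \<longlonglongrightarrow> B u (e s)"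
      using tendsto_diff[OF tendsto_const LIMSEQ_ignore_initial_segment[OF B_e_lim[OF u], of s], of "B u (e s)"]
      by simp
    have Bu_le: "B u (e s) \<le> (\<Sum>\<^sub>\<infinity>l. G l * D (e s) l)"
    proof (rule LIMSEQ_le[OF limBu limG], intro exI[of _ 0] allI impI)
      show "B u (a n) \<le> (\<Sum>\<^sub>\<infinity>l. G l * D (a n) l)" for n
        using res[OF finite_supp_in[OF suppa[of n]]] by (simp add: G_def)
    qed
    show ?thesis using Bu_le key0[of s] X(2)[of s] by simp
  qed
  define \<phi> where "\<phi> = (\<lambda>s. sqrt (\<Sum>\<^sub>\<infinity>l\<in>- cube s. (D u l)\<^sup>2))"
  have \<phi>2: "(\<phi> s)\<^sup>2 = (\<Sum>\<^sub>\<infinity>l\<in>- cube s. (D u l)\<^sup>2)" for s by (simp add: \<phi>_def infsum_nonneg)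
  have sub: "(\<lambda>l. (D v l)\<^sup>2) summable_on Y" if "(\<lambda>l. (D v l)\<^sup>2) summable_on UNIV" for v Y
    using that summable_on_subset_banach by blast
  \<comment> \<open>The interior bound is used inside \<open>cube s\<close>. Outside it only the
    quadratic part of \<open>G\<close> is left, because \<open>q \<le> s\<close>, and the bound by
    the whole energy norm is enough there.\<close>
  have est: "X s \<le> (sqrt K2 * infsum G UNIV + K3) / c * (1 / sqrt (real s ^ ?d) + (\<phi> s)\<^sup>2)"
    if s: "max (6 * m) q \<le> s" for s
  proof -
    have De_X: "D (e s) l \<le> X s" for l
    proof -
      have "(D (e s) l)\<^sup>2 \<le> (X s)\<^sup>2" using finite_sum_le_infsum[OF se[of s], of "{l}"] by (simp add: X(2))
      then show ?thesis using X(1) power2_le_imp_le by blast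
    qed
    have De_in: "D (e s) l \<le> sqrt K2 / sqrt (real s ^ ?d) * X s" if "l \<in> cube s" for l
    proof -
      have "sqrt ((D (e s) l)\<^sup>2) \<le> sqrt (K2 / real s ^ ?d * (X s)\<^sup>2)"
        using interior[of s l] s that by (intro real_sqrt_le_mono) auto
      then show ?thesis using X(1)[of s] by (simp add: real_sqrt_mult real_sqrt_divide)
    qed
    have sGD: "(\<lambda>l. G l * D (e s) l) summable_on UNIV"
      using Cauchy_Schwarz_infsum(1)[OF sG2 se[of s]] G0 by (simp add: abs_mult)
    have "(\<Sum>\<^sub>\<infinity>l. G l * D (e s) l) = (\<Sum>\<^sub>\<infinity>l\<in>cube s. G l * D (e s) l) + (\<Sum>\<^sub>\<infinity>l\<in>- cube s. G l * D (e s) l)"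
    proof -
      have "(\<Sum>\<^sub>\<infinity>l\<in>cube s \<union> - cube s. G l * D (e s) l)
          = (\<Sum>\<^sub>\<infinity>l\<in>cube s. G l * D (e s) l) + (\<Sum>\<^sub>\<infinity>l\<in>- cube s. G l * D (e s) l)"
      proof (rule infsum_Un_disjoint)
        show "(\<lambda>l. G l * D (e s) l) summable_on - cube s" by (rule summable_on_subset_banach[OF sGD]) simp
      qed simp_all
      then show ?thesis by simp
    qed
    also have "(\<Sum>\<^sub>\<infinity>l\<in>cube s. G l * D (e s) l) \<le> infsum G UNIV * (sqrt K2 / sqrt (real s ^ ?d) * X s)"
    proof -
      have "(\<Sum>\<^sub>\<infinity>l\<in>cube s. G l * D (e s) l) = (\<Sum>l\<in>cube s. G l * D (e s) l)" by simp
      also have "\<dots> \<le> (\<Sum>l\<in>cube s. G l * (sqrt K2 / sqrt (real s ^ ?d) * X s))"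
        by (intro sum_mono mult_left_mono De_in G0)
      also have "\<dots> = (\<Sum>l\<in>cube s. G l) * (sqrt K2 / sqrt (real s ^ ?d) * X s)" by (rule sum_distrib_right[symmetric])
      also have "\<dots> \<le> infsum G UNIV * (sqrt K2 / sqrt (real s ^ ?d) * X s)"
        using K2 X(1)[of s] G0 by (intro mult_right_mono finite_sum_le_infsum sG) auto
      finally show ?thesis .
    qed
    also have "(\<Sum>\<^sub>\<infinity>l\<in>- cube s. G l * D (e s) l) \<le> K3 * (\<phi> s)\<^sup>2 * X s"
    proof -
      have "(\<Sum>\<^sub>\<infinity>l\<in>- cube s. G l * D (e s) l) \<le> (\<Sum>\<^sub>\<infinity>l\<in>- cube s. (K3 * X s) * (D u l)\<^sup>2)"
      proof (rule infsum_mono)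
        show "(\<lambda>l. G l * D (e s) l) summable_on - cube s" by (rule summable_on_subset_banach[OF sGD]) auto
        show "(\<lambda>l. K3 * X s * (D u l)\<^sup>2) summable_on - cube s" by (rule summable_on_cmult_right, rule sub, rule u)
        fix l :: "int^'d" assume "l \<in> - cube s"
        then have "l \<notin> cube q" using s cube_mono[of q s] by auto
        then have "G l * D (e s) l = K3 * (D u l)\<^sup>2 * D (e s) l" by (simp add: G_def)
        also have "\<dots> \<le> K3 * (D u l)\<^sup>2 * X s" using De_X K3 by (intro mult_left_mono) auto
        finally show "G l * D (e s) l \<le> K3 * X s * (D u l)\<^sup>2" by (simp add: algebra_simps)
      qed
      also have "\<dots> = (K3 * X s) * (\<phi> s)\<^sup>2" unfolding \<phi>2 by (rule infsum_cmult_right')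
      finally show ?thesis by (simp add: algebra_simps)
    qed
    finally have "(\<Sum>\<^sub>\<infinity>l. G l * D (e s) l) \<le> infsum G UNIV * (sqrt K2 / sqrt (real s ^ ?d) * X s) + K3 * (\<phi> s)\<^sup>2 * X s"
      by simp
    with key[of s] have "c * X s * X s \<le> (sqrt K2 * infsum G UNIV * (1 / sqrt (real s ^ ?d)) + K3 * (\<phi> s)\<^sup>2) * X s"
      by (simp add: power2_eq_square algebra_simps)
    moreover have GG: "0 \<le> infsum G UNIV" using G0 by (simp add: infsum_nonneg)
    ultimately have "c * X s \<le> sqrt K2 * infsum G UNIV * (1 / sqrt (real s ^ ?d)) + K3 * (\<phi> s)\<^sup>2"

    proof (cases "X s = 0")
      case False
      then show ?thesis using \<open>c * X s * X s \<le> _\<close> X(1)[of s] by (intro mult_right_le_imp_le[of "c * X s" "X s"]) auto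
    qed (use K2 K3 in auto)
    also have "\<dots> \<le> (sqrt K2 * infsum G UNIV + K3) * (1 / sqrt (real s ^ ?d)) + (sqrt K2 * infsum G UNIV + K3) * (\<phi> s)\<^sup>2"
      using K2 K3 GG by (intro add_mono mult_right_mono) auto
    finally show ?thesis using c_pos by (simp add: field_simps)
  qed
  define K6 where "K6 = (sqrt K2 * infsum G UNIV + K3) / c"
  have K6: "0 \<le> K6" using K2 K3 G0 c_pos by (simp add: K6_def infsum_nonneg)
  have "\<exists>C\<ge>0. \<forall>s\<ge>1. \<phi> s \<le> C / sqrt (real s ^ ?d)"
  proof (rule quadratic_decay)
    show "\<phi> s \<le> \<phi> r" if "r \<le> s" for r s
      unfolding \<phi>_def using cube_mono[OF that]
      by (intro real_sqrt_le_mono infsum_mono_neutral sub[OF u]) auto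
    show "0 \<le> \<phi> s" for s by (simp add: \<phi>_def infsum_nonneg)
    then have \<phi>0: "0 \<le> \<phi> s" for s .
    show "\<phi> \<longlonglongrightarrow> 0"
    proof (rule LIMSEQ_I)
      fix r :: real assume r: "0 < r"
      then have "0 < r\<^sup>2" by simp
      then obtain F where F: "finite F" "(\<Sum>\<^sub>\<infinity>l\<in>UNIV - F. (D u l)\<^sup>2) < r\<^sup>2"
        using infsum_tail_small[OF u, of "r\<^sup>2"] by auto
      define N where "N = nat (Max (insert 0 (inf_norm ` F)))"
      have "norm (\<phi> n - 0) < r" if n: "N \<le> n" for n
      proof -
        have "F \<subseteq> cube n"
        proof
          fix l assume "l \<in> F"
          then have "inf_norm l \<le> Max (insert 0 (inf_norm ` F))" using F by (intro Max_ge) auto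
          then show "l \<in> cube n" unfolding cube_inf_norm using n by (simp add: N_def)
        qed
        then have "(\<phi> n)\<^sup>2 \<le> (\<Sum>\<^sub>\<infinity>l\<in>UNIV - F. (D u l)\<^sup>2)"
          unfolding \<phi>2 by (intro infsum_mono_neutral sub[OF u]) auto
        then have "(\<phi> n)\<^sup>2 < r\<^sup>2" using F by simp
        then show ?thesis using \<phi>0[of n] r power_less_imp_less_base[of "\<phi> n" 2 r] by simp
      qed
      then show "\<exists>N. \<forall>n\<ge>N. norm (\<phi> n - 0) < r" by blast
    qed
    \<comment> \<open>The scale factor takes one layer more than the support of \<open>w s\<close>:
      beyond it all stencil differences of the error are those of \<open>u\<close>.\<close>
    show "1 < ?d + 4" "0 \<le> K6" using K6 by auto
    fix s assume s: "max (6 * m) q \<le> s"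
    have "(\<phi> ((?d + 4) * s))\<^sup>2 \<le> (X s)\<^sup>2"
      unfolding \<phi>2 X(2)
    proof (rule infsum_mono_neutral)
      fix l :: "int^'d" assume "l \<in> - cube ((?d + 4) * s) \<inter> UNIV"
      moreover have "(?d + 3) * s + m \<le> (?d + 4) * s" using s by (simp add: algebra_simps)
      ultimately have l: "l \<notin> cube ((?d + 3) * s + m)" using cube_mono by blast
      have "fd (e s) l \<rho> = fd u l \<rho>" if "\<rho> \<in> S" for \<rho>
        using fd_outside[OF w l that] by (simp add: e_def fd_diff)
      then have "D (e s) l = D u l" unfolding D_def by (rule stencil_norm_cong)
      then show "(D u l)\<^sup>2 \<le> (D (e s) l)\<^sup>2" by simp
    qed (use sub[OF u] u se in auto)
    then have "\<phi> ((?d + 4) * s) \<le> X s" using X(1)[of s] power2_le_imp_le by blast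
    then show "\<phi> ((?d + 4) * s) \<le> K6 * (1 / sqrt (real s ^ ?d) + (\<phi> s)\<^sup>2)"
      using est[OF s] by (simp add: K6_def)
  qed
  then obtain C where C: "0 \<le> C" "\<And>s. s \<ge> 1 \<Longrightarrow> \<phi> s \<le> C / sqrt (real s ^ ?d)" by blast
  \<comment> \<open>The rate for \<phi> is inserted into \<open>est\<close>: its square is of order
    \<open>1 / s ^ d\<close>, which for \<open>s \<ge> 1\<close> is at most the square root of that
    quantity.\<close>
  define K8 where "K8 = K6 * (1 + C\<^sup>2)"
  have "supp_in ((?d + 3) * s) (w s) \<and> (\<lambda>l. (D (\<lambda>l. u l - w s l) l)\<^sup>2) summable_on UNIV \<and>
    (\<Sum>\<^sub>\<infinity>l. (D (\<lambda>l. u l - w s l) l)\<^sup>2) \<le> K8\<^sup>2 / real s ^ ?d" if s: "max (max (6 * m) q) 1 \<le> s" for s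
  proof -
    have s1: "1 \<le> real s ^ ?d" using s by simp
    define y where "y = sqrt (real s ^ ?d)"
    have y: "1 \<le> y" "y\<^sup>2 = real s ^ ?d" using s1 by (auto simp: y_def)
    have "(\<phi> s)\<^sup>2 \<le> (C / y)\<^sup>2" unfolding y_def using C(2)[of s] s by (intro power_mono) (auto simp: \<phi>_def infsum_nonneg)
    also have "\<dots> \<le> C\<^sup>2 * (1 / y)"
    proof -
      have "1 / y\<^sup>2 \<le> 1 / y" using y(1) by (intro divide_left_mono) (auto simp: power2_eq_square)
      then have "C\<^sup>2 * (1 / y\<^sup>2) \<le> C\<^sup>2 * (1 / y)" by (rule mult_left_mono) simp
      then show ?thesis by (simp add: power_divide)
    qed
    finally have "1 / y + (\<phi> s)\<^sup>2 \<le> (1 + C\<^sup>2) * (1 / y)" by (simp add: algebra_simps)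
    then have "K6 * (1 / y + (\<phi> s)\<^sup>2) \<le> K8 * (1 / y)"
      unfolding K8_def mult.assoc using K6 by (rule mult_left_mono)
    then have "X s \<le> K8 / y" using est[of s] s by (simp add: K6_def y_def)
    then have "(X s)\<^sup>2 \<le> (K8 / y)\<^sup>2" using X(1) by (intro power_mono) auto
    then show ?thesis using w[of s] se[of s] X(2)[of s] y by (simp add: e_def power_divide)
  qed
  then have "\<forall>s\<ge>max (max (6 * m) q) 1. \<exists>w. supp_in ((?d + 3) * s) w \<and>
    (\<lambda>l. (D (\<lambda>l. u l - w l) l)\<^sup>2) summable_on UNIV \<and>
    (\<Sum>\<^sub>\<infinity>l. (D (\<lambda>l. u l - w l) l)\<^sup>2) \<le> K8\<^sup>2 / real s ^ ?d" by fast
  moreover have "0 \<le> K8\<^sup>2" by simp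
  ultimately show ?thesis by (intro exI conjI)
qed

end


section \<open>Taylor estimates for site potentials\<close>

text \<open>\<open>Ck_stencil\<close> supplies only partial derivatives, so the way from
  \<open>g\<close> to \<open>g + h\<close> moves one coordinate at a time; \<open>J\<close> collects
  the coordinates already moved.\<close>

definition partial_shift :: "('b \<Rightarrow> real^'d) \<Rightarrow> ('b \<Rightarrow> real^'d) \<Rightarrow> ('b \<times> 'd) set \<Rightarrow> 'b \<Rightarrow> real^'d" where
  "partial_shift g h J = (\<lambda>\<sigma>. \<chi> j. g \<sigma> $ j + (if (\<sigma>, j) \<in> J then h \<sigma> $ j else 0))"

lemma Ck_stencil_mono: "Ck_stencil (Suc n) R f \<Longrightarrow> Ck_stencil n R f"
proof (induction n arbitrary: f)
  case 0
  then show ?case by simp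
next
  case (Suc n)
  show ?case
    unfolding Ck_stencil.simps(2)[of n]
  proof (intro conjI ballI allI)
    show "continuous_on (stencil_space R) f" using Suc.prems by simp
    fix \<rho> i assume "\<rho> \<in> R"
    then obtain f' where "\<forall>g \<in> stencil_space R. ((\<lambda>t. f (g(\<rho> := g \<rho> + t *\<^sub>R axis i 1))) has_real_derivative f' g) (at 0)"
      "Ck_stencil (Suc n) R f'" using Suc.prems unfolding Ck_stencil.simps(2)[of "Suc n"] by blast
    then show "\<exists>f'. (\<forall>g \<in> stencil_space R. ((\<lambda>t. f (g(\<rho> := g \<rho> + t *\<^sub>R axis i 1))) has_real_derivative f' g) (at 0)) \<and>
        Ck_stencil n R f'" using Suc.IH by blast
  qed
qed

lemma Ck_stencil_le: "Ck_stencil n R f \<Longrightarrow> k \<le> n \<Longrightarrow> Ck_stencil k R f"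
  by (induction n) (auto simp: le_Suc_eq dest: Ck_stencil_mono simp del: Ck_stencil.simps)

text \<open>One scalar mean value theorem per coordinate. The intermediate points differ from
  coordinate to coordinate, but all lie in the box spanned by \<open>g\<close> and
  \<open>g + h\<close>, and the later bounds hold on that box.\<close>

lemma stencil_mvt:
  fixes f :: "(real^'d \<Rightarrow> real^'d) \<Rightarrow> real"
  assumes "finite J" "J \<subseteq> R \<times> UNIV"
    and der: "\<And>\<rho> i g. \<rho> \<in> R \<Longrightarrow> g \<in> stencil_space R \<Longrightarrow>
      ((\<lambda>t. f (g(\<rho> := g \<rho> + t *\<^sub>R axis i 1))) has_real_derivative f' (\<rho>, i) g) (at 0)"
    and g: "g \<in> stencil_space R"
  shows "\<exists>\<xi>. (\<forall>j\<in>J. \<xi> j \<in> stencil_space R \<and>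
        (\<forall>\<sigma> k. \<xi> j \<sigma> $ k \<in> closed_segment (g \<sigma> $ k) (g \<sigma> $ k + h \<sigma> $ k))) \<and>
      f (partial_shift g h J) - f g = (\<Sum>j\<in>J. f' j (\<xi> j) * h (fst j) $ snd j)"
  using assms(1,2)
proof (induction J rule: finite_induct)
  case empty
  have "partial_shift g h {} = g" by (simp add: partial_shift_def)
  then show ?case by simp
next
  case (insert j J)
  obtain \<rho> i where j: "j = (\<rho>, i)" by force
  have \<rho>: "\<rho> \<in> R" using insert.prems j by auto
  obtain \<xi> where \<xi>: "\<And>j. j \<in> J \<Longrightarrow> \<xi> j \<in> stencil_space R"
      "\<And>j \<sigma> k. j \<in> J \<Longrightarrow> \<xi> j \<sigma> $ k \<in> closed_segment (g \<sigma> $ k) (g \<sigma> $ k + h \<sigma> $ k)"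
      "f (partial_shift g h J) - f g = (\<Sum>j\<in>J. f' j (\<xi> j) * h (fst j) $ snd j)"
    using insert.IH insert.prems by blast
  define G where "G = partial_shift g h J"
  have G: "G \<in> stencil_space R"
    using g insert.prems by (auto simp: G_def partial_shift_def stencil_space_def vec_eq_iff)
  define x where "x = h \<rho> $ i"
  define p where "p = (\<lambda>t. G(\<rho> := G \<rho> + t *\<^sub>R axis i 1))"
  have p: "p t \<in> stencil_space R" for t
    using G \<rho> by (auto simp: p_def stencil_space_def)
  have new: "partial_shift g h (insert j J) = p x"
  proof (rule ext)
    fix \<sigma>
    have "partial_shift g h (insert j J) \<sigma> $ k = p x \<sigma> $ k" for k
      using insert.hyps(2) by (auto simp: j p_def G_def partial_shift_def x_def axis_def)
    then show "partial_shift g h (insert j J) \<sigma> = p x \<sigma>" by (simp add: vec_eq_iff)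
  qed
  have old: "p 0 = G" by (simp add: p_def)
  have dp: "((\<lambda>t. f (p t)) has_real_derivative f' j (p t)) (at t)" for t
  proof -
    have "p t \<rho> = G \<rho> + t *\<^sub>R axis i 1" by (simp add: p_def)
    then have eq: "(p t)(\<rho> := p t \<rho> + s *\<^sub>R axis i 1) = p (t + s)" for s
      by (simp add: p_def scaleR_add_left add.assoc)
    have "((\<lambda>s. f (p (t + s))) has_real_derivative f' j (p t)) (at 0)"
      using der[OF \<rho> p[of t], of i] by (simp add: eq j)
    then show ?thesis using DERIV_shift[of "\<lambda>t. f (p t)" "f' j (p t)" 0 t]
      by (simp add: add.commute)
  qed
  have "((\<lambda>s. f (p (s * x))) has_real_derivative f' j (p (s * x)) * x) (at s)" for s
    by (rule DERIV_chain2[OF dp]) (auto intro!: derivative_eq_intros)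
  then obtain z where z: "0 < z" "z < 1" "f (p (1 * x)) - f (p (0 * x)) = (1 - 0) * (f' j (p (z * x)) * x)"
    using MVT2[of 0 1 "\<lambda>s. f (p (s * x))" "\<lambda>s. f' j (p (s * x)) * x"] by auto
  define \<xi>' where "\<xi>' = \<xi>(j := p (z * x))"
  have jJ: "j \<notin> J" using insert.hyps by simp
  have seg: "p (z * x) \<sigma> $ k \<in> closed_segment (g \<sigma> $ k) (g \<sigma> $ k + h \<sigma> $ k)" for \<sigma> k
  proof -
    have zx: "g \<sigma> $ k + z * y \<in> closed_segment (g \<sigma> $ k) (g \<sigma> $ k + y)" for y
      unfolding closed_segment_def using z by (auto intro!: exI[of _ z] simp: algebra_simps)
    show ?thesis
      using zx[of x] jJ by (auto simp: j p_def G_def partial_shift_def x_def axis_def)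
  qed
  have "f (partial_shift g h (insert j J)) - f g = (\<Sum>j\<in>insert j J. f' j (\<xi>' j) * h (fst j) $ snd j)"
  proof -
    have "(\<Sum>k\<in>J. f' k (\<xi>' k) * h (fst k) $ snd k) = (\<Sum>k\<in>J. f' k (\<xi> k) * h (fst k) $ snd k)"
      using jJ by (intro sum.cong) (auto simp: \<xi>'_def)
    moreover have "f (p x) - f G = f' j (p (z * x)) * x" using z old by simp
    moreover have "h (fst j) $ snd j = x" by (simp add: j x_def)
    ultimately show ?thesis
      using \<xi>(3) jJ insert.hyps(1) by (simp add: new \<xi>'_def G_def)
  qed
  then show ?case using \<xi> seg p by (intro exI[of _ \<xi>']) (auto simp: \<xi>'_def)
qed

text \<open>The box is a product of compact sets, with the factors off \<open>R\<close> pinned to 0,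
  so Tychonoff applies in the product topology.\<close>

lemma compact_stencil_box:
  fixes R :: "(real^'d) set"
  shows "compact {g \<in> stencil_space R. \<forall>\<sigma> k. \<bar>g \<sigma> $ k\<bar> \<le> (M::real)}"
proof -
  \<comment> \<open>For negative \<open>M\<close> no function satisfies the bound; the intersection
    makes the factors off \<open>R\<close> empty in that case too.\<close>
  define Y where "Y = (\<lambda>\<sigma>::real^'d. if \<sigma> \<in> R then {x::real^'d. \<forall>k. \<bar>x $ k\<bar> \<le> M} else {0} \<inter> {x::real^'d. \<forall>k. \<bar>x $ k\<bar> \<le> M})"
  have box: "{x::real^'d. \<forall>k. \<bar>x $ k\<bar> \<le> M} = cbox (\<chi> k. - M) (\<chi> k. M)"
    by (auto simp: mem_box_cart abs_le_iff minus_le_iff)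
  have "compact (Y \<sigma>)" for \<sigma>
    unfolding Y_def box by (auto intro: compact_Int_closed)
  then have "compactin (product_topology (\<lambda>_. euclidean) UNIV) (PiE UNIV Y)"
    by (simp add: compactin_PiE)
  then have "compact (PiE UNIV Y)" by (simp add: euclidean_product_topology)
  moreover have "PiE UNIV Y = {g \<in> stencil_space R. \<forall>\<sigma> k. \<bar>g \<sigma> $ k\<bar> \<le> M}"
  proof (rule set_eqI)
    fix g
    have "g \<in> PiE UNIV Y \<longleftrightarrow> (\<forall>\<sigma>. g \<sigma> \<in> Y \<sigma>)" by (simp add: PiE_iff)
    also have "\<dots> \<longleftrightarrow> (\<forall>\<sigma>. (\<forall>k. \<bar>g \<sigma> $ k\<bar> \<le> M) \<and> (\<sigma> \<notin> R \<longrightarrow> g \<sigma> = 0))"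
      unfolding Y_def by (intro iff_allI) auto
    also have "\<dots> \<longleftrightarrow> g \<in> {g \<in> stencil_space R. \<forall>\<sigma> k. \<bar>g \<sigma> $ k\<bar> \<le> M}"
      by (auto simp: stencil_space_def)
    finally show "g \<in> PiE UNIV Y \<longleftrightarrow> g \<in> {g \<in> stencil_space R. \<forall>\<sigma> k. \<bar>g \<sigma> $ k\<bar> \<le> M}" .
  qed
  ultimately show ?thesis by simp
qed

lemma stencil_bounded:
  fixes R :: "(real^'d) set"
  assumes "continuous_on (stencil_space R) f"
  shows "\<exists>K\<ge>0. \<forall>g \<in> stencil_space R. (\<forall>\<sigma> k. \<bar>g \<sigma> $ k\<bar> \<le> M) \<longrightarrow> \<bar>f g :: real\<bar> \<le> K"
proof -
  let ?P = "{g \<in> stencil_space R. \<forall>\<sigma> k. \<bar>g \<sigma> $ k\<bar> \<le> M}"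
  have "compact (f ` ?P)"
    by (rule compact_continuous_image[OF continuous_on_subset[OF assms] compact_stencil_box]) auto
  then obtain K where "\<forall>y\<in>f ` ?P. norm y \<le> K" using compact_imp_bounded bounded_iff by blast
  then show ?thesis by (intro exI[of _ "max K 0"]) (auto simp: le_max_iff_disj)
qed

lemma component_le_stencil_norm:
  assumes "finite R" "h \<in> stencil_space R"
  shows "\<bar>h \<sigma> $ k\<bar> \<le> stencil_norm R h"
proof (cases "\<sigma> \<in> R")
  case True
  have "\<bar>h \<sigma> $ k\<bar> \<le> norm (h \<sigma>)" by (rule component_le_norm_cart)
  then show ?thesis using norm_le_stencil_norm[OF assms(1) True, of h] by linarith
next
  case False
  then show ?thesis using assms by (simp add: stencil_space_def)
qed

lemma partial_shift_full:
  assumes "h \<in> stencil_space R"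
  shows "partial_shift g h (R \<times> UNIV) = (\<lambda>\<sigma>. g \<sigma> + h \<sigma>)"
  using assms by (auto simp: partial_shift_def stencil_space_def vec_eq_iff fun_eq_iff)

lemma segment_bound:
  assumes "\<xi> \<in> closed_segment a (a + b)" "\<bar>a\<bar> \<le> M" "\<bar>a + b\<bar> \<le> (M::real)"
  shows "\<bar>\<xi>\<bar> \<le> M" "\<bar>\<xi> - a\<bar> \<le> \<bar>b\<bar>"
  using assms by (auto simp: closed_segment_eq_real_ivl split: if_splits)

lemma Ck_stencil_partials:
  assumes "Ck_stencil (Suc n) R f"
  obtains f' where "\<And>\<rho> i g. \<rho> \<in> R \<Longrightarrow> g \<in> stencil_space R \<Longrightarrow>
      ((\<lambda>t. f (g(\<rho> := g \<rho> + t *\<^sub>R axis i 1))) has_real_derivative f' (\<rho>, i) g) (at 0)"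
    "\<And>\<rho> i. \<rho> \<in> R \<Longrightarrow> Ck_stencil n R (f' (\<rho>, i))"
proof -
  have "\<forall>\<rho> i. \<exists>f'. \<rho> \<in> R \<longrightarrow> (\<forall>g \<in> stencil_space R. ((\<lambda>t. f (g(\<rho> := g \<rho> + t *\<^sub>R axis i 1))) has_real_derivative f' g) (at 0)) \<and>
        Ck_stencil n R f'" using assms by auto
  then obtain F where "\<forall>\<rho> i. \<rho> \<in> R \<longrightarrow> (\<forall>g \<in> stencil_space R. ((\<lambda>t. f (g(\<rho> := g \<rho> + t *\<^sub>R axis i 1))) has_real_derivative F \<rho> i g) (at 0)) \<and>
        Ck_stencil n R (F \<rho> i)" by metis
  then show ?thesis using that[of "\<lambda>(\<rho>, i). F \<rho> i"] by simp
qed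

lemma sum_components_le:
  fixes R :: "(real^'d) set"
  assumes R: "finite R" and h: "h \<in> stencil_space R" and a: "\<And>j. j \<in> R \<times> (UNIV :: 'd set) \<Longrightarrow> \<bar>a j\<bar> \<le> (A::real)"
  shows "\<bar>\<Sum>j\<in>R \<times> UNIV. a j * (h (fst j) :: real^'d) $ snd j\<bar> \<le> real (card R * CARD('d)) * A * stencil_norm R h"
proof -
  have "\<bar>\<Sum>j\<in>R \<times> UNIV. a j * h (fst j) $ snd j\<bar> \<le> (\<Sum>j\<in>R \<times> (UNIV :: 'd set). A * stencil_norm R h)"
  proof (rule order_trans[OF sum_abs sum_mono])
    fix j assume j: "j \<in> R \<times> (UNIV :: 'd set)"
    have "\<bar>a j\<bar> * \<bar>h (fst j) $ snd j\<bar> \<le> A * stencil_norm R h"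
      using a[OF j] component_le_stencil_norm[OF R h] by (intro mult_mono) (auto intro: order_trans[OF abs_ge_zero])
    then show "\<bar>a j * h (fst j) $ snd j\<bar> \<le> A * stencil_norm R h" by (simp add: abs_mult)
  qed
  then show ?thesis by (simp add: card_cartesian_product)
qed

lemma Ck_stencil_lipschitz:
  fixes R :: "(real^'d) set"
  assumes R: "finite R" and f: "Ck_stencil (Suc n) R f"
  shows "\<exists>K\<ge>0. \<forall>g\<in>stencil_space R. \<forall>h\<in>stencil_space R. (\<forall>\<sigma> k. \<bar>g \<sigma> $ k\<bar> \<le> M) \<longrightarrow> (\<forall>\<sigma> k. \<bar>(g \<sigma> + h \<sigma>) $ k\<bar> \<le> M) \<longrightarrow>
    \<bar>f (\<lambda>\<sigma>. g \<sigma> + h \<sigma>) - f g\<bar> \<le> K * stencil_norm R h"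
proof -
  obtain f' where der: "\<And>\<rho> i g. \<rho> \<in> R \<Longrightarrow> g \<in> stencil_space R \<Longrightarrow>
      ((\<lambda>t. f (g(\<rho> := g \<rho> + t *\<^sub>R axis i 1))) has_real_derivative f' (\<rho>, i) g) (at 0)"
    and C: "\<And>\<rho> i. \<rho> \<in> R \<Longrightarrow> Ck_stencil n R (f' (\<rho>, i))"
    using Ck_stencil_partials[OF f] by blast
  have "\<exists>K\<ge>0. \<forall>g \<in> stencil_space R. (\<forall>\<sigma> k. \<bar>g \<sigma> $ k\<bar> \<le> M) \<longrightarrow> \<bar>f' j g\<bar> \<le> K" if "j \<in> R \<times> UNIV" for j
    using that C[of "fst j" "snd j"] by (intro stencil_bounded) (cases n; auto)
  then obtain KK where KK: "\<And>j g. j \<in> R \<times> UNIV \<Longrightarrow> g \<in> stencil_space R \<Longrightarrow> (\<forall>\<sigma> k. \<bar>g \<sigma> $ k\<bar> \<le> M) \<Longrightarrow> \<bar>f' j g\<bar> \<le> KK j"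
    "\<And>j. j \<in> R \<times> UNIV \<Longrightarrow> 0 \<le> KK j" by metis
  define A where "A = (\<Sum>j\<in>R \<times> UNIV. KK j)"
  have A: "KK j \<le> A" if "j \<in> R \<times> UNIV" for j
    unfolding A_def using R KK that by (intro member_le_sum) auto
  have A0: "0 \<le> A" unfolding A_def using KK by (intro sum_nonneg) auto
  have "\<bar>f (\<lambda>\<sigma>. g \<sigma> + h \<sigma>) - f g\<bar> \<le> real (card R * CARD('d)) * A * stencil_norm R h"
    if g: "g \<in> stencil_space R" and h: "h \<in> stencil_space R" and bd: "\<forall>\<sigma> k. \<bar>g \<sigma> $ k\<bar> \<le> M" "\<forall>\<sigma> k. \<bar>(g \<sigma> + h \<sigma>) $ k\<bar> \<le> M" for g h
  proof -
    obtain \<xi> where \<xi>: "\<forall>j\<in>R \<times> UNIV. \<xi> j \<in> stencil_space R \<and>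
        (\<forall>\<sigma> k. \<xi> j \<sigma> $ k \<in> closed_segment (g \<sigma> $ k) (g \<sigma> $ k + h \<sigma> $ k))"
      "f (\<lambda>\<sigma>. g \<sigma> + h \<sigma>) - f g = (\<Sum>j\<in>R \<times> UNIV. f' j (\<xi> j) * h (fst j) $ snd j)"
      using stencil_mvt[OF _ order_refl der g, where h=h] R unfolding partial_shift_full[OF h] by auto
    have "\<bar>f' j (\<xi> j)\<bar> \<le> A" if j: "j \<in> R \<times> UNIV" for j
    proof -
      have "\<forall>\<sigma> k. \<bar>\<xi> j \<sigma> $ k\<bar> \<le> M"
      proof (intro allI)
        fix \<sigma> i
        have "\<xi> j \<sigma> $ i \<in> closed_segment (g \<sigma> $ i) (g \<sigma> $ i + h \<sigma> $ i)" using \<xi>(1) j by blast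
        from segment_bound(1)[OF this, of M] show "\<bar>\<xi> j \<sigma> $ i\<bar> \<le> M" using bd by simp
      qed
      then have "\<bar>f' j (\<xi> j)\<bar> \<le> KK j" using \<xi>(1) j by (intro KK) auto
      then show ?thesis using A[OF j] by linarith
    qed
    then show ?thesis unfolding \<xi>(2) by (rule sum_components_le[OF R h])
  qed
  then show ?thesis using A0 by (intro exI[of _ "real (card R * CARD('d)) * A"]) auto
qed

text \<open>The mean value points differ from \<open>g\<close> by at most \<open>h\<close> in every
  component, so the Lipschitz bound for the partial derivatives turns the mean value formula into a
  quadratic remainder.\<close>

lemma Ck_stencil_taylor:
  fixes R :: "(real^'d) set"
  assumes R: "finite R" and f: "Ck_stencil (Suc (Suc n)) R f"
    and der: "\<And>\<rho> i g. \<rho> \<in> R \<Longrightarrow> g \<in> stencil_space R \<Longrightarrow>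
      ((\<lambda>t. f (g(\<rho> := g \<rho> + t *\<^sub>R axis i 1))) has_real_derivative f' (\<rho>, i) g) (at 0)"
    and C: "\<And>\<rho> i. \<rho> \<in> R \<Longrightarrow> Ck_stencil (Suc n) R (f' (\<rho>, i))"
  shows "\<exists>K\<ge>0. \<forall>g\<in>stencil_space R. \<forall>h\<in>stencil_space R. (\<forall>\<sigma> k. \<bar>g \<sigma> $ k\<bar> \<le> M) \<longrightarrow> (\<forall>\<sigma> k. \<bar>(g \<sigma> + h \<sigma>) $ k\<bar> \<le> M) \<longrightarrow>
    \<bar>f (\<lambda>\<sigma>. g \<sigma> + h \<sigma>) - f g - (\<Sum>j\<in>R \<times> UNIV. f' j g * h (fst j) $ snd j)\<bar> \<le> K * (stencil_norm R h)\<^sup>2"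
proof -
  define P where "P = (\<lambda>j K. \<forall>g\<in>stencil_space R. \<forall>h\<in>stencil_space R. (\<forall>\<sigma> k. \<bar>g \<sigma> $ k\<bar> \<le> M) \<longrightarrow>
    (\<forall>\<sigma> k. \<bar>(g \<sigma> + h \<sigma>) $ k\<bar> \<le> M) \<longrightarrow> \<bar>f' j (\<lambda>\<sigma>. g \<sigma> + h \<sigma>) - f' j g\<bar> \<le> K * stencil_norm R h)"
  have "\<exists>K\<ge>0. P j K" if "j \<in> R \<times> UNIV" for j
    unfolding P_def using that C[of "fst j" "snd j"]
    by (intro Ck_stencil_lipschitz[OF R, of n]) (auto simp del: Ck_stencil.simps)
  then obtain KK where "\<And>j. j \<in> R \<times> UNIV \<Longrightarrow> P j (KK j)" and KK0: "\<And>j. j \<in> R \<times> UNIV \<Longrightarrow> 0 \<le> KK j"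
    by metis
  then have KK: "\<bar>f' j (\<lambda>\<sigma>. g \<sigma> + h \<sigma>) - f' j g\<bar> \<le> KK j * stencil_norm R h"
    if "j \<in> R \<times> UNIV" "g \<in> stencil_space R" "h \<in> stencil_space R"
     "\<forall>\<sigma> k. \<bar>g \<sigma> $ k\<bar> \<le> M" "\<forall>\<sigma> k. \<bar>(g \<sigma> + h \<sigma>) $ k\<bar> \<le> M" for j g h
    using that unfolding P_def by blast
  define A where "A = (\<Sum>j\<in>R \<times> UNIV. KK j)"
  have A: "KK j \<le> A" if "j \<in> R \<times> UNIV" for j
    unfolding A_def using R KK0 that by (intro member_le_sum) auto
  have A0: "0 \<le> A" unfolding A_def using KK0 by (intro sum_nonneg) auto
  have "\<bar>f (\<lambda>\<sigma>. g \<sigma> + h \<sigma>) - f g - (\<Sum>j\<in>R \<times> UNIV. f' j g * h (fst j) $ snd j)\<bar> \<le> real (card R * CARD('d)) * A * (stencil_norm R h)\<^sup>2"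
    if g: "g \<in> stencil_space R" and h: "h \<in> stencil_space R" and bd: "\<forall>\<sigma> k. \<bar>g \<sigma> $ k\<bar> \<le> M" "\<forall>\<sigma> k. \<bar>(g \<sigma> + h \<sigma>) $ k\<bar> \<le> M" for g h
  proof -
    obtain \<xi> where \<xi>: "\<forall>j\<in>R \<times> UNIV. \<xi> j \<in> stencil_space R \<and>
        (\<forall>\<sigma> k. \<xi> j \<sigma> $ k \<in> closed_segment (g \<sigma> $ k) (g \<sigma> $ k + h \<sigma> $ k))"
      "f (\<lambda>\<sigma>. g \<sigma> + h \<sigma>) - f g = (\<Sum>j\<in>R \<times> UNIV. f' j (\<xi> j) * h (fst j) $ snd j)"
      using stencil_mvt[OF _ order_refl der g, where h=h] R unfolding partial_shift_full[OF h] by auto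
    have lip: "\<bar>f' j (\<xi> j) - f' j g\<bar> \<le> A * stencil_norm R h" if j: "j \<in> R \<times> UNIV" for j
    proof -
      define k where "k = (\<lambda>\<sigma>. \<xi> j \<sigma> - g \<sigma>)"
      have k: "k \<in> stencil_space R" using \<xi>(1) j g by (auto simp: k_def stencil_space_def)
      have \<xi>k: "\<xi> j = (\<lambda>\<sigma>. g \<sigma> + k \<sigma>)" by (simp add: k_def)
      have bk: "\<forall>\<sigma> i. \<bar>(g \<sigma> + k \<sigma>) $ i\<bar> \<le> M"
      proof (intro allI)
        fix \<sigma> i
        have "\<xi> j \<sigma> $ i \<in> closed_segment (g \<sigma> $ i) (g \<sigma> $ i + h \<sigma> $ i)" using \<xi>(1) j by blast
        from segment_bound(1)[OF this, of M] show "\<bar>(g \<sigma> + k \<sigma>) $ i\<bar> \<le> M"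
          using bd by (simp add: k_def)
      qed
      have "norm (k \<sigma>) \<le> norm (h \<sigma>)" for \<sigma>
      proof (rule norm_le_componentwise_cart)
        fix i
        have "\<xi> j \<sigma> $ i \<in> closed_segment (g \<sigma> $ i) (g \<sigma> $ i + h \<sigma> $ i)" using \<xi>(1) j by blast
        from segment_bound(2)[OF this, of M] show "norm (k \<sigma> $ i) \<le> norm (h \<sigma> $ i)"
          using bd by (simp add: k_def)
      qed
      then have "stencil_norm R k \<le> stencil_norm R h" by (intro stencil_norm_mono)
      moreover have "\<bar>f' j (\<xi> j) - f' j g\<bar> \<le> KK j * stencil_norm R k"
        unfolding \<xi>k by (rule KK[OF j g k bd(1) bk])
      moreover have "KK j * stencil_norm R k \<le> A * stencil_norm R h"
        using calculation(1) A[OF j] A0 by (intro mult_mono) auto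
      ultimately show ?thesis by linarith
    qed
    have "f (\<lambda>\<sigma>. g \<sigma> + h \<sigma>) - f g - (\<Sum>j\<in>R \<times> UNIV. f' j g * h (fst j) $ snd j)
       = (\<Sum>j\<in>R \<times> UNIV. (f' j (\<xi> j) - f' j g) * h (fst j) $ snd j)"
      unfolding \<xi>(2) by (simp add: left_diff_distrib sum_subtractf)
    then show ?thesis
      using sum_components_le[OF R h lip] by (simp add: power2_eq_square mult.assoc)
  qed
  then show ?thesis using A0 by (intro exI[of _ "real (card R * CARD('d)) * A"]) auto
qed

text \<open>In \<open>d2 g k h\<close> the increment of \<open>g\<close> enters through the last
  slot. One constant serves all five estimates, so that finitely many bounds can be merged by
  enlarging it.\<close>

definition C2_bound ::
  "real \<Rightarrow> real \<Rightarrow> (real^'d) set \<Rightarrow> ((real^'d \<Rightarrow> real^'d) \<Rightarrow> real) \<Rightarrow> ((real^'d \<Rightarrow> real^'d) \<Rightarrow> (real^'d \<Rightarrow> real^'d) \<Rightarrow> real) \<Rightarrow>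
     ((real^'d \<Rightarrow> real^'d) \<Rightarrow> (real^'d \<Rightarrow> real^'d) \<Rightarrow> (real^'d \<Rightarrow> real^'d) \<Rightarrow> real) \<Rightarrow> bool" where
  "C2_bound M K R f d1 d2 \<longleftrightarrow>
     (\<forall>g\<in>stencil_space R. \<forall>h\<in>stencil_space R. stencil_norm R g \<le> M \<longrightarrow> stencil_norm R (\<lambda>\<rho>. g \<rho> + h \<rho>) \<le> M \<longrightarrow>
       \<bar>f (\<lambda>\<rho>. g \<rho> + h \<rho>) - f g - d1 g h\<bar> \<le> K * (stencil_norm R h)\<^sup>2 \<and>
       (\<forall>k\<in>stencil_space R. \<bar>d1 (\<lambda>\<rho>. g \<rho> + h \<rho>) k - d1 g k - d2 g k h\<bar> \<le> K * (stencil_norm R h)\<^sup>2 * stencil_norm R k) \<and>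
       (\<forall>k\<in>stencil_space R. \<bar>d1 g k\<bar> \<le> K * stencil_norm R k) \<and>
       (\<forall>k\<in>stencil_space R. \<forall>l\<in>stencil_space R.
          \<bar>d2 (\<lambda>\<rho>. g \<rho> + h \<rho>) k l - d2 g k l\<bar> \<le> K * stencil_norm R h * stencil_norm R k * stencil_norm R l \<and>
          \<bar>d2 g k l\<bar> \<le> K * stencil_norm R k * stencil_norm R l))"

text \<open>
  The forms \<open>d1 g\<close> and \<open>d2 g\<close> are the first and second derivatives at \<open>g\<close>; \<open>d2 g\<close> is not claimed
  to be symmetric.
\<close>
definition C2_forms ::
  "(real^'d) set \<Rightarrow> ((real^'d \<Rightarrow> real^'d) \<Rightarrow> real) \<Rightarrow> ((real^'d \<Rightarrow> real^'d) \<Rightarrow> (real^'d \<Rightarrow> real^'d) \<Rightarrow> real) \<Rightarrow>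
     ((real^'d \<Rightarrow> real^'d) \<Rightarrow> (real^'d \<Rightarrow> real^'d) \<Rightarrow> (real^'d \<Rightarrow> real^'d) \<Rightarrow> real) \<Rightarrow> bool" where
  "C2_forms R f d1 d2 \<longleftrightarrow>
     (\<forall>g x h h'. d1 g (\<lambda>\<rho>. x *\<^sub>R h \<rho> + h' \<rho>) = x * d1 g h + d1 g h') \<and>
     (\<forall>g x h h' k. d2 g (\<lambda>\<rho>. x *\<^sub>R h \<rho> + h' \<rho>) k = x * d2 g h k + d2 g h' k) \<and>
     (\<forall>g x h h' k. d2 g k (\<lambda>\<rho>. x *\<^sub>R h \<rho> + h' \<rho>) = x * d2 g k h + d2 g k h') \<and>
     (\<forall>M. \<exists>K\<ge>0. C2_bound M K R f d1 d2)"

lemma C2_bound_mono: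
  assumes "C2_bound M K R f d1 d2" "K \<le> K'"
  shows "C2_bound M K' R f d1 d2"
proof -
  have 1: "K * x \<le> K' * x" if "0 \<le> x" for x using assms(2) that by (rule mult_right_mono)
  have 2: "K * x * y \<le> K' * x * y" if "0 \<le> x" "0 \<le> y" for x y
    using 1[of "x * y"] that by (simp add: mult.assoc)
  have 3: "K * x * y * z \<le> K' * x * y * z" if "0 \<le> x" "0 \<le> y" "0 \<le> z" for x y z
    using 1[of "x * y * z"] that by (simp add: mult.assoc)
  show ?thesis
    using assms(1) unfolding C2_bound_def
    by (intro ballI impI) (auto intro: order_trans[OF _ 1] order_trans[OF _ 2] order_trans[OF _ 3])
qed

lemma uniform_bound_finite:
  assumes "finite J" "\<And>j. j \<in> J \<Longrightarrow> \<exists>K\<ge>0. P j (K::real)" "\<And>j K K'. P j K \<Longrightarrow> K \<le> K' \<Longrightarrow> P j K'"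
  shows "\<exists>K\<ge>0. \<forall>j\<in>J. P j K"
  using assms(1,2)
proof (induction J rule: finite_induct)
  case (insert j J)
  then obtain K where K: "0 \<le> K" "\<forall>j\<in>J. P j K" by auto
  obtain K' where K': "0 \<le> K'" "P j K'" using insert.prems[of j] by auto
  show ?case using K K' assms(3) by (intro exI[of _ "max K K'"]) (auto intro: max.coboundedI1 max.coboundedI2)
qed auto

text \<open>Three orders of smoothness are asked because the second partial derivatives have to be
  Lipschitz on bounded sets. Each estimate is first made uniform over the finitely many coordinates
  or pairs of coordinates.\<close>

lemma Ck_stencil_C2_forms:
  fixes R :: "(real^'d) set"
  assumes R: "finite R" and f: "Ck_stencil (Suc (Suc (Suc n))) R f"
  shows "\<exists>d1 d2. C2_forms R f d1 d2"
proof -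
  obtain f' where der1: "\<And>\<rho> i g. \<rho> \<in> R \<Longrightarrow> g \<in> stencil_space R \<Longrightarrow>
      ((\<lambda>t. f (g(\<rho> := g \<rho> + t *\<^sub>R axis i 1))) has_real_derivative f' (\<rho>, i) g) (at 0)"
    and C1: "\<And>\<rho> i. \<rho> \<in> R \<Longrightarrow> Ck_stencil (Suc (Suc n)) R (f' (\<rho>, i))"
    using Ck_stencil_partials[OF f] by blast
  let ?J = "R \<times> (UNIV :: 'd set)"
  have finJ: "finite ?J" using R by simp
  define Q where "Q = (\<lambda>j F. (\<forall>\<rho> i g. \<rho> \<in> R \<longrightarrow> g \<in> stencil_space R \<longrightarrow>
      ((\<lambda>t. f' j (g(\<rho> := g \<rho> + t *\<^sub>R axis i 1))) has_real_derivative F (\<rho>, i) g) (at 0)) \<and>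
      (\<forall>\<rho> i. \<rho> \<in> R \<longrightarrow> Ck_stencil (Suc n) R (F (\<rho>, i))))"
  have "\<exists>F. Q j F" if "j \<in> ?J" for j
  proof -
    have "Ck_stencil (Suc (Suc n)) R (f' j)" using C1[of "fst j" "snd j"] that by (auto simp del: Ck_stencil.simps)
    then obtain F where F: "\<And>\<rho> i g. \<rho> \<in> R \<Longrightarrow> g \<in> stencil_space R \<Longrightarrow>
      ((\<lambda>t. f' j (g(\<rho> := g \<rho> + t *\<^sub>R axis i 1))) has_real_derivative F (\<rho>, i) g) (at 0)"
      "\<And>\<rho> i. \<rho> \<in> R \<Longrightarrow> Ck_stencil (Suc n) R (F (\<rho>, i))"
      by (rule Ck_stencil_partials) blast
    then show ?thesis unfolding Q_def by blast
  qed
  then obtain f'' where "\<And>j. j \<in> ?J \<Longrightarrow> Q j (f'' j)" by metis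
  then have der2: "\<And>j \<rho> i g. j \<in> ?J \<Longrightarrow> \<rho> \<in> R \<Longrightarrow> g \<in> stencil_space R \<Longrightarrow>
      ((\<lambda>t. f' j (g(\<rho> := g \<rho> + t *\<^sub>R axis i 1))) has_real_derivative f'' j (\<rho>, i) g) (at 0)"
    and C2: "\<And>j \<rho> i. j \<in> ?J \<Longrightarrow> \<rho> \<in> R \<Longrightarrow> Ck_stencil (Suc n) R (f'' j (\<rho>, i))"
    unfolding Q_def by blast+
  define d1 where "d1 = (\<lambda>g (h::real^'d \<Rightarrow> real^'d). \<Sum>j\<in>?J. f' j g * h (fst j) $ snd j)"
  define d2 where "d2 = (\<lambda>g (h::real^'d \<Rightarrow> real^'d) (k::real^'d \<Rightarrow> real^'d).
    \<Sum>j\<in>?J. (\<Sum>i\<in>?J. f'' j i g * k (fst i) $ snd i) * h (fst j) $ snd j)"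
  define c where "c = real (card R * CARD('d))"
  have c: "0 \<le> c" by (simp add: c_def)
  have lin: "d1 g (\<lambda>\<rho>. x *\<^sub>R h \<rho> + h' \<rho>) = x * d1 g h + d1 g h'"
    "d2 g (\<lambda>\<rho>. x *\<^sub>R h \<rho> + h' \<rho>) k = x * d2 g h k + d2 g h' k"
    "d2 g k (\<lambda>\<rho>. x *\<^sub>R h \<rho> + h' \<rho>) = x * d2 g k h + d2 g k h'" for g x h h' k
    by (simp_all add: d1_def d2_def algebra_simps sum.distrib sum_distrib_left sum_distrib_right)
  define bx where "bx = (\<lambda>M (g::real^'d \<Rightarrow> real^'d). \<forall>\<sigma> k. \<bar>g \<sigma> $ k\<bar> \<le> M)"
  have bnd: "\<exists>K\<ge>0. C2_bound M K R f d1 d2" for M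
  proof -
    obtain K1 where K1: "0 \<le> K1" "\<And>g h. g\<in>stencil_space R \<Longrightarrow> h\<in>stencil_space R \<Longrightarrow> bx M g \<Longrightarrow> bx M (\<lambda>\<rho>. g \<rho> + h \<rho>) \<Longrightarrow>
      \<bar>f (\<lambda>\<sigma>. g \<sigma> + h \<sigma>) - f g - d1 g h\<bar> \<le> K1 * (stencil_norm R h)\<^sup>2"
      using Ck_stencil_taylor[OF R f der1 C1, of M] unfolding d1_def bx_def by blast
    define P2 where "P2 = (\<lambda>j K. \<forall>g\<in>stencil_space R. \<forall>h\<in>stencil_space R. bx M g \<longrightarrow> bx M (\<lambda>\<rho>. g \<rho> + h \<rho>) \<longrightarrow>
      \<bar>f' j (\<lambda>\<sigma>. g \<sigma> + h \<sigma>) - f' j g - (\<Sum>i\<in>?J. f'' j i g * h (fst i) $ snd i)\<bar> \<le> K * (stencil_norm R h)\<^sup>2)"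
    have "\<exists>K\<ge>0. \<forall>j\<in>?J. P2 j K"
    proof (rule uniform_bound_finite[OF finJ])
      fix j assume j: "j \<in> ?J"
      then have "Ck_stencil (Suc (Suc n)) R (f' j)" using C1[of "fst j" "snd j"] by (auto simp del: Ck_stencil.simps)
      from Ck_stencil_taylor[OF R this der2[OF j] C2[OF j], of M]
      show "\<exists>K\<ge>0. P2 j K" unfolding P2_def bx_def by blast
    next
      show "P2 j K'" if "P2 j K" "K \<le> K'" for j K K'
        using that unfolding P2_def by (meson mult_right_mono order_trans zero_le_power2)
    qed
    then obtain K2 where K2: "0 \<le> K2" "\<And>j g h. j \<in> ?J \<Longrightarrow> g\<in>stencil_space R \<Longrightarrow> h\<in>stencil_space R \<Longrightarrow> bx M g \<Longrightarrow> bx M (\<lambda>\<rho>. g \<rho> + h \<rho>) \<Longrightarrow>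
      \<bar>f' j (\<lambda>\<sigma>. g \<sigma> + h \<sigma>) - f' j g - (\<Sum>i\<in>?J. f'' j i g * h (fst i) $ snd i)\<bar> \<le> K2 * (stencil_norm R h)\<^sup>2"
      unfolding P2_def by blast
    define P3 where "P3 = (\<lambda>j K. \<forall>g\<in>stencil_space R. bx M g \<longrightarrow> \<bar>f' j g\<bar> \<le> K)"
    have "\<exists>K\<ge>0. \<forall>j\<in>?J. P3 j K"
    proof (rule uniform_bound_finite[OF finJ])
      fix j assume j: "j \<in> ?J"
      then have "Ck_stencil (Suc (Suc n)) R (f' j)" using C1[of "fst j" "snd j"] by (auto simp del: Ck_stencil.simps)
      then show "\<exists>K\<ge>0. P3 j K" unfolding P3_def bx_def by (intro stencil_bounded) simp
    qed (auto simp: P3_def intro: order_trans)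
    then obtain K3 where K3: "0 \<le> K3" "\<And>j g. j \<in> ?J \<Longrightarrow> g\<in>stencil_space R \<Longrightarrow> bx M g \<Longrightarrow> \<bar>f' j g\<bar> \<le> K3"
      unfolding P3_def by blast
    define P4 where "P4 = (\<lambda>ji K. \<forall>g\<in>stencil_space R. bx M g \<longrightarrow> \<bar>f'' (fst ji) (snd ji) g\<bar> \<le> K)"
    have C2': "Ck_stencil (Suc n) R (f'' (fst ji) (snd ji))" if "ji \<in> ?J \<times> ?J" for ji
      using C2[of "fst ji" "fst (snd ji)" "snd (snd ji)"] that by (auto simp del: Ck_stencil.simps)
    have "\<exists>K\<ge>0. \<forall>ji\<in>?J \<times> ?J. P4 ji K"
    proof (rule uniform_bound_finite)
      fix ji assume ji: "ji \<in> ?J \<times> ?J"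
      show "\<exists>K\<ge>0. P4 ji K" unfolding P4_def bx_def using C2'[OF ji] by (intro stencil_bounded) simp
    qed (use finJ in \<open>auto simp: P4_def intro: order_trans\<close>)
    then obtain K4 where K4: "0 \<le> K4" "\<And>j i g. j \<in> ?J \<Longrightarrow> i \<in> ?J \<Longrightarrow> g\<in>stencil_space R \<Longrightarrow> bx M g \<Longrightarrow> \<bar>f'' j i g\<bar> \<le> K4"
      unfolding P4_def by force
    define P5 where "P5 = (\<lambda>ji K. \<forall>g\<in>stencil_space R. \<forall>h\<in>stencil_space R. bx M g \<longrightarrow> bx M (\<lambda>\<rho>. g \<rho> + h \<rho>) \<longrightarrow>
      \<bar>f'' (fst ji) (snd ji) (\<lambda>\<sigma>. g \<sigma> + h \<sigma>) - f'' (fst ji) (snd ji) g\<bar> \<le> K * stencil_norm R h)"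
    have "\<exists>K\<ge>0. \<forall>ji\<in>?J \<times> ?J. P5 ji K"
    proof (rule uniform_bound_finite)
      fix ji assume ji: "ji \<in> ?J \<times> ?J"
      show "\<exists>K\<ge>0. P5 ji K" unfolding P5_def bx_def by (rule Ck_stencil_lipschitz[OF R C2'[OF ji]])
    next
      show "P5 j K'" if "P5 j K" "K \<le> K'" for j K K'
        using that unfolding P5_def by (meson mult_right_mono order_trans stencil_norm_nonneg)
    qed (use finJ in auto)
    then obtain K5 where K5: "0 \<le> K5" "\<And>j i g h. j \<in> ?J \<Longrightarrow> i \<in> ?J \<Longrightarrow> g\<in>stencil_space R \<Longrightarrow> h\<in>stencil_space R \<Longrightarrow> bx M g \<Longrightarrow> bx M (\<lambda>\<rho>. g \<rho> + h \<rho>) \<Longrightarrow>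
       \<bar>f'' j i (\<lambda>\<sigma>. g \<sigma> + h \<sigma>) - f'' j i g\<bar> \<le> K5 * stencil_norm R h"
      unfolding P5_def by force
    define K where "K = K1 + c * K2 + c * K3 + c * (c * K4) + c * (c * K5)"
    have KK: "0 \<le> K1" "0 \<le> c * K2" "0 \<le> c * K3" "0 \<le> c * (c * K4)" "0 \<le> c * (c * K5)"
      using c K1 K2 K3 K4 K5 by auto
    have le: "K1 \<le> K" "c * K2 \<le> K" "c * K3 \<le> K" "c * (c * K4) \<le> K" "c * (c * K5) \<le> K" "0 \<le> K"
      unfolding K_def using KK by linarith+
    have "C2_bound M K R f d1 d2"
      unfolding C2_bound_def
    proof (intro conjI ballI impI)
      fix g h assume g: "g \<in> stencil_space R" and h: "h \<in> stencil_space R"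
        and N: "stencil_norm R g \<le> M" "stencil_norm R (\<lambda>\<rho>. g \<rho> + h \<rho>) \<le> M"
      have gh: "(\<lambda>\<rho>. g \<rho> + h \<rho>) \<in> stencil_space R" using g h by (simp add: stencil_space_def)
      have b: "bx M g" "bx M (\<lambda>\<rho>. g \<rho> + h \<rho>)"
        unfolding bx_def using component_le_stencil_norm[OF R g] component_le_stencil_norm[OF R gh] N
        by (meson order_trans)+
      show "\<bar>f (\<lambda>\<rho>. g \<rho> + h \<rho>) - f g - d1 g h\<bar> \<le> K * (stencil_norm R h)\<^sup>2"
        by (rule order_trans[OF K1(2)[OF g h b]]) (intro mult_right_mono le, simp)
      fix k assume k: "k \<in> stencil_space R"
      have "d1 (\<lambda>\<rho>. g \<rho> + h \<rho>) k - d1 g k - d2 g k h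
         = (\<Sum>j\<in>?J. (f' j (\<lambda>\<sigma>. g \<sigma> + h \<sigma>) - f' j g - (\<Sum>i\<in>?J. f'' j i g * h (fst i) $ snd i)) * k (fst j) $ snd j)"
        by (simp add: d1_def d2_def left_diff_distrib sum_subtractf)
      then have "\<bar>d1 (\<lambda>\<rho>. g \<rho> + h \<rho>) k - d1 g k - d2 g k h\<bar> \<le> c * (K2 * (stencil_norm R h)\<^sup>2) * stencil_norm R k"
        using sum_components_le[OF R k, of "\<lambda>j. f' j (\<lambda>\<sigma>. g \<sigma> + h \<sigma>) - f' j g - (\<Sum>i\<in>?J. f'' j i g * h (fst i) $ snd i)"] K2(2)[OF _ g h b]
        by (simp add: c_def)
      also have "\<dots> = (c * K2) * (stencil_norm R h)\<^sup>2 * stencil_norm R k" by simp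
      also have "\<dots> \<le> K * (stencil_norm R h)\<^sup>2 * stencil_norm R k"
        by (intro mult_right_mono le) auto
      finally show "\<bar>d1 (\<lambda>\<rho>. g \<rho> + h \<rho>) k - d1 g k - d2 g k h\<bar> \<le> K * (stencil_norm R h)\<^sup>2 * stencil_norm R k" .
      have "\<bar>d1 g k\<bar> \<le> c * K3 * stencil_norm R k"
        unfolding d1_def c_def by (intro sum_components_le R k K3 g b)
      also have "\<dots> \<le> K * stencil_norm R k" by (intro mult_right_mono le) auto
      finally show "\<bar>d1 g k\<bar> \<le> K * stencil_norm R k" .
      fix l assume l: "l \<in> stencil_space R"
      have "\<bar>d2 g k l\<bar> \<le> c * (c * K4 * stencil_norm R l) * stencil_norm R k"
        unfolding d2_def c_def by (intro sum_components_le R k l K4 g b)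
      also have "\<dots> = c * (c * K4) * stencil_norm R k * stencil_norm R l" by simp
      also have "\<dots> \<le> K * stencil_norm R k * stencil_norm R l" by (intro mult_right_mono le) auto
      finally show "\<bar>d2 g k l\<bar> \<le> K * stencil_norm R k * stencil_norm R l" .
      have "d2 (\<lambda>\<rho>. g \<rho> + h \<rho>) k l - d2 g k l
         = (\<Sum>j\<in>?J. (\<Sum>i\<in>?J. (f'' j i (\<lambda>\<rho>. g \<rho> + h \<rho>) - f'' j i g) * l (fst i) $ snd i) * k (fst j) $ snd j)"
        by (simp add: d2_def left_diff_distrib sum_subtractf)
      also have "\<bar>\<dots>\<bar> \<le> c * (c * (K5 * stencil_norm R h) * stencil_norm R l) * stencil_norm R k"
        unfolding c_def by (intro sum_components_le R k l K5 g h b)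
      also have "\<dots> = c * (c * K5) * stencil_norm R h * stencil_norm R k * stencil_norm R l" by simp
      also have "\<dots> \<le> K * stencil_norm R h * stencil_norm R k * stencil_norm R l" by (intro mult_right_mono le) auto
      finally show "\<bar>d2 (\<lambda>\<rho>. g \<rho> + h \<rho>) k l - d2 g k l\<bar> \<le> K * stencil_norm R h * stencil_norm R k * stencil_norm R l" .
    qed
    then show ?thesis using le(6) by blast
  qed
  show ?thesis unfolding C2_forms_def using lin bnd by (intro exI[of _ d1] exI[of _ d2] conjI allI)
qed


section \<open>Piecewise affine interpolation\<close>

text \<open>Uniform discreteness and relative density are what is kept of the lattice; together with
  shape regularity they bound the cells from above and below.\<close>

locale mesh =
  fixes \<Lambda> :: "(real^'d) set" and \<T> :: "(real^'d) set set"
    and R :: "real^'d \<Rightarrow> (real^'d) set" and rcut :: real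
  assumes partition: "regular_partition \<T> \<Lambda>"
    and separated: "\<exists>\<delta>>0. \<forall>x\<in>\<Lambda>. \<forall>y\<in>\<Lambda>. x \<noteq> y \<longrightarrow> \<delta> \<le> dist x y"
    and covering: "\<exists>\<rho>>0. \<forall>x. \<exists>l\<in>\<Lambda>. dist x l < \<rho>"
    and rcut_pos: "0 < rcut"
    and R_sub: "\<And>l. l \<in> \<Lambda> \<Longrightarrow> R l \<subseteq> (ball 0 rcut \<inter> (\<lambda>m. m - l) ` \<Lambda>) - {0}"
    and R_edges: "\<And>l \<rho> T. l \<in> \<Lambda> \<Longrightarrow> T \<in> \<T> \<Longrightarrow> closed_segment l (l + \<rho>) edge_of T \<Longrightarrow> \<rho> \<in> R l"
begin

definition verts :: "(real^'d) set \<Rightarrow> (real^'d) set" where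
  "verts T = {v. v extreme_point_of T}"

lemma simplexT: "T \<in> \<T> \<Longrightarrow> int CARD('d) simplex T"
  and covers: "\<Union>\<T> = UNIV"
  and faces: "T \<in> \<T> \<Longrightarrow> T' \<in> \<T> \<Longrightarrow> T \<inter> T' face_of T \<and> T \<inter> T' face_of T'"
  and nodes: "{x. \<exists>T\<in>\<T>. x extreme_point_of T} = \<Lambda>"
  using partition unfolding regular_partition_def by blast+

lemma verts:
  assumes "T \<in> \<T>"
  shows "\<not> affine_dependent (verts T)" "finite (verts T)" "card (verts T) = CARD('d) + 1"
    "T = convex hull (verts T)" "verts T \<subseteq> \<Lambda>" "verts T \<subseteq> T"
proof -
  obtain C where C: "\<not> affine_dependent C" "int (card C) = int CARD('d) + 1" "T = convex hull C"
    using simplexT[OF assms] unfolding simplex_def by blast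
  have V: "verts T = C"
    using extreme_point_of_convex_hull_affine_independent[OF C(1)] by (auto simp: verts_def C(3))
  show "\<not> affine_dependent (verts T)" "card (verts T) = CARD('d) + 1" "T = convex hull (verts T)"
    using C V by auto
  show "finite (verts T)" unfolding V by (rule aff_independent_finite[OF C(1)])
  show "verts T \<subseteq> \<Lambda>" using nodes assms by (auto simp: verts_def)
  show "verts T \<subseteq> T" by (auto simp: verts_def extreme_point_of_def)
qed

lemma closedT: "T \<in> \<T> \<Longrightarrow> closed T" and convexT: "T \<in> \<T> \<Longrightarrow> convex T" and boundedT: "T \<in> \<T> \<Longrightarrow> bounded T"
proof -
  assume T: "T \<in> \<T>"
  have "compact (convex hull (verts T))" using verts(2)[OF T] by (rule finite_imp_compact_convex_hull)
  then have "compact T" using verts(4)[OF T] by simp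
  then show "closed T" "bounded T" by (auto simp: compact_imp_closed compact_imp_bounded)
  show "convex T" using verts(4)[OF T] by (metis convex_convex_hull)
qed

text \<open>No hanging nodes: \<open>l\<close> is a vertex of some \<open>T'\<close>, the
  intersection of \<open>T\<close> and \<open>T'\<close> is a face of both, and extreme points pass
  from a cell to a face and back.\<close>

lemma node_in_cell:
  assumes "l \<in> \<Lambda>" "T \<in> \<T>" "l \<in> T"
  shows "l \<in> verts T"
proof -
  obtain T' where T': "T' \<in> \<T>" "l extreme_point_of T'" using nodes assms by blast
  have "l \<in> T \<inter> T'" using T' assms by (auto simp: extreme_point_of_def)
  then have "l extreme_point_of (T \<inter> T')"
    using extreme_point_of_face[of "T \<inter> T'" T' l] faces[OF assms(2) T'(1)] T'(2) by blast
  then have "l extreme_point_of T"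
    using extreme_point_of_face[of "T \<inter> T'" T l] faces[OF assms(2) T'(1)] by blast
  then show ?thesis by (simp add: verts_def)
qed

text \<open>An inscribed ball has no node in its interior, so its radius is at most the covering
  radius; a cell has two vertices, so its diameter is at least the separation. Shape regularity
  converts the first bound into one for the diameter and the second into one for the inscribed
  radius.\<close>

lemma shape_regular:
  "\<exists>D>0. \<exists>s>0. \<forall>T\<in>\<T>. diameter T \<le> D \<and> (\<exists>y. cball y s \<subseteq> T)"
proof -
  obtain \<sigma> where \<sigma>: "\<sigma> > 0" "\<And>T. T \<in> \<T> \<Longrightarrow> \<exists>x r. r > 0 \<and> cball x r \<subseteq> T \<and> diameter T \<le> \<sigma> * r"
    using partition unfolding regular_partition_def by blast
  obtain \<delta> where \<delta>: "\<delta> > 0" "\<And>x y. x \<in> \<Lambda> \<Longrightarrow> y \<in> \<Lambda> \<Longrightarrow> x \<noteq> y \<Longrightarrow> \<delta> \<le> dist x y" using separated by blast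
  obtain \<rho> where \<rho>: "\<rho> > 0" "\<And>x. \<exists>l\<in>\<Lambda>. dist x l < \<rho>" using covering by blast
  have "diameter T \<le> \<sigma> * \<rho> \<and> (\<exists>y. cball y (\<delta> / \<sigma>) \<subseteq> T)" if T: "T \<in> \<T>" for T
  proof -
    obtain y r where y: "r > 0" "cball y r \<subseteq> T" "diameter T \<le> \<sigma> * r" using \<sigma>(2)[OF T] by blast
    have "r \<le> \<rho>"
    proof (rule ccontr)
      assume "\<not> r \<le> \<rho>"
      obtain l where l: "l \<in> \<Lambda>" "dist y l < \<rho>" using \<rho>(2) by blast
      then have "l \<in> ball y r" using \<open>\<not> r \<le> \<rho>\<close> by simp
      moreover have "ball y r \<subseteq> interior T"
        using y ball_subset_cball[of y r] by (intro interior_maximal) auto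
      ultimately have "l \<in> interior T" by blast
      moreover have "l extreme_point_of T"
        using node_in_cell[OF l(1) T] \<open>l \<in> interior T\<close> interior_subset[of T] by (auto simp: verts_def)
      ultimately show False using extreme_point_not_in_interior by blast
    qed
    then have "\<sigma> * r \<le> \<sigma> * \<rho>" using \<sigma>(1) by simp
    have "2 \<le> card (verts T)" using verts(3)[OF T] zero_less_card_finite[where 'a='d] by linarith
    then obtain a b where ab: "a \<in> verts T" "b \<in> verts T" "a \<noteq> b"
      using card_le_Suc0_iff_eq[OF verts(2)[OF T]] by fastforce
    have "\<delta> \<le> dist a b" using ab verts(5)[OF T] by (intro \<delta>(2)) auto
    also have "\<dots> \<le> diameter T"
      using ab verts(6)[OF T] by (intro diameter_bounded_bound boundedT[OF T]) auto
    finally have "\<delta> \<le> \<sigma> * r" using y(3) by linarith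
    then have "\<delta> / \<sigma> \<le> r" using \<sigma>(1) by (simp add: field_simps)
    then have "cball y (\<delta> / \<sigma>) \<subseteq> T" using y(2) subset_cball[of "\<delta> / \<sigma>" r y] by blast
    then show ?thesis using y(3) \<open>\<sigma> * r \<le> \<sigma> * \<rho>\<close> by auto
  qed
  moreover have "0 < \<sigma> * \<rho>" "0 < \<delta> / \<sigma>" using \<sigma> \<rho> \<delta> by auto
  ultimately show ?thesis by blast
qed

text \<open>Packing: balls of half the separation around the nodes are disjoint and lie in a
  slightly larger ball, so their volumes bound their number.\<close>

lemma node_count: "\<exists>N::nat. \<forall>x. finite (\<Lambda> \<inter> cball x r) \<and> card (\<Lambda> \<inter> cball x r) \<le> N"
proof -
  obtain \<delta> where \<delta>: "\<delta> > 0" "\<And>x y. x \<in> \<Lambda> \<Longrightarrow> y \<in> \<Lambda> \<Longrightarrow> x \<noteq> y \<Longrightarrow> \<delta> \<le> dist x y" using separated by blast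
  define v where "v = (\<lambda>r. measure lebesgue (ball (0::real^'d) r))"
  have v: "measure lebesgue (ball x r) = v r" if "r \<ge> 0" for x :: "real^'d" and r
    unfolding v_def using that by (simp add: content_ball)
  have vpos: "0 < v (\<delta> / 2)" using \<delta> by (simp add: v_def content_ball)
  define r' where "r' = \<bar>r\<bar> + \<delta>"
  define N where "N = nat \<lceil>v r' / v (\<delta> / 2)\<rceil>"
  have key: "card F \<le> N" if F: "finite F" "F \<subseteq> \<Lambda> \<inter> cball x r" for F x
  proof -
    have disj: "disjoint_family_on (\<lambda>l. ball l (\<delta> / 2)) F"
      unfolding disjoint_family_on_def
    proof (intro ballI impI)
      fix a b assume ab: "a \<in> F" "b \<in> F" "a \<noteq> b"
      then have "\<delta> \<le> dist a b" using F by (intro \<delta>(2)) auto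
      then show "ball a (\<delta> / 2) \<inter> ball b (\<delta> / 2) = {}" by (intro disjoint_ballI) auto
    qed
    have "real (card F) * v (\<delta> / 2) = (\<Sum>l\<in>F. measure lebesgue (ball l (\<delta> / 2)))"
    proof -
      have "(\<Sum>l\<in>F. measure lebesgue (ball l (\<delta> / 2))) = (\<Sum>l\<in>F. v (\<delta> / 2))"
        by (intro sum.cong refl v) (use \<delta> in simp)
      then show ?thesis by simp
    qed
    also have "\<dots> = measure lebesgue (\<Union>l\<in>F. ball l (\<delta> / 2))"
    proof (rule measure_finite_Union[symmetric, OF F(1) _ disj])
      show "emeasure lebesgue (ball l (\<delta> / 2)) \<noteq> \<infinity>" for l :: "real^'d"
        using emeasure_bounded_finite[OF bounded_ball, of l "\<delta> / 2"] by auto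
    qed auto
    also have "\<dots> \<le> measure lebesgue (ball x r')"
    proof (rule measure_mono_fmeasurable)
      show "(\<Union>l\<in>F. ball l (\<delta> / 2)) \<subseteq> ball x r'"
      proof safe
        fix l y assume l: "l \<in> F" and y: "y \<in> ball l (\<delta> / 2)"
        have "dist x l \<le> r" using F l by auto
        then show "y \<in> ball x r'" using y dist_triangle[of x y l] \<delta> by (auto simp: r'_def dist_commute)
      qed
      show "(\<Union>l\<in>F. ball l (\<delta> / 2)) \<in> sets lebesgue" by (intro sets.finite_UN F(1)) auto
    qed auto
    also have "\<dots> = v r'" using \<delta> by (intro v) (simp add: r'_def)
    finally have "real (card F) \<le> v r' / v (\<delta> / 2)" using vpos by (simp add: field_simps)
    then show ?thesis unfolding N_def by linarith
  qed
  have fin: "finite (\<Lambda> \<inter> cball x r)" for x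
    using finite_if_finite_subsets_card_bdd[of "\<Lambda> \<inter> cball x r" N] key[of _ x] by blast
  then show ?thesis using key by (intro exI[of _ N]) auto
qed

lemma finite_nodes: "finite (\<Lambda> \<inter> cball x r)"
  using node_count[of r] by blast

lemma finite_R: "l \<in> \<Lambda> \<Longrightarrow> finite (R l)"
proof -
  assume l: "l \<in> \<Lambda>"
  have "R l \<subseteq> (\<lambda>m. m - l) ` (\<Lambda> \<inter> cball l rcut)"
    using R_sub[OF l] by (auto simp: dist_norm norm_minus_commute)
  then show ?thesis using finite_nodes finite_subset by blast
qed

lemma R_node: "l \<in> \<Lambda> \<Longrightarrow> \<rho> \<in> R l \<Longrightarrow> l + \<rho> \<in> \<Lambda> \<and> norm \<rho> < rcut"
  using R_sub by fastforce

lemma card_R: "\<exists>N::nat. \<forall>l\<in>\<Lambda>. card (R l) \<le> N"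
proof -
  obtain N where N: "\<And>x. card (\<Lambda> \<inter> cball x rcut) \<le> N" using node_count[of rcut] by blast
  have "card (R l) \<le> N" if l: "l \<in> \<Lambda>" for l
  proof -
    have "R l \<subseteq> (\<lambda>m. m - l) ` (\<Lambda> \<inter> cball l rcut)"
      using R_sub[OF l] by (auto simp: dist_norm norm_minus_commute)
    then have "card (R l) \<le> card ((\<lambda>m. m - l) ` (\<Lambda> \<inter> cball l rcut))"
      by (intro card_mono finite_imageI finite_nodes)
    also have "\<dots> \<le> card (\<Lambda> \<inter> cball l rcut)" by (rule card_image_le[OF finite_nodes])
    finally show ?thesis using N[of l] by linarith
  qed
  then show ?thesis by blast
qed

text \<open>A cell is the hull of its vertices, which are nodes at bounded distance; finitely many
  nodes have finitely many subsets.\<close>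

lemma finite_cells: "finite {T \<in> \<T>. T \<inter> cball x r \<noteq> {}}"
proof -
  obtain D where D: "D > 0" "\<And>T. T \<in> \<T> \<Longrightarrow> diameter T \<le> D" using shape_regular by blast
  have "{T \<in> \<T>. T \<inter> cball x r \<noteq> {}} \<subseteq> (\<lambda>C. convex hull C) ` Pow (\<Lambda> \<inter> cball x (r + D))"
  proof
    fix T assume T: "T \<in> {T \<in> \<T>. T \<inter> cball x r \<noteq> {}}"
    then obtain y where y: "y \<in> T" "dist x y \<le> r" by auto
    have "verts T \<subseteq> \<Lambda> \<inter> cball x (r + D)"
    proof
      fix v assume v: "v \<in> verts T"
      have "dist y v \<le> D"
        using diameter_bounded_bound[OF boundedT, of T y v] y v verts(6)[of T] D(2)[of T] T by force
      then show "v \<in> \<Lambda> \<inter> cball x (r + D)"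
        using v y verts(5)[of T] T dist_triangle[of x v y] by auto
    qed
    then show "T \<in> (\<lambda>C. convex hull C) ` Pow (\<Lambda> \<inter> cball x (r + D))" using verts(4)[of T] T by blast
  qed
  then show ?thesis by (rule finite_subset) (intro finite_imageI, simp only: finite_Pow_iff finite_nodes)
qed

lemma countable_cells: "countable \<T>"
proof -
  have eq: "\<T> = (\<Union>n. {T \<in> \<T>. T \<inter> cball 0 (real n) \<noteq> {}})"
  proof safe
    fix T assume T: "T \<in> \<T>"
    then obtain y where "y \<in> T" using verts(3)[OF T] verts(6)[OF T] by (metis card.empty ex_in_conv add_is_0 subset_empty zero_neq_one)
    moreover obtain n where "norm y \<le> real n" using real_arch_simple by blast
    ultimately have "y \<in> T \<inter> cball 0 (real n)" by simp
    then show "T \<in> (\<Union>n. {T \<in> \<T>. T \<inter> cball 0 (real n) \<noteq> {}})" using T by blast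
  qed
  have "countable (\<Union>n. {T \<in> \<T>. T \<inter> cball 0 (real n) \<noteq> {}})"
    by (rule countable_UN[OF countableI_type countable_finite[OF finite_cells]])
  then show ?thesis by (rule ssubst[OF eq])
qed

lemma in_cell: "\<exists>T\<in>\<T>. x \<in> T"
  using covers by blast

lemma near_cells_cover: "cball x r \<subseteq> \<Union>{T \<in> \<T>. T \<inter> cball x r \<noteq> {}}"
  using in_cell by blast

lemma negligible_skeleton: "negligible (- (\<Union>T\<in>\<T>. interior T))"
proof -
  have "- (\<Union>T\<in>\<T>. interior T) \<subseteq> (\<Union>T\<in>\<T>. frontier T)"
  proof
    fix x assume x: "x \<in> - (\<Union>T\<in>\<T>. interior T)"
    obtain T where "T \<in> \<T>" "x \<in> T" using in_cell by blast
    then show "x \<in> (\<Union>T\<in>\<T>. frontier T)" using x closure_subset[of T] by (auto simp: frontier_def)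
  qed
  moreover have "negligible (\<Union>T\<in>\<T>. frontier T)"
    using countable_cells convexT by (intro negligible_countable_Union countable_image) (auto intro: negligible_convex_frontier)
  ultimately show ?thesis using negligible_subset by blast
qed

end

section \<open>The piecewise affine interpolant\<close>

lemma affine_interpolation:
  fixes C :: "(real^'d) set" and u :: "real^'d \<Rightarrow> real^'d"
  assumes "\<not> affine_dependent C"
  shows "\<exists>(M::real^'d^'d) b. \<forall>v\<in>C. M *v v + b = u v"
proof (cases "C = {}")
  case False
  then obtain a where a: "a \<in> C" by blast
  define B where "B = (\<lambda>x. - a + x) ` (C - {a})"
  have "\<not> affine_dependent (insert a (C - {a}))" using assms a by (simp add: insert_absorb)
  then have "independent B" using affine_dependent_iff_dependent[of a "C - {a}"] by (simp add: B_def)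
  then obtain f where f: "linear f" "\<forall>x\<in>B. f x = u (a + x) - u a"
    using linear_independent_extend[of B "\<lambda>x. u (a + x) - u a"] by blast
  have "matrix f *v v + (u a - f a) = u v" if v: "v \<in> C" for v
  proof (cases "v = a")
    case True
    then show ?thesis by (simp add: matrix_vector_mul f(1))
  next
    case False
    then have "- a + v \<in> B" using v by (auto simp: B_def)
    then have "f (- a + v) = u v - u a" using f(2) by auto
    moreover have "f (- a + v) = f v - f a" using f(1) linear_diff[of f v a] by simp
    ultimately have "f v - f a = u v - u a" by simp
    then show ?thesis by (simp add: f(1) algebra_simps)
  qed
  then show ?thesis by blast
qed simp

lemma affine_agree_hull:
  fixes M M' :: "real^'d^'d"
  assumes "\<And>v. v \<in> C \<Longrightarrow> M *v v + b = M' *v v + b'" "x \<in> convex hull C"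
  shows "M *v x + b = M' *v x + b'"
proof -
  define X where "X = {x. (M - M') *v x = b' - b}"
  have "convex X"
    unfolding X_def convex_def
    by (auto simp: matrix_vector_right_distrib matrix_vector_mult_scaleR simp flip: scaleR_add_left)
  moreover have "C \<subseteq> X" using assms(1) by (auto simp: X_def matrix_vector_mult_diff_rdistrib algebra_simps)
  ultimately have "x \<in> X" using assms(2) hull_minimal by blast
  then show ?thesis by (auto simp: X_def matrix_vector_mult_diff_rdistrib algebra_simps)
qed

context mesh begin

text \<open>The definite description defining \<open>interpolant\<close> says nothing before
  existence and uniqueness are known. The affine maps on two cells agree on the intersection,
  because this common face is spanned by shared vertices; continuity of the glued function follows
  from local finiteness of the closed cells.\<close>

lemma interpolant_properties:
  shows interpolant_continuous: "continuous_on UNIV (interpolant \<Lambda> \<T> u)"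
    and interpolant_affine: "T \<in> \<T> \<Longrightarrow> \<exists>(M::real^'d^'d) b. \<forall>x\<in>T. interpolant \<Lambda> \<T> u x = M *v x + b"
    and interpolant_node: "l \<in> \<Lambda> \<Longrightarrow> interpolant \<Lambda> \<T> u l = u l"
    and interpolant_unique: "continuous_on UNIV w \<Longrightarrow> (\<And>T. T \<in> \<T> \<Longrightarrow> \<exists>(M::real^'d^'d) b. \<forall>x\<in>T. w x = M *v x + b) \<Longrightarrow>
       (\<And>l. l \<in> \<Lambda> \<Longrightarrow> w l = u l) \<Longrightarrow> interpolant \<Lambda> \<T> u = w"
proof -
  define Pr where "Pr = (\<lambda>w. continuous_on UNIV w \<and> (\<forall>T\<in>\<T>. \<exists>(M::real^'d^'d) b. \<forall>x\<in>T. w x = M *v x + b) \<and> (\<forall>l\<in>\<Lambda>. w l = u l))"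
  have uniq: "w = w'" if Prw: "Pr w" "Pr w'" for w w'
  proof
    fix x
    obtain T where T: "T \<in> \<T>" "x \<in> T" using in_cell by blast
    obtain M b where M: "\<forall>x\<in>T. w x = M *v x + b" using Prw T unfolding Pr_def by blast
    obtain M' b' where M': "\<forall>x\<in>T. w' x = M' *v x + b'" using Prw T unfolding Pr_def by blast
    have "M *v v + b = M' *v v + b'" if v: "v \<in> verts T" for v
    proof -
      have "v \<in> T" "v \<in> \<Lambda>" using verts[OF T(1)] v by auto
      then show ?thesis using M M' Prw unfolding Pr_def by metis
    qed
    from affine_agree_hull[of "verts T", OF this, of x] show "w x = w' x"
      using M M' T verts(4)[OF T(1)] by auto
  qed
  have "\<forall>T. \<exists>M b. T \<in> \<T> \<longrightarrow> (\<forall>v\<in>verts T. (M::real^'d^'d) *v v + b = u v)"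
    using affine_interpolation verts(1) by blast
  then obtain M b where Mb: "\<And>T v. T \<in> \<T> \<Longrightarrow> v \<in> verts T \<Longrightarrow> (M T::real^'d^'d) *v v + b T = u v" by metis
  have agree: "M T *v x + b T = M T' *v x + b T'" if T: "T \<in> \<T>" "T' \<in> \<T>" "x \<in> T" "x \<in> T'" for T T' x
  proof -
    have "T \<inter> T' face_of convex hull (verts T)" using faces[OF T(1,2)] verts(4)[OF T(1)] by simp
    then obtain c where c: "c \<subseteq> verts T" "T \<inter> T' = convex hull c"
      using face_of_convex_hull_affine_independent[OF verts(1)[OF T(1)]] by blast
    show ?thesis
    proof (rule affine_agree_hull[of c])
      show "x \<in> convex hull c" using c T by blast
      fix v assume v: "v \<in> c"
      then have "v \<in> T'" using c hull_subset[of c convex] by blast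
      moreover have "v \<in> \<Lambda>" using v c verts(5)[OF T(1)] by blast
      ultimately have "v \<in> verts T'" using node_in_cell T(2) by blast
      then show "M T *v v + b T = M T' *v v + b T'" using Mb T v c by (metis subsetD)
    qed
  qed
  \<comment> \<open>By \<open>agree\<close> the value does not depend on the cell chosen.\<close>
  define w0 where "w0 = (\<lambda>x. let T = SOME T. T \<in> \<T> \<and> x \<in> T in M T *v x + b T)"
  have wT: "w0 x = M T *v x + b T" if "T \<in> \<T>" "x \<in> T" for T x
  proof -
    define T' where "T' = (SOME T. T \<in> \<T> \<and> x \<in> T)"
    have "T' \<in> \<T> \<and> x \<in> T'" unfolding T'_def by (rule someI[of _ T]) (use that in auto)
    then show ?thesis using agree[of T' T x] that by (simp add: w0_def T'_def Let_def)
  qed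
  have "Pr w0"
    unfolding Pr_def
  proof (intro conjI ballI)
    have "continuous (at x) w0" for x
    proof -
      let ?F = "{T \<in> \<T>. T \<inter> cball x 1 \<noteq> {}}"
      have "continuous_on (\<Union>T\<in>?F. T) w0"
      proof (rule continuous_on_closed_Union)
        fix T assume "T \<in> ?F"
        then have T: "T \<in> \<T>" by simp
        show "closed T" by (rule closedT[OF T])
        have "continuous_on T (\<lambda>x. M T *v x + b T)"
          by (intro continuous_intros matrix_vector_mult_linear_continuous_on)
        then show "continuous_on T w0" using wT[OF T] by (simp cong: continuous_on_cong)
      qed (rule finite_cells)
      then have "continuous_on (ball x 1) w0"
        by (rule continuous_on_subset) (use near_cells_cover[of x 1] ball_subset_cball[of x 1] in auto)
      then show ?thesis using continuous_on_eq_continuous_at[of "ball x 1" w0] by simp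
    qed
    then show "continuous_on UNIV w0" by (simp add: continuous_at_imp_continuous_on)
    show "\<exists>M b. \<forall>x\<in>T. w0 x = M *v x + b" if "T \<in> \<T>" for T using wT[OF that] by blast
    show "w0 l = u l" if "l \<in> \<Lambda>" for l
    proof -
      obtain T where T: "T \<in> \<T>" "l \<in> T" using in_cell by blast
      then have "l \<in> verts T" using node_in_cell that by blast
      then show ?thesis using wT[OF T] Mb[OF T(1)] by simp
    qed
  qed
  have I: "interpolant \<Lambda> \<T> u = (THE w. Pr w)" by (simp add: interpolant_def Pr_def)
  have "Pr (interpolant \<Lambda> \<T> u)" unfolding I by (rule theI[of Pr, OF \<open>Pr w0\<close>]) (use uniq \<open>Pr w0\<close> in blast)
  then show "continuous_on UNIV (interpolant \<Lambda> \<T> u)"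
    "T \<in> \<T> \<Longrightarrow> \<exists>(M::real^'d^'d) b. \<forall>x\<in>T. interpolant \<Lambda> \<T> u x = M *v x + b"
    "l \<in> \<Lambda> \<Longrightarrow> interpolant \<Lambda> \<T> u l = u l"
    unfolding Pr_def by blast+
  assume "continuous_on UNIV w" "\<And>T. T \<in> \<T> \<Longrightarrow> \<exists>(M::real^'d^'d) b. \<forall>x\<in>T. w x = M *v x + b" "\<And>l. l \<in> \<Lambda> \<Longrightarrow> w l = u l"
  then have "Pr w" unfolding Pr_def by blast
  then show "interpolant \<Lambda> \<T> u = w" using uniq \<open>Pr (interpolant \<Lambda> \<T> u)\<close> by blast
qed

end

section \<open>Equivalence of gradient and stencil norms\<close>

lemma norm_matrix_vector_le: "norm (A *v x) \<le> norm (A :: real^'n^'m) * norm (x :: real^'n)"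
proof -
  have "norm (A *v x) = L2_set (\<lambda>i. \<bar>A $ i \<bullet> x\<bar>) UNIV"
    by (simp add: norm_vec_def matrix_vector_mul_component)
  also have "\<dots> \<le> L2_set (\<lambda>i. norm (A $ i) * norm x) UNIV"
    by (intro L2_set_mono Cauchy_Schwarz_ineq2) auto
  also have "\<dots> = norm A * norm x"
    by (simp add: norm_vec_def[of A] L2_set_left_distrib)
  finally show ?thesis .
qed

lemma norm_matrix_le:
  fixes A :: "real^'n^'m"
  assumes "\<And>j. norm (A *v axis j 1) \<le> a"
  shows "norm A \<le> real (CARD('m) * CARD('n)) * a"
proof -
  have "\<bar>A $ i $ j\<bar> \<le> a" for i j
  proof -
    have "\<bar>A $ i $ j\<bar> = \<bar>(A *v axis j 1) $ i\<bar>" by (simp add: matrix_vector_mul_component inner_axis)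
    also have "\<dots> \<le> norm (A *v axis j 1)" by (rule component_le_norm_cart)
    finally show ?thesis using assms[of j] by linarith
  qed
  then have "norm (A $ i) \<le> real CARD('n) * a" for i
    using norm_le_l1_cart[of "A $ i"] sum_bounded_above[of UNIV "\<lambda>j. \<bar>A $ i $ j\<bar>" a] by fastforce
  then have "(\<Sum>i\<in>UNIV. norm (A $ i)) \<le> (\<Sum>i\<in>(UNIV :: 'm set). real CARD('n) * a)" by (intro sum_mono)
  moreover have "norm A \<le> (\<Sum>i\<in>UNIV. norm (A $ i))"
    unfolding norm_vec_def by (rule L2_set_le_sum) auto
  ultimately show ?thesis by simp
qed

context mesh begin

abbreviation "I \<equiv> interpolant \<Lambda> \<T>"
abbreviation "G \<equiv> grad \<Lambda> \<T>"

definition Dn :: "(real^'d \<Rightarrow> real^'d) \<Rightarrow> real^'d \<Rightarrow> real" where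
  "Dn u l = stencil_norm (R l) (fd u l)"

lemma Dn_nonneg [simp]: "0 \<le> Dn u l"
  by (simp add: Dn_def)

lemma grad_eqI:
  assumes "(I u has_derivative (\<lambda>h. M *v h)) (at x)"
  shows "G u x = M"
proof -
  have "I u differentiable (at x)" using assms differentiable_def by blast
  moreover have "jacobian (I u) (at x) = M"
    unfolding jacobian_def frechet_derivative_at[OF assms, symmetric] by (rule matrix_of_matrix_vector_mul)
  ultimately show ?thesis by (simp add: grad_def)
qed

lemma has_derivative_interior:
  fixes M :: "real^'d^'d"
  assumes "\<forall>y\<in>T. I u y = M *v y + b" "x \<in> interior T"
  shows "(I u has_derivative (\<lambda>h. M *v h)) (at x)"
proof (rule has_derivative_transform_within_open[OF _ open_interior assms(2)])
  show "((\<lambda>y. M *v y + b) has_derivative (\<lambda>h. M *v h)) (at x)"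
    by (auto intro!: derivative_eq_intros bounded_linear_imp_has_derivative matrix_vector_mul_bounded_linear)
  show "M *v y + b = I u y" if "y \<in> interior T" for y
  proof -
    have "y \<in> T" using that interior_subset by blast
    then show ?thesis using assms(1) by simp
  qed
qed

lemma interior_nonempty: "T \<in> \<T> \<Longrightarrow> interior T \<noteq> {}"
proof -
  assume T: "T \<in> \<T>"
  obtain s y where s: "0 < s" "cball y s \<subseteq> T" using shape_regular T by blast
  then have "ball y s \<subseteq> interior T" using ball_subset_cball[of y s] by (intro interior_maximal) auto
  then show ?thesis using s by auto
qed

text \<open>The gradient is constant in the interior of a cell, so any interior point represents
  it.\<close>

definition cell_grad :: "(real^'d \<Rightarrow> real^'d) \<Rightarrow> (real^'d) set \<Rightarrow> real^'d^'d" where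
  "cell_grad u T = G u (SOME x. x \<in> interior T)"

lemma cell_grad:
  assumes "T \<in> \<T>"
  shows "\<exists>b. \<forall>y\<in>T. I u y = cell_grad u T *v y + b"
    and "x \<in> interior T \<Longrightarrow> G u x = cell_grad u T"
    and "x \<in> interior T \<Longrightarrow> (I u has_derivative (\<lambda>h. cell_grad u T *v h)) (at x)"
proof -
  obtain M :: "real^'d^'d" and b where M: "\<forall>y\<in>T. I u y = M *v y + b"
    using interpolant_affine[OF assms] by blast
  have *: "G u x = M" if "x \<in> interior T" for x
    by (rule grad_eqI[OF has_derivative_interior[OF M that]])
  have "(SOME x. x \<in> interior T) \<in> interior T"
    using interior_nonempty[OF assms] by (simp add: some_in_eq)
  then have cg: "cell_grad u T = M" unfolding cell_grad_def by (rule *)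
  show "\<exists>b. \<forall>y\<in>T. I u y = cell_grad u T *v y + b" using M cg by blast
  show "x \<in> interior T \<Longrightarrow> G u x = cell_grad u T" using * cg by simp
  show "x \<in> interior T \<Longrightarrow> (I u has_derivative (\<lambda>h. cell_grad u T *v h)) (at x)"
    using has_derivative_interior[OF M] cg by simp
qed

lemma interpolant_lin: "I (\<lambda>l. a *\<^sub>R u l + v l) = (\<lambda>y. a *\<^sub>R I u y + I v y)"
proof (rule interpolant_unique)
  show "continuous_on UNIV (\<lambda>y. a *\<^sub>R I u y + I v y)"
    by (intro continuous_intros interpolant_continuous)
  fix T assume T: "T \<in> \<T>"
  obtain b where b: "\<forall>y\<in>T. I u y = cell_grad u T *v y + b" using cell_grad(1)[OF T] by blast
  obtain b' where b': "\<forall>y\<in>T. I v y = cell_grad v T *v y + b'" using cell_grad(1)[OF T] by blast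
  have "\<forall>x\<in>T. a *\<^sub>R I u x + I v x = (a *\<^sub>R cell_grad u T + cell_grad v T) *v x + (a *\<^sub>R b + b')"
    using b b' by (simp add: matrix_vector_mult_add_rdistrib scaleR_matrix_vector_assoc[symmetric] algebra_simps)
  then show "\<exists>(M::real^'d^'d) b. \<forall>x\<in>T. a *\<^sub>R I u x + I v x = M *v x + b" by blast
next
  show "l \<in> \<Lambda> \<Longrightarrow> a *\<^sub>R I u l + I v l = a *\<^sub>R u l + v l" for l by (simp add: interpolant_node)
qed

lemma grad_lin:
  assumes "T \<in> \<T>" "x \<in> interior T"
  shows "G (\<lambda>l. a *\<^sub>R u l + v l) x = a *\<^sub>R G u x + G v x"
proof (rule grad_eqI)
  have "((\<lambda>y. a *\<^sub>R I u y + I v y) has_derivative (\<lambda>h. a *\<^sub>R (cell_grad u T *v h) + cell_grad v T *v h)) (at x)"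
    by (intro derivative_intros cell_grad(3) assms)
  moreover have "(\<lambda>h. a *\<^sub>R (cell_grad u T *v h) + cell_grad v T *v h) = (\<lambda>h. (a *\<^sub>R G u x + G v x) *v h)"
    using cell_grad(2)[OF assms]
    by (simp add: matrix_vector_mult_add_rdistrib scaleR_matrix_vector_assoc[symmetric])
  ultimately show "(I (\<lambda>l. a *\<^sub>R u l + v l) has_derivative (\<lambda>h. (a *\<^sub>R G u x + G v x) *v h)) (at x)"
    unfolding interpolant_lin by simp
qed

lemma AE_interior: "AE x in lebesgue. \<exists>T\<in>\<T>. x \<in> interior T"
proof (rule AE_I')
  show "- (\<Union>T\<in>\<T>. interior T) \<in> null_sets lebesgue"
    using negligible_skeleton negligible_iff_null_sets by blast
qed auto

lemma grad_measurable [measurable]: "G u \<in> borel_measurable lebesgue"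
proof (rule borel_measurableI)
  fix S :: "(real^'d^'d) set" assume "open S"
  define N where "N = - (\<Union>T\<in>\<T>. interior T)"
  have N: "negligible N" using negligible_skeleton by (simp add: N_def)
  have eq: "G u -` S \<inter> space lebesgue = (\<Union>T\<in>{T \<in> \<T>. cell_grad u T \<in> S}. interior T) \<union> (G u -` S \<inter> N)"
    using cell_grad(2) by (auto simp: N_def)
  have "(\<Union>T\<in>{T \<in> \<T>. cell_grad u T \<in> S}. interior T) \<in> sets lebesgue"
    by (rule sets_completionI_sets) (auto intro!: borel_open)
  moreover have "G u -` S \<inter> N \<in> sets lebesgue"
    using negligible_subset[OF N, of "G u -` S \<inter> N"] negligible_imp_sets by blast
  ultimately show "G u -` S \<inter> space lebesgue \<in> sets lebesgue" unfolding eq by (rule sets.Un)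
qed

text \<open>Two vertices of a simplex always span an edge, so the stencil at one vertex reaches all
  the others in a single step.\<close>

lemma cell_edge:
  assumes T: "T \<in> \<T>" and v: "v0 \<in> verts T" "v \<in> verts T" "v \<noteq> v0"
  shows "v - v0 \<in> R v0"
proof (rule R_edges[OF _ T])
  show "v0 \<in> \<Lambda>" using v verts(5)[OF T] by blast
  have "closed_segment v0 v = convex hull {v0, v}" by (rule segment_convex_hull)
  moreover have "convex hull {v0, v} face_of convex hull (verts T)"
    unfolding face_of_convex_hull_affine_independent[OF verts(1)[OF T]]
    using v by (intro exI[of _ "{v0, v}"]) simp
  ultimately have "closed_segment v0 v face_of T" using verts(4)[OF T, symmetric] by simp
  moreover have "aff_dim (closed_segment v0 v) = 1"
    using v(3) by (simp add: segment_convex_hull aff_dim_convex_hull aff_dim_2)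
  ultimately show "closed_segment v0 (v0 + (v - v0)) edge_of T" by (simp add: edge_of_def)
qed

text \<open>All vertex values lie in the ball of radius \<open>Dn u v0\<close> about
  \<open>u v0\<close>, and by convexity so does the image of the cell. As the cell contains a ball
  of radius \<open>s\<close>, a step of length \<open>s\<close> along an axis changes the
  interpolant by at most the diameter of that image ball, which bounds each column of the
  gradient.\<close>

lemma cell_grad_le:
  "\<exists>K>0. \<forall>u. \<forall>T\<in>\<T>. \<forall>v0\<in>verts T. norm (cell_grad u T) \<le> K * Dn u v0"
proof -
  obtain s where s: "0 < s" "\<And>T. T \<in> \<T> \<Longrightarrow> \<exists>y. cball y s \<subseteq> T" using shape_regular by blast
  define K where "K = real (CARD('d) * CARD('d)) * (2 / s)"
  have "norm (cell_grad u T) \<le> K * Dn u v0" if T: "T \<in> \<T>" and v0: "v0 \<in> verts T" for u T v0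
  proof -
    obtain y where y: "cball y s \<subseteq> T" using s T by blast
    obtain b where b: "\<forall>x\<in>T. I u x = cell_grad u T *v x + b" using cell_grad(1)[OF T] by blast
    have v0L: "v0 \<in> \<Lambda>" using v0 verts(5)[OF T] by blast
    have nodes_le: "I u v \<in> cball (u v0) (Dn u v0)" if v: "v \<in> verts T" for v
    proof (cases "v = v0")
      case True
      then show ?thesis using v0L by (simp add: interpolant_node)
    next
      case False
      have "norm (fd u v0 (v - v0)) \<le> Dn u v0"
        unfolding Dn_def by (rule norm_le_stencil_norm[OF finite_R[OF v0L] cell_edge[OF T v0 v False]])
      moreover have "v \<in> \<Lambda>" using v verts(5)[OF T] by blast
      ultimately show ?thesis by (simp add: fd_def interpolant_node dist_norm norm_minus_commute)
    qed
    define X where "X = {x. cell_grad u T *v x + b \<in> cball (u v0) (Dn u v0)}"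
    have "convex X"
    proof -
      have "X = (\<lambda>x. cell_grad u T *v x) -` ((\<lambda>z. - b + z) ` cball (u v0) (Dn u v0))"
      proof (intro set_eqI iffI)
        fix x assume "x \<in> X"
        then have "cell_grad u T *v x = - b + (cell_grad u T *v x + b)" "cell_grad u T *v x + b \<in> cball (u v0) (Dn u v0)"
          by (auto simp: X_def)
        then show "x \<in> (\<lambda>x. cell_grad u T *v x) -` ((\<lambda>z. - b + z) ` cball (u v0) (Dn u v0))"
          by (metis imageI vimageI2)
      qed (auto simp: X_def)
      then show ?thesis by (simp add: convex_linear_vimage convex_translation del: translation_Compl)
    qed
    moreover have "verts T \<subseteq> X"
    proof
      fix v assume v: "v \<in> verts T"
      then have "v \<in> T" using verts(6)[OF T] by blast
      then show "v \<in> X" using nodes_le[OF v] b by (simp add: X_def)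
    qed
    ultimately have "T \<subseteq> X" using hull_minimal[of "verts T" X convex] verts(4)[OF T, symmetric] by auto
    then have in_ball: "I u x \<in> cball (u v0) (Dn u v0)" if "x \<in> T" for x using that b by (auto simp: X_def)
    have "norm (cell_grad u T *v axis j 1) \<le> 2 / s * Dn u v0" for j
    proof -
      have yT: "y \<in> T" "y + s *\<^sub>R axis j 1 \<in> T" using y s(1) by (auto simp: dist_norm subset_iff)
      have "s *\<^sub>R (cell_grad u T *v axis j 1) = I u (y + s *\<^sub>R axis j 1) - I u y"
        using b yT by (simp add: matrix_vector_right_distrib matrix_vector_mult_scaleR)
      then have "s * norm (cell_grad u T *v axis j 1) = dist (I u (y + s *\<^sub>R axis j 1)) (I u y)"
        using s(1) by (metis abs_of_pos dist_norm norm_scaleR)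
      also have "\<dots> \<le> 2 * Dn u v0"
        using in_ball[OF yT(1)] in_ball[OF yT(2)] dist_triangle2[of "I u (y + s *\<^sub>R axis j 1)" "I u y" "u v0"]
        by (simp add: dist_commute)
      finally show ?thesis using s(1) by (simp add: field_simps)
    qed
    from norm_matrix_le[OF this] show ?thesis by (simp add: K_def)
  qed
  moreover have "0 < K" using s(1) by (simp add: K_def)
  ultimately show ?thesis by blast
qed

text \<open>A segment may run inside faces, where the interpolant has no gradient, so the Lipschitz
  bounds on the finitely many closed cells are glued along the segment instead of integrating a
  gradient.\<close>

lemma interpolant_lipschitz_segment:
  assumes m: "0 \<le> m" and bd: "\<And>T. T \<in> \<T> \<Longrightarrow> T \<inter> closed_segment x y \<noteq> {} \<Longrightarrow> norm (cell_grad u T) \<le> m"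
  shows "norm (I u y - I u x) \<le> m * norm (y - x)"
proof -
  define p where "p = (\<lambda>t. x + t *\<^sub>R (y - x))"
  have pc: "continuous_on UNIV p" unfolding p_def by (intro continuous_intros)
  have pseg: "p t \<in> closed_segment x y" if "t \<in> {0..1}" for t
    unfolding p_def closed_segment_def using that by (auto intro!: exI[of _ t] simp: algebra_simps)
  let ?F = "{T \<in> \<T>. T \<inter> cball x (dist x y) \<noteq> {}}"
  have "(m * norm (y - x))-lipschitz_on {0..1} (\<lambda>t. I u (p t))"
  proof (rule lipschitz_on_closed_Union[of ?F _ "\<lambda>T. {0..1} \<inter> p -` T"])
    fix T assume T: "T \<in> ?F"
    show "closed ({0..1} \<inter> p -` T)"
      using T pc closedT by (intro closed_Int closed_vimage) auto
    obtain b where b: "\<forall>z\<in>T. I u z = cell_grad u T *v z + b" using cell_grad(1) T by blast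
    show "(m * norm (y - x))-lipschitz_on ({0..1} \<inter> p -` T) (\<lambda>t. I u (p t))"
    proof (rule lipschitz_onI)
      fix t s assume ts: "t \<in> {0..1} \<inter> p -` T" "s \<in> {0..1} \<inter> p -` T"
      have "T \<inter> closed_segment x y \<noteq> {}" using ts pseg[of t] by auto
      then have n: "norm (cell_grad u T) \<le> m" using bd T by blast
      have "I u (p t) - I u (p s) = cell_grad u T *v (p t - p s)"
        using b ts by (simp add: matrix_vector_mult_diff_distrib)
      then have "dist (I u (p t)) (I u (p s)) \<le> norm (cell_grad u T) * norm (p t - p s)"
        by (simp add: dist_norm norm_matrix_vector_le)
      also have "\<dots> \<le> m * norm (p t - p s)" using n by (rule mult_right_mono) simp
      also have "p t - p s = (t - s) *\<^sub>R (y - x)" by (simp add: p_def algebra_simps)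
      finally show "dist (I u (p t)) (I u (p s)) \<le> m * norm (y - x) * dist t s"
        by (simp add: dist_real_def mult.commute mult.left_commute)
    qed (use m in simp)
  next
    show "finite ?F" by (rule finite_cells)
    show "{0..1} \<subseteq> (\<Union>T\<in>?F. {0..1} \<inter> p -` T)"
    proof
      fix t :: real assume t: "t \<in> {0..1}"
      obtain T where T: "T \<in> \<T>" "p t \<in> T" using in_cell by blast
      have "dist x (p t) \<le> dist x y" using t by (simp add: p_def dist_norm mult_left_le_one_le norm_minus_commute)
      then have "p t \<in> T \<inter> cball x (dist x y)" using T by simp
      then have "T \<in> ?F" using T by blast
      then show "t \<in> (\<Union>T\<in>?F. {0..1} \<inter> p -` T)" using T t by blast
    qed
  qed (use m in auto)
  then have "dist (I u (p 1)) (I u (p 0)) \<le> m * norm (y - x) * dist 1 (0::real)"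
    by (rule lipschitz_onD) auto
  then show ?thesis by (simp add: p_def dist_norm)
qed

text \<open>All stencil segments at \<open>l\<close> lie in \<open>cball l rcut\<close>. Only
  finitely many cells meet this ball, and the one with the largest gradient dominates every
  difference at once.\<close>

lemma Dn_le_cells:
  "\<exists>K>0. \<forall>u. \<forall>l\<in>\<Lambda>. \<exists>T\<in>\<T>. T \<inter> cball l rcut \<noteq> {} \<and> (Dn u l)\<^sup>2 \<le> K * (norm (cell_grad u T))\<^sup>2"
proof -
  obtain N where N: "\<And>l. l \<in> \<Lambda> \<Longrightarrow> card (R l) \<le> N" using card_R by blast
  define K where "K = (real N + 1) * rcut\<^sup>2"
  have "\<exists>T\<in>\<T>. T \<inter> cball l rcut \<noteq> {} \<and> (Dn u l)\<^sup>2 \<le> K * (norm (cell_grad u T))\<^sup>2" if l: "l \<in> \<Lambda>" for u l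
  proof -
    let ?F = "{T \<in> \<T>. T \<inter> cball l rcut \<noteq> {}}"
    have F: "finite ?F" by (rule finite_cells)
    have "l \<in> cball l rcut" using rcut_pos by simp
    then have "?F \<noteq> {}" using in_cell[of l] by blast
    then have "(\<lambda>T. norm (cell_grad u T)) ` ?F \<noteq> {}" by blast
    then have "Max ((\<lambda>T. norm (cell_grad u T)) ` ?F) \<in> (\<lambda>T. norm (cell_grad u T)) ` ?F"
      using F by (intro Max_in finite_imageI)
    then obtain T where T1: "T \<in> ?F" "norm (cell_grad u T) = Max ((\<lambda>T. norm (cell_grad u T)) ` ?F)" by force
    have T2: "norm (cell_grad u T') \<le> norm (cell_grad u T)" if "T' \<in> ?F" for T'
      unfolding T1(2) using that by (intro Max_ge finite_imageI F imageI)
    note T = T1(1) T2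
    have "norm (fd u l \<rho>) \<le> norm (cell_grad u T) * rcut" if \<rho>: "\<rho> \<in> R l" for \<rho>
    proof -
      have lr: "l + \<rho> \<in> \<Lambda>" "norm \<rho> < rcut" using R_node[OF l \<rho>] by auto
      have "closed_segment l (l + \<rho>) \<subseteq> cball l rcut"
        using lr rcut_pos by (intro closed_segment_subset) (auto simp: dist_norm)
      then have "norm (I u (l + \<rho>) - I u l) \<le> norm (cell_grad u T) * norm (l + \<rho> - l)"
        by (intro interpolant_lipschitz_segment T(2)) auto
      also have "\<dots> \<le> norm (cell_grad u T) * rcut" using lr by (intro mult_left_mono) auto
      finally show ?thesis using l lr by (simp add: interpolant_node fd_def)
    qed
    then have "(Dn u l)\<^sup>2 \<le> (\<Sum>\<rho>\<in>R l. (norm (cell_grad u T) * rcut)\<^sup>2)"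
      unfolding Dn_def stencil_norm_sq by (intro sum_mono power_mono) auto
    also have "\<dots> = real (card (R l)) * (rcut\<^sup>2 * (norm (cell_grad u T))\<^sup>2)" by (simp add: power_mult_distrib)
    also have "\<dots> \<le> (real N + 1) * (rcut\<^sup>2 * (norm (cell_grad u T))\<^sup>2)"
      using N[OF l] by (intro mult_right_mono) auto
    finally have "(Dn u l)\<^sup>2 \<le> K * (norm (cell_grad u T))\<^sup>2" by (simp add: K_def mult.assoc)
    then show ?thesis using T(1) by blast
  qed
  moreover have "0 < K" using rcut_pos by (simp add: K_def add_nonneg_pos)
  ultimately show ?thesis by blast
qed

text \<open>Each node is charged to the integral over a ball of radius \<open>rcut + D\<close>
  around it, which contains the ball inscribed in the cell given by \<open>Dn_le_cells\<close>. The
  overlap of these balls is bounded by \<open>node_count\<close>.\<close>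

lemma Dn_le_grad:
  "\<exists>K>0. \<forall>u\<in>W_12 \<Lambda> \<T>. (\<lambda>l. (Dn u l)\<^sup>2) summable_on \<Lambda> \<and> (\<Sum>\<^sub>\<infinity>l\<in>\<Lambda>. (Dn u l)\<^sup>2) \<le> K * (L2_norm (G u))\<^sup>2"
proof -
  obtain K0 where K0: "0 < K0" "\<And>u l. l \<in> \<Lambda> \<Longrightarrow> \<exists>T\<in>\<T>. T \<inter> cball l rcut \<noteq> {} \<and> (Dn u l)\<^sup>2 \<le> K0 * (norm (cell_grad u T))\<^sup>2"
    using Dn_le_cells by blast
  obtain D s where Ds: "0 < D" "0 < s" "\<And>T. T \<in> \<T> \<Longrightarrow> diameter T \<le> D" "\<And>T. T \<in> \<T> \<Longrightarrow> \<exists>y. cball y s \<subseteq> T"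
    using shape_regular by blast
  define r where "r = rcut + D"
  obtain N where N: "\<And>x. finite (\<Lambda> \<inter> cball x r)" "\<And>x. card (\<Lambda> \<inter> cball x r) \<le> N" using node_count[of r] by blast
  define \<mu> where "\<mu> = measure lebesgue (ball (0::real^'d) s)"
  have \<mu>: "0 < \<mu>" "\<And>y::real^'d. measure lebesgue (ball y s) = \<mu>" using Ds(2) by (auto simp: \<mu>_def content_ball)
  define K where "K = K0 / \<mu> * (real N + 1)"
  have K: "0 < K" using K0 \<mu> by (simp add: K_def add_nonneg_pos)
  have main: "(\<Sum>l\<in>F. (Dn u l)\<^sup>2) \<le> K * (L2_norm (G u))\<^sup>2" if u: "u \<in> W_12 \<Lambda> \<T>" and F: "finite F" "F \<subseteq> \<Lambda>" for u F
  proof -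
    define g where "g = (\<lambda>x. (norm (G u x))\<^sup>2)"
    have g: "integrable lebesgue g" using u by (simp add: W_12_def in_L2_def g_def)
    have L2: "(L2_norm (G u))\<^sup>2 = (LINT x|lebesgue. g x)" by (simp add: L2_norm_def g_def)
    have gi: "integrable lebesgue (\<lambda>x. indicator (cball l r) x * g x)" for l
      using integrable_mult_indicator[OF _ g, of "cball l r"] by simp
    have loc: "(Dn u l)\<^sup>2 \<le> K0 / \<mu> * (LINT x|lebesgue. indicator (cball l r) x * g x)" if l: "l \<in> F" for l
    proof -
      obtain T where T: "T \<in> \<T>" "T \<inter> cball l rcut \<noteq> {}" "(Dn u l)\<^sup>2 \<le> K0 * (norm (cell_grad u T))\<^sup>2"
        using K0(2)[of l u] l F by blast
      obtain y where y: "cball y s \<subseteq> T" using Ds(4)[OF T(1)] by blast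
      have by_T: "ball y s \<subseteq> interior T" using y ball_subset_cball[of y s] by (intro interior_maximal) auto
      obtain z where z: "z \<in> T" "dist l z \<le> rcut" using T(2) by auto
      have T_sub: "T \<subseteq> cball l r"
      proof
        fix x assume "x \<in> T"
        then have "dist z x \<le> D" using diameter_bounded_bound[OF boundedT[OF T(1)] z(1)] Ds(3)[OF T(1)] by force
        then show "x \<in> cball l r" using z dist_triangle[of l x z] by (simp add: r_def)
      qed
      have "\<mu> * (norm (cell_grad u T))\<^sup>2 = (LINT x|lebesgue. indicator (ball y s) x * (norm (cell_grad u T))\<^sup>2)"
        using \<mu>(2)[of y] by simp
      also have "\<dots> = (LINT x|lebesgue. indicator (ball y s) x * g x)"
        by (intro Bochner_Integration.integral_cong refl)
           (use by_T cell_grad(2)[OF T(1)] in \<open>auto simp: g_def indicator_def\<close>)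
      also have "\<dots> \<le> (LINT x|lebesgue. indicator (cball l r) x * g x)"
      proof (rule integral_mono[OF _ gi])
        show "integrable lebesgue (\<lambda>x. indicator (ball y s) x * g x)"
          using integrable_mult_indicator[OF _ g, of "ball y s"] by simp
        have "ball y s \<subseteq> cball l r" using by_T T_sub interior_subset[of T] by blast
        then show "indicator (ball y s) x * g x \<le> indicator (cball l r) x * g x" for x
          unfolding g_def by (intro mult_right_mono) (auto split: split_indicator)
      qed
      finally have "(norm (cell_grad u T))\<^sup>2 \<le> (LINT x|lebesgue. indicator (cball l r) x * g x) / \<mu>"
        using \<mu>(1) by (simp add: field_simps)
      then have "K0 * (norm (cell_grad u T))\<^sup>2 \<le> K0 * ((LINT x|lebesgue. indicator (cball l r) x * g x) / \<mu>)"
        using K0(1) by (intro mult_left_mono) auto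
      then show ?thesis using T(3) by simp
    qed
    have "(\<Sum>l\<in>F. (Dn u l)\<^sup>2) \<le> (\<Sum>l\<in>F. K0 / \<mu> * (LINT x|lebesgue. indicator (cball l r) x * g x))"
      by (intro sum_mono loc)
    also have "\<dots> = K0 / \<mu> * (LINT x|lebesgue. (\<Sum>l\<in>F. indicator (cball l r) x * g x))"
      unfolding sum_distrib_left[symmetric] using gi by (subst Bochner_Integration.integral_sum) auto
    also have "\<dots> \<le> K0 / \<mu> * (LINT x|lebesgue. (real N + 1) * g x)"
    proof (rule mult_left_mono)
    show "(LINT x|lebesgue. (\<Sum>l\<in>F. indicator (cball l r) x * g x)) \<le> (LINT x|lebesgue. (real N + 1) * g x)"
    proof (rule integral_mono)
      show "integrable lebesgue (\<lambda>x. \<Sum>l\<in>F. indicator (cball l r) x * g x)" using gi by simp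
      show "integrable lebesgue (\<lambda>x. (real N + 1) * g x)" using g by simp
      fix x
      have "(\<Sum>l\<in>F. indicator (cball l r) x :: real) = (\<Sum>l\<in>F. if l \<in> cball x r then 1 else 0)"
        by (intro sum.cong refl) (auto simp: indicator_def dist_commute)
      also have "\<dots> = real (card (F \<inter> cball x r))"
        using F(1) by (simp add: sum.If_cases Int_def)
      also have "\<dots> \<le> real (card (\<Lambda> \<inter> cball x r))"
        using F N(1) by (intro of_nat_mono card_mono) auto
      also have "\<dots> \<le> real N + 1" using N(2)[of x] by simp
      finally have "(\<Sum>l\<in>F. indicator (cball l r) x :: real) * g x \<le> (real N + 1) * g x"
        by (rule mult_right_mono) (simp add: g_def)
      then show "(\<Sum>l\<in>F. indicator (cball l r) x * g x) \<le> (real N + 1) * g x" by (simp add: sum_distrib_right)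
    qed
    qed (use K0 \<mu> in auto)
    also have "\<dots> = K * (L2_norm (G u))\<^sup>2" by (simp add: L2 K_def)
    finally show ?thesis .
  qed
  have "(\<lambda>l. (Dn u l)\<^sup>2) summable_on \<Lambda> \<and> (\<Sum>\<^sub>\<infinity>l\<in>\<Lambda>. (Dn u l)\<^sup>2) \<le> K * (L2_norm (G u))\<^sup>2" if "u \<in> W_12 \<Lambda> \<T>" for u
    using summable_on_nonneg_boundedI[of \<Lambda> "\<lambda>l. (Dn u l)\<^sup>2", OF _ main[OF that]] by auto
  then show ?thesis using K by blast
qed

text \<open>Integrability of the gradient is part of the claim, so the estimate is made with
  integrals of non-negative extended functions: almost everywhere the squared gradient is below a
  sum over nodes of weighted indicators of balls, and sum and integral may be exchanged.\<close>

lemma grad_le_Dn: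
  "\<exists>K>0. \<forall>u. (\<lambda>l. (Dn u l)\<^sup>2) summable_on \<Lambda> \<longrightarrow> u \<in> W_12 \<Lambda> \<T> \<and> (L2_norm (G u))\<^sup>2 \<le> K * (\<Sum>\<^sub>\<infinity>l\<in>\<Lambda>. (Dn u l)\<^sup>2)"
proof -
  obtain K0 where K0: "0 < K0" "\<And>u T v0. T \<in> \<T> \<Longrightarrow> v0 \<in> verts T \<Longrightarrow> norm (cell_grad u T) \<le> K0 * Dn u v0"
    using cell_grad_le by blast
  obtain D where D: "0 < D" "\<And>T. T \<in> \<T> \<Longrightarrow> diameter T \<le> D" using shape_regular by blast
  define \<mu> where "\<mu> = measure lebesgue (cball (0::real^'d) D)"
  have \<mu>: "0 < \<mu>" "\<And>v::real^'d. emeasure lebesgue (cball v D) = ennreal \<mu>"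
    using D(1) by (auto simp: \<mu>_def content_cball emeasure_cball)
  define K where "K = K0\<^sup>2 * \<mu>"
  have "u \<in> W_12 \<Lambda> \<T> \<and> (L2_norm (G u))\<^sup>2 \<le> K * (\<Sum>\<^sub>\<infinity>l\<in>\<Lambda>. (Dn u l)\<^sup>2)" if u: "(\<lambda>l. (Dn u l)\<^sup>2) summable_on \<Lambda>" for u
  proof -
    define g where "g = (\<lambda>x. (norm (G u x))\<^sup>2)"
    have gm [measurable]: "g \<in> borel_measurable lebesgue" unfolding g_def by measurable
    have cov: "\<Lambda> = (\<Union>n. \<Lambda> \<inter> cball 0 (real n))" using real_arch_simple by auto
    have "countable (\<Union>n. \<Lambda> \<inter> cball 0 (real n))"
      by (rule countable_UN[OF countableI_type countable_finite[OF finite_nodes]])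
    then have cL: "countable \<Lambda>" by (rule ssubst[OF cov])
    define h where "h = (\<lambda>v x. ennreal (K0\<^sup>2 * (Dn u v)\<^sup>2) * indicator (cball v D) x)"
    have "cball v D \<in> sets lebesgue" for v :: "real^'d" by simp
    then have hm: "h v \<in> borel_measurable lebesgue" for v
      unfolding h_def by (intro borel_measurable_times_ennreal borel_measurable_const borel_measurable_indicator)
    have pt: "AE x in lebesgue. ennreal (g x) \<le> (\<integral>\<^sup>+v. h v x \<partial>count_space \<Lambda>)"
      using AE_interior
    proof (rule AE_mp, intro AE_I2 impI)
      fix x assume "\<exists>T\<in>\<T>. x \<in> interior T"
      then obtain T where T: "T \<in> \<T>" "x \<in> interior T" by blast
      have "verts T \<noteq> {}" using verts(3)[OF T(1)] by auto
      then obtain v where v: "v \<in> verts T" by blast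
      have vL: "v \<in> \<Lambda>" "v \<in> T" using v verts[OF T(1)] by auto
      have "dist v x \<le> D"
        using diameter_bounded_bound[OF boundedT[OF T(1)] vL(2), of x] T(2) interior_subset[of T] D(2)[OF T(1)] by force
      moreover have "g x \<le> K0\<^sup>2 * (Dn u v)\<^sup>2"
        unfolding g_def cell_grad(2)[OF T] using power_mono[OF K0(2)[OF T(1) v, of u], of 2] by (simp add: power_mult_distrib)
      ultimately have "ennreal (g x) \<le> h v x" by (simp add: h_def ennreal_leI)
      also have "\<dots> \<le> (\<integral>\<^sup>+v. h v x \<partial>count_space \<Lambda>)" by (rule nn_integral_ge_point[OF vL(1)])
      finally show "ennreal (g x) \<le> (\<integral>\<^sup>+v. h v x \<partial>count_space \<Lambda>)" .
    qed
    have "(\<integral>\<^sup>+x. ennreal (g x) \<partial>lebesgue) \<le> (\<integral>\<^sup>+x. \<integral>\<^sup>+v. h v x \<partial>count_space \<Lambda> \<partial>lebesgue)"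
      by (rule nn_integral_mono_AE[OF pt])
    also have "\<dots> = (\<integral>\<^sup>+v. \<integral>\<^sup>+x. h v x \<partial>lebesgue \<partial>count_space \<Lambda>)"
      by (rule nn_integral_count_space_nn_integral[OF cL hm])
    also have "\<dots> = (\<integral>\<^sup>+v. ennreal (K * (Dn u v)\<^sup>2) \<partial>count_space \<Lambda>)"
    proof (rule nn_integral_cong)
      fix v
      have "(\<integral>\<^sup>+x. h v x \<partial>lebesgue) = ennreal (K0\<^sup>2 * (Dn u v)\<^sup>2) * ennreal \<mu>"
        unfolding h_def using \<mu>(2)[of v] by (simp add: nn_integral_cmult_indicator)
      then show "(\<integral>\<^sup>+x. h v x \<partial>lebesgue) = ennreal (K * (Dn u v)\<^sup>2)"
        using \<mu>(1) by (simp add: ennreal_mult[symmetric] K_def mult_ac)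
    qed
    also have "\<dots> = ennreal (\<Sum>\<^sub>\<infinity>v\<in>\<Lambda>. K * (Dn u v)\<^sup>2)"
    proof -
      have K0': "0 \<le> K" using \<mu> by (simp add: K_def)
      have "(\<lambda>v. K * (Dn u v)\<^sup>2) summable_on \<Lambda>" by (rule summable_on_cmult_right[OF u])
      then have "Infinite_Sum.abs_summable_on (\<lambda>v. K * (Dn u v)\<^sup>2) \<Lambda>" using K0' by simp
      then have s: "Infinite_Set_Sum.abs_summable_on (\<lambda>v. K * (Dn u v)\<^sup>2) \<Lambda>" using abs_summable_equivalent by blast
      show ?thesis using nn_integral_conv_infsetsum[OF s] infsetsum_infsum[OF s] K0' by simp
    qed
    also have "(\<Sum>\<^sub>\<infinity>v\<in>\<Lambda>. K * (Dn u v)\<^sup>2) = K * (\<Sum>\<^sub>\<infinity>l\<in>\<Lambda>. (Dn u l)\<^sup>2)" by (rule infsum_cmult_right')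
    finally have le: "(\<integral>\<^sup>+x. ennreal (g x) \<partial>lebesgue) \<le> ennreal (K * (\<Sum>\<^sub>\<infinity>l\<in>\<Lambda>. (Dn u l)\<^sup>2))" .
    have gint: "integrable lebesgue g"
    proof (rule integrableI_bounded)
      have "(\<integral>\<^sup>+x. ennreal (norm (g x)) \<partial>lebesgue) = (\<integral>\<^sup>+x. ennreal (g x) \<partial>lebesgue)" by (simp add: g_def)
      also have "\<dots> < \<infinity>" using le by (simp add: le_less_trans)
      finally show "(\<integral>\<^sup>+x. ennreal (norm (g x)) \<partial>lebesgue) < \<infinity>" .
    qed (rule gm)
    have "ennreal (LINT x|lebesgue. g x) \<le> ennreal (K * (\<Sum>\<^sub>\<infinity>l\<in>\<Lambda>. (Dn u l)\<^sup>2))"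
      using le nn_integral_eq_integral[OF gint] by (simp add: g_def)
    moreover have "0 \<le> K * (\<Sum>\<^sub>\<infinity>l\<in>\<Lambda>. (Dn u l)\<^sup>2)" using \<mu> by (simp add: K_def infsum_nonneg)
    ultimately have "(LINT x|lebesgue. g x) \<le> K * (\<Sum>\<^sub>\<infinity>l\<in>\<Lambda>. (Dn u l)\<^sup>2)" by (simp add: ennreal_le_iff)
    moreover have "(L2_norm (G u))\<^sup>2 = (LINT x|lebesgue. g x)" by (simp add: L2_norm_def g_def)
    moreover have "u \<in> W_12 \<Lambda> \<T>" using gint by (simp add: W_12_def in_L2_def g_def[symmetric])
    ultimately show ?thesis by simp
  qed
  moreover have "0 < K" using K0 \<mu> by (simp add: K_def)
  ultimately show ?thesis by blast
qed

text \<open>\<open>grad\<close> is additive only inside cells, because it is set to 0 where the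
  interpolant is not differentiable; the norm does not see the remaining null set.\<close>

lemma L2_norm_grad_diff: "L2_norm (\<lambda>x. G v x - G u x) = L2_norm (G (\<lambda>l. v l - u l))"
proof -
  have "(LINT x|lebesgue. (norm (G v x - G u x))\<^sup>2) = (LINT x|lebesgue. (norm (G (\<lambda>l. v l - u l) x))\<^sup>2)"
  proof (rule integral_cong_AE)
    show "AE x in lebesgue. (norm (G v x - G u x))\<^sup>2 = (norm (G (\<lambda>l. v l - u l) x))\<^sup>2"
      using AE_interior
    proof (rule AE_mp, intro AE_I2 impI)
      fix x assume "\<exists>T\<in>\<T>. x \<in> interior T"
      then obtain T where T: "T \<in> \<T>" "x \<in> interior T" by blast
      show "(norm (G v x - G u x))\<^sup>2 = (norm (G (\<lambda>l. v l - u l) x))\<^sup>2"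
        using grad_lin[OF T, of "-1" u v] by simp
    qed
  qed measurable
  then show ?thesis by (simp add: L2_norm_def)
qed

lemma finite_support_W_c:
  assumes fin: "finite {l \<in> \<Lambda>. u l \<noteq> 0}"
  shows "u \<in> W_c \<Lambda> \<T>"
proof -
  obtain D where D: "0 < D" "\<And>T. T \<in> \<T> \<Longrightarrow> diameter T \<le> D" using shape_regular by blast
  obtain r where r: "\<And>l. l \<in> \<Lambda> \<Longrightarrow> u l \<noteq> 0 \<Longrightarrow> norm l \<le> r"
    using finite_imp_bounded[OF fin] by (auto simp: bounded_iff)
  have "G u x = 0" if x: "norm x > r + D + 1" for x
  proof (rule grad_eqI)
    have zero: "I u y = 0" if y: "y \<in> ball x 1" for y
    proof -
      obtain T where T: "T \<in> \<T>" "y \<in> T" using in_cell by blast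
      obtain b where b: "\<forall>z\<in>T. I u z = cell_grad u T *v z + b" using cell_grad(1)[OF T(1)] by blast
      have "cell_grad u T *v v + b = 0 *v v + 0" if v: "v \<in> verts T" for v
      proof -
        have vT: "v \<in> T" "v \<in> \<Lambda>" using v verts[OF T(1)] by auto
        have "dist y v \<le> D" using diameter_bounded_bound[OF boundedT[OF T(1)] T(2) vT(1)] D(2)[OF T(1)] by linarith
        moreover have "norm x \<le> norm v + dist v y + dist y x"
          using norm_triangle_sub[of x v] dist_triangle[of v x y] by (simp add: dist_norm norm_minus_commute)
        ultimately have "norm v > r" using x y by (simp add: dist_commute)
        then have "u v = 0" using r[OF vT(2)] by force
        then show ?thesis using b vT interpolant_node[OF vT(2), of u] by simp
      qed
      from affine_agree_hull[of "verts T", OF this, of y] have "cell_grad u T *v y + b = 0"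
        using T verts(4)[OF T(1), symmetric] by simp
      then show ?thesis using b T by simp
    qed
    show "(I u has_derivative (\<lambda>h. 0 *v h)) (at x)"
      by (rule has_derivative_transform_within_open[of "\<lambda>_. 0" _ x UNIV "ball x 1"]) (use zero in auto)
  qed
  then have "{x. G u x \<noteq> 0} \<subseteq> cball 0 (r + D + 1)" by force
  then have "bounded {x. G u x \<noteq> 0}" using bounded_cball bounded_subset by blast
  then show ?thesis by (simp add: W_c_def compact_closure)
qed

text \<open>Bounds values by strains once one value is fixed; this yields compactness of norm balls
  among displacements supported in a finite set.\<close>

lemma node_lipschitz:
  "\<exists>K\<ge>0. \<forall>u. (\<lambda>l. (Dn u l)\<^sup>2) summable_on \<Lambda> \<longrightarrow>
     (\<forall>x\<in>\<Lambda>. \<forall>y\<in>\<Lambda>. norm (u y - u x) \<le> K * sqrt (\<Sum>\<^sub>\<infinity>l\<in>\<Lambda>. (Dn u l)\<^sup>2) * norm (y - x))"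
proof -
  obtain K0 where K0: "0 < K0" "\<And>u T v0. T \<in> \<T> \<Longrightarrow> v0 \<in> verts T \<Longrightarrow> norm (cell_grad u T) \<le> K0 * Dn u v0"
    using cell_grad_le by blast
  have "norm (u y - u x) \<le> K0 * sqrt (\<Sum>\<^sub>\<infinity>l\<in>\<Lambda>. (Dn u l)\<^sup>2) * norm (y - x)"
    if u: "(\<lambda>l. (Dn u l)\<^sup>2) summable_on \<Lambda>" and xy: "x \<in> \<Lambda>" "y \<in> \<Lambda>" for u x y
  proof -
    have "norm (I u y - I u x) \<le> K0 * sqrt (\<Sum>\<^sub>\<infinity>l\<in>\<Lambda>. (Dn u l)\<^sup>2) * norm (y - x)"
    proof (rule interpolant_lipschitz_segment)
      fix T assume T: "T \<in> \<T>"
      have "verts T \<noteq> {}" using verts(3)[OF T] by auto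
      then obtain v where v: "v \<in> verts T" by blast
      then have vL: "v \<in> \<Lambda>" using verts(5)[OF T] by blast
      have "(Dn u v)\<^sup>2 \<le> (\<Sum>\<^sub>\<infinity>l\<in>\<Lambda>. (Dn u l)\<^sup>2)"
        using finite_sum_le_infsum[OF u, of "{v}"] vL by simp
      then have "Dn u v \<le> sqrt (\<Sum>\<^sub>\<infinity>l\<in>\<Lambda>. (Dn u l)\<^sup>2)" by (rule real_le_rsqrt)
      then have "K0 * Dn u v \<le> K0 * sqrt (\<Sum>\<^sub>\<infinity>l\<in>\<Lambda>. (Dn u l)\<^sup>2)" using K0(1) by simp
      then show "norm (cell_grad u T) \<le> K0 * sqrt (\<Sum>\<^sub>\<infinity>l\<in>\<Lambda>. (Dn u l)\<^sup>2)" using K0(2)[OF T v, of u] by linarith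
    qed (use K0(1) in \<open>simp add: infsum_nonneg\<close>)
    then show ?thesis using xy by (simp add: interpolant_node)
  qed
  then show ?thesis using K0(1) less_imp_le by blast
qed

end


section \<open>The energy near a strongly stable solution\<close>

lemma L2_triangle_infsum:
  fixes f g h :: "'b \<Rightarrow> real"
  assumes f: "(\<lambda>x. (f x)\<^sup>2) summable_on A" and g: "(\<lambda>x. (g x)\<^sup>2) summable_on A"
    and h: "\<And>x. x \<in> A \<Longrightarrow> \<bar>h x\<bar> \<le> \<bar>f x\<bar> + \<bar>g x\<bar>"
  shows "sqrt (infsum (\<lambda>x. (h x)\<^sup>2) A) \<le> sqrt (infsum (\<lambda>x. (f x)\<^sup>2) A) + sqrt (infsum (\<lambda>x. (g x)\<^sup>2) A)"
proof -
  define a where "a = sqrt (infsum (\<lambda>x. (f x)\<^sup>2) A)"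
  define c where "c = sqrt (infsum (\<lambda>x. (g x)\<^sup>2) A)"
  have ac: "0 \<le> a" "0 \<le> c" "a\<^sup>2 = infsum (\<lambda>x. (f x)\<^sup>2) A" "c\<^sup>2 = infsum (\<lambda>x. (g x)\<^sup>2) A"
    by (auto simp: a_def c_def infsum_nonneg)
  note CS = Cauchy_Schwarz_infsum[OF f g]
  have s: "(\<lambda>x. (f x)\<^sup>2 + 2 * \<bar>f x * g x\<bar> + (g x)\<^sup>2) summable_on A"
    by (rule summable_on_add[OF summable_on_add[OF f summable_on_cmult_right[OF CS(1)]] g])
  have "infsum (\<lambda>x. (h x)\<^sup>2) A \<le> infsum (\<lambda>x. (f x)\<^sup>2 + 2 * \<bar>f x * g x\<bar> + (g x)\<^sup>2) A"
  proof (rule infsum_mono[OF sq_summable_add(1)[OF f g h] s])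
    fix x assume "x \<in> A"
    have "(h x)\<^sup>2 \<le> (\<bar>f x\<bar> + \<bar>g x\<bar>)\<^sup>2" using power_mono[OF h[OF \<open>x \<in> A\<close>], of 2] by simp
    then show "(h x)\<^sup>2 \<le> (f x)\<^sup>2 + 2 * \<bar>f x * g x\<bar> + (g x)\<^sup>2" by (simp add: power2_sum abs_mult)
  qed
  also have "\<dots> = infsum (\<lambda>x. (f x)\<^sup>2) A + 2 * infsum (\<lambda>x. \<bar>f x * g x\<bar>) A + infsum (\<lambda>x. (g x)\<^sup>2) A"
    by (simp add: infsum_add[OF summable_on_add[OF f summable_on_cmult_right[OF CS(1)]] g]
        infsum_add[OF f summable_on_cmult_right[OF CS(1)]] infsum_cmult_right')
  also have "\<dots> \<le> a\<^sup>2 + 2 * (a * c) + c\<^sup>2" using CS(2) ac by (simp add: a_def c_def)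
  also have "\<dots> = (a + c)\<^sup>2" by (simp add: power2_sum)
  finally have "sqrt (infsum (\<lambda>x. (h x)\<^sup>2) A) \<le> sqrt ((a + c)\<^sup>2)" by (rule real_sqrt_le_mono)
  then show ?thesis using ac by (simp add: a_def[symmetric] c_def[symmetric])
qed

lemma DERIV_quadratic_remainder:
  fixes \<phi> :: "real \<Rightarrow> real"
  assumes "\<And>t. \<bar>t\<bar> \<le> 1 \<Longrightarrow> \<bar>\<phi> t - \<phi> 0 - t * a\<bar> \<le> C * t\<^sup>2"
  shows "(\<phi> has_real_derivative a) (at 0)"
  unfolding DERIV_def
proof (rule LIM_I)
  fix r :: real assume r: "0 < r"
  define s where "s = min 1 (r / (\<bar>C\<bar> + 1))"
  have s: "0 < s" using r by (simp add: s_def)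
  have "norm ((\<phi> (0 + h) - \<phi> 0) / h - a) < r" if h: "h \<noteq> 0" "norm (h - 0) < s" for h
  proof -
    have h1: "\<bar>h\<bar> \<le> 1" "\<bar>h\<bar> < r / (\<bar>C\<bar> + 1)" using h(2) by (auto simp: s_def)
    have "\<bar>(\<phi> h - \<phi> 0) / h - a\<bar> = \<bar>\<phi> h - \<phi> 0 - h * a\<bar> / \<bar>h\<bar>"
      using h(1) by (simp add: field_simps flip: abs_divide)
    also have "\<dots> \<le> (C * h\<^sup>2) / \<bar>h\<bar>" by (intro divide_right_mono assms h1) auto
    also have "\<dots> = C * \<bar>h\<bar>" using h(1) by (simp add: power2_eq_square field_simps abs_if)
    also have "\<dots> \<le> (\<bar>C\<bar> + 1) * \<bar>h\<bar>" by (intro mult_right_mono) auto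
    also have "\<dots> < r" using h1(2) by (simp add: field_simps)
    finally show ?thesis by simp
  qed
  then show "\<exists>s>0. \<forall>h. h \<noteq> 0 \<and> norm (h - 0) < s \<longrightarrow> norm ((\<phi> (0 + h) - \<phi> 0) / h - a) < r"
    using s by blast
qed

text \<open>\<open>E\<close> enters only through its values on \<open>W_c\<close> and its
  continuity. The forms \<open>d1\<close> and \<open>d2\<close> have bounds that are uniform over
  the sites; all formulas for derivatives of \<open>E\<close> are reduced to them.\<close>

locale energy_model = mesh \<Lambda> \<T> R rcut
  for \<Lambda> :: "(real^'d) set" and \<T> :: "(real^'d) set set"
    and R :: "real^'d \<Rightarrow> (real^'d) set" and rcut :: real +
  fixes V :: "real^'d \<Rightarrow> (real^'d \<Rightarrow> real^'d) \<Rightarrow> real"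
    and d1 :: "real^'d \<Rightarrow> (real^'d \<Rightarrow> real^'d) \<Rightarrow> (real^'d \<Rightarrow> real^'d) \<Rightarrow> real"
    and d2 :: "real^'d \<Rightarrow> (real^'d \<Rightarrow> real^'d) \<Rightarrow> (real^'d \<Rightarrow> real^'d) \<Rightarrow> (real^'d \<Rightarrow> real^'d) \<Rightarrow> real"
    and E :: "(real^'d \<Rightarrow> real^'d) \<Rightarrow> real"
  assumes d1_lin: "\<And>l g x h h'. l \<in> \<Lambda> \<Longrightarrow> d1 l g (\<lambda>\<rho>. x *\<^sub>R h \<rho> + h' \<rho>) = x * d1 l g h + d1 l g h'"
    and d2_lin2: "\<And>l g x h h' k. l \<in> \<Lambda> \<Longrightarrow> d2 l g k (\<lambda>\<rho>. x *\<^sub>R h \<rho> + h' \<rho>) = x * d2 l g k h + d2 l g k h'"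
    and C2_uniform: "\<And>M. \<exists>K\<ge>0. \<forall>l\<in>\<Lambda>. C2_bound M K (R l) (V l) (d1 l) (d2 l)"
    and V_cont: "\<And>l. l \<in> \<Lambda> \<Longrightarrow> continuous_on (stencil_space (R l)) (V l)"
    and V_0: "\<And>l. l \<in> \<Lambda> \<Longrightarrow> V l (\<lambda>_. 0) = 0"
    and E_ext: "continuous_extension \<Lambda> \<T> (energy_c \<Lambda> R V) E"
begin

abbreviation st :: "(real^'d \<Rightarrow> real^'d) \<Rightarrow> real^'d \<Rightarrow> real^'d \<Rightarrow> real^'d" where
  "st v l \<equiv> fd_stencil (R l) v l"

definition sq :: "(real^'d \<Rightarrow> real^'d) \<Rightarrow> bool" where
  "sq v \<longleftrightarrow> (\<lambda>l. (Dn v l)\<^sup>2) summable_on \<Lambda>"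

definition nD :: "(real^'d \<Rightarrow> real^'d) \<Rightarrow> real" where
  "nD v = sqrt (\<Sum>\<^sub>\<infinity>l\<in>\<Lambda>. (Dn v l)\<^sup>2)"

definition fs :: "(real^'d \<Rightarrow> real^'d) \<Rightarrow> bool" where
  "fs v \<longleftrightarrow> finite {l \<in> \<Lambda>. v l \<noteq> 0}"

text \<open>The sites whose energy a perturbation by \<open>v\<close> can change.\<close>

definition act :: "(real^'d \<Rightarrow> real^'d) \<Rightarrow> (real^'d) set" where
  "act v = {l \<in> \<Lambda>. st v l \<noteq> (\<lambda>_. 0)}"

lemma nD_nonneg [simp]: "0 \<le> nD v"
  by (simp add: nD_def infsum_nonneg)

lemma nD_sq: "(nD v)\<^sup>2 = (\<Sum>\<^sub>\<infinity>l\<in>\<Lambda>. (Dn v l)\<^sup>2)"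
  by (simp add: nD_def infsum_nonneg)

lemma st_space [simp]: "st v l \<in> stencil_space (R l)"
  by (simp add: stencil_space_def fd_stencil_def)

lemma st_norm: "stencil_norm (R l) (st v l) = Dn v l"
  unfolding Dn_def by (rule stencil_norm_cong) (simp add: fd_stencil_def fd_def)

lemma st_lin: "st (\<lambda>l. a *\<^sub>R v l + w l) l = (\<lambda>\<rho>. a *\<^sub>R st v l \<rho> + st w l \<rho>)"
  by (rule ext) (simp add: fd_stencil_def algebra_simps)

lemma st_add: "st (\<lambda>l. v l + w l) l = (\<lambda>\<rho>. st v l \<rho> + st w l \<rho>)"
  using st_lin[where a=1 and v=v and w=w and l=l] by simp

lemma st_add_scaleR: "st (\<lambda>l. v l + a *\<^sub>R w l) l = (\<lambda>\<rho>. st v l \<rho> + a *\<^sub>R st w l \<rho>)"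
  by (rule ext) (simp add: fd_stencil_def algebra_simps)

lemma Dn_lin_le: "Dn (\<lambda>l. a *\<^sub>R v l + w l) l \<le> \<bar>a\<bar> * Dn v l + Dn w l"
  using stencil_norm_triangle[of "R l" "\<lambda>\<rho>. a *\<^sub>R st v l \<rho>" "st w l"]
  by (simp add: st_lin stencil_norm_scaleR flip: st_norm)

lemma Dn_scaleR: "Dn (\<lambda>l. a *\<^sub>R v l) l = \<bar>a\<bar> * Dn v l"
  unfolding Dn_def fd_scaleR by (rule stencil_norm_scaleR)

lemma sq_nD_scaleR: "sq v \<Longrightarrow> sq (\<lambda>l. a *\<^sub>R v l)" "nD (\<lambda>l. a *\<^sub>R v l) = \<bar>a\<bar> * nD v"
proof -
  show "sq v \<Longrightarrow> sq (\<lambda>l. a *\<^sub>R v l)"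
    unfolding sq_def Dn_scaleR power_mult_distrib by (rule summable_on_cmult_right)
  show "nD (\<lambda>l. a *\<^sub>R v l) = \<bar>a\<bar> * nD v"
    by (simp add: nD_def Dn_scaleR power_mult_distrib infsum_cmult_right' real_sqrt_mult)
qed

lemma Dn_add_le: "Dn (\<lambda>l. v l + w l) l \<le> Dn v l + Dn w l"
  using Dn_lin_le[where a=1 and v=v and w=w and l=l] by simp

lemma sq_nD_add:
  assumes "sq v" "sq w"
  shows "sq (\<lambda>l. v l + w l)" "nD (\<lambda>l. v l + w l) \<le> nD v + nD w"
proof -
  have "\<bar>Dn (\<lambda>l. v l + w l) l\<bar> \<le> \<bar>Dn v l\<bar> + \<bar>Dn w l\<bar>" for l using Dn_add_le[of v w l] by simp
  note le = this
  show "sq (\<lambda>l. v l + w l)"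
    unfolding sq_def by (rule sq_summable_add(1)[OF assms[unfolded sq_def] le])
  show "nD (\<lambda>l. v l + w l) \<le> nD v + nD w"
    unfolding nD_def by (rule L2_triangle_infsum[OF assms[unfolded sq_def] le])
qed

lemma sq_nD_diff:
  assumes "sq v" "sq w"
  shows "sq (\<lambda>l. v l - w l)" "nD (\<lambda>l. v l - w l) \<le> nD v + nD w"
  using sq_nD_add[OF assms(1) sq_nD_scaleR(1)[OF assms(2), where a="-1"]] sq_nD_scaleR(2)[where a="-1" and v=w] by auto

lemma Dn_le_nD: "sq v \<Longrightarrow> l \<in> \<Lambda> \<Longrightarrow> Dn v l \<le> nD v"
proof -
  assume "sq v" "l \<in> \<Lambda>"
  then have "(Dn v l)\<^sup>2 \<le> (nD v)\<^sup>2"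
    using finite_sum_le_infsum[of "\<lambda>l. (Dn v l)\<^sup>2" \<Lambda> "{l}"] by (simp add: sq_def nD_sq)
  then show ?thesis by (rule power2_le_imp_le) simp
qed

lemma act_Dn: "l \<in> \<Lambda> \<Longrightarrow> l \<notin> act v \<Longrightarrow> st v l = (\<lambda>_. 0) \<and> Dn v l = 0"
  using st_norm[of l v] by (simp add: act_def)

lemma fs_act: "fs v \<Longrightarrow> finite (act v)" and act_sub: "act v \<subseteq> \<Lambda>"
proof -
  show "act v \<subseteq> \<Lambda>" by (auto simp: act_def)
  assume v: "fs v"
  have "act v \<subseteq> (\<Union>p\<in>{l \<in> \<Lambda>. v l \<noteq> 0}. \<Lambda> \<inter> cball p rcut)"
  proof
    fix l assume "l \<in> act v"
    then have l: "l \<in> \<Lambda>" "st v l \<noteq> (\<lambda>_. 0)" by (auto simp: act_def)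
    then obtain \<rho> where \<rho>: "\<rho> \<in> R l" "v (l + \<rho>) \<noteq> v l" by (auto simp: fd_stencil_def fun_eq_iff split: if_splits)
    have lr: "l + \<rho> \<in> \<Lambda>" "norm \<rho> < rcut" using R_node[OF l(1) \<rho>(1)] by auto
    show "l \<in> (\<Union>p\<in>{l \<in> \<Lambda>. v l \<noteq> 0}. \<Lambda> \<inter> cball p rcut)"
    proof (cases "v l = 0")
      case True
      then have "v (l + \<rho>) \<noteq> 0" using \<rho> by auto
      moreover have "l \<in> cball (l + \<rho>) rcut" using lr by (simp add: dist_norm)
      ultimately show ?thesis using lr l by blast
    next
      case False
      then show ?thesis using l rcut_pos by (intro UN_I[of l]) auto
    qed
  qed
  moreover have "finite (\<Union>p\<in>{l \<in> \<Lambda>. v l \<noteq> 0}. \<Lambda> \<inter> cball p rcut)"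
    by (rule finite_UN_I[OF v[unfolded fs_def] finite_nodes])
  ultimately show "finite (act v)" by (rule finite_subset)
qed

lemma fs_sq: "fs v \<Longrightarrow> sq v"
  unfolding sq_def
  by (rule finite_nonzero_values_imp_summable_on, rule finite_subset[OF _ fs_act[of v]]) (auto dest: act_Dn)

lemma fs_lin: "fs v \<Longrightarrow> fs w \<Longrightarrow> fs (\<lambda>l. a *\<^sub>R v l + w l)"
  unfolding fs_def by (rule finite_subset[of _ "{l \<in> \<Lambda>. v l \<noteq> 0} \<union> {l \<in> \<Lambda>. w l \<noteq> 0}"]) auto

lemma fs_add: "fs v \<Longrightarrow> fs w \<Longrightarrow> fs (\<lambda>l. v l + w l)"
  using fs_lin[where a=1 and v=v and w=w] by simp

lemma fs_scaleR: "fs v \<Longrightarrow> fs (\<lambda>l. a *\<^sub>R v l)"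
  unfolding fs_def by (rule finite_subset[of _ "{l \<in> \<Lambda>. v l \<noteq> 0}"]) auto

lemma fs_diff: "fs v \<Longrightarrow> fs w \<Longrightarrow> fs (\<lambda>l. v l - w l)"
  using fs_lin[where a="-1" and v=w and w=v] by (simp add: algebra_simps)

lemma nD_sq_act: "fs v \<Longrightarrow> (nD v)\<^sup>2 = (\<Sum>l\<in>act v. (Dn v l)\<^sup>2)"
proof -
  assume v: "fs v"
  have "(\<Sum>\<^sub>\<infinity>l\<in>\<Lambda>. (Dn v l)\<^sup>2) = (\<Sum>\<^sub>\<infinity>l\<in>act v. (Dn v l)\<^sup>2)"
    by (rule infsum_cong_neutral) (use act_Dn act_sub in auto)
  then show ?thesis using fs_act[OF v] by (simp add: nD_sq)
qed

lemma energy_fs: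
  assumes "fs v" "finite F" "act v \<subseteq> F" "F \<subseteq> \<Lambda>"
  shows "E v = (\<Sum>l\<in>F. V l (st v l))"
proof -
  have "E v = energy_c \<Lambda> R V v"
    using E_ext finite_support_W_c[of v] assms(1) by (simp add: continuous_extension_def fs_def)
  also have "\<dots> = (\<Sum>\<^sub>\<infinity>l\<in>F. V l (st v l))"
    unfolding energy_c_def by (rule infsum_cong_neutral) (use assms act_Dn V_0 in force)+
  finally show ?thesis using assms(2) by simp
qed

lemma W_12_iff_sq: "u \<in> W_12 \<Lambda> \<T> \<longleftrightarrow> sq u"
  using Dn_le_grad grad_le_Dn unfolding sq_def by blast

lemma L2_norm_nonneg: "0 \<le> L2_norm f"
  by (simp add: L2_norm_def)

lemma L2_norm_equiv:
  "\<exists>K>0. \<forall>u. sq u \<longrightarrow> nD u \<le> K * L2_norm (G u) \<and> L2_norm (G u) \<le> K * nD u"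
proof -
  obtain K1 where K1: "0 < K1" "\<And>u. sq u \<Longrightarrow> (\<Sum>\<^sub>\<infinity>l\<in>\<Lambda>. (Dn u l)\<^sup>2) \<le> K1 * (L2_norm (G u))\<^sup>2"
    using Dn_le_grad W_12_iff_sq by blast
  obtain K2 where K2: "0 < K2" "\<And>u. sq u \<Longrightarrow> (L2_norm (G u))\<^sup>2 \<le> K2 * (\<Sum>\<^sub>\<infinity>l\<in>\<Lambda>. (Dn u l)\<^sup>2)"
    using grad_le_Dn sq_def by blast
  define K where "K = sqrt K1 + sqrt K2"
  have "nD u \<le> K * L2_norm (G u) \<and> L2_norm (G u) \<le> K * nD u" if u: "sq u" for u
  proof
    have "nD u \<le> sqrt (K1 * (L2_norm (G u))\<^sup>2)" unfolding nD_def by (intro real_sqrt_le_mono K1 u)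
    also have "\<dots> = sqrt K1 * L2_norm (G u)" by (simp add: real_sqrt_mult L2_norm_nonneg)
    also have "\<dots> \<le> K * L2_norm (G u)" using K2 by (intro mult_right_mono) (auto simp: K_def L2_norm_nonneg)
    finally show "nD u \<le> K * L2_norm (G u)" .
    have "L2_norm (G u) = sqrt ((L2_norm (G u))\<^sup>2)" by (simp add: L2_norm_nonneg)
    also have "\<dots> \<le> sqrt (K2 * (\<Sum>\<^sub>\<infinity>l\<in>\<Lambda>. (Dn u l)\<^sup>2))" by (intro real_sqrt_le_mono K2 u)
    also have "\<dots> = sqrt K2 * nD u" by (simp add: real_sqrt_mult nD_def)
    also have "\<dots> \<le> K * nD u" using K1 by (intro mult_right_mono) (auto simp: K_def)
    finally show "L2_norm (G u) \<le> K * nD u" .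
  qed
  moreover have "0 < K" using K1 K2 by (simp add: K_def add_pos_pos)
  ultimately show ?thesis by blast
qed

lemma E_tendsto:
  assumes u: "sq u" and w: "\<And>n. sq (w n)" and lim: "(\<lambda>n. nD (\<lambda>l. w n l - u l)) \<longlonglongrightarrow> 0"
  shows "(\<lambda>n. E (w n)) \<longlonglongrightarrow> E u"
proof (rule LIMSEQ_I)
  fix \<epsilon> :: real assume "0 < \<epsilon>"
  then obtain \<delta> where \<delta>: "0 < \<delta>" "\<And>v. sq v \<Longrightarrow> L2_norm (\<lambda>x. G v x - G u x) < \<delta> \<Longrightarrow> \<bar>E v - E u\<bar> < \<epsilon>"
    using E_ext u unfolding continuous_extension_def W_12_iff_sq[symmetric] by blast
  obtain K where K: "0 < K" "\<And>u. sq u \<Longrightarrow> L2_norm (G u) \<le> K * nD u" using L2_norm_equiv by blast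
  have "0 < \<delta> / K" using \<delta> K by simp
  from LIMSEQ_D[OF lim this] obtain N where N: "\<And>n. n \<ge> N \<Longrightarrow> nD (\<lambda>l. w n l - u l) < \<delta> / K" by auto
  have "norm (E (w n) - E u) < \<epsilon>" if "n \<ge> N" for n
  proof -
    have "L2_norm (\<lambda>x. G (w n) x - G u x) \<le> K * nD (\<lambda>l. w n l - u l)"
      unfolding L2_norm_grad_diff by (rule K(2)[OF sq_nD_diff(1)[OF w u]])
    also have "\<dots> < \<delta>" using N[OF that] K(1) by (simp add: field_simps)
    finally show ?thesis using \<delta>(2)[OF w] by simp
  qed
  then show "\<exists>N. \<forall>n\<ge>N. norm (E (w n) - E u) < \<epsilon>" by blast
qed

text \<open>On a bounded set a quadratic remainder is also linear: the increment has norm at most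
  \<open>2 * \<bar>M\<bar>\<close>.\<close>

lemma V_lipschitz:
  "\<exists>K\<ge>0. \<forall>l\<in>\<Lambda>. \<forall>g\<in>stencil_space (R l). \<forall>h\<in>stencil_space (R l).
     stencil_norm (R l) g \<le> M \<longrightarrow> stencil_norm (R l) (\<lambda>\<rho>. g \<rho> + h \<rho>) \<le> M \<longrightarrow>
     \<bar>V l (\<lambda>\<rho>. g \<rho> + h \<rho>) - V l g\<bar> \<le> K * stencil_norm (R l) h \<and>
     (\<forall>k\<in>stencil_space (R l). \<bar>d1 l (\<lambda>\<rho>. g \<rho> + h \<rho>) k - d1 l g k\<bar> \<le> K * stencil_norm (R l) h * stencil_norm (R l) k)"
proof -
  obtain K where K: "0 \<le> K" "\<And>l g h. l \<in> \<Lambda> \<Longrightarrow> g \<in> stencil_space (R l) \<Longrightarrow> h \<in> stencil_space (R l) \<Longrightarrow>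
       stencil_norm (R l) g \<le> M \<Longrightarrow> stencil_norm (R l) (\<lambda>\<rho>. g \<rho> + h \<rho>) \<le> M \<Longrightarrow>
       \<bar>V l (\<lambda>\<rho>. g \<rho> + h \<rho>) - V l g - d1 l g h\<bar> \<le> K * (stencil_norm (R l) h)\<^sup>2 \<and>
       (\<forall>k\<in>stencil_space (R l). \<bar>d1 l (\<lambda>\<rho>. g \<rho> + h \<rho>) k - d1 l g k - d2 l g k h\<bar> \<le> K * (stencil_norm (R l) h)\<^sup>2 * stencil_norm (R l) k) \<and>
       (\<forall>k\<in>stencil_space (R l). \<bar>d1 l g k\<bar> \<le> K * stencil_norm (R l) k) \<and>
       (\<forall>k\<in>stencil_space (R l). \<forall>j\<in>stencil_space (R l). \<bar>d2 l g k j\<bar> \<le> K * stencil_norm (R l) k * stencil_norm (R l) j)"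
    using C2_uniform[of M, unfolded C2_bound_def] by blast
  have "\<bar>V l (\<lambda>\<rho>. g \<rho> + h \<rho>) - V l g\<bar> \<le> K * (1 + 2 * \<bar>M\<bar>) * stencil_norm (R l) h \<and>
     (\<forall>k\<in>stencil_space (R l). \<bar>d1 l (\<lambda>\<rho>. g \<rho> + h \<rho>) k - d1 l g k\<bar> \<le> K * (1 + 2 * \<bar>M\<bar>) * stencil_norm (R l) h * stencil_norm (R l) k)"
    if *: "l \<in> \<Lambda>" "g \<in> stencil_space (R l)" "h \<in> stencil_space (R l)"
       "stencil_norm (R l) g \<le> M" "stencil_norm (R l) (\<lambda>\<rho>. g \<rho> + h \<rho>) \<le> M" for l g h
  proof -
    note KK = K(2)[OF *]
    define n where "n = stencil_norm (R l) h"
    have n0: "0 \<le> n" by (simp add: n_def)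
    have "n \<le> 2 * \<bar>M\<bar>"
      using stencil_norm_triangle_diff[of "R l" "\<lambda>\<rho>. g \<rho> + h \<rho>" g] *(4,5) by (simp add: n_def)
    then have n2: "n\<^sup>2 \<le> 2 * \<bar>M\<bar> * n" using n0 by (simp add: power2_eq_square mult_right_mono)
    have 1: "K * n\<^sup>2 \<le> K * (2 * \<bar>M\<bar> * n)" using K(1) n2 by (rule mult_left_mono[rotated])
    have "\<bar>V l (\<lambda>\<rho>. g \<rho> + h \<rho>) - V l g - d1 l g h\<bar> \<le> K * n\<^sup>2" "\<bar>d1 l g h\<bar> \<le> K * n"
      using KK *(3) by (auto simp: n_def)
    then have "\<bar>V l (\<lambda>\<rho>. g \<rho> + h \<rho>) - V l g\<bar> \<le> K * n\<^sup>2 + K * n" by linarith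
    also have "\<dots> \<le> K * (1 + 2 * \<bar>M\<bar>) * n" using 1 by (simp add: algebra_simps)
    finally have A: "\<bar>V l (\<lambda>\<rho>. g \<rho> + h \<rho>) - V l g\<bar> \<le> K * (1 + 2 * \<bar>M\<bar>) * n" .
    have "\<bar>d1 l (\<lambda>\<rho>. g \<rho> + h \<rho>) k - d1 l g k\<bar> \<le> K * (1 + 2 * \<bar>M\<bar>) * n * stencil_norm (R l) k"
      if k: "k \<in> stencil_space (R l)" for k
    proof -
      define p where "p = stencil_norm (R l) k"
      have "\<bar>d1 l (\<lambda>\<rho>. g \<rho> + h \<rho>) k - d1 l g k - d2 l g k h\<bar> \<le> K * n\<^sup>2 * p" "\<bar>d2 l g k h\<bar> \<le> K * p * n"
        using KK *(3) k by (auto simp: n_def p_def)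
      then have "\<bar>d1 l (\<lambda>\<rho>. g \<rho> + h \<rho>) k - d1 l g k\<bar> \<le> K * n\<^sup>2 * p + K * p * n" by linarith
      also have "\<dots> = (K * n\<^sup>2 + K * n) * p" by (simp add: algebra_simps)
      also have "\<dots> \<le> (K * (1 + 2 * \<bar>M\<bar>) * n) * p"
        using 1 by (intro mult_right_mono) (simp_all add: algebra_simps p_def)
      finally show ?thesis by (simp add: p_def)
    qed
    then show ?thesis using A by (auto simp: n_def)
  qed
  moreover have "0 \<le> K * (1 + 2 * \<bar>M\<bar>)" using K(1) by simp
  ultimately show ?thesis by blast
qed

text \<open>Density of finite supports, carried as a property of \<open>u\<close> at this stage; for
  point defects \<open>sq_approx\<close> derives it from \<open>sq u\<close> alone.\<close>

definition approx :: "(real^'d \<Rightarrow> real^'d) \<Rightarrow> bool" where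
  "approx u \<longleftrightarrow> sq u \<and> (\<exists>w. (\<forall>n. fs (w n)) \<and> (\<lambda>n. nD (\<lambda>l. w n l - u l)) \<longlonglongrightarrow> 0)"

lemma approx_add:
  assumes "approx u" "fs v"
  shows "approx (\<lambda>l. u l + a *\<^sub>R v l)"
proof -
  obtain w where w: "\<And>n. fs (w n)" "(\<lambda>n. nD (\<lambda>l. w n l - u l)) \<longlonglongrightarrow> 0" "sq u"
    using assms(1) unfolding approx_def by blast
  have "fs (\<lambda>l. w n l + a *\<^sub>R v l)" for n by (rule fs_add[OF w(1) fs_scaleR[OF assms(2)]])
  moreover have "(\<lambda>l. (w n l + a *\<^sub>R v l) - (u l + a *\<^sub>R v l)) = (\<lambda>l. w n l - u l)" for n by simp
  moreover have "sq (\<lambda>l. u l + a *\<^sub>R v l)" by (rule sq_nD_add(1)[OF w(3) sq_nD_scaleR(1)[OF fs_sq[OF assms(2)]]])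
  ultimately show ?thesis unfolding approx_def using w(2) by (intro conjI exI[of _ "\<lambda>n l. w n l + a *\<^sub>R v l"]) auto
qed

lemma fs_approx: "fs v \<Longrightarrow> approx v"
proof -
  assume v: "fs v"
  have "nD (\<lambda>l. v l - v l) = 0" by (simp add: nD_def Dn_def fd_def)
  then show ?thesis unfolding approx_def using v fs_sq[OF v] by (intro conjI exI[of _ "\<lambda>n. v"]) auto
qed

lemma V_tendsto:
  assumes u: "sq u" and w: "\<And>n. sq (w n)" and lim: "(\<lambda>n. nD (\<lambda>l. w n l - u l)) \<longlonglongrightarrow> 0" and l: "l \<in> \<Lambda>"
  shows "(\<lambda>n. V l (st (w n) l)) \<longlonglongrightarrow> V l (st u l)"
proof -
  define M where "M = nD u + 1"
  obtain K where K: "0 \<le> K" "\<And>g h. g \<in> stencil_space (R l) \<Longrightarrow> h \<in> stencil_space (R l) \<Longrightarrow>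
     stencil_norm (R l) g \<le> M \<Longrightarrow> stencil_norm (R l) (\<lambda>\<rho>. g \<rho> + h \<rho>) \<le> M \<Longrightarrow>
     \<bar>V l (\<lambda>\<rho>. g \<rho> + h \<rho>) - V l g\<bar> \<le> K * stencil_norm (R l) h" using V_lipschitz[of M] l by blast
  have K0: "(\<lambda>n. K * nD (\<lambda>l. w n l - u l)) \<longlonglongrightarrow> 0" using tendsto_mult_right_zero[OF lim] by simp
  have "\<forall>\<^sub>F n in sequentially. nD (\<lambda>l. w n l - u l) < 1"
    using lim by (rule order_tendstoD) simp
  then have "\<forall>\<^sub>F n in sequentially. norm (V l (st (w n) l) - V l (st u l)) \<le> K * nD (\<lambda>l. w n l - u l)"
  proof eventually_elim
    case (elim n)
    define h where "h = st (\<lambda>l. w n l - u l) l"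
    have wn: "st (w n) l = (\<lambda>\<rho>. st u l \<rho> + h \<rho>)" by (rule ext) (simp add: h_def fd_stencil_def)
    have hn: "stencil_norm (R l) h \<le> nD (\<lambda>l. w n l - u l)"
      unfolding h_def st_norm by (rule Dn_le_nD[OF sq_nD_diff(1)[OF w u] l])
    have un: "stencil_norm (R l) (st u l) \<le> nD u" unfolding st_norm by (rule Dn_le_nD[OF u l])
    have "stencil_norm (R l) (\<lambda>\<rho>. st u l \<rho> + h \<rho>) \<le> M"
      using stencil_norm_triangle[of "R l" "st u l" h] hn un elim by (simp add: M_def)
    then have "\<bar>V l (\<lambda>\<rho>. st u l \<rho> + h \<rho>) - V l (st u l)\<bar> \<le> K * stencil_norm (R l) h"
      using un by (intro K(2)) (auto simp: h_def M_def)
    also have "\<dots> \<le> K * nD (\<lambda>l. w n l - u l)" using hn K(1) by (rule mult_left_mono)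
    finally show ?case unfolding wn by simp
  qed
  then have "(\<lambda>n. V l (st (w n) l) - V l (st u l)) \<longlonglongrightarrow> 0" by (rule Lim_null_comparison[OF _ K0])
  then show ?thesis by (simp add: LIM_zero_iff)
qed

text \<open>The energy of \<open>u\<close> is only a limit, but its change under a finitely
  supported perturbation is a finite sum. This is clear for the finitely supported approximations of
  \<open>u\<close>, whose sums all run over the same sites \<open>act v\<close>, and so it survives
  the limit.\<close>

lemma E_diff:
  assumes u: "approx u" and v: "fs v"
  shows "E (\<lambda>l. u l + a *\<^sub>R v l) - E u = (\<Sum>l\<in>act v. V l (\<lambda>\<rho>. st u l \<rho> + a *\<^sub>R st v l \<rho>) - V l (st u l))"
proof -
  obtain w where w: "\<And>n. fs (w n)" "(\<lambda>n. nD (\<lambda>l. w n l - u l)) \<longlonglongrightarrow> 0" "sq u"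
    using u unfolding approx_def by blast
  define x where "x = (\<lambda>n l. w n l + a *\<^sub>R v l)"
  have x: "fs (x n)" for n unfolding x_def by (rule fs_add[OF w(1) fs_scaleR[OF v]])
  have limx: "(\<lambda>n. nD (\<lambda>l. x n l - (u l + a *\<^sub>R v l))) \<longlonglongrightarrow> 0" using w(2) by (simp add: x_def)
  have squ: "sq (\<lambda>l. u l + a *\<^sub>R v l)" by (rule sq_nD_add(1)[OF w(3) sq_nD_scaleR(1)[OF fs_sq[OF v]]])
  have fin: "E (x n) - E (w n) = (\<Sum>l\<in>act v. V l (st (x n) l) - V l (st (w n) l))" for n
  proof -
    let ?F = "act v \<union> act (w n) \<union> act (x n)"
    have F: "finite ?F" "?F \<subseteq> \<Lambda>" using fs_act[OF v] fs_act[OF w(1)] fs_act[OF x] act_sub by auto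
    have "E (x n) - E (w n) = (\<Sum>l\<in>?F. V l (st (x n) l) - V l (st (w n) l))"
    proof -
      have "E (x n) = (\<Sum>l\<in>?F. V l (st (x n) l))" by (rule energy_fs[OF x F(1) _ F(2)]) blast
      moreover have "E (w n) = (\<Sum>l\<in>?F. V l (st (w n) l))" by (rule energy_fs[OF w(1) F(1) _ F(2)]) blast
      ultimately show ?thesis by (simp add: sum_subtractf)
    qed
    also have "\<dots> = (\<Sum>l\<in>act v. V l (st (x n) l) - V l (st (w n) l))"
    proof (rule sum.mono_neutral_right[OF F(1)])
      show "\<forall>l\<in>?F - act v. V l (st (x n) l) - V l (st (w n) l) = 0"
      proof
        fix l assume l: "l \<in> ?F - act v"
        then have "st v l = (\<lambda>_. 0)" using act_Dn F(2) by blast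
        then have "st (x n) l = st (w n) l" unfolding x_def st_add_scaleR by simp
        then show "V l (st (x n) l) - V l (st (w n) l) = 0" by simp
      qed
    qed auto
    finally show ?thesis .
  qed
  have "(\<lambda>n. E (x n) - E (w n)) \<longlonglongrightarrow> E (\<lambda>l. u l + a *\<^sub>R v l) - E u"
    by (intro tendsto_diff E_tendsto squ w limx fs_sq x)
  moreover have "(\<lambda>n. E (x n) - E (w n)) \<longlonglongrightarrow> (\<Sum>l\<in>act v. V l (st (\<lambda>l. u l + a *\<^sub>R v l) l) - V l (st u l))"
    unfolding fin
    by (intro tendsto_sum tendsto_diff V_tendsto squ limx fs_sq x w(1,2,3)) (use act_sub in auto)
  ultimately show ?thesis unfolding st_add_scaleR by (rule LIMSEQ_unique)
qed

definition dE :: "(real^'d \<Rightarrow> real^'d) \<Rightarrow> (real^'d \<Rightarrow> real^'d) \<Rightarrow> real" where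
  "dE u v = (\<Sum>l\<in>act v. d1 l (st u l) (st v l))"

definition ddE :: "(real^'d \<Rightarrow> real^'d) \<Rightarrow> (real^'d \<Rightarrow> real^'d) \<Rightarrow> real" where
  "ddE u v = (\<Sum>l\<in>act v. d2 l (st u l) (st v l) (st v l))"

lemma d1_scaleR: "l \<in> \<Lambda> \<Longrightarrow> d1 l g (\<lambda>\<rho>. x *\<^sub>R h \<rho>) = x * d1 l g h"
  using d1_lin[of l g x h "\<lambda>_. 0"] d1_lin[of l g 0 h "\<lambda>_. 0"] d1_lin[of l g 1 "\<lambda>_. 0" "\<lambda>_. 0"] by simp

lemma d2_scaleR2: "l \<in> \<Lambda> \<Longrightarrow> d2 l g k (\<lambda>\<rho>. x *\<^sub>R h \<rho>) = x * d2 l g k h"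
  using d2_lin2[of l g k x h "\<lambda>_. 0"] d2_lin2[of l g k 1 "\<lambda>_. 0" "\<lambda>_. 0"] by simp

text \<open>The forms are known through their quadratic remainders; differentiability along lines is
  recovered from these.\<close>

lemma stencil_deriv:
  assumes l: "l \<in> \<Lambda>" and g: "g \<in> stencil_space (R l)" and h: "h \<in> stencil_space (R l)"
  shows "((\<lambda>t. V l (\<lambda>\<rho>. g \<rho> + t *\<^sub>R h \<rho>)) has_real_derivative d1 l g h) (at 0)"
    and "k \<in> stencil_space (R l) \<Longrightarrow> ((\<lambda>t. d1 l (\<lambda>\<rho>. g \<rho> + t *\<^sub>R h \<rho>) k) has_real_derivative d2 l g k h) (at 0)"
proof -
  define M where "M = stencil_norm (R l) g + stencil_norm (R l) h"
  have gM: "stencil_norm (R l) g \<le> M" by (simp add: M_def)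
  obtain K where K: "0 \<le> K" "\<And>h. h \<in> stencil_space (R l) \<Longrightarrow>
       stencil_norm (R l) (\<lambda>\<rho>. g \<rho> + h \<rho>) \<le> M \<Longrightarrow>
       \<bar>V l (\<lambda>\<rho>. g \<rho> + h \<rho>) - V l g - d1 l g h\<bar> \<le> K * (stencil_norm (R l) h)\<^sup>2 \<and>
       (\<forall>k\<in>stencil_space (R l). \<bar>d1 l (\<lambda>\<rho>. g \<rho> + h \<rho>) k - d1 l g k - d2 l g k h\<bar> \<le> K * (stencil_norm (R l) h)\<^sup>2 * stencil_norm (R l) k)"
    using C2_uniform[of M, unfolded C2_bound_def] l g gM by blast
  have th: "(\<lambda>\<rho>. t *\<^sub>R h \<rho>) \<in> stencil_space (R l)" for t using h by (simp add: stencil_space_def)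
  have tb: "stencil_norm (R l) (\<lambda>\<rho>. g \<rho> + t *\<^sub>R h \<rho>) \<le> M" if "\<bar>t\<bar> \<le> 1" for t
  proof -
    have "\<bar>t\<bar> * stencil_norm (R l) h \<le> 1 * stencil_norm (R l) h" using that by (intro mult_right_mono) auto
    then show ?thesis
      using stencil_norm_triangle[of "R l" g "\<lambda>\<rho>. t *\<^sub>R h \<rho>"] by (simp add: M_def stencil_norm_scaleR)
  qed
  show "((\<lambda>t. V l (\<lambda>\<rho>. g \<rho> + t *\<^sub>R h \<rho>)) has_real_derivative d1 l g h) (at 0)"
  proof (rule DERIV_quadratic_remainder)
    fix t :: real assume t: "\<bar>t\<bar> \<le> 1"
    show "\<bar>V l (\<lambda>\<rho>. g \<rho> + t *\<^sub>R h \<rho>) - V l (\<lambda>\<rho>. g \<rho> + 0 *\<^sub>R h \<rho>) - t * d1 l g h\<bar> \<le> K * (stencil_norm (R l) h)\<^sup>2 * t\<^sup>2"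
      using K(2)[OF th tb[OF t]] by (simp add: d1_scaleR[OF l] stencil_norm_scaleR power_mult_distrib mult_ac)
  qed
  assume k: "k \<in> stencil_space (R l)"
  show "((\<lambda>t. d1 l (\<lambda>\<rho>. g \<rho> + t *\<^sub>R h \<rho>) k) has_real_derivative d2 l g k h) (at 0)"
  proof (rule DERIV_quadratic_remainder)
    fix t :: real assume t: "\<bar>t\<bar> \<le> 1"
    show "\<bar>d1 l (\<lambda>\<rho>. g \<rho> + t *\<^sub>R h \<rho>) k - d1 l (\<lambda>\<rho>. g \<rho> + 0 *\<^sub>R h \<rho>) k - t * d2 l g k h\<bar>
       \<le> K * (stencil_norm (R l) h)\<^sup>2 * stencil_norm (R l) k * t\<^sup>2"
      using K(2)[OF th tb[OF t]] k by (simp add: d2_scaleR2[OF l] stencil_norm_scaleR power_mult_distrib mult_ac)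
  qed
qed

lemma E_deriv:
  assumes u: "approx u" and v: "fs v"
  shows "((\<lambda>t. E (\<lambda>l. u l + t *\<^sub>R v l)) has_real_derivative dE (\<lambda>l. u l + s *\<^sub>R v l) v) (at s)"
proof -
  have at0: "((\<lambda>t. E (\<lambda>l. u l + t *\<^sub>R v l)) has_real_derivative dE u v) (at 0)" if u: "approx u" for u
  proof -
    have eq: "E (\<lambda>l. u l + t *\<^sub>R v l) = E u + (\<Sum>l\<in>act v. V l (\<lambda>\<rho>. st u l \<rho> + t *\<^sub>R st v l \<rho>) - V l (st u l))" for t
      using E_diff[OF u v, of t] by simp
    have "((\<lambda>t. E u + (\<Sum>l\<in>act v. V l (\<lambda>\<rho>. st u l \<rho> + t *\<^sub>R st v l \<rho>) - V l (st u l)))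
        has_real_derivative 0 + (\<Sum>l\<in>act v. d1 l (st u l) (st v l) - 0)) (at 0)"
      by (intro DERIV_add DERIV_const DERIV_sum DERIV_diff stencil_deriv(1)) (use act_sub in auto)
    then show ?thesis unfolding eq by (simp add: dE_def)
  qed
  have "((\<lambda>t. E (\<lambda>l. (u l + s *\<^sub>R v l) + t *\<^sub>R v l)) has_real_derivative dE (\<lambda>l. u l + s *\<^sub>R v l) v) (at 0)"
    by (rule at0[OF approx_add[OF u v]])
  moreover have "(\<lambda>t. E (\<lambda>l. (u l + s *\<^sub>R v l) + t *\<^sub>R v l)) = (\<lambda>t. E (\<lambda>l. u l + (t + s) *\<^sub>R v l))"
    by (simp add: scaleR_add_left add_ac)
  ultimately show ?thesis
    using DERIV_shift[of "\<lambda>t. E (\<lambda>l. u l + t *\<^sub>R v l)" "dE (\<lambda>l. u l + s *\<^sub>R v l) v" 0 s] by simp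
qed

lemma dE_deriv: "((\<lambda>t. dE (\<lambda>l. u l + t *\<^sub>R v l) v) has_real_derivative ddE (\<lambda>l. u l + s *\<^sub>R v l) v) (at s)"
proof -
  have at0: "((\<lambda>t. dE (\<lambda>l. u l + t *\<^sub>R v l) v) has_real_derivative ddE u v) (at 0)" for u
    unfolding dE_def ddE_def st_add_scaleR
    by (intro DERIV_sum stencil_deriv(2)) (use act_sub in auto)
  have "((\<lambda>t. dE (\<lambda>l. (u l + s *\<^sub>R v l) + t *\<^sub>R v l) v) has_real_derivative ddE (\<lambda>l. u l + s *\<^sub>R v l) v) (at 0)"
    by (rule at0)
  moreover have "(\<lambda>t. dE (\<lambda>l. (u l + s *\<^sub>R v l) + t *\<^sub>R v l) v) = (\<lambda>t. dE (\<lambda>l. u l + (t + s) *\<^sub>R v l) v)"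
    by (simp add: scaleR_add_left add_ac)
  ultimately show ?thesis
    using DERIV_shift[of "\<lambda>t. dE (\<lambda>l. u l + t *\<^sub>R v l) v" "ddE (\<lambda>l. u l + s *\<^sub>R v l) v" 0 s] by simp
qed

lemma first_variation_eq: "approx u \<Longrightarrow> fs v \<Longrightarrow> first_variation E u v = dE u v"
  unfolding first_variation_def using DERIV_imp_deriv[OF E_deriv[of u v 0]] by simp

lemma second_variation_eq: "approx u \<Longrightarrow> fs v \<Longrightarrow> second_variation E u v v = ddE u v"
  unfolding second_variation_def
  using DERIV_imp_deriv[OF dE_deriv[of u v 0]] by (simp add: first_variation_eq[OF approx_add])

lemma sum_act_CS:
  assumes "sq h" "fs v"
  shows "(\<Sum>l\<in>act v. Dn h l * Dn v l) \<le> nD h * nD v"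
proof -
  have "(\<Sum>l\<in>act v. \<bar>Dn h l\<bar> * \<bar>Dn v l\<bar>) \<le> L2_set (Dn h) (act v) * L2_set (Dn v) (act v)"
    by (rule L2_set_mult_ineq)
  also have "\<dots> \<le> nD h * nD v"
  proof (rule mult_mono)
    show "L2_set (Dn h) (act v) \<le> nD h"
      unfolding L2_set_def nD_def using assms fs_act act_sub
      by (intro real_sqrt_le_mono finite_sum_le_infsum) (auto simp: sq_def)
    show "L2_set (Dn v) (act v) \<le> nD v"
      using nD_sq_act[OF assms(2)] by (simp add: L2_set_def real_le_lsqrt flip: nD_sq_act)
  qed (auto simp: L2_set_nonneg)
  finally show ?thesis by simp
qed

text \<open>The estimate for \<open>ddE\<close> has three strain factors. In the discrete setting
  one of them may be bounded pointwise by the energy norm, as in \<open>Dn_le_nD\<close>, and the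
  other two by their square sums.\<close>

lemma variations_lipschitz:
  "\<exists>K\<ge>0. \<forall>u h v. sq u \<longrightarrow> sq h \<longrightarrow> nD u \<le> M \<longrightarrow> nD (\<lambda>l. u l + h l) \<le> M \<longrightarrow> fs v \<longrightarrow>
     \<bar>dE (\<lambda>l. u l + h l) v - dE u v\<bar> \<le> K * nD h * nD v \<and>
     \<bar>ddE (\<lambda>l. u l + h l) v - ddE u v\<bar> \<le> K * nD h * (nD v)\<^sup>2"
proof -
  obtain K1 where K1: "0 \<le> K1" "\<And>l g h k. l\<in>\<Lambda> \<Longrightarrow> g\<in>stencil_space (R l) \<Longrightarrow> h\<in>stencil_space (R l) \<Longrightarrow>
     stencil_norm (R l) g \<le> M \<Longrightarrow> stencil_norm (R l) (\<lambda>\<rho>. g \<rho> + h \<rho>) \<le> M \<Longrightarrow> k\<in>stencil_space (R l) \<Longrightarrow>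
     \<bar>d1 l (\<lambda>\<rho>. g \<rho> + h \<rho>) k - d1 l g k\<bar> \<le> K1 * stencil_norm (R l) h * stencil_norm (R l) k"
    using V_lipschitz[of M] by blast
  obtain K2 where K2: "0 \<le> K2" "\<And>l g h k j. l\<in>\<Lambda> \<Longrightarrow> g\<in>stencil_space (R l) \<Longrightarrow> h\<in>stencil_space (R l) \<Longrightarrow>
     stencil_norm (R l) g \<le> M \<Longrightarrow> stencil_norm (R l) (\<lambda>\<rho>. g \<rho> + h \<rho>) \<le> M \<Longrightarrow> k\<in>stencil_space (R l) \<Longrightarrow> j\<in>stencil_space (R l) \<Longrightarrow>
     \<bar>d2 l (\<lambda>\<rho>. g \<rho> + h \<rho>) k j - d2 l g k j\<bar> \<le> K2 * stencil_norm (R l) h * stencil_norm (R l) k * stencil_norm (R l) j"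
    using C2_uniform[of M, unfolded C2_bound_def] by blast
  have "\<bar>dE (\<lambda>l. u l + h l) v - dE u v\<bar> \<le> (K1 + K2) * nD h * nD v \<and>
     \<bar>ddE (\<lambda>l. u l + h l) v - ddE u v\<bar> \<le> (K1 + K2) * nD h * (nD v)\<^sup>2"
    if *: "sq u" "sq h" "nD u \<le> M" "nD (\<lambda>l. u l + h l) \<le> M" "fs v" for u h v
  proof -
    have st_M: "stencil_norm (R l) (st u l) \<le> M" "stencil_norm (R l) (\<lambda>\<rho>. st u l \<rho> + st h l \<rho>) \<le> M" if "l \<in> \<Lambda>" for l
      unfolding st_add[symmetric] st_norm
      using Dn_le_nD[OF *(1) that] Dn_le_nD[OF sq_nD_add(1)[OF *(1,2)] that] *(3,4) by auto
    have "\<bar>dE (\<lambda>l. u l + h l) v - dE u v\<bar> = \<bar>\<Sum>l\<in>act v. d1 l (\<lambda>\<rho>. st u l \<rho> + st h l \<rho>) (st v l) - d1 l (st u l) (st v l)\<bar>"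
      by (simp add: dE_def st_add sum_subtractf)
    also have "\<dots> \<le> (\<Sum>l\<in>act v. K1 * (Dn h l * Dn v l))"
    proof (rule order_trans[OF sum_abs sum_mono])
      fix l assume "l \<in> act v"
      then have l: "l \<in> \<Lambda>" using act_sub by blast
      show "\<bar>d1 l (\<lambda>\<rho>. st u l \<rho> + st h l \<rho>) (st v l) - d1 l (st u l) (st v l)\<bar> \<le> K1 * (Dn h l * Dn v l)"
        using K1(2)[OF l st_space st_space st_M[OF l] st_space, of v] by (simp add: st_norm mult.assoc)
    qed
    also have "\<dots> \<le> K1 * (nD h * nD v)"
      unfolding sum_distrib_left[symmetric] by (intro mult_left_mono sum_act_CS * K1)
    also have "\<dots> \<le> (K1 + K2) * nD h * nD v" using K2 unfolding mult.assoc by (intro mult_right_mono) auto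
    finally have A: "\<bar>dE (\<lambda>l. u l + h l) v - dE u v\<bar> \<le> (K1 + K2) * nD h * nD v" .
    have "\<bar>ddE (\<lambda>l. u l + h l) v - ddE u v\<bar> = \<bar>\<Sum>l\<in>act v. d2 l (\<lambda>\<rho>. st u l \<rho> + st h l \<rho>) (st v l) (st v l) - d2 l (st u l) (st v l) (st v l)\<bar>"
      by (simp add: ddE_def st_add sum_subtractf)
    also have "\<dots> \<le> (\<Sum>l\<in>act v. K2 * nD h * (Dn v l)\<^sup>2)"
    proof (rule order_trans[OF sum_abs sum_mono])
      fix l assume "l \<in> act v"
      then have l: "l \<in> \<Lambda>" using act_sub by blast
      have "\<bar>d2 l (\<lambda>\<rho>. st u l \<rho> + st h l \<rho>) (st v l) (st v l) - d2 l (st u l) (st v l) (st v l)\<bar> \<le> K2 * Dn h l * (Dn v l)\<^sup>2"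
        using K2(2)[OF l st_space st_space st_M[OF l] st_space st_space, of v v] by (simp add: st_norm power2_eq_square mult.assoc)
      also have "\<dots> \<le> K2 * nD h * (Dn v l)\<^sup>2"
        using Dn_le_nD[OF *(2) l] K2(1) by (intro mult_right_mono mult_left_mono) auto
      finally show "\<bar>d2 l (\<lambda>\<rho>. st u l \<rho> + st h l \<rho>) (st v l) (st v l) - d2 l (st u l) (st v l) (st v l)\<bar> \<le> K2 * nD h * (Dn v l)\<^sup>2" .
    qed
    also have "\<dots> = K2 * nD h * (nD v)\<^sup>2" by (simp add: nD_sq_act[OF *(5)] sum_distrib_left)
    also have "\<dots> \<le> (K1 + K2) * nD h * (nD v)\<^sup>2" using K1 by (intro mult_right_mono) auto
    finally show ?thesis using A by simp
  qed
  moreover have "0 \<le> K1 + K2" using K1 K2 by simp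
  ultimately show ?thesis by blast
qed

end

section \<open>Minimisers near a strongly stable solution\<close>

context energy_model begin

lemma act_subset: "(\<And>l. l \<in> \<Lambda> \<Longrightarrow> l \<notin> \<Omega> \<Longrightarrow> v l = 0) \<Longrightarrow> act v \<subseteq> (\<Union>p\<in>\<Omega>. \<Lambda> \<inter> cball p rcut)"
proof
  fix l assume v: "\<And>l. l \<in> \<Lambda> \<Longrightarrow> l \<notin> \<Omega> \<Longrightarrow> v l = 0" and "l \<in> act v"
  then have l: "l \<in> \<Lambda>" "st v l \<noteq> (\<lambda>_. 0)" by (auto simp: act_def)
  then obtain \<rho> where \<rho>: "\<rho> \<in> R l" "v (l + \<rho>) \<noteq> v l" by (auto simp: fd_stencil_def fun_eq_iff split: if_splits)
  have lr: "l + \<rho> \<in> \<Lambda>" "norm \<rho> < rcut" using R_node[OF l(1) \<rho>(1)] by auto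
  show "l \<in> (\<Union>p\<in>\<Omega>. \<Lambda> \<inter> cball p rcut)"
  proof (cases "l \<in> \<Omega>")
    case False
    then have "l + \<rho> \<in> \<Omega>" using v[OF lr(1)] v[OF l(1)] \<rho>(2) by auto
    moreover have "l \<in> cball (l + \<rho>) rcut" using lr by (simp add: dist_norm)
    ultimately show ?thesis using l by blast
  next
    case True
    then show ?thesis using l rcut_pos by (intro UN_I[of l]) auto
  qed
qed

text \<open>Displacements are functions on the whole space; this allows a competitor to be replaced
  by a representative that vanishes off the domain.\<close>

lemma agree_on_nodes:
  assumes "\<And>l. l \<in> \<Lambda> \<Longrightarrow> u l = v l"
  shows "l \<in> \<Lambda> \<Longrightarrow> st u l = st v l" "nD u = nD v" "sq u \<longleftrightarrow> sq v" "fs u \<longleftrightarrow> fs v" "fs u \<Longrightarrow> E u = E v"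
proof -
  show st: "st u l = st v l" if "l \<in> \<Lambda>" for l
    using assms R_node[OF that] that by (auto simp: fd_stencil_def fun_eq_iff)
  have Dn: "Dn u l = Dn v l" if "l \<in> \<Lambda>" for l using st[OF that] by (simp flip: st_norm)
  show "nD u = nD v" unfolding nD_def using Dn by (simp cong: infsum_cong)
  show "sq u \<longleftrightarrow> sq v" unfolding sq_def using Dn by (simp cong: summable_on_cong)
  have supp: "{l \<in> \<Lambda>. u l \<noteq> 0} = {l \<in> \<Lambda>. v l \<noteq> 0}" using assms by auto
  then show *: "fs u \<longleftrightarrow> fs v" by (simp add: fs_def)
  have act: "act u = act v" using st by (auto simp: act_def)
  assume "fs u"
  then have "E u = (\<Sum>l\<in>act u. V l (st u l))" "E v = (\<Sum>l\<in>act u. V l (st v l))"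
    using energy_fs[of u "act u"] energy_fs[of v "act u"] fs_act act_sub act * by auto
  then show "E u = E v" using st act_sub[of u] by (simp add: subset_iff)
qed

lemma W_0_iff: "finite \<Omega> \<Longrightarrow> u \<in> W_0 \<Lambda> \<T> \<Omega> \<longleftrightarrow> (\<forall>l\<in>\<Lambda> - \<Omega>. u l = 0)"
  and W_0_fs: "finite \<Omega> \<Longrightarrow> u \<in> W_0 \<Lambda> \<T> \<Omega> \<Longrightarrow> fs u"
proof -
  assume \<Omega>: "finite \<Omega>"
  have fin: "finite {l \<in> \<Lambda>. u l \<noteq> 0}" if "\<forall>l\<in>\<Lambda> - \<Omega>. u l = 0"
    by (rule finite_subset[OF _ \<Omega>]) (use that in auto)
  then show "u \<in> W_0 \<Lambda> \<T> \<Omega> \<longleftrightarrow> (\<forall>l\<in>\<Lambda> - \<Omega>. u l = 0)"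
    using finite_support_W_c[of u] by (auto simp: W_0_def)
  then show "u \<in> W_0 \<Lambda> \<T> \<Omega> \<Longrightarrow> fs u" using fin by (simp add: fs_def)
qed

lemma exists_node_outside: "finite \<Omega> \<Longrightarrow> \<exists>l\<in>\<Lambda>. l \<notin> \<Omega>"
proof -
  assume "finite \<Omega>"
  then obtain r where r: "\<And>l. l \<in> \<Omega> \<Longrightarrow> norm l \<le> r" using finite_imp_bounded bounded_iff by metis
  obtain \<rho> where \<rho>: "\<And>x. \<exists>l\<in>\<Lambda>. dist x l < \<rho>" using covering by blast
  obtain x :: "real^'d" where x: "norm x = \<bar>r\<bar> + \<bar>\<rho>\<bar> + 1" using vector_choose_size[of "\<bar>r\<bar> + \<bar>\<rho>\<bar> + 1"] by auto
  obtain l where l: "l \<in> \<Lambda>" "dist x l < \<rho>" using \<rho> by blast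
  have "norm l > r" using x l(2) norm_triangle_ineq2[of x l] by (simp add: dist_norm)
  then have "l \<notin> \<Omega>" using r by force
  then show ?thesis using l by blast
qed

lemma supported_bound:
  assumes \<Omega>: "finite \<Omega>" and p: "p \<in> \<Lambda>" "p \<notin> \<Omega>"
  shows "\<exists>B\<ge>0. \<forall>v. (\<forall>l. l \<notin> \<Omega> \<longrightarrow> v l = 0) \<longrightarrow> nD v \<le> r \<longrightarrow> (\<forall>l\<in>\<Lambda>. norm (v l) \<le> B * norm (l - p))"
proof -
  obtain K where K: "0 \<le> K" "\<And>u x y. sq u \<Longrightarrow> x \<in> \<Lambda> \<Longrightarrow> y \<in> \<Lambda> \<Longrightarrow> norm (u y - u x) \<le> K * nD u * norm (y - x)"
    using node_lipschitz unfolding sq_def nD_def by blast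
  have "norm (v l) \<le> (K * \<bar>r\<bar>) * norm (l - p)"
    if v: "\<forall>l. l \<notin> \<Omega> \<longrightarrow> v l = 0" "nD v \<le> r" and l: "l \<in> \<Lambda>" for v l
  proof -
    have "finite {l \<in> \<Lambda>. v l \<noteq> 0}" by (rule finite_subset[OF _ \<Omega>]) (use v in auto)
    then have "sq v" by (intro fs_sq) (simp add: fs_def)
    from K(2)[OF this p(1) l] have "norm (v l) \<le> K * nD v * norm (l - p)" using v p by simp
    also have "\<dots> \<le> (K * \<bar>r\<bar>) * norm (l - p)" using v(2) K(1) by (intro mult_right_mono mult_left_mono) auto
    finally show ?thesis .
  qed
  then show ?thesis using K(1) by (intro exI[of _ "K * \<bar>r\<bar>"]) auto
qed

lemma continuous_on_Dn: "continuous_on Y (\<lambda>v. Dn v l)"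
  unfolding Dn_def stencil_norm_def L2_set_def fd_def
  by (intro continuous_intros continuous_on_subset[OF continuous_on_product_coordinates]) auto

text \<open>Some node lies outside the finite domain and carries the value 0, so the strain bounds
  all other values. The set is thus closed in a product of compact balls, compact in the topology of
  functions.\<close>

lemma compact_supported:
  assumes \<Omega>: "finite \<Omega>" "\<Omega> \<subseteq> \<Lambda>"
  shows "compact {v. (\<forall>l. l \<notin> \<Omega> \<longrightarrow> v l = 0) \<and> nD v \<le> r}"
proof -
  obtain p where p: "p \<in> \<Lambda>" "p \<notin> \<Omega>" using exists_node_outside[OF \<Omega>(1)] by blast
  obtain B where B: "0 \<le> B" "\<And>v l. (\<forall>l. l \<notin> \<Omega> \<longrightarrow> v l = 0) \<Longrightarrow> nD v \<le> r \<Longrightarrow> l \<in> \<Lambda> \<Longrightarrow> norm (v l) \<le> B * norm (l - p)"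
    using supported_bound[OF \<Omega>(1) p, where r=r] by metis
  define Z where "Z = (\<lambda>l. if l \<in> \<Omega> then cball (0::real^'d) (B * norm (l - p)) else {0})"
  have "compact (Z l)" for l by (simp add: Z_def)
  then have "compactin (product_topology (\<lambda>_. euclidean) UNIV) (PiE UNIV Z)"
    by (simp add: compactin_PiE)
  then have cZ: "compact (PiE UNIV Z)" by (simp add: euclidean_product_topology)
  define F where "F = (\<Union>p\<in>\<Omega>. \<Lambda> \<inter> cball p rcut)"
  have F: "finite F" "F \<subseteq> \<Lambda>" unfolding F_def using \<Omega>(1) finite_nodes by blast+
  have clos: "closed {v. (\<Sum>l\<in>F. (Dn v l)\<^sup>2) \<le> r\<^sup>2}"
    by (intro closed_Collect_le continuous_intros continuous_on_Dn)
  have nD_F: "(nD v)\<^sup>2 = (\<Sum>l\<in>F. (Dn v l)\<^sup>2)" if v: "\<forall>l. l \<notin> \<Omega> \<longrightarrow> v l = 0" for v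
  proof -
    have "fs v" unfolding fs_def by (rule finite_subset[OF _ \<Omega>(1)]) (use v in auto)
    then have "(nD v)\<^sup>2 = (\<Sum>l\<in>act v. (Dn v l)\<^sup>2)" by (rule nD_sq_act)
    also have "\<dots> = (\<Sum>l\<in>F. (Dn v l)\<^sup>2)"
      using act_subset[of \<Omega> v] v F act_Dn by (intro sum.mono_neutral_left) (auto simp: F_def)
    finally show ?thesis .
  qed
  show ?thesis
  proof (cases "0 \<le> r")
    case True
    have "{v. (\<forall>l. l \<notin> \<Omega> \<longrightarrow> v l = 0) \<and> nD v \<le> r} = PiE UNIV Z \<inter> {v. (\<Sum>l\<in>F. (Dn v l)\<^sup>2) \<le> r\<^sup>2}"
    proof (intro set_eqI iffI)
      fix v assume v: "v \<in> {v. (\<forall>l. l \<notin> \<Omega> \<longrightarrow> v l = 0) \<and> nD v \<le> r}"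
      then have "(nD v)\<^sup>2 \<le> r\<^sup>2" by (intro power_mono) auto
      moreover have "v l \<in> Z l" for l using v B(2)[of v l] \<Omega>(2) by (auto simp: Z_def)
      ultimately show "v \<in> PiE UNIV Z \<inter> {v. (\<Sum>l\<in>F. (Dn v l)\<^sup>2) \<le> r\<^sup>2}"
        using v nD_F[of v] by (simp add: PiE_iff)
    next
      fix v assume v: "v \<in> PiE UNIV Z \<inter> {v. (\<Sum>l\<in>F. (Dn v l)\<^sup>2) \<le> r\<^sup>2}"
      then have 0: "\<forall>l. l \<notin> \<Omega> \<longrightarrow> v l = 0" by (auto simp: PiE_iff Z_def split: if_splits)
      then have "(nD v)\<^sup>2 \<le> r\<^sup>2" using v nD_F[OF 0] by simp
      then have "nD v \<le> r" using True by (rule power2_le_imp_le)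
      then show "v \<in> {v. (\<forall>l. l \<notin> \<Omega> \<longrightarrow> v l = 0) \<and> nD v \<le> r}" using 0 by simp
    qed
    then show ?thesis using cZ clos by (simp add: compact_Int_closed)
  next
    case False
    then have "{v. (\<forall>l. l \<notin> \<Omega> \<longrightarrow> v l = 0) \<and> nD v \<le> r} = {}" using nD_nonneg order_trans by blast
    then show ?thesis by (metis compact_empty)
  qed
qed

lemma continuous_energy_supported:
  assumes \<Omega>: "finite \<Omega>" "\<Omega> \<subseteq> \<Lambda>" and w: "fs w" and Y: "\<And>v l. v \<in> Y \<Longrightarrow> l \<notin> \<Omega> \<Longrightarrow> v l = 0"
  shows "continuous_on Y (\<lambda>v. E (\<lambda>l. w l + v l))"
proof -
  define F where "F = (\<Union>p\<in>\<Omega>. \<Lambda> \<inter> cball p rcut) \<union> act w"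
  have F: "finite F" "F \<subseteq> \<Lambda>" unfolding F_def using \<Omega>(1) finite_nodes fs_act[OF w] act_sub by blast+
  have eq: "E (\<lambda>l. w l + v l) = (\<Sum>l\<in>F. V l (st (\<lambda>l. w l + v l) l))" if v: "v \<in> Y" for v
  proof (rule energy_fs[OF _ F(1) _ F(2)])
    have "fs v" unfolding fs_def by (rule finite_subset[OF _ \<Omega>(1)]) (use Y[OF v] in auto)
    then show "fs (\<lambda>l. w l + v l)" by (rule fs_add[OF w])
    show "act (\<lambda>l. w l + v l) \<subseteq> F"
    proof
      fix l assume l: "l \<in> act (\<lambda>l. w l + v l)"
      then have "l \<in> \<Lambda>" using act_sub by blast
      have "l \<in> act w \<or> l \<in> act v"
      proof (rule ccontr)
        assume "\<not> (l \<in> act w \<or> l \<in> act v)"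
        then have "st w l = (\<lambda>_. 0)" "st v l = (\<lambda>_. 0)" using act_Dn[OF \<open>l \<in> \<Lambda>\<close>] by auto
        then show False using l by (simp add: act_def st_add)
      qed
      moreover have "act v \<subseteq> (\<Union>p\<in>\<Omega>. \<Lambda> \<inter> cball p rcut)" by (rule act_subset) (rule Y[OF v])
      ultimately show "l \<in> F" unfolding F_def by blast
    qed
  qed
  have "continuous_on Y (\<lambda>v. \<Sum>l\<in>F. V l (st (\<lambda>l. w l + v l) l))"
  proof (intro continuous_on_sum)
    fix l assume "l \<in> F"
    then have l: "l \<in> \<Lambda>" using F by blast
    have "continuous_on Y (\<lambda>v. st (\<lambda>l. w l + v l) l)"
    proof (rule continuous_on_coordinatewise_then_product)
      fix \<rho>
      show "continuous_on Y (\<lambda>v. st (\<lambda>l. w l + v l) l \<rho>)"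
        unfolding fd_stencil_def
        by (cases "\<rho> \<in> R l") (auto intro!: continuous_intros continuous_on_subset[OF continuous_on_product_coordinates])
    qed
    then show "continuous_on Y (\<lambda>v. V l (st (\<lambda>l. w l + v l) l))"
      by (rule continuous_on_compose2[OF V_cont[OF l]]) auto
  qed
  then show ?thesis using eq by (simp cong: continuous_on_cong)
qed

text \<open>Translates stability from gradients and variations of \<open>E\<close> into finite sums
  and the node-wise norm, in which the rest of the argument works.\<close>

lemma stable_variations:
  assumes ub: "approx ubar" and stable: "strongly_stable_solution \<Lambda> \<T> E (W_12 \<Lambda> \<T>) (W_c \<Lambda> \<T>) ubar"
  shows "\<And>v. fs v \<Longrightarrow> dE ubar v = 0" "\<exists>c0>0. \<forall>v. fs v \<longrightarrow> c0 * (nD v)\<^sup>2 \<le> ddE ubar v"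
proof -
  obtain c where c: "c > 0" "\<And>v. v \<in> W_c \<Lambda> \<T> \<Longrightarrow> second_variation E ubar v v \<ge> c * (L2_norm (G v))\<^sup>2"
    and fv: "\<And>v. v \<in> W_12 \<Lambda> \<T> \<Longrightarrow> first_variation E ubar v = 0"
    using stable unfolding strongly_stable_solution_def by blast
  show "dE ubar v = 0" if "fs v" for v
    using fv[of v] first_variation_eq[OF ub that] fs_sq[OF that] W_12_iff_sq by simp
  obtain K where K: "0 < K" "\<And>u. sq u \<Longrightarrow> nD u \<le> K * L2_norm (G u)" using L2_norm_equiv by blast
  have "c / K\<^sup>2 * (nD v)\<^sup>2 \<le> ddE ubar v" if v: "fs v" for v
  proof -
    have "(nD v)\<^sup>2 \<le> (K * L2_norm (G v))\<^sup>2" using K(2)[OF fs_sq[OF v]] by (intro power_mono) auto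
    then have "(nD v)\<^sup>2 / K\<^sup>2 \<le> (L2_norm (G v))\<^sup>2" using K(1) by (simp add: power_mult_distrib field_simps)
    then have "c * ((nD v)\<^sup>2 / K\<^sup>2) \<le> c * (L2_norm (G v))\<^sup>2" by (rule mult_left_mono) (use c(1) in simp)
    also have "\<dots> \<le> ddE ubar v"
      using c(2)[OF finite_support_W_c[OF v[unfolded fs_def]]] second_variation_eq[OF ub v] by simp
    finally show ?thesis by simp
  qed
  moreover have "0 < c / K\<^sup>2" using c K by simp
  ultimately show "\<exists>c0>0. \<forall>v. fs v \<longrightarrow> c0 * (nD v)\<^sup>2 \<le> ddE ubar v" by blast
qed

text \<open>Second-order Taylor expansion with a lower bound on the second derivative, by two
  monotonicity arguments: \<xi> is the derivative and \<psi> the energy along the segment, each with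
  its quadratic model removed.\<close>

lemma energy_growth:
  assumes w: "fs w" and v: "fs v" and c: "\<And>t. 0 \<le> t \<Longrightarrow> t \<le> 1 \<Longrightarrow> c * (nD v)\<^sup>2 \<le> ddE (\<lambda>l. w l + t *\<^sub>R v l) v"
  shows "E w + dE w v + c / 2 * (nD v)\<^sup>2 \<le> E (\<lambda>l. w l + v l)"
proof -
  define \<xi> where "\<xi> = (\<lambda>t. dE (\<lambda>l. w l + t *\<^sub>R v l) v - c * (nD v)\<^sup>2 * t)"
  define \<psi> where "\<psi> = (\<lambda>t. E (\<lambda>l. w l + t *\<^sub>R v l) - (dE w v * t + c / 2 * (nD v)\<^sup>2 * t\<^sup>2))"
  have d\<xi>: "(\<xi> has_real_derivative (ddE (\<lambda>l. w l + t *\<^sub>R v l) v - c * (nD v)\<^sup>2)) (at t)" for t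
  proof -
    have "((\<lambda>t. c * (nD v)\<^sup>2 * t) has_real_derivative c * (nD v)\<^sup>2) (at t)"
      by (auto intro!: derivative_eq_intros)
    then show ?thesis unfolding \<xi>_def by (rule DERIV_diff[OF dE_deriv])
  qed
  have d\<psi>: "(\<psi> has_real_derivative (\<xi> t - dE w v)) (at t)" for t
  proof -
    have "((\<lambda>t. dE w v * t + c / 2 * (nD v)\<^sup>2 * t\<^sup>2) has_real_derivative dE w v + c * (nD v)\<^sup>2 * t) (at t)"
      by (auto intro!: derivative_eq_intros)
    from DERIV_diff[OF E_deriv[OF fs_approx[OF w] v, of t] this] show ?thesis
      by (simp add: \<psi>_def \<xi>_def algebra_simps)
  qed
  have "\<xi> 0 \<le> \<xi> t" if t: "0 \<le> t" "t \<le> 1" for t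
  proof (rule DERIV_nonneg_imp_nondecreasing[OF t(1)])
    fix x assume "0 \<le> x" "x \<le> t"
    then have "0 \<le> ddE (\<lambda>l. w l + x *\<^sub>R v l) v - c * (nD v)\<^sup>2" using c[of x] t by simp
    then show "\<exists>y. (\<xi> has_real_derivative y) (at x) \<and> 0 \<le> y" using d\<xi> by blast
  qed
  then have \<xi>_ge: "dE w v \<le> \<xi> t" if "0 \<le> t" "t \<le> 1" for t using that by (simp add: \<xi>_def)
  have "\<psi> 0 \<le> \<psi> 1"
  proof (rule DERIV_nonneg_imp_nondecreasing[of 0 1 \<psi>])
    fix x :: real assume "0 \<le> x" "x \<le> 1"
    then have "0 \<le> \<xi> x - dE w v" using \<xi>_ge by simp
    then show "\<exists>y. (\<psi> has_real_derivative y) (at x) \<and> 0 \<le> y" using d\<psi> by blast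
  qed simp
  then show ?thesis by (simp add: \<psi>_def)
qed

text \<open>Existence rests on compactness rather than on a fixed point. \<open>C\<close> and
  \<open>\<eta>0\<close> are fixed before the domain and \<open>w\<close>, which makes the estimate
  uniform over all domains.\<close>

theorem minimiser_near_stable_solution:
  assumes ub: "approx ubar" and stable: "strongly_stable_solution \<Lambda> \<T> E (W_12 \<Lambda> \<T>) (W_c \<Lambda> \<T>) ubar"
  shows "\<exists>C>0. \<exists>\<eta>0>0. \<forall>\<eta> \<Omega> w. 0 < \<eta> \<longrightarrow> \<eta> \<le> \<eta>0 \<longrightarrow> finite \<Omega> \<longrightarrow> \<Omega> \<subseteq> \<Lambda> \<longrightarrow> (\<forall>l\<in>\<Lambda> - \<Omega>. w l = 0) \<longrightarrow>
    nD (\<lambda>l. w l - ubar l) \<le> \<eta> \<longrightarrow>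
    (\<exists>uR. strongly_stable_solution \<Lambda> \<T> E (W_0 \<Lambda> \<T> \<Omega>) (W_0 \<Lambda> \<T> \<Omega>) uR \<and>
       uR \<in> local_minimisers \<Lambda> \<T> E (W_0 \<Lambda> \<T> \<Omega>) \<and>
       L2_norm (\<lambda>x. G uR x - G ubar x) \<le> C * \<eta> \<and> \<bar>E uR - E ubar\<bar> \<le> C * \<eta>\<^sup>2)"
proof -
  have squ: "sq ubar" using ub by (simp add: approx_def)
  have crit: "\<And>v. fs v \<Longrightarrow> dE ubar v = 0" by (rule stable_variations(1)[OF ub stable])
  obtain c0 where c0: "c0 > 0" "\<And>v. fs v \<Longrightarrow> c0 * (nD v)\<^sup>2 \<le> ddE ubar v"
    using stable_variations(2)[OF ub stable] by blast
  define M where "M = nD ubar + 1"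
  obtain K where K: "0 \<le> K" "\<And>u h v. sq u \<Longrightarrow> sq h \<Longrightarrow> nD u \<le> M \<Longrightarrow> nD (\<lambda>l. u l + h l) \<le> M \<Longrightarrow> fs v \<Longrightarrow>
     \<bar>dE (\<lambda>l. u l + h l) v - dE u v\<bar> \<le> K * nD h * nD v \<and>
     \<bar>ddE (\<lambda>l. u l + h l) v - ddE u v\<bar> \<le> K * nD h * (nD v)\<^sup>2"
    using variations_lipschitz[of M] by blast
  obtain K2 where K2: "0 < K2" "\<And>u. sq u \<Longrightarrow> nD u \<le> K2 * L2_norm (G u)" "\<And>u. sq u \<Longrightarrow> L2_norm (G u) \<le> K2 * nD u"
    using L2_norm_equiv by blast
  define dd where "dd = (\<lambda>u. nD (\<lambda>l. u l - ubar l))"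
  \<comment> \<open>At \<open>ubar\<close> the first variation vanishes and the second is coercive;
    the Lipschitz bounds carry both facts to nearby displacements, with errors proportional to the
    distance \<open>dd u\<close>.\<close>
  have near: "\<bar>dE u v\<bar> \<le> K * dd u * nD v" "(c0 - K * dd u) * (nD v)\<^sup>2 \<le> ddE u v"
    if u: "sq u" "dd u \<le> 1" and v: "fs v" for u v
  proof -
    define h where "h = (\<lambda>l. u l - ubar l)"
    have h: "sq h" "nD h = dd u" unfolding h_def dd_def by (auto intro: sq_nD_diff u squ)
    have uh: "(\<lambda>l. ubar l + h l) = u" by (simp add: h_def)
    have "nD (\<lambda>l. ubar l + h l) \<le> M" using sq_nD_add(2)[OF squ h(1)] u(2) h(2) by (simp add: M_def)
    from K(2)[OF squ h(1) _ this v] show "\<bar>dE u v\<bar> \<le> K * dd u * nD v" "(c0 - K * dd u) * (nD v)\<^sup>2 \<le> ddE u v"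
      using crit[OF v] c0(2)[OF v] unfolding uh h(2) by (auto simp: M_def left_diff_distrib abs_le_iff)
  qed
  define c where "c = c0 / 2"
  have c: "0 < c" using c0 by (simp add: c_def)
  \<comment> \<open>Within this distance at most half of \<open>c0\<close> is lost. The bound 1/2
    leaves room for another 1/2 in the energy estimate, since \<open>near\<close> asks for distance
    at most 1.\<close>
  define \<delta> where "\<delta> = min (1/2) (c / (K + 1))"
  have \<delta>: "0 < \<delta>" "\<delta> \<le> 1 / 2" "K * \<delta> \<le> c"
  proof -
    show "0 < \<delta>" using c K(1) by (simp add: \<delta>_def)
    show "\<delta> \<le> 1 / 2" unfolding \<delta>_def by (rule min.cobounded1)
    have "K * \<delta> \<le> K * (c / (K + 1))" using K(1) by (intro mult_left_mono) (auto simp: \<delta>_def)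
    also have "\<dots> \<le> c" using K(1) c by (simp add: field_simps)
    finally show "K * \<delta> \<le> c" .
  qed
  have coer: "c * (nD v)\<^sup>2 \<le> ddE u v" if u: "sq u" "dd u \<le> \<delta>" and v: "fs v" for u v
  proof -
    have "K * dd u \<le> K * \<delta>" using u(2) K(1) by (rule mult_left_mono)
    then have "c \<le> c0 - K * dd u" using \<delta>(3) by (simp add: c_def)
    then have "c * (nD v)\<^sup>2 \<le> (c0 - K * dd u) * (nD v)\<^sup>2" by (rule mult_right_mono) simp
    also have "\<dots> \<le> ddE u v" using near(2)[OF u(1) _ v] u(2) \<delta>(2) by simp
    finally show ?thesis .
  qed
  \<comment> \<open>On the sphere of radius \<open>r = \<kappa> * \<eta>\<close> the quadratic
    growth \<open>c / 2 * r\<^sup>2\<close> must exceed the first-order term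
    \<open>K * \<eta> * r\<close>, that is \<open>c * \<kappa> > 2 * K\<close>; the summand 1 makes
    this strict.\<close>
  define \<kappa> where "\<kappa> = 2 * K / c + 1"
  have \<kappa>: "1 \<le> \<kappa>" using K c by (simp add: \<kappa>_def)
  \<comment> \<open>Keeps the whole ball around \<open>w\<close> within distance \<delta> of
    \<open>ubar\<close>, because \<open>\<eta> + \<kappa> * \<eta> \<le> \<delta>\<close>.\<close>
  define \<eta>0 where "\<eta>0 = \<delta> / (1 + \<kappa>)"
  have \<eta>0: "0 < \<eta>0" using \<delta> \<kappa> by (simp add: \<eta>0_def)
  define C where "C = K2 * (1 + \<kappa>) + K * (1 + \<kappa>)\<^sup>2"
  have C: "0 < C" using K2 \<kappa> K by (simp add: C_def add_pos_nonneg)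
  have "\<exists>uR. strongly_stable_solution \<Lambda> \<T> E (W_0 \<Lambda> \<T> \<Omega>) (W_0 \<Lambda> \<T> \<Omega>) uR \<and>
       uR \<in> local_minimisers \<Lambda> \<T> E (W_0 \<Lambda> \<T> \<Omega>) \<and>
       L2_norm (\<lambda>x. G uR x - G ubar x) \<le> C * \<eta> \<and> \<bar>E uR - E ubar\<bar> \<le> C * \<eta>\<^sup>2"
    if \<eta>: "0 < \<eta>" "\<eta> \<le> \<eta>0" and \<Omega>: "finite \<Omega>" "\<Omega> \<subseteq> \<Lambda>" and w0: "\<forall>l\<in>\<Lambda> - \<Omega>. w l = 0"
      and wu: "nD (\<lambda>l. w l - ubar l) \<le> \<eta>" for \<eta> \<Omega> w
  proof -
    define r where "r = \<kappa> * \<eta>"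
    have r: "0 < r" using \<kappa> \<eta> by (simp add: r_def)
    have \<eta>r: "\<eta> + r \<le> \<delta>"
    proof -
      have "\<eta> * (1 + \<kappa>) \<le> \<delta>" using \<eta>(2) \<kappa> by (simp add: \<eta>0_def field_simps)
      then show ?thesis by (simp add: r_def algebra_simps)
    qed
    have w: "fs w" unfolding fs_def by (rule finite_subset[OF _ \<Omega>(1)]) (use w0 in auto)
    define Y where "Y = {v. (\<forall>l. l \<notin> \<Omega> \<longrightarrow> v l = 0) \<and> nD v \<le> r}"
    have Yfs: "fs v" if "v \<in> Y" for v
      unfolding fs_def by (rule finite_subset[OF _ \<Omega>(1)]) (use that in \<open>auto simp: Y_def\<close>)
    have zero: "(\<lambda>_. 0) \<in> Y" using r by (simp add: Y_def nD_def Dn_def fd_def)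
    have "continuous_on Y (\<lambda>v. E (\<lambda>l. w l + v l))"
      by (rule continuous_energy_supported[OF \<Omega> w]) (simp add: Y_def)
    then obtain vs where vs: "vs \<in> Y" "\<And>v. v \<in> Y \<Longrightarrow> E (\<lambda>l. w l + vs l) \<le> E (\<lambda>l. w l + v l)"
      using continuous_attains_inf[OF compact_supported[OF \<Omega>, of r, folded Y_def]] zero by blast
    have vs_fs: "fs vs" by (rule Yfs[OF vs(1)])
    have dd_wv: "dd (\<lambda>l. w l + t *\<^sub>R v l) \<le> \<delta>" if "0 \<le> t" "t \<le> 1" "nD v \<le> r" "fs v" for t v
    proof -
      have "dd (\<lambda>l. w l + t *\<^sub>R v l) = nD (\<lambda>l. (w l - ubar l) + t *\<^sub>R v l)"
        by (simp add: dd_def algebra_simps)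
      also have "\<dots> \<le> nD (\<lambda>l. w l - ubar l) + nD (\<lambda>l. t *\<^sub>R v l)"
        by (intro sq_nD_add sq_nD_diff sq_nD_scaleR fs_sq w squ that(4))
      also have "\<dots> \<le> \<eta> + 1 * r"
        unfolding sq_nD_scaleR(2) using wu that by (intro add_mono mult_mono) auto
      finally show ?thesis using \<eta>r by simp
    qed
    have less: "nD vs < r"
    proof (rule ccontr)
      assume "\<not> nD vs < r"
      then have eq: "nD vs = r" using vs(1) by (simp add: Y_def)
      have "E w + dE w vs + c / 2 * (nD vs)\<^sup>2 \<le> E (\<lambda>l. w l + vs l)"
        by (rule energy_growth[OF w vs_fs])
           (intro coer dd_wv vs_fs fs_sq fs_add fs_scaleR w; simp add: eq)
      moreover have "\<bar>dE w vs\<bar> \<le> K * \<eta> * r"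
      proof -
        have "\<bar>dE w vs\<bar> \<le> K * dd w * nD vs"
          using near(1)[OF fs_sq[OF w] _ vs_fs] wu \<eta>r r \<delta>(2) by (simp add: dd_def)
        also have "\<dots> \<le> K * \<eta> * r" using wu K(1) r eq \<eta>(1) by (intro mult_mono) (auto simp: dd_def)
        finally show ?thesis .
      qed
      moreover have "E (\<lambda>l. w l + vs l) \<le> E w" using vs(2)[OF zero] by simp
      ultimately have "c / 2 * r\<^sup>2 \<le> K * \<eta> * r" unfolding eq by linarith
      then have "c / 2 * r \<le> K * \<eta>" using r by (simp add: power2_eq_square)
      then have "c * \<kappa> * \<eta> \<le> 2 * K * \<eta>" by (simp add: r_def)
      then have "c * \<kappa> \<le> 2 * K" using \<eta> by simp
      moreover have "c * \<kappa> = 2 * K + c" using c by (simp add: \<kappa>_def field_simps)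
      ultimately show False using c by simp
    qed
    define uR where "uR = (\<lambda>l. w l + vs l)"
    have uR_fs: "fs uR" unfolding uR_def by (rule fs_add[OF w vs_fs])
    have uR_W: "uR \<in> W_0 \<Lambda> \<T> \<Omega>" unfolding W_0_iff[OF \<Omega>(1)] using w0 vs(1) by (simp add: uR_def Y_def)
    have dd_uR: "dd uR \<le> \<eta> + r"
    proof -
      have "dd uR = nD (\<lambda>l. (w l - ubar l) + vs l)" by (simp add: dd_def uR_def algebra_simps)
      also have "\<dots> \<le> nD (\<lambda>l. w l - ubar l) + nD vs" by (intro sq_nD_add sq_nD_diff fs_sq w squ vs_fs)
      finally show ?thesis using wu less by simp
    qed
    \<comment> \<open>A gradient distance within which every competitor stays in the ball; positive
      because the minimiser is interior.\<close>
    define \<epsilon> where "\<epsilon> = (r - nD vs) / K2"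
    have \<epsilon>: "0 < \<epsilon>" using less K2(1) by (simp add: \<epsilon>_def)
    have loc: "E uR \<le> E u'" if u': "u' \<in> W_0 \<Lambda> \<T> \<Omega>" "L2_norm (\<lambda>x. G u' x - G uR x) < \<epsilon>" for u'
    proof -
      have u'0: "\<forall>l\<in>\<Lambda> - \<Omega>. u' l = 0" using u'(1) W_0_iff[OF \<Omega>(1)] by blast
      have u'fs: "fs u'" by (rule W_0_fs[OF \<Omega>(1) u'(1)])
      have "nD (\<lambda>l. u' l - uR l) \<le> K2 * L2_norm (\<lambda>x. G u' x - G uR x)"
        unfolding L2_norm_grad_diff by (intro K2 sq_nD_diff fs_sq u'fs uR_fs)
      also have "\<dots> < K2 * \<epsilon>" using u'(2) K2(1) by simp
      also have "\<dots> = r - nD vs" using K2(1) by (simp add: \<epsilon>_def)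
      finally have d: "nD (\<lambda>l. u' l - uR l) < r - nD vs" .
      \<comment> \<open>A competitor may take any values off \<Lambda>; \<open>v'\<close> sets them
        to 0, as membership in \<open>Y\<close> demands, without changing the energy.\<close>
      define v' where "v' = (\<lambda>l. if l \<in> \<Omega> then u' l - w l else 0)"
      have ag: "v' l = (u' l - uR l) + vs l" if "l \<in> \<Lambda>" for l
        using that u'0 w0 vs(1) by (simp add: v'_def uR_def Y_def)
      have "nD v' = nD (\<lambda>l. (u' l - uR l) + vs l)" by (rule agree_on_nodes(2)[OF ag])
      also have "\<dots> \<le> nD (\<lambda>l. u' l - uR l) + nD vs" by (intro sq_nD_add sq_nD_diff fs_sq u'fs uR_fs vs_fs)
      finally have "v' \<in> Y" using d by (simp add: Y_def v'_def)
      then have "E uR \<le> E (\<lambda>l. w l + v' l)" unfolding uR_def by (rule vs(2))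
      also have "\<dots> = E u'"
        using agree_on_nodes(5)[of "\<lambda>l. w l + v' l" u'] fs_add[OF w Yfs[OF \<open>v' \<in> Y\<close>]] u'0 w0
        by (auto simp: v'_def)
      finally show ?thesis .
    qed
    have fvar: "first_variation E uR v = 0" if v: "v \<in> W_0 \<Lambda> \<T> \<Omega>" for v
    proof -
      have vf: "fs v" by (rule W_0_fs[OF \<Omega>(1) v])
      have der: "((\<lambda>t. E (\<lambda>l. uR l + t *\<^sub>R v l)) has_real_derivative dE uR v) (at 0)"
        using E_deriv[OF fs_approx[OF uR_fs] vf, of 0] by simp
      define \<tau> where "\<tau> = \<epsilon> / (K2 * nD v + 1)"
      have pos: "0 < K2 * nD v + 1" using K2(1) by (simp add: add_nonneg_pos)
      have \<tau>: "0 < \<tau>" using \<epsilon> pos by (simp add: \<tau>_def)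
      have "dE uR v = 0"
      proof (rule DERIV_local_min[OF der \<tau>], intro allI impI)
        fix t :: real assume t: "\<bar>0 - t\<bar> < \<tau>"
        have "L2_norm (\<lambda>x. G (\<lambda>l. uR l + t *\<^sub>R v l) x - G uR x) = L2_norm (G (\<lambda>l. t *\<^sub>R v l))"
          by (simp add: L2_norm_grad_diff)
        also have "\<dots> \<le> K2 * nD (\<lambda>l. t *\<^sub>R v l)" by (intro K2 fs_sq fs_scaleR vf)
        also have "\<dots> = \<bar>t\<bar> * (K2 * nD v)" by (simp add: sq_nD_scaleR(2))
        also have "\<dots> \<le> \<bar>t\<bar> * (K2 * nD v + 1)" by (intro mult_left_mono) auto
        also have "\<dots> < \<epsilon>" using t pos by (simp add: \<tau>_def field_simps)
        finally have "L2_norm (\<lambda>x. G (\<lambda>l. uR l + t *\<^sub>R v l) x - G uR x) < \<epsilon>" .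
        moreover have "(\<lambda>l. uR l + t *\<^sub>R v l) \<in> W_0 \<Lambda> \<T> \<Omega>"
          using uR_W v unfolding W_0_iff[OF \<Omega>(1)] by simp
        ultimately show "E (\<lambda>l. uR l + 0 *\<^sub>R v l) \<le> E (\<lambda>l. uR l + t *\<^sub>R v l)" using loc by simp
      qed
      then show ?thesis using first_variation_eq[OF fs_approx[OF uR_fs] vf] by simp
    qed
    have svar: "c / K2\<^sup>2 * (L2_norm (G v))\<^sup>2 \<le> second_variation E uR v v" if v: "v \<in> W_0 \<Lambda> \<T> \<Omega>" for v
    proof -
      have vf: "fs v" by (rule W_0_fs[OF \<Omega>(1) v])
      have "(L2_norm (G v))\<^sup>2 \<le> (K2 * nD v)\<^sup>2" using K2(3)[OF fs_sq[OF vf]] L2_norm_nonneg by (intro power_mono) auto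
      then have "(L2_norm (G v))\<^sup>2 / K2\<^sup>2 \<le> (nD v)\<^sup>2" using K2(1) by (simp add: power_mult_distrib field_simps)
      then have "c * ((L2_norm (G v))\<^sup>2 / K2\<^sup>2) \<le> c * (nD v)\<^sup>2" by (rule mult_left_mono) (use c in simp)
      also have "\<dots> \<le> ddE uR v" using dd_uR \<eta>r by (intro coer fs_sq uR_fs vf) simp
      finally show ?thesis using second_variation_eq[OF fs_approx[OF uR_fs] vf] by simp
    qed
    have g_err: "L2_norm (\<lambda>x. G uR x - G ubar x) \<le> C * \<eta>"
    proof -
      have "L2_norm (\<lambda>x. G uR x - G ubar x) \<le> K2 * dd uR"
        unfolding L2_norm_grad_diff dd_def by (intro K2 sq_nD_diff fs_sq uR_fs squ)
      also have "\<dots> \<le> K2 * (\<eta> + r)" using dd_uR K2(1) by simp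
      also have "\<dots> = K2 * (1 + \<kappa>) * \<eta>" by (simp add: r_def algebra_simps)
      also have "\<dots> \<le> C * \<eta>" using \<eta> K(1) by (intro mult_right_mono) (auto simp: C_def)
      finally show ?thesis .
    qed
    \<comment> \<open>\<open>ubar\<close> has no finite support, so \<open>uR\<close> is compared
      with approximations \<open>z n\<close> and the limit is taken at the end. The mean value
      theorem gives a first variation between \<open>uR\<close> and \<open>z n\<close>; as it
      vanishes at \<open>ubar\<close>, it is of first order in the distance, and the product with
      the increment is of second order.\<close>
    have e_err: "\<bar>E uR - E ubar\<bar> \<le> C * \<eta>\<^sup>2"
    proof -
      obtain z where z: "\<And>n. fs (z n)" "(\<lambda>n. nD (\<lambda>l. z n l - ubar l)) \<longlonglongrightarrow> 0"
        using ub unfolding approx_def by blast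
      define \<rho> where "\<rho> = \<eta> + r"
      have lim1: "(\<lambda>n. \<bar>E (z n) - E uR\<bar>) \<longlonglongrightarrow> \<bar>E ubar - E uR\<bar>"
        by (intro tendsto_rabs tendsto_diff E_tendsto squ fs_sq z tendsto_const)
      have lim2: "(\<lambda>n. K * (\<rho> + nD (\<lambda>l. z n l - ubar l))\<^sup>2) \<longlonglongrightarrow> K * (\<rho> + 0)\<^sup>2"
        by (intro tendsto_mult tendsto_power tendsto_add z tendsto_const)
      have "\<forall>\<^sub>F n in sequentially. nD (\<lambda>l. z n l - ubar l) < 1 / 2"
        using z(2) by (rule order_tendstoD) simp
      then have ev: "\<forall>\<^sub>F n in sequentially. \<bar>E (z n) - E uR\<bar> \<le> K * (\<rho> + nD (\<lambda>l. z n l - ubar l))\<^sup>2"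
      proof eventually_elim
        case (elim n)
        define q where "q = nD (\<lambda>l. z n l - ubar l)"
        define d where "d = (\<lambda>l. z n l - uR l)"
        have d: "fs d" unfolding d_def by (rule fs_diff[OF z(1) uR_fs])
        obtain x where x: "0 < x" "x < 1" "E (\<lambda>l. uR l + 1 *\<^sub>R d l) - E (\<lambda>l. uR l + 0 *\<^sub>R d l) = (1 - 0) * dE (\<lambda>l. uR l + x *\<^sub>R d l) d"
          using MVT2[of 0 1 "\<lambda>t. E (\<lambda>l. uR l + t *\<^sub>R d l)" "\<lambda>t. dE (\<lambda>l. uR l + t *\<^sub>R d l) d"]
            E_deriv[OF fs_approx[OF uR_fs] d] by auto
        have Ez: "E (z n) - E uR = dE (\<lambda>l. uR l + x *\<^sub>R d l) d" using x(3) by (simp add: d_def)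
        have nd: "nD d \<le> \<rho> + q"
        proof -
          have "nD d = nD (\<lambda>l. (z n l - ubar l) - (uR l - ubar l))" by (simp add: d_def)
          also have "\<dots> \<le> q + dd uR"
            unfolding q_def dd_def by (intro sq_nD_diff fs_sq z uR_fs squ)
          finally show ?thesis using dd_uR by (simp add: \<rho>_def)
        qed
        have q0: "0 \<le> q" "q < 1 / 2" using elim by (auto simp: q_def)
        have ddx: "dd (\<lambda>l. uR l + x *\<^sub>R d l) \<le> \<rho> + q"
        proof -
          have "dd (\<lambda>l. uR l + x *\<^sub>R d l) = nD (\<lambda>l. (1 - x) *\<^sub>R (uR l - ubar l) + x *\<^sub>R (z n l - ubar l))"
            by (simp add: dd_def d_def algebra_simps)
          also have "\<dots> \<le> nD (\<lambda>l. (1 - x) *\<^sub>R (uR l - ubar l)) + nD (\<lambda>l. x *\<^sub>R (z n l - ubar l))"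
            by (intro sq_nD_add sq_nD_scaleR sq_nD_diff fs_sq z uR_fs squ)
          also have "\<dots> = (1 - x) * dd uR + x * q" using x by (simp add: sq_nD_scaleR(2) dd_def q_def)
          also have "\<dots> \<le> 1 * dd uR + 1 * q" using x q0 by (intro add_mono mult_right_mono) (auto simp: dd_def)
          finally show ?thesis using dd_uR by (simp add: \<rho>_def)
        qed
        have "\<bar>dE (\<lambda>l. uR l + x *\<^sub>R d l) d\<bar> \<le> K * dd (\<lambda>l. uR l + x *\<^sub>R d l) * nD d"
          using ddx q0 \<eta>r \<delta>(2) by (intro near d fs_sq fs_add fs_scaleR uR_fs) (simp add: \<rho>_def)
        also have "\<dots> \<le> K * (\<rho> + q) * (\<rho> + q)"
          using ddx nd K(1) q0 \<eta> r by (intro mult_mono) (auto simp: dd_def \<rho>_def)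
        finally show ?case unfolding Ez by (simp add: q_def power2_eq_square mult.assoc)
      qed
      have "\<bar>E ubar - E uR\<bar> \<le> K * (\<rho> + 0)\<^sup>2"
        by (rule tendsto_le[OF _ lim2 lim1 ev]) simp
      also have "\<dots> = K * (1 + \<kappa>)\<^sup>2 * \<eta>\<^sup>2" by (simp add: \<rho>_def r_def power_mult_distrib[symmetric] algebra_simps)
      also have "\<dots> \<le> C * \<eta>\<^sup>2" using K2(1) \<kappa> by (intro mult_right_mono) (auto simp: C_def)
      finally show ?thesis by (simp add: abs_minus_commute)
    qed
    have "strongly_stable_solution \<Lambda> \<T> E (W_0 \<Lambda> \<T> \<Omega>) (W_0 \<Lambda> \<T> \<Omega>) uR"
      unfolding strongly_stable_solution_def
      using uR_W fvar svar c K2(1) by (intro conjI exI[of _ "c / K2\<^sup>2"]) auto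
    moreover have "uR \<in> local_minimisers \<Lambda> \<T> E (W_0 \<Lambda> \<T> \<Omega>)"
      unfolding local_minimisers_def using uR_W loc \<epsilon> by blast
    ultimately show ?thesis using g_err e_err by blast
  qed
  then show ?thesis using C \<eta>0 by blast
qed

end


section \<open>Decay of point defects\<close>

context point_defect begin

definition emb :: "int^'d \<Rightarrow> real^'d" where
  "emb z = A *v (\<chi> i. real_of_int (z $ i))"

lemma emb_add: "emb (x + y) = emb x + emb y"
proof -
  have "(\<chi> i. real_of_int ((x + y) $ i)) = (\<chi> i. real_of_int (x $ i)) + (\<chi> i. real_of_int (y $ i))"
    by (simp add: vec_eq_iff)
  then show ?thesis by (simp add: emb_def matrix_vector_right_distrib)
qed

lemma emb_diff: "emb (x - y) = emb x - emb y"
  using emb_add[of "x - y" y] by (simp add: eq_diff_eq)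

lemma range_emb: "range emb = bravais_lattice A"
proof -
  have "range (\<lambda>z::int^'d. \<chi> i. real_of_int (z $ i)) = {z. \<forall>i. z $ i \<in> \<int>}"
  proof (intro set_eqI iffI)
    fix x :: "real^'d" assume "x \<in> {z. \<forall>i. z $ i \<in> \<int>}"
    then have "x = (\<chi> i. real_of_int ((\<chi> i. \<lfloor>x $ i\<rfloor>) $ i))" by (auto simp: vec_eq_iff elim!: Ints_cases)
    then show "x \<in> range (\<lambda>z::int^'d. \<chi> i. real_of_int (z $ i))" by (rule range_eqI)
  qed auto
  then show ?thesis unfolding bravais_lattice_def emb_def by (metis image_image)
qed

lemma emb_axis: "emb (axis i 1) = A *v axis i 1"
proof -
  have "(\<chi> j. real_of_int (axis i 1 $ j)) = axis i 1" by (simp add: vec_eq_iff axis_def)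
  then show ?thesis by (simp add: emb_def)
qed

lemma emb_lower: "\<exists>\<alpha>>0. \<forall>z i. \<alpha> * real_of_int \<bar>z $ i\<bar> \<le> norm (emb z)"
proof -
  obtain B where B: "B ** A = mat 1" using nonsingular unfolding invertible_def by blast
  have "1 / (norm B + 1) * real_of_int \<bar>z $ i\<bar> \<le> norm (emb z)" for z i
  proof -
    define x where "x = (\<chi> i. real_of_int (z $ i))"
    have "x = B *v emb z" using B by (simp add: emb_def x_def matrix_vector_mul_assoc)
    then have "norm x \<le> norm B * norm (emb z)" by (metis norm_matrix_vector_le)
    also have "\<dots> \<le> (norm B + 1) * norm (emb z)" by (intro mult_right_mono) auto
    finally have "norm x / (norm B + 1) \<le> norm (emb z)" by (simp add: pos_divide_le_eq add_nonneg_pos mult.commute)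
    moreover have "real_of_int \<bar>z $ i\<bar> \<le> norm x" using component_le_norm_cart[of x i] by (simp add: x_def)
    then have "real_of_int \<bar>z $ i\<bar> / (norm B + 1) \<le> norm x / (norm B + 1)" by (rule divide_right_mono) simp
    ultimately show ?thesis by simp
  qed
  moreover have "0 < 1 / (norm B + 1)" by (simp add: add_nonneg_pos)
  ultimately show ?thesis by blast
qed

lemma emb_upper: "\<exists>\<beta>>0. \<forall>r. \<forall>z\<in>cube r. norm (emb z) \<le> \<beta> * real r"
proof -
  have "norm (emb z) \<le> (norm A * real CARD('d) + 1) * real r" if z: "z \<in> cube r" for z r
  proof -
    define x where "x = (\<chi> i. real_of_int (z $ i))"
    have "\<bar>x $ i\<bar> \<le> real r" for i
    proof -
      have "\<bar>z $ i\<bar> \<le> int r" using z by (simp add: cube_def)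
      then show ?thesis by (simp add: x_def)
    qed
    then have "norm x \<le> real CARD('d) * real r"
      using norm_le_l1_cart[of x] sum_bounded_above[of UNIV "\<lambda>i. \<bar>x $ i\<bar>" "real r"] by fastforce
    then have "norm A * norm x \<le> norm A * (real CARD('d) * real r)" by (rule mult_left_mono) simp
    then have "norm (emb z) \<le> norm A * (real CARD('d) * real r)"
      using norm_matrix_vector_le[of A x] by (simp add: emb_def x_def)
    then show ?thesis by (simp add: algebra_simps)
  qed
  moreover have "0 < norm A * real CARD('d) + 1" by (simp add: add_nonneg_pos)
  ultimately show ?thesis by blast
qed

lemma emb_bounded: "\<exists>n. \<forall>z. norm (emb z) \<le> r \<longrightarrow> z \<in> cube n"
proof -
  obtain \<alpha> where \<alpha>: "0 < \<alpha>" "\<And>z i. \<alpha> * real_of_int \<bar>z $ i\<bar> \<le> norm (emb z)" using emb_lower by blast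
  have "z \<in> cube (nat \<lceil>r / \<alpha>\<rceil>)" if z: "norm (emb z) \<le> r" for z
    unfolding cube_def
  proof (intro CollectI allI)
    fix i
    have "\<alpha> * real_of_int \<bar>z $ i\<bar> \<le> r" using \<alpha>(2)[of z i] z by linarith
    then have "real_of_int \<bar>z $ i\<bar> \<le> r / \<alpha>" using \<alpha>(1) by (simp add: field_simps)
    then show "\<bar>z $ i\<bar> \<le> int (nat \<lceil>r / \<alpha>\<rceil>)" by linarith
  qed
  then show ?thesis by blast
qed

lemma emb_eq_iff [simp]: "emb x = emb y \<longleftrightarrow> x = y"
proof
  obtain \<alpha> where \<alpha>: "0 < \<alpha>" "\<And>z i. \<alpha> * real_of_int \<bar>z $ i\<bar> \<le> norm (emb z)" using emb_lower by blast
  assume "emb x = emb y"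
  then have "emb (x - y) = 0" by (simp add: emb_diff)
  then have "\<alpha> * real_of_int \<bar>(x - y) $ i\<bar> \<le> 0" for i using \<alpha>(2)[of "x - y" i] by simp
  then have "real_of_int \<bar>(x - y) $ i\<bar> \<le> 0" for i using \<alpha>(1) by (simp add: mult_le_0_iff)
  then show "x = y" by (simp add: vec_eq_iff)
qed simp

lemma inj_emb: "inj emb"
  by (simp add: inj_on_def)

lemma node_emb: "l \<in> \<Lambda> \<Longrightarrow> Rdef \<le> norm l \<Longrightarrow> \<exists>z. l = emb z"
proof -
  assume "l \<in> \<Lambda>" "Rdef \<le> norm l"
  then have "l \<in> \<Lambda> - ball 0 Rdef" by simp
  then have "l \<in> range emb" unfolding lattice_outside range_emb by blast
  then show ?thesis by blast
qed

lemma emb_node: "Rdef \<le> norm (emb z) \<Longrightarrow> emb z \<in> \<Lambda>"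
proof -
  assume "Rdef \<le> norm (emb z)"
  then have "emb z \<in> bravais_lattice A - ball 0 Rdef" by (simp flip: range_emb)
  then show ?thesis unfolding lattice_outside[symmetric] by blast
qed

lemma emb_unbounded: "\<exists>z. r \<le> norm (emb z)"
proof (rule ccontr)
  assume "\<not> ?thesis"
  then have r: "\<And>z. norm (emb z) \<le> r" by (meson linear)
  obtain n where "\<And>z :: int^'d. z \<in> cube n" using emb_bounded[of r] r by blast
  then have "axis undefined (int n + 1) \<in> (cube n :: (int^'d) set)" .
  then show False by (auto simp: cube_def axis_def dest!: spec[of _ undefined])
qed

text \<open>Lattice points are separated by \<open>emb_lower\<close>. Each of the finitely many core
  nodes has its own positive distance from all other nodes, and the minimum of these numbers
  works.\<close>

lemma separated_nodes: "\<exists>\<delta>>0. \<forall>x\<in>\<Lambda>. \<forall>y\<in>\<Lambda>. x \<noteq> y \<longrightarrow> \<delta> \<le> dist x y"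
proof -
  obtain \<alpha> where \<alpha>: "0 < \<alpha>" "\<And>z i. \<alpha> * real_of_int \<bar>z $ i\<bar> \<le> norm (emb z)" using emb_lower by blast
  have lat: "\<alpha> \<le> dist (emb x) (emb y)" if ne: "x \<noteq> y" for x y
  proof -
    obtain i where "x $ i \<noteq> y $ i" using ne by (auto simp: vec_eq_iff)
    then have "1 \<le> \<bar>(x - y) $ i\<bar>" by simp
    then have "\<alpha> * 1 \<le> \<alpha> * real_of_int \<bar>(x - y) $ i\<bar>" using \<alpha>(1) by (intro mult_left_mono) linarith+
    also have "\<dots> \<le> norm (emb (x - y))" by (rule \<alpha>(2))
    finally show ?thesis by (simp add: emb_diff dist_norm)
  qed
  have fin: "finite (\<Lambda> \<inter> cball p 1)" for p
  proof -
    obtain n where n: "\<And>z. norm (emb z) \<le> norm p + 1 \<Longrightarrow> z \<in> cube n" using emb_bounded by blast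
    have "\<Lambda> \<inter> cball p 1 \<subseteq> (\<Lambda> \<inter> ball 0 Rdef) \<union> emb ` cube n"
    proof
      fix l assume l: "l \<in> \<Lambda> \<inter> cball p 1"
      show "l \<in> (\<Lambda> \<inter> ball 0 Rdef) \<union> emb ` cube n"
      proof (cases "norm l < Rdef")
        case False
        then have "Rdef \<le> norm l" by simp
        then obtain z where z: "l = emb z" using node_emb[of l] l by blast
        have "norm l \<le> norm p + 1" using l norm_triangle_ineq2[of l p] by (simp add: dist_norm norm_minus_commute)
        then show ?thesis using n z by blast
      qed (use l in auto)
    qed
    then show ?thesis by (rule finite_subset) (simp add: core_finite)
  qed
  have "\<exists>d>0. \<forall>q\<in>\<Lambda>. q \<noteq> p \<longrightarrow> d \<le> dist p q" for p
  proof -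
    obtain d where d: "0 < d" "\<And>q. q \<in> \<Lambda> \<inter> cball p 1 \<Longrightarrow> q \<noteq> p \<Longrightarrow> d \<le> dist p q"
      using finite_set_avoid[OF fin[of p], of p] by blast
    then show ?thesis by (intro exI[of _ "min d 1"]) (force simp: min_le_iff_disj)
  qed
  then obtain d where d: "\<And>p. 0 < d p" "\<And>p q. q \<in> \<Lambda> \<Longrightarrow> q \<noteq> p \<Longrightarrow> d p \<le> dist p q" by metis
  define \<delta> where "\<delta> = Min (insert \<alpha> (d ` (\<Lambda> \<inter> ball 0 Rdef)))"
  have \<delta>: "0 < \<delta>" "\<delta> \<le> \<alpha>" "\<And>p. p \<in> \<Lambda> \<Longrightarrow> norm p < Rdef \<Longrightarrow> \<delta> \<le> d p"
    using core_finite \<alpha>(1) d(1) by (auto simp: \<delta>_def Min_gr_iff intro!: Min_le)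
  have "\<delta> \<le> dist x y" if xy: "x \<in> \<Lambda>" "y \<in> \<Lambda>" "x \<noteq> y" for x y
  proof -
    consider "norm x < Rdef" | "norm y < Rdef" | "Rdef \<le> norm x" "Rdef \<le> norm y" by linarith
    then show ?thesis
    proof cases
      case 1
      then show ?thesis using \<delta>(3)[of x] d(2)[of y x] xy by fastforce
    next
      case 2
      then show ?thesis using \<delta>(3)[of y] d(2)[of x y] xy by (fastforce simp: dist_commute)
    next
      case 3
      then obtain a b where "x = emb a" "y = emb b" using node_emb xy by blast
      then show ?thesis using lat[of a b] \<delta>(2) xy by auto
    qed
  qed
  then show ?thesis using \<delta>(1) by blast
qed

lemma covering_nodes: "\<exists>\<rho>>0. \<forall>x. \<exists>l\<in>\<Lambda>. dist x l < \<rho>"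
proof -
  obtain B where B: "A ** B = mat 1" using nonsingular unfolding invertible_def by blast
  \<comment> \<open>The shift by \<open>p\<close> moves any lattice point of the defect ball out of
    it, since \<open>emb p\<close> has at least twice the radius; the node found this way is farther
    off by a fixed amount only.\<close>
  obtain p where p: "2 * Rdef \<le> norm (emb p)" using emb_unbounded by blast
  define \<rho> where "\<rho> = norm A * real CARD('d) + norm (emb p) + 1"
  have "\<exists>l\<in>\<Lambda>. dist x l < \<rho>" for x
  proof -
    define y where "y = B *v x"
    define z :: "int^'d" where "z = (\<chi> i. \<lfloor>y $ i\<rfloor>)"
    have "\<bar>(y - (\<chi> i. real_of_int (z $ i))) $ i\<bar> \<le> 1" for i by (simp add: z_def) linarith
    then have "norm (y - (\<chi> i. real_of_int (z $ i))) \<le> real CARD('d) * 1"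
      using norm_le_l1_cart[of "y - (\<chi> i. real_of_int (z $ i))"]
        sum_bounded_above[of UNIV "\<lambda>i. \<bar>(y - (\<chi> i. real_of_int (z $ i))) $ i\<bar>" 1] by fastforce
    then have n: "norm A * norm (y - (\<chi> i. real_of_int (z $ i))) \<le> norm A * real CARD('d)"
      by (intro mult_left_mono) auto
    have "x = A *v y" using B by (simp add: y_def matrix_vector_mul_assoc)
    then have "x - emb z = A *v (y - (\<chi> i. real_of_int (z $ i)))" by (simp add: emb_def matrix_vector_mult_diff_distrib)
    then have d: "dist x (emb z) \<le> norm A * real CARD('d)"
      using norm_matrix_vector_le[of A "y - (\<chi> i. real_of_int (z $ i))"] n by (simp add: dist_norm)
    show ?thesis
    proof (cases "Rdef \<le> norm (emb z)")
      case True
      then show ?thesis using d emb_node[OF True] by (intro bexI[of _ "emb z"]) (auto simp: \<rho>_def add_nonneg_pos intro: le_less_trans)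
    next
      case False
      have "norm (emb p) \<le> norm (emb (z + p)) + norm (emb z)"
        using norm_triangle_ineq4[of "emb (z + p)" "emb z"] by (simp add: emb_add)
      then have "Rdef \<le> norm (emb (z + p))" using p False by linarith
      moreover have "dist x (emb (z + p)) \<le> dist x (emb z) + norm (emb p)"
        using dist_triangle[of x "emb (z + p)" "emb z"] by (simp add: emb_add dist_norm)
      ultimately show ?thesis using d emb_node by (intro bexI[of _ "emb (z + p)"]) (auto simp: \<rho>_def)
    qed
  qed
  moreover have "0 < \<rho>" by (simp add: \<rho>_def add_nonneg_pos)
  ultimately show ?thesis by blast
qed

end

sublocale point_defect \<subseteq> mesh \<Lambda> \<T> \<R> rcut
  by unfold_locales (use partition separated_nodes covering_nodes rcut_pos stencils stencil_edges in auto)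

section \<open>The homogeneous stencil and the forms of the site potentials\<close>

context point_defect begin

definition S :: "(int^'d) set" where "S = {z. emb z \<in> \<R>hom}"

lemma far_imp: "Rdef + rcut \<le> norm l \<Longrightarrow> Rdef \<le> norm l"
  using rcut_pos by linarith

text \<open>A witness from which properties of the homogeneous stencil are read off. The margin
  \<open>rcut\<close> keeps its neighbours outside the defect ball.\<close>

lemma Rhom_node: "\<exists>l\<in>\<Lambda>. Rdef + rcut \<le> norm l \<and> \<R> l = \<R>hom"
proof -
  obtain z where "Rdef + rcut \<le> norm (emb z)" using emb_unbounded by blast
  then show ?thesis using emb_node[OF far_imp] stencil_hom[OF emb_node[OF far_imp] far_imp] by blast
qed

text \<open>The stencil vectors are lattice vectors because, around a far node, both the node and
  its neighbour are lattice points, and \<rho> is their difference.\<close>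

lemma emb_S: "emb ` S = \<R>hom"
proof -
  obtain l where l: "l \<in> \<Lambda>" "Rdef + rcut \<le> norm l" and Rl: "\<R> l = \<R>hom" using Rhom_node by blast
  have "\<exists>z. \<rho> = emb z" if \<rho>: "\<rho> \<in> \<R>hom" for \<rho>
  proof -
    have lr: "l + \<rho> \<in> \<Lambda>" "norm \<rho> < rcut" using R_node[OF l(1)] \<rho> Rl by auto
    have "Rdef \<le> norm (l + \<rho>)" using norm_triangle_ineq2[of l "- \<rho>"] l lr by simp
    then obtain x y where "l + \<rho> = emb x" "l = emb y"
      using node_emb[OF lr(1)] node_emb[OF l(1) far_imp[OF l(2)]] by blast
    then have "\<rho> = emb (x - y)" by (simp add: emb_diff algebra_simps)
    then show ?thesis by blast
  qed
  then show ?thesis by (auto simp: S_def)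
qed

lemma finite_Rhom: "finite \<R>hom"
  using Rhom_node finite_R by metis

lemma finite_S': "finite S"
  using finite_Rhom emb_S finite_imageD[of emb S] inj_emb by (metis inj_on_subset subset_UNIV)

lemma Rhom_short: "\<rho> \<in> \<R>hom \<Longrightarrow> norm \<rho> < rcut"
proof -
  obtain l where l: "l \<in> \<Lambda>" "\<R> l = \<R>hom" using Rhom_node by blast
  then show "\<rho> \<in> \<R>hom \<Longrightarrow> norm \<rho> < rcut" using R_node[OF l(1)] by auto
qed

lemma S_cube: "\<exists>m>0. S \<subseteq> cube m"
proof -
  obtain n where "\<And>z. norm (emb z) \<le> rcut \<Longrightarrow> z \<in> cube n" using emb_bounded by blast
  then have "S \<subseteq> cube n" using Rhom_short by (auto simp: S_def intro: less_imp_le)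
  then have "S \<subseteq> cube (n + 1)" using cube_mono[of n "n + 1"] by auto
  then show ?thesis by (intro exI[of _ "n + 1"]) simp
qed

lemma axis_in_S: "axis i 1 \<in> S"
  using stencil_basis[of i] by (simp add: S_def emb_axis)

end

lemma C2_bound_cong:
  assumes "\<And>g. g \<in> stencil_space R \<Longrightarrow> f g = f' g" "C2_bound M K R f d1 d2"
  shows "C2_bound M K R f' d1 d2"
proof -
  have "(\<lambda>\<rho>. g \<rho> + h \<rho>) \<in> stencil_space R" if "g \<in> stencil_space R" "h \<in> stencil_space R" for g h
    using that by (simp add: stencil_space_def)
  then show ?thesis using assms unfolding C2_bound_def by simp
qed

context point_defect begin

text \<open>Derivative forms exist site by site. Taking those of one far site \<open>l0\<close> for
  all sites outside the defect ball leaves finitely many others, hence uniform constants, and gives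
  the same forms at every such site.\<close>

lemma energy_model_forms:
  assumes "continuous_extension \<Lambda> \<T> (energy_c \<Lambda> \<R> V) E"
  shows "\<exists>d1 d2 e1 e2. energy_model \<Lambda> \<T> \<R> rcut V d1 d2 E \<and> C2_forms \<R>hom Vhom e1 e2 \<and>
    (\<forall>l\<in>\<Lambda>. Rdef \<le> norm l \<longrightarrow> d1 l = e1 \<and> d2 l = e2)"
proof -
  obtain n where n: "k = Suc (Suc (Suc n))" using k_ge_4 by (intro that[of "k - 3"]) simp
  have "\<exists>d1 d2. C2_forms (\<R> l) (V l) d1 d2" if "l \<in> \<Lambda>" for l
    using Ck_stencil_C2_forms[OF finite_R[OF that]] potential_Ck[OF that] n by blast
  then obtain c1 c2 where c: "\<And>l. l \<in> \<Lambda> \<Longrightarrow> C2_forms (\<R> l) (V l) (c1 l) (c2 l)" by metis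
  obtain l0 where l0: "l0 \<in> \<Lambda>" "Rdef + rcut \<le> norm l0" "\<R> l0 = \<R>hom" using Rhom_node by blast
  have V0: "V l0 g = Vhom g" if "g \<in> stencil_space \<R>hom" for g
    using potential_hom[OF l0(1) far_imp[OF l0(2)] that] .
  have hom: "C2_forms \<R>hom Vhom (c1 l0) (c2 l0)"
    using c[OF l0(1)] C2_bound_cong[where f="V l0" and f'=Vhom and R="\<R>hom", OF V0] unfolding C2_forms_def l0(3) by blast
  define d1 where "d1 l = (if Rdef \<le> norm l then c1 l0 else c1 l)" for l
  define d2 where "d2 l = (if Rdef \<le> norm l then c2 l0 else c2 l)" for l
  have uni: "\<exists>K\<ge>0. \<forall>l\<in>\<Lambda>. C2_bound M K (\<R> l) (V l) (d1 l) (d2 l)" for M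
  proof -
    have "\<exists>K\<ge>0. \<forall>l\<in>\<Lambda> \<inter> ball 0 Rdef. C2_bound M K (\<R> l) (V l) (c1 l) (c2 l)"
      using core_finite
    proof (rule uniform_bound_finite)
      show "\<exists>K\<ge>0. C2_bound M K (\<R> l) (V l) (c1 l) (c2 l)" if "l \<in> \<Lambda> \<inter> ball 0 Rdef" for l
        using c[of l] that unfolding C2_forms_def by blast
    qed (rule C2_bound_mono)
    then obtain K where K: "0 \<le> K" "\<And>l. l \<in> \<Lambda> \<Longrightarrow> norm l < Rdef \<Longrightarrow> C2_bound M K (\<R> l) (V l) (c1 l) (c2 l)"
      by auto
    obtain K' where K': "0 \<le> K'" "C2_bound M K' \<R>hom Vhom (c1 l0) (c2 l0)"
      using hom unfolding C2_forms_def by blast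
    have "C2_bound M (max K K') (\<R> l) (V l) (d1 l) (d2 l)" if l: "l \<in> \<Lambda>" for l
    proof (cases "Rdef \<le> norm l")
      case True
      have "C2_bound M K' \<R>hom (V l) (c1 l0) (c2 l0)"
        by (rule C2_bound_cong[where f=Vhom, OF _ K'(2)]) (simp add: potential_hom[OF l True])
      then show ?thesis
        using C2_bound_mono[of M K' "\<R> l" "V l" "c1 l0" "c2 l0" "max K K'"] stencil_hom[OF l True] True by (simp add: d1_def d2_def)
    next
      case False
      then show ?thesis
        using C2_bound_mono[of M K "\<R> l" "V l" "c1 l" "c2 l" "max K K'"] K(2)[OF l] by (simp add: d1_def d2_def)
    qed
    then show ?thesis using K(1) by (intro exI[of _ "max K K'"]) auto
  qed
  have lin1: "d1 l g (\<lambda>\<rho>. x *\<^sub>R h \<rho> + h' \<rho>) = x * d1 l g h + d1 l g h'" if "l \<in> \<Lambda>" for l g x h h'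
    using c[OF that] c[OF l0(1)] by (simp add: C2_forms_def d1_def)
  have lin3: "d2 l g j (\<lambda>\<rho>. x *\<^sub>R h \<rho> + h' \<rho>) = x * d2 l g j h + d2 l g j h'" if "l \<in> \<Lambda>" for l g x h h' j
    using c[OF that] c[OF l0(1)] by (simp add: C2_forms_def d2_def)
  have cont: "continuous_on (stencil_space (\<R> l)) (V l)" if "l \<in> \<Lambda>" for l
    using Ck_stencil_le[OF potential_Ck[OF that], of 0] by simp
  have "energy_model \<Lambda> \<T> \<R> rcut V d1 d2 E"
    by unfold_locales (fact lin1 lin3 uni cont potential_0 assms)+
  moreover have "\<forall>l\<in>\<Lambda>. Rdef \<le> norm l \<longrightarrow> d1 l = c1 l0 \<and> d2 l = c2 l0" by (simp add: d1_def d2_def)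
  ultimately show ?thesis using hom by blast
qed

end

section \<open>Transfer between the defect configuration and the integer lattice\<close>

locale defect_energy = point_defect A Rdef \<Lambda> \<T> rcut \<R> \<R>hom V Vhom k + energy_model \<Lambda> \<T> \<R> rcut V d1 d2 E
  for A :: "real^'d^'d" and Rdef \<Lambda> \<T> rcut \<R> \<R>hom V Vhom k d1 d2 E +
  fixes e1 e2
  assumes hom_forms: "C2_forms \<R>hom Vhom e1 e2"
    and far_forms: "\<And>l. l \<in> \<Lambda> \<Longrightarrow> Rdef \<le> norm l \<Longrightarrow> d1 l = e1 \<and> d2 l = e2"
begin

abbreviation DZ :: "(int^'d \<Rightarrow> real^'d) \<Rightarrow> int^'d \<Rightarrow> real" where
  "DZ e z \<equiv> stencil_norm S (fd e z)"

definition conv :: "(int^'d \<Rightarrow> real^'d) \<Rightarrow> real^'d \<Rightarrow> real^'d" where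
  "conv g = (\<lambda>\<rho>. if \<rho> \<in> \<R>hom then g (inv emb \<rho>) else 0)"

text \<open>Inside the defect ball \<open>near\<close> takes a dummy value, so \<open>extend e\<close> is constant there.\<close>
definition near :: "real^'d \<Rightarrow> int^'d" where
  "near l = (if Rdef \<le> norm l then inv emb l else 0)"

definition extend :: "(int^'d \<Rightarrow> real^'d) \<Rightarrow> real^'d \<Rightarrow> real^'d" where
  "extend e l = e (near l)"

text \<open>Lattice sites in the defect ball need not be nodes; the value 0 there is a filler that
  affects finitely many stencils.\<close>

definition restr :: "(real^'d \<Rightarrow> real^'d) \<Rightarrow> int^'d \<Rightarrow> real^'d" where
  "restr u z = (if Rdef \<le> norm (emb z) then u (emb z) else 0)"

text \<open>The margin \<open>rcut\<close> keeps the entire stencil of such a site outside the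
  defect ball, where all lattice points are nodes; there \<open>restr\<close> and
  \<open>extend\<close> preserve stencils.\<close>

definition far :: "(int^'d) set" where
  "far = {z. Rdef + rcut \<le> norm (emb z)}"

definition core :: "(real^'d) set" where
  "core = {l \<in> \<Lambda>. norm l < Rdef + rcut}"

lemma inv_emb [simp]: "inv emb (emb z) = z"
  by (rule inv_f_f[OF inj_emb])

lemma conv_space [simp]: "conv g \<in> stencil_space \<R>hom"
  by (simp add: conv_def stencil_space_def)

lemma conv_lin: "conv (\<lambda>\<rho>. x *\<^sub>R g \<rho> + h \<rho>) = (\<lambda>\<rho>. x *\<^sub>R conv g \<rho> + conv h \<rho>)"
  by (simp add: conv_def fun_eq_iff)

lemma conv_norm: "stencil_norm \<R>hom (conv g) = stencil_norm S g"
proof -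
  have "(\<Sum>\<rho>\<in>\<R>hom. (norm (conv g \<rho>))\<^sup>2) = (\<Sum>s\<in>S. (norm (conv g (emb s)))\<^sup>2)"
    by (rule sum.reindex_cong[OF inj_on_subset[OF inj_emb] emb_S[symmetric]]) auto
  also have "\<dots> = (\<Sum>s\<in>S. (norm (g s))\<^sup>2)"
    by (rule sum.cong) (auto simp: conv_def S_def)
  finally have "(stencil_norm \<R>hom (conv g))\<^sup>2 = (stencil_norm S g)\<^sup>2" by (simp add: stencil_norm_sq)
  then show ?thesis by (simp add: power2_eq_iff_nonneg)
qed

lemma near_emb: "Rdef \<le> norm (emb z) \<Longrightarrow> near (emb z) = z"
  by (simp add: near_def)

lemma extend_emb: "Rdef \<le> norm (emb z) \<Longrightarrow> extend e (emb z) = e z"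
  by (simp add: extend_def near_emb)

lemma far_node: "z \<in> far \<Longrightarrow> emb z \<in> \<Lambda>" "z \<in> far \<Longrightarrow> Rdef \<le> norm (emb z)"
  using emb_node far_imp by (auto simp: far_def)

lemma far_shift: "z \<in> far \<Longrightarrow> s \<in> S \<Longrightarrow> Rdef \<le> norm (emb (z + s))"
proof -
  assume "z \<in> far" "s \<in> S"
  then have "norm (emb s) < rcut" "Rdef + rcut \<le> norm (emb z)" using Rhom_short by (auto simp: S_def far_def)
  then show ?thesis using norm_triangle_ineq2[of "emb z" "- emb s"] by (simp add: emb_add)
qed

lemma far_stencil:
  assumes z: "z \<in> far" and u: "\<And>y. Rdef \<le> norm (emb y) \<Longrightarrow> u (emb y) = e y"
  shows "st u (emb z) = conv (fd e z)" "Dn u (emb z) = DZ e z"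
proof -
  have R: "\<R> (emb z) = \<R>hom" using stencil_hom far_node[OF z] by blast
  show 1: "st u (emb z) = conv (fd e z)"
  proof
    fix \<rho>
    show "st u (emb z) \<rho> = conv (fd e z) \<rho>"
    proof (cases "\<rho> \<in> \<R>hom")
      case True
      then obtain s where s: "s \<in> S" "\<rho> = emb s" using emb_S by blast
      have "u (emb z + emb s) = e (z + s)" using u[OF far_shift[OF z s(1)]] by (simp add: emb_add)
      then show ?thesis using True s u[OF far_node(2)[OF z]] by (simp add: fd_stencil_def conv_def R fd_def)
    qed (simp add: fd_stencil_def conv_def R)
  qed
  show "Dn u (emb z) = DZ e z" using st_norm[of "emb z" u] unfolding 1 unfolding R conv_norm by simp
qed

lemma far_extend: "z \<in> far \<Longrightarrow> st (extend e) (emb z) = conv (fd e z)" "z \<in> far \<Longrightarrow> Dn (extend e) (emb z) = DZ e z"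
  using far_stencil[of z "extend e" e] extend_emb by auto

lemma far_restr: "z \<in> far \<Longrightarrow> st u (emb z) = conv (fd (restr u) z)" "z \<in> far \<Longrightarrow> Dn u (emb z) = DZ (restr u) z"
  using far_stencil[of z u "restr u"] by (auto simp: restr_def)

lemma nodes_split: "core \<union> emb ` far = \<Lambda>" "core \<inter> emb ` far = {}"
proof -
  have "l \<in> core \<union> emb ` far" if l: "l \<in> \<Lambda>" for l
  proof (cases "norm l < Rdef + rcut")
    case False
    then have "Rdef + rcut \<le> norm l" by simp
    then obtain z where "l = emb z" using node_emb[OF l far_imp] by blast
    then show ?thesis using False by (auto simp: far_def)
  qed (use l in \<open>auto simp: core_def\<close>)
  moreover have "core \<subseteq> \<Lambda>" by (auto simp: core_def)
  ultimately show "core \<union> emb ` far = \<Lambda>" using far_node(1) by blast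
  show "core \<inter> emb ` far = {}" by (auto simp: core_def far_def)
qed

lemma finite_core: "finite core"
  by (rule finite_subset[OF _ finite_nodes[of 0 "Rdef + rcut"]]) (auto simp: core_def)

lemma far_cofinite: "\<exists>q. - far \<subseteq> cube q"
proof -
  obtain q where "\<And>z. norm (emb z) \<le> Rdef + rcut \<Longrightarrow> z \<in> cube q" using emb_bounded by blast
  then show ?thesis by (intro exI[of _ q]) (force simp: far_def)
qed

lemma inj_emb_on: "inj_on emb X"
  using inj_emb inj_on_subset by blast

text \<open>Unit steps along axes lead from \<open>y\<close> to 0, and each step is a stencil
  difference. The single number \<open>q\<close> is both factor and radius, so that enlarging it
  weakens the bound.\<close>

lemma oscillation:
  "\<exists>q. \<forall>e. norm (e y - e 0) \<le> real q * (\<Sum>z\<in>cube q. DZ e z)"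
proof (induction "\<Sum>i\<in>UNIV. nat \<bar>y $ i\<bar>" arbitrary: y rule: less_induct)
  case less
  show ?case
  proof (cases "y = 0")
    case False
    then obtain i where i: "y $ i \<noteq> 0" by (auto simp: vec_eq_iff)
    define x where "x = y - axis i (sgn (y $ i))"
    have "(\<Sum>i\<in>UNIV. nat \<bar>x $ i\<bar>) < (\<Sum>i\<in>UNIV. nat \<bar>y $ i\<bar>)"
      by (rule sum_strict_mono_ex1) (use i in \<open>auto simp: x_def axis_def sgn_if intro!: exI[of _ i]\<close>)
    from less[OF this] obtain q where q: "\<And>e. norm (e x - e 0) \<le> real q * (\<Sum>z\<in>cube q. DZ e z)" by blast
    obtain p where p: "norm (emb x) \<le> p" "norm (emb y) \<le> p" by (meson max.cobounded1 max.cobounded2)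
    obtain r where r: "\<And>z. norm (emb z) \<le> p \<Longrightarrow> z \<in> cube r" using emb_bounded by blast
    have xy: "x \<in> cube r" "y \<in> cube r" using p by (auto intro: r)
    have "norm (e y - e 0) \<le> real (q + r + 1) * (\<Sum>z\<in>cube (q + r + 1). DZ e z)" for e
    proof -
      let ?s = "\<Sum>z\<in>cube (q + r + 1). DZ e z"
      have s: "(\<Sum>z\<in>cube q. DZ e z) \<le> ?s" by (rule sum_mono2) (use cube_mono[of q "q + r + 1"] in auto)
      have D: "DZ e z \<le> ?s" if "z \<in> cube r" for z
        using that cube_mono[of r "q + r + 1"] by (intro member_le_sum) auto
      have "norm (e y - e x) \<le> ?s"
      proof (cases "0 < y $ i")
        case True
        then have "norm (e y - e x) = norm (fd e x (axis i 1))" by (simp add: fd_def x_def)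
        also have "\<dots> \<le> DZ e x" by (rule norm_le_stencil_norm[OF finite_S' axis_in_S])
        finally show ?thesis using D[OF xy(1)] by simp
      next
        case False
        then have "x = y + axis i 1" using i by (auto simp: x_def vec_eq_iff axis_def)
        then have "norm (e y - e x) = norm (fd e y (axis i 1))" by (simp add: fd_def norm_minus_commute)
        also have "\<dots> \<le> DZ e y" by (rule norm_le_stencil_norm[OF finite_S' axis_in_S])
        finally show ?thesis using D[OF xy(2)] by simp
      qed
      moreover have "norm (e x - e 0) \<le> real q * ?s"
        using q[of e] mult_left_mono[OF s, of "real q"] by simp
      moreover have "norm (e y - e 0) \<le> norm (e y - e x) + norm (e x - e 0)"
        using norm_triangle_ineq[of "e y - e x" "e x - e 0"] by simp
      moreover have "0 \<le> real r * ?s" by (intro mult_nonneg_nonneg sum_nonneg) auto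
      ultimately show ?thesis by (simp add: algebra_simps)
    qed
    then show ?thesis by blast
  qed (auto intro: exI[of _ 0])
qed

text \<open>On the stencils of core nodes \<open>extend e\<close> involves only finitely many values
  of \<open>e\<close>, and their differences are controlled by \<open>oscillation\<close>.\<close>

lemma core_bound:
  "\<exists>K\<ge>0. \<exists>q. \<forall>l\<in>core. \<forall>e. Dn (extend e) l \<le> K * (\<Sum>z\<in>cube q. DZ e z)"
proof -
  \<comment> \<open>The real \<open>K\<close> serves as factor and, rounded up, as radius, so that
    bounds for finitely many points can be merged by \<open>uniform_bound_finite\<close>.\<close>
  define P where "P y K \<longleftrightarrow> (\<forall>e. norm (e y - e 0) \<le> K * (\<Sum>z\<in>cube (nat \<lceil>K\<rceil>). DZ e z))" for y K
  define Y where "Y = (\<Union>l\<in>core. insert (near l) ((\<lambda>\<rho>. near (l + \<rho>)) ` \<R> l))"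
  have "\<exists>K\<ge>0. \<forall>y\<in>Y. P y K"
  proof (rule uniform_bound_finite)
    show "finite Y" unfolding Y_def using finite_core finite_R by (auto simp: core_def)
    show "\<exists>K\<ge>0. P y K" for y
    proof -
      obtain q where "\<And>e. norm (e y - e 0) \<le> real q * (\<Sum>z\<in>cube q. DZ e z)" using oscillation by blast
      then show ?thesis by (intro exI[of _ "real q"]) (simp add: P_def)
    qed
    \<comment> \<open>Monotonicity is required for all reals, hence the separate treatment of
      negative \<open>K\<close> and \<open>K'\<close>, for which the cube degenerates to radius
      0.\<close>
    show "P y K'" if "P y K" "K \<le> K'" for y K K'
      unfolding P_def
    proof
      fix e
      have "(\<Sum>z\<in>cube (nat \<lceil>K\<rceil>). DZ e z) \<le> (\<Sum>z\<in>cube (nat \<lceil>K'\<rceil>). DZ e z)"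
        by (intro sum_mono2 cube_mono[OF nat_mono[OF ceiling_mono[OF that(2)]]]) auto
      show "norm (e y - e 0) \<le> K' * (\<Sum>z\<in>cube (nat \<lceil>K'\<rceil>). DZ e z)"
      proof (cases "0 \<le> K")
        case True
        have "K * (\<Sum>z\<in>cube (nat \<lceil>K\<rceil>). DZ e z) \<le> K' * (\<Sum>z\<in>cube (nat \<lceil>K'\<rceil>). DZ e z)"
          using \<open>(\<Sum>z\<in>cube (nat \<lceil>K\<rceil>). DZ e z) \<le> _\<close> that(2) True by (intro mult_mono) (auto intro: sum_nonneg)
        then show ?thesis using that(1) unfolding P_def by (meson order_trans)
      next
        case False
        have "K * (\<Sum>z\<in>cube (nat \<lceil>K\<rceil>). DZ e z) \<le> K' * (\<Sum>z\<in>cube (nat \<lceil>K\<rceil>). DZ e z)"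
          using that(2) by (intro mult_right_mono) (auto intro: sum_nonneg)
        then have n: "norm (e y - e 0) \<le> K' * (\<Sum>z\<in>cube (nat \<lceil>K\<rceil>). DZ e z)"
          using that(1) unfolding P_def by (meson order_trans)
        show ?thesis
        proof (cases "0 \<le> K'")
          case True
          then show ?thesis
            using n mult_left_mono[OF \<open>(\<Sum>z\<in>cube (nat \<lceil>K\<rceil>). DZ e z) \<le> _\<close> True] by linarith
        next
          case False
          then have "nat \<lceil>K'\<rceil> = nat \<lceil>K\<rceil>" using \<open>\<not> 0 \<le> K\<close> by simp
          then show ?thesis using n by simp
        qed
      qed
    qed
  qed
  then obtain K where K: "0 \<le> K" "\<And>y. y \<in> Y \<Longrightarrow> P y K" by blast
  define N where "N = (\<Sum>l\<in>core. card (\<R> l))"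
  have "Dn (extend e) l \<le> (real N * (2 * K)) * (\<Sum>z\<in>cube (nat \<lceil>K\<rceil>). DZ e z)" if l: "l \<in> core" for l e
  proof -
    let ?s = "\<Sum>z\<in>cube (nat \<lceil>K\<rceil>). DZ e z"
    have s0: "0 \<le> ?s" by (intro sum_nonneg) auto
    have lY: "near l \<in> Y" using l by (auto simp: Y_def)
    have 1: "norm (extend e (l + \<rho>) - extend e l) \<le> 2 * K * ?s" if "\<rho> \<in> \<R> l" for \<rho>
    proof -
      have "near (l + \<rho>) \<in> Y" using l that by (auto simp: Y_def)
      then have "norm (e (near (l + \<rho>)) - e 0) \<le> K * ?s" "norm (e (near l) - e 0) \<le> K * ?s"
        using K(2) lY unfolding P_def by blast+
      then show ?thesis
        using norm_triangle_ineq4[of "e (near (l + \<rho>)) - e 0" "e (near l) - e 0"] by (simp add: extend_def)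
    qed
    have "Dn (extend e) l \<le> (\<Sum>\<rho>\<in>\<R> l. norm (extend e (l + \<rho>) - extend e l))"
      unfolding Dn_def stencil_norm_def fd_def by (rule L2_set_le_sum) simp
    also have "\<dots> \<le> real (card (\<R> l)) * (2 * K * ?s)" by (rule sum_bounded_above) (rule 1)
    also have "\<dots> \<le> real N * (2 * K * ?s)"
      unfolding N_def using l finite_core K(1) s0
      by (intro mult_right_mono) (auto intro!: member_le_sum)
    finally show ?thesis by (simp add: mult_ac)
  qed
  moreover have "0 \<le> real N * (2 * K)" using K by simp
  ultimately show ?thesis by blast
qed

text \<open>At far sites the strain of \<open>extend e\<close> is that of \<open>e\<close>; the
  finitely many core sites are absorbed by \<open>core_bound\<close> and Cauchy-Schwarz.\<close>

lemma extend_sq: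
  "\<exists>K\<ge>0. \<forall>e. (\<lambda>z. (DZ e z)\<^sup>2) summable_on UNIV \<longrightarrow>
     sq (extend e) \<and> (nD (extend e))\<^sup>2 \<le> K * (\<Sum>\<^sub>\<infinity>z. (DZ e z)\<^sup>2)"
proof -
  obtain K q where K: "0 \<le> K" "\<And>l e. l \<in> core \<Longrightarrow> Dn (extend e) l \<le> K * (\<Sum>z\<in>cube q. DZ e z)"
    using core_bound by blast
  define C where "C = real (card core) * (K\<^sup>2 * real (card (cube q :: (int^'d) set)))"
  have C: "0 \<le> C" by (simp add: C_def)
  have "sq (extend e) \<and> (nD (extend e))\<^sup>2 \<le> (C + 1) * (\<Sum>\<^sub>\<infinity>z. (DZ e z)\<^sup>2)"
    if e: "(\<lambda>z. (DZ e z)\<^sup>2) summable_on UNIV" for e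
  proof -
    let ?I = "\<Sum>\<^sub>\<infinity>z. (DZ e z)\<^sup>2"
    have efar: "(\<lambda>z. (DZ e z)\<^sup>2) summable_on far" using e by (rule summable_on_subset_banach) simp
    have eq: "((\<lambda>l. (Dn (extend e) l)\<^sup>2) \<circ> emb) z = (DZ e z)\<^sup>2" if "z \<in> far" for z
      using far_extend(2)[OF that] by simp
    have s1: "(\<lambda>l. (Dn (extend e) l)\<^sup>2) summable_on emb ` far"
      unfolding summable_on_reindex[OF inj_emb_on]
      using efar by (rule summable_on_cong[THEN iffD2, OF eq, rotated])
    have "(\<Sum>\<^sub>\<infinity>l\<in>emb ` far. (Dn (extend e) l)\<^sup>2) = (\<Sum>\<^sub>\<infinity>z\<in>far. (DZ e z)\<^sup>2)"
      unfolding infsum_reindex[OF inj_emb_on] using eq by (rule infsum_cong)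
    also have "\<dots> \<le> ?I" by (rule infsum_mono_neutral[OF efar e]) auto
    finally have i1: "(\<Sum>\<^sub>\<infinity>l\<in>emb ` far. (Dn (extend e) l)\<^sup>2) \<le> ?I" .
    have s2: "(\<lambda>l. (Dn (extend e) l)\<^sup>2) summable_on core" by (simp add: finite_core)
    have i2: "(\<Sum>\<^sub>\<infinity>l\<in>core. (Dn (extend e) l)\<^sup>2) \<le> C * ?I"
    proof -
      have "(Dn (extend e) l)\<^sup>2 \<le> K\<^sup>2 * real (card (cube q :: (int^'d) set)) * ?I" if l: "l \<in> core" for l
      proof -
        have "0 \<le> Dn (extend e) l" by (simp add: Dn_def)
        then have "(Dn (extend e) l)\<^sup>2 \<le> (K * (\<Sum>z\<in>cube q. DZ e z))\<^sup>2" using K(2)[OF l, of e] by (rule power_mono[rotated])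
        also have "\<dots> \<le> K\<^sup>2 * ((\<Sum>z\<in>cube q. (DZ e z)\<^sup>2) * real (card (cube q :: (int^'d) set)))"
          unfolding power_mult_distrib by (intro mult_left_mono sum_squared_le_sum_of_squares) auto
        also have "\<dots> \<le> K\<^sup>2 * (?I * real (card (cube q :: (int^'d) set)))"
          by (intro mult_left_mono mult_right_mono finite_sum_le_infsum e) auto
        finally show ?thesis by (simp add: mult_ac)
      qed
      then have "(\<Sum>l\<in>core. (Dn (extend e) l)\<^sup>2) \<le> real (card core) * (K\<^sup>2 * real (card (cube q :: (int^'d) set)) * ?I)"
        by (rule sum_bounded_above)
      then show ?thesis by (simp add: C_def finite_core mult_ac)
    qed
    have "sq (extend e)" using summable_on_Un_disjoint[OF s2 s1 nodes_split(2)] unfolding sq_def nodes_split(1) .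
    moreover have "(nD (extend e))\<^sup>2 \<le> (C + 1) * ?I"
      using infsum_Un_disjoint[OF s2 s1 nodes_split(2)] i1 i2 unfolding nD_sq nodes_split(1) by (simp add: algebra_simps)
    ultimately show ?thesis ..
  qed
  moreover have "0 \<le> C + 1" using C by simp
  ultimately show ?thesis by blast
qed

lemma restr_sq: "sq u \<Longrightarrow> (\<lambda>z. (DZ (restr u) z)\<^sup>2) summable_on UNIV"
proof -
  assume u: "sq u"
  have "(\<lambda>l. (Dn u l)\<^sup>2) summable_on emb ` far"
    using u unfolding sq_def by (rule summable_on_subset_banach) (use far_node in auto)
  then have s1: "((\<lambda>l. (Dn u l)\<^sup>2) \<circ> emb) summable_on far" unfolding summable_on_reindex[OF inj_emb_on] .
  have "(\<lambda>z. (DZ (restr u) z)\<^sup>2) summable_on far"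
    using s1 by (rule summable_on_cong[THEN iffD1, rotated]) (simp add: far_restr)
  moreover have "(\<lambda>z. (DZ (restr u) z)\<^sup>2) summable_on - far"
    using far_cofinite finite_subset[OF _ finite_cube] by (meson summable_on_finite)
  ultimately have "(\<lambda>z. (DZ (restr u) z)\<^sup>2) summable_on far \<union> - far" by (rule summable_on_Un_disjoint) simp
  then show ?thesis by simp
qed

end

lemma finite_subset_cube: "finite X \<Longrightarrow> \<exists>r. X \<subseteq> cube r"
proof (induction X rule: finite_induct)
  case (insert x X)
  then obtain r where "X \<subseteq> cube r" by blast
  moreover have "x \<in> cube (nat (inf_norm x))" unfolding cube_inf_norm by simp
  ultimately have "insert x X \<subseteq> cube (max r (nat (inf_norm x)))"
    using cube_mono[of r "max r (nat (inf_norm x))"] cube_mono[of "nat (inf_norm x)" "max r (nat (inf_norm x))"] by auto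
  then show ?case by blast
qed simp

lemma infsum_finite_support:
  fixes f :: "'b \<Rightarrow> real"
  assumes "finite Y" "\<And>y. y \<notin> Y \<Longrightarrow> f y = 0"
  shows "infsum f UNIV = sum f Y"
proof -
  have "infsum f UNIV = infsum f Y" by (rule infsum_cong_neutral) (use assms in auto)
  then show ?thesis using assms by simp
qed

section \<open>Finitely supported corrections, density and the form at infinity\<close>

context defect_energy begin

lemma fs_extend: "finite {y. z y \<noteq> 0} \<Longrightarrow> fs (extend z)"
proof -
  assume z: "finite {y. z y \<noteq> 0}"
  have "{l \<in> \<Lambda>. extend z l \<noteq> 0} \<subseteq> core \<union> emb ` {y. z y \<noteq> 0}"
  proof
    fix l assume l: "l \<in> {l \<in> \<Lambda>. extend z l \<noteq> 0}"
    then consider "l \<in> core" | y where "l = emb y" "y \<in> far" using nodes_split(1) by blast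
    then show "l \<in> core \<union> emb ` {y. z y \<noteq> 0}"
      by cases (use l far_node(2) in \<open>auto simp: extend_emb\<close>)
  qed
  then show ?thesis unfolding fs_def by (rule finite_subset) (simp add: finite_core z)
qed

lemma fd_outside_support:
  assumes z: "\<And>y. y \<notin> cube r \<Longrightarrow> z y = 0" and S: "S \<subseteq> cube m" and y: "y \<notin> cube (r + m)"
  shows "conv (fd z y) = (\<lambda>_. 0)" "DZ z y = 0"
proof -
  have "z (y + s) = 0" if "s \<in> S" for s
  proof (rule z)
    show "y + s \<notin> cube r" using cube_diff[of "y + s" r s m] that S y by auto
  qed
  moreover have "z y = 0" by (rule z) (use y cube_mono[of r "r + m"] in auto)
  ultimately have *: "fd z y s = 0" if "s \<in> S" for s using that by (simp add: fd_def)
  show "conv (fd z y) = (\<lambda>_. 0)"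
  proof
    show "conv (fd z y) \<rho> = 0" for \<rho>
    proof (cases "\<rho> \<in> \<R>hom")
      case True
      then obtain s where "s \<in> S" "\<rho> = emb s" using emb_S by blast
      then show ?thesis using * by (simp add: conv_def)
    qed (simp add: conv_def)
  qed
  then show "DZ z y = 0" using conv_norm[of "fd z y"] by simp
qed

text \<open>The index set may be enlarged because \<phi> vanishes wherever the stencil does; the
  enlarged set splits into the core, left as it is, and a lattice sum.\<close>

lemma act_sum:
  assumes Y: "finite Y" "\<And>y. y \<notin> Y \<Longrightarrow> conv (fd z y) = (\<lambda>_. 0)"
    and \<phi>: "\<And>l. l \<in> \<Lambda> \<Longrightarrow> st (extend z) l = (\<lambda>_. 0) \<Longrightarrow> \<phi> l = (0::real)"
  shows "sum \<phi> (act (extend z)) = sum \<phi> core + (\<Sum>y\<in>Y \<inter> far. \<phi> (emb y))"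
proof -
  have sub: "act (extend z) \<subseteq> core \<union> emb ` (Y \<inter> far)"
  proof
    fix l assume l: "l \<in> act (extend z)"
    then have "l \<in> \<Lambda>" using act_sub by blast
    then consider "l \<in> core" | y where "l = emb y" "y \<in> far" using nodes_split(1) by blast
    then show "l \<in> core \<union> emb ` (Y \<inter> far)"
    proof cases
      case 2
      then have "conv (fd z y) \<noteq> (\<lambda>_. 0)" using l far_extend(1)[OF 2(2)] by (simp add: act_def)
      then show ?thesis using Y 2 by auto
    qed auto
  qed
  have fin: "finite (core \<union> emb ` (Y \<inter> far))" using finite_core Y by auto
  have dis: "core \<inter> emb ` (Y \<inter> far) = {}" using nodes_split(2) by blast
  have "core \<union> emb ` (Y \<inter> far) \<subseteq> \<Lambda>" using nodes_split(1) by blast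
  then have "sum \<phi> (act (extend z)) = sum \<phi> (core \<union> emb ` (Y \<inter> far))"
    by (intro sum.mono_neutral_left[OF fin sub]) (use act_Dn \<phi> in blast)
  also have "\<dots> = sum \<phi> core + sum \<phi> (emb ` (Y \<inter> far))"
    by (rule sum.union_disjoint) (use finite_core Y dis in auto)
  also have "sum \<phi> (emb ` (Y \<inter> far)) = (\<Sum>y\<in>Y \<inter> far. \<phi> (emb y))"
    by (rule sum.reindex_cong[OF inj_emb_on]) auto
  finally show ?thesis .
qed

lemma d1_0: "l \<in> \<Lambda> \<Longrightarrow> d1 l g (\<lambda>_. 0) = 0"
  using d1_scaleR[of l g 0 "\<lambda>_. 0"] by simp

lemma d2_0: "l \<in> \<Lambda> \<Longrightarrow> d2 l g h (\<lambda>_. 0) = 0"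
  using d2_scaleR2[of l g h 0 "\<lambda>_. 0"] by simp

lemma dE_extend:
  assumes "finite Y" "\<And>y. y \<notin> Y \<Longrightarrow> conv (fd z y) = (\<lambda>_. 0)"
  shows "dE u (extend z) = (\<Sum>l\<in>core. d1 l (st u l) (st (extend z) l)) +
    (\<Sum>y\<in>Y \<inter> far. e1 (conv (fd (restr u) y)) (conv (fd z y)))"
proof -
  have "dE u (extend z) = (\<Sum>l\<in>core. d1 l (st u l) (st (extend z) l)) +
    (\<Sum>y\<in>Y \<inter> far. d1 (emb y) (st u (emb y)) (st (extend z) (emb y)))"
    unfolding dE_def by (rule act_sum[OF assms]) (simp_all add: d1_0)
  moreover have "d1 (emb y) (st u (emb y)) (st (extend z) (emb y)) = e1 (conv (fd (restr u) y)) (conv (fd z y))"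
    if "y \<in> Y \<inter> far" for y
    using that far_extend(1) far_restr(1) far_forms[OF far_node] by simp
  ultimately show ?thesis by simp
qed

lemma ddE_extend:
  assumes "finite Y" "\<And>y. y \<notin> Y \<Longrightarrow> conv (fd z y) = (\<lambda>_. 0)"
  shows "ddE u (extend z) = (\<Sum>l\<in>core. d2 l (st u l) (st (extend z) l) (st (extend z) l)) +
    (\<Sum>y\<in>Y \<inter> far. e2 (conv (fd (restr u) y)) (conv (fd z y)) (conv (fd z y)))"
proof -
  have "ddE u (extend z) = (\<Sum>l\<in>core. d2 l (st u l) (st (extend z) l) (st (extend z) l)) +
    (\<Sum>y\<in>Y \<inter> far. d2 (emb y) (st u (emb y)) (st (extend z) (emb y)) (st (extend z) (emb y)))"
    unfolding ddE_def by (rule act_sum[OF assms]) (simp_all add: d2_0)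
  moreover have "d2 (emb y) (st u (emb y)) (st (extend z) (emb y)) (st (extend z) (emb y))
      = e2 (conv (fd (restr u) y)) (conv (fd z y)) (conv (fd z y))"
    if "y \<in> Y \<inter> far" for y
    using that far_extend(1) far_restr(1) far_forms[OF far_node] by simp
  ultimately show ?thesis by simp
qed

lemma nD_extend:
  assumes "finite Y" "\<And>y. y \<notin> Y \<Longrightarrow> conv (fd z y) = (\<lambda>_. 0)" "fs (extend z)"
  shows "(nD (extend z))\<^sup>2 = (\<Sum>l\<in>core. (Dn (extend z) l)\<^sup>2) + (\<Sum>y\<in>Y \<inter> far. (DZ z y)\<^sup>2)"
proof -
  have "(nD (extend z))\<^sup>2 = (\<Sum>l\<in>core. (Dn (extend z) l)\<^sup>2) + (\<Sum>y\<in>Y \<inter> far. (Dn (extend z) (emb y))\<^sup>2)"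
    unfolding nD_sq_act[OF assms(3)]
  proof (rule act_sum[OF assms(1,2)])
    show "(Dn (extend z) l)\<^sup>2 = 0" if "l \<in> \<Lambda>" "st (extend z) l = (\<lambda>_. 0)" for l
      using st_norm[of l "extend z"] that by simp
  qed
  then show ?thesis by (simp add: far_extend(2))
qed

text \<open>The comparison displacement used for density and for the final rate: outside the defect
  ball it equals \<open>w\<close>, inside it equals \<open>u\<close> up to a constant. Subtracting
  the extended error from \<open>u\<close>, rather than extending \<open>w\<close>, thus keeps the
  distance to \<open>u\<close> as small as the error.\<close>

lemma fs_correction:
  assumes "finite {y. w y \<noteq> 0}"
  shows "fs (\<lambda>l. u l - extend (\<lambda>z. restr u z - w z) l)"
proof -
  have "{l \<in> \<Lambda>. u l - extend (\<lambda>z. restr u z - w z) l \<noteq> 0} \<subseteq> core \<union> emb ` {y. w y \<noteq> 0}"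
  proof
    fix l assume l: "l \<in> {l \<in> \<Lambda>. u l - extend (\<lambda>z. restr u z - w z) l \<noteq> 0}"
    then consider "l \<in> core" | y where "l = emb y" "y \<in> far" using nodes_split(1) by blast
    then show "l \<in> core \<union> emb ` {y. w y \<noteq> 0}"
      by cases (use l far_node(2) in \<open>auto simp: extend_emb restr_def\<close>)
  qed
  then show ?thesis unfolding fs_def by (rule finite_subset) (simp add: finite_core assms)
qed

text \<open>Galerkin projection for the form that sums inner products of differences, which is
  coercive with constant 1 by construction; its strongly convergent projections are carried back to
  \<Lambda>.\<close>

lemma sq_approx:
  assumes u: "sq u"
  shows "approx u"
proof -
  obtain m where m: "0 < m" "S \<subseteq> cube m" using S_cube by blast
  interpret simple: lattice_form S "\<lambda>g h. \<Sum>s\<in>S. inner (g s) (h s) :: real" m 1 1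
  proof (unfold_locales, goal_cases)
    case (6 g h)
    have "\<bar>\<Sum>s\<in>S. inner (g s) (h s)\<bar> \<le> (\<Sum>s\<in>S. \<bar>norm (g s)\<bar> * \<bar>norm (h s)\<bar>)"
      by (rule order_trans[OF sum_abs]) (simp add: sum_mono Cauchy_Schwarz_ineq2)
    also have "\<dots> \<le> stencil_norm S g * stencil_norm S h"
      unfolding stencil_norm_def by (rule L2_set_mult_ineq)
    finally show ?case by simp
  qed (use m axis_in_S in \<open>auto simp: stencil_norm_sq power2_norm_eq_inner inner_add_left inner_add_right
      sum.distrib sum_distrib_left\<close>)
  obtain w where w: "\<And>n. finite {l. w n l \<noteq> 0}"
    "\<And>n. (\<lambda>l. (DZ (\<lambda>l. restr u l - w n l) l)\<^sup>2) summable_on UNIV"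
    "(\<lambda>n. \<Sum>\<^sub>\<infinity>l. (DZ (\<lambda>l. restr u l - w n l) l)\<^sup>2) \<longlonglongrightarrow> 0"
    using simple.galerkin_density[unfolded simple.D_def, OF restr_sq[OF u]] by blast
  obtain K where K: "0 \<le> K" "\<And>e. (\<lambda>z. (DZ e z)\<^sup>2) summable_on UNIV \<Longrightarrow> (nD (extend e))\<^sup>2 \<le> K * (\<Sum>\<^sub>\<infinity>z. (DZ e z)\<^sup>2)"
    using extend_sq by blast
  define W where "W n = (\<lambda>l. u l - extend (\<lambda>z. restr u z - w n z) l)" for n
  have "fs (W n)" for n unfolding W_def by (rule fs_correction[OF w(1)])
  moreover have "(\<lambda>n. nD (\<lambda>l. W n l - u l)) \<longlonglongrightarrow> 0"
  proof -
    have "(\<lambda>n. sqrt (K * (\<Sum>\<^sub>\<infinity>l. (DZ (\<lambda>l. restr u l - w n l) l)\<^sup>2))) \<longlonglongrightarrow> sqrt (K * 0)"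
      by (intro tendsto_intros w)
    then have lim: "(\<lambda>n. sqrt (K * (\<Sum>\<^sub>\<infinity>l. (DZ (\<lambda>l. restr u l - w n l) l)\<^sup>2))) \<longlonglongrightarrow> 0" by simp
    have "nD (\<lambda>l. W n l - u l) \<le> sqrt (K * (\<Sum>\<^sub>\<infinity>l. (DZ (\<lambda>l. restr u l - w n l) l)\<^sup>2))" for n
    proof -
      have "nD (\<lambda>l. W n l - u l) = nD (extend (\<lambda>z. restr u z - w n z))"
        using sq_nD_scaleR(2)[where a="-1" and v="extend (\<lambda>z. restr u z - w n z)"] by (simp add: W_def)
      also have "\<dots> \<le> sqrt (K * (\<Sum>\<^sub>\<infinity>l. (DZ (\<lambda>l. restr u l - w n l) l)\<^sup>2))"
        by (rule real_le_rsqrt[OF K(2)[OF w(2)]])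
      finally show ?thesis .
    qed
    then show ?thesis by (intro tendsto_sandwich[OF _ _ tendsto_const lim]) (auto intro!: always_eventually)
  qed
  ultimately show ?thesis unfolding approx_def using u by blast
qed

lemma finite_large_stencils:
  assumes "sq u" "0 < \<epsilon>"
  shows "finite {y. \<epsilon> \<le> DZ (restr u) y}"
proof -
  have "0 < \<epsilon>\<^sup>2" using assms(2) by simp
  from infsum_tail_small[OF restr_sq[OF assms(1)] _ this] obtain F
    where F: "finite F" "infsum (\<lambda>z. (DZ (restr u) z)\<^sup>2) (UNIV - F) < \<epsilon>\<^sup>2" by auto
  have "y \<in> F" if y: "\<epsilon> \<le> DZ (restr u) y" for y
  proof (rule ccontr)
    assume "y \<notin> F"
    have "(\<lambda>z. (DZ (restr u) z)\<^sup>2) summable_on UNIV - F"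
      using restr_sq[OF assms(1)] by (rule summable_on_subset_banach) simp
    then have "(DZ (restr u) y)\<^sup>2 \<le> infsum (\<lambda>z. (DZ (restr u) z)\<^sup>2) (UNIV - F)"
      using finite_sum_le_infsum[of "\<lambda>z. (DZ (restr u) z)\<^sup>2" "UNIV - F" "{y}"] \<open>y \<notin> F\<close> by simp
    moreover have "\<epsilon>\<^sup>2 \<le> (DZ (restr u) y)\<^sup>2" using y assms(2) by (intro power_mono) auto
    ultimately show False using F(2) by linarith
  qed
  then show ?thesis by (intro finite_subset[OF _ F(1)]) auto
qed

lemma translate_away:
  assumes "finite X" "finite (Y :: (int^'d) set)"
  shows "\<exists>t. \<forall>y\<in>Y. y + t \<notin> X"
proof -
  have inf: "infinite (UNIV :: (int^'d) set)"
  proof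
    assume "finite (UNIV :: (int^'d) set)"
    then obtain r where r: "(UNIV :: (int^'d) set) \<subseteq> cube r" using finite_subset_cube by blast
    have "axis undefined (int r + 1) \<in> (cube r :: (int^'d) set)" using r by blast
    then show False by (auto simp: cube_def axis_def dest!: spec[of _ undefined])
  qed
  have "finite ((\<lambda>(x, y). x - y) ` (X \<times> Y))" using assms by simp
  then obtain t where "t \<notin> (\<lambda>(x, y). x - y) ` (X \<times> Y)" using inf by (metis ex_new_if_finite)
  then show ?thesis by (intro exI[of _ t]) (force simp: image_iff)
qed

text \<open>Translating a test function to infinity replaces the second variation by the homogeneous form.\<close>
lemma hom_coercive:
  assumes u: "sq u" and c0: "\<And>v. fs v \<Longrightarrow> c0 * (nD v)\<^sup>2 \<le> ddE u v" and z: "finite {y. z y \<noteq> 0}"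
  shows "c0 * (\<Sum>\<^sub>\<infinity>y. (DZ z y)\<^sup>2) \<le> (\<Sum>\<^sub>\<infinity>y. e2 (\<lambda>_. 0) (conv (fd z y)) (conv (fd z y)))"
proof -
  obtain m where m: "0 < m" "S \<subseteq> cube m" using S_cube by blast
  obtain r where r: "{y. z y \<noteq> 0} \<subseteq> cube r" using finite_subset_cube[OF z] by blast
  then have zr: "z y = 0" if "y \<notin> cube r" for y using that by blast
  define Y :: "(int^'d) set" where "Y = cube (r + m)"
  have Yf: "finite Y" by (simp add: Y_def)
  have Y0: "conv (fd z y) = (\<lambda>_. 0)" "DZ z y = 0" if "y \<notin> Y" for y
    using fd_outside_support[where z=z and r=r and m=m and y=y, OF zr m(2)] that unfolding Y_def by blast+
  obtain l0 where l0: "l0 \<in> \<Lambda>" "Rdef + rcut \<le> norm l0" "\<R> l0 = \<R>hom" using Rhom_node by blast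
  have d20: "e2 g h (\<lambda>_. 0) = 0" for g h using d2_0[OF l0(1)] far_forms[OF l0(1) far_imp[OF l0(2)]] by simp
  define Q where "Q = (\<Sum>y\<in>Y. (DZ z y)\<^sup>2)"
  define H where "H = (\<Sum>y\<in>Y. e2 (\<lambda>_. 0) (conv (fd z y)) (conv (fd z y)))"
  have Q: "(\<Sum>\<^sub>\<infinity>y. (DZ z y)\<^sup>2) = Q" unfolding Q_def by (rule infsum_finite_support[OF Yf]) (simp add: Y0)
  have H: "(\<Sum>\<^sub>\<infinity>y. e2 (\<lambda>_. 0) (conv (fd z y)) (conv (fd z y))) = H"
    unfolding H_def by (rule infsum_finite_support[OF Yf]) (simp add: Y0 d20)
  obtain K where K: "0 \<le> K" "C2_bound 1 K \<R>hom Vhom e1 e2" using hom_forms unfolding C2_forms_def by blast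
  have Q0: "0 \<le> Q" by (simp add: Q_def sum_nonneg)
  have main: "c0 * Q \<le> H + K * \<epsilon> * Q" if \<epsilon>: "0 < \<epsilon>" "\<epsilon> \<le> 1" for \<epsilon>
  proof -
    define N where "N = (\<Union>l\<in>core. insert (near l) ((\<lambda>\<rho>. near (l + \<rho>)) ` \<R> l))"
    \<comment> \<open>The translate has to avoid the lattice points seen by core stencils, the sites
      where the strain of \<open>u\<close> is at least \<epsilon>, and the sites that are not far.
      All three sets are finite.\<close>
    define X where "X = N \<union> {y. \<epsilon> \<le> DZ (restr u) y} \<union> - far"
    have "finite N" unfolding N_def using finite_core finite_R by (auto simp: core_def)
    moreover have "finite (- far)" using far_cofinite finite_subset[OF _ finite_cube] by blast
    ultimately have "finite X" using finite_large_stencils[OF u \<epsilon>(1)] by (simp only: X_def finite_Un simp_thms)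
    from translate_away[OF this Yf] obtain t where t: "\<And>y. y \<in> Y \<Longrightarrow> y + t \<notin> X" by blast
    define zt where "zt y = z (y - t)" for y
    have fdt: "fd zt (y + t) = fd z y" for y by (simp add: fd_def zt_def fun_eq_iff algebra_simps)
    define Yt where "Yt = (\<lambda>y. y + t) ` Y"
    have Ytf: "finite Yt" by (simp add: Yt_def Yf)
    have Yt0: "conv (fd zt y) = (\<lambda>_. 0)" if "y \<notin> Yt" for y
    proof -
      have "y - t \<notin> Y" using that image_eqI[of y "\<lambda>y. y + t" "y - t" Y] by (auto simp: Yt_def)
      then show ?thesis using fdt[of "y - t"] Y0(1)[of "y - t"] by simp
    qed
    have "{y. zt y \<noteq> 0} = (\<lambda>y. y - t) -` {y. z y \<noteq> 0}" by (auto simp: zt_def)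
    moreover have "finite ((\<lambda>y. y - t) -` {y. z y \<noteq> 0})" by (rule finite_vimageI[OF z]) (simp add: inj_on_def)
    ultimately have fs: "fs (extend zt)" using fs_extend by simp
    have ztN: "zt y = 0" if "y \<in> N" for y
    proof (rule ccontr)
      assume "zt y \<noteq> 0"
      then have "y - t \<in> cube r" using r by (auto simp: zt_def)
      then have "y - t \<in> Y" using cube_mono[of r "r + m"] by (auto simp: Y_def)
      then show False using t[of "y - t"] that by (simp add: X_def)
    qed
    have core0: "st (extend zt) l = (\<lambda>_. 0)" if l: "l \<in> core" for l
    proof
      fix \<rho>
      have "near l \<in> N" "\<rho> \<in> \<R> l \<Longrightarrow> near (l + \<rho>) \<in> N" using l by (auto simp: N_def)
      then show "st (extend zt) l \<rho> = 0" using ztN by (simp add: fd_stencil_def extend_def)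
    qed
    have core1: "Dn (extend zt) l = 0" if l: "l \<in> core" for l
      using st_norm[of l "extend zt"] core0[OF l] by simp
    have coreL: "l \<in> \<Lambda>" if "l \<in> core" for l using that by (simp add: core_def)
    have Yfar: "Yt \<inter> far = Yt" using t by (auto simp: Yt_def X_def)
    have sumt: "(\<Sum>y\<in>Yt. f y) = (\<Sum>y\<in>Y. f (y + t))" for f :: "int^'d \<Rightarrow> real"
      unfolding Yt_def by (rule sum.reindex_cong[where l="\<lambda>y. y + t"]) auto
    have "(nD (extend zt))\<^sup>2 = (\<Sum>l\<in>core. (Dn (extend zt) l)\<^sup>2) + (\<Sum>y\<in>Yt \<inter> far. (DZ zt y)\<^sup>2)"
      using Ytf Yt0 fs by (rule nD_extend)
    then have "(nD (extend zt))\<^sup>2 = Q"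
      unfolding Yfar sumt fdt Q_def by (simp add: core1)
    moreover have "ddE u (extend zt) = (\<Sum>l\<in>core. d2 l (st u l) (st (extend zt) l) (st (extend zt) l)) +
      (\<Sum>y\<in>Yt \<inter> far. e2 (conv (fd (restr u) y)) (conv (fd zt y)) (conv (fd zt y)))"
      using Ytf Yt0 by (rule ddE_extend)
    then have "ddE u (extend zt) = (\<Sum>y\<in>Y. e2 (conv (fd (restr u) (y + t))) (conv (fd z y)) (conv (fd z y)))"
      unfolding Yfar sumt fdt by (simp add: core0 d2_0[OF coreL])
    moreover have "\<dots> \<le> (\<Sum>y\<in>Y. e2 (\<lambda>_. 0) (conv (fd z y)) (conv (fd z y)) + K * \<epsilon> * (DZ z y)\<^sup>2)"
    proof (rule sum_mono)
      fix y assume y: "y \<in> Y"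
      let ?k = "conv (fd z y)" and ?g = "conv (fd (restr u) (y + t))"
      have g: "stencil_norm \<R>hom ?g \<le> \<epsilon>" using t[OF y] unfolding conv_norm by (auto simp: X_def)
      have zs: "(\<lambda>_. 0) \<in> stencil_space \<R>hom" by (simp add: stencil_space_def)
      have "\<bar>e2 (\<lambda>\<rho>. 0 + ?g \<rho>) ?k ?k - e2 (\<lambda>_. 0) ?k ?k\<bar> \<le> K * stencil_norm \<R>hom ?g * stencil_norm \<R>hom ?k * stencil_norm \<R>hom ?k"
        using K(2)[unfolded C2_bound_def, rule_format, OF zs conv_space[of "fd (restr u) (y + t)"]] g \<epsilon> by simp
      also have "\<dots> \<le> K * \<epsilon> * stencil_norm \<R>hom ?k * stencil_norm \<R>hom ?k"
        using g K(1) by (intro mult_right_mono mult_left_mono) auto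
      finally show "e2 ?g ?k ?k \<le> e2 (\<lambda>_. 0) ?k ?k + K * \<epsilon> * (DZ z y)\<^sup>2"
        by (simp add: conv_norm power2_eq_square mult_ac)
    qed
    moreover have "\<dots> = H + K * \<epsilon> * Q" by (simp add: H_def Q_def sum.distrib sum_distrib_left)
    ultimately show ?thesis using c0[OF fs] by simp
  qed
  \<comment> \<open>The limit of \<open>main\<close> as \<epsilon> tends to 0, carried out with one
    sufficiently small \<epsilon>.\<close>
  have "c0 * Q \<le> H"
  proof (rule ccontr)
    assume "\<not> ?thesis"
    then have d: "0 < c0 * Q - H" by simp
    define \<epsilon> where "\<epsilon> = min 1 ((c0 * Q - H) / (2 * (K * Q + 1)))"
    have KQ: "0 \<le> K * Q" using K Q0 by simp
    have \<epsilon>: "0 < \<epsilon>" "\<epsilon> \<le> 1" "\<epsilon> \<le> (c0 * Q - H) / (2 * (K * Q + 1))" using d KQ by (auto simp: \<epsilon>_def)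
    define p where "p = \<epsilon> * (K * Q)"
    have "\<epsilon> * (2 * (K * Q + 1)) \<le> c0 * Q - H" using \<epsilon>(3) KQ by (simp add: pos_le_divide_eq)
    moreover have "\<epsilon> * (2 * (K * Q + 1)) = 2 * p + 2 * \<epsilon>" unfolding p_def by (simp only: distrib_left mult_1_right mult.left_commute)
    moreover have "c0 * Q - H \<le> p" using main[OF \<epsilon>(1,2)] unfolding p_def by (simp only: mult.left_commute mult.assoc diff_le_eq add.commute)
    moreover have "0 \<le> p" unfolding p_def by (rule mult_nonneg_nonneg[OF less_imp_le[OF \<epsilon>(1)] KQ])
    ultimately show False using \<epsilon>(1) by linarith
  qed
  then show ?thesis unfolding Q H .
qed

end

section \<open>The quadratic residual and the resulting rate\<close>

context defect_energy begin

lemma hom_linear: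
  "e1 g (\<lambda>\<rho>. x *\<^sub>R h \<rho> + h' \<rho>) = x * e1 g h + e1 g h'"
  "e2 g (\<lambda>\<rho>. x *\<^sub>R h \<rho> + h' \<rho>) j = x * e2 g h j + e2 g h' j"
  "e2 g j (\<lambda>\<rho>. x *\<^sub>R h \<rho> + h' \<rho>) = x * e2 g j h + e2 g j h'"
  using hom_forms unfolding C2_forms_def by blast+

lemma hom_zero: "e1 g (\<lambda>_. 0) = 0" "e2 g (\<lambda>_. 0) j = 0" "e2 g j (\<lambda>_. 0) = 0"
  using hom_linear(1)[of g 1 "\<lambda>_. 0" "\<lambda>_. 0"] hom_linear(2)[of g 1 "\<lambda>_. 0" "\<lambda>_. 0" j]
    hom_linear(3)[of g j 1 "\<lambda>_. 0" "\<lambda>_. 0"] by simp_all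

lemma sum_translate:
  fixes z :: "int^'d \<Rightarrow> real^'d"
  assumes z: "\<And>y. y \<notin> cube r \<Longrightarrow> z y = 0" and s: "s \<in> cube m" and N: "r + m \<le> N"
  shows "(\<Sum>y\<in>cube N. z (y + s)) = (\<Sum>y\<in>cube N. z y)"
proof -
  have "(\<Sum>y\<in>cube N. z (y + s)) = (\<Sum>y\<in>(\<lambda>y. y + s) ` cube N. z y)"
    by (rule sum.reindex_cong[where l="\<lambda>y. y - s"]) (auto simp: image_image inj_on_def)
  also have "\<dots> = (\<Sum>y\<in>cube r. z y)"
  proof (rule sum.mono_neutral_right)
    show "cube r \<subseteq> (\<lambda>y. y + s) ` cube N"
    proof
      fix y :: "int^'d" assume "y \<in> cube r"
      then have "y - s \<in> cube N" using cube_diff[of y r s m] s cube_mono[OF N] by blast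
      then show "y \<in> (\<lambda>y. y + s) ` cube N" by (rule rev_image_eqI) simp
    qed
  qed (use z in auto)
  also have "\<dots> = (\<Sum>y\<in>cube N. z y)"
    by (rule sum.mono_neutral_left) (use z N cube_mono[of r N] in auto)
  finally show ?thesis .
qed

text \<open>By linearity the sum is the form applied to the summed stencil, and the sum of a
  difference of a finitely supported function vanishes by translation.\<close>

lemma first_order_telescope:
  assumes z: "\<And>y. y \<notin> cube r \<Longrightarrow> z y = 0" and S: "S \<subseteq> cube m" and N: "r + m \<le> N"
  shows "(\<Sum>y\<in>cube N. e1 g (conv (fd z y))) = 0"
proof -
  have "(\<Sum>y\<in>Y. e1 g (conv (fd z y))) = e1 g (conv (\<lambda>s. \<Sum>y\<in>Y. fd z y s))" if "finite Y" for Y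
    using that
  proof (induction Y rule: finite_induct)
    case empty
    have "conv (\<lambda>s. 0) = (\<lambda>_. 0)" by (simp add: conv_def fun_eq_iff)
    then show ?case by (simp add: hom_zero)
  next
    case (insert y Y)
    then show ?case
      using conv_lin[of 1 "fd z y" "\<lambda>s. \<Sum>y\<in>Y. fd z y s"]
        hom_linear(1)[of g 1 "conv (fd z y)" "conv (\<lambda>s. \<Sum>y\<in>Y. fd z y s)"] by simp
  qed
  moreover have "conv (\<lambda>s. \<Sum>y\<in>cube N. fd z y s) = (\<lambda>_. 0)"
  proof
    fix \<rho>
    show "conv (\<lambda>s. \<Sum>y\<in>cube N. fd z y s) \<rho> = 0"
    proof (cases "\<rho> \<in> \<R>hom")
      case True
      then obtain s where s: "s \<in> S" "\<rho> = emb s" using emb_S by blast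
      then have "s \<in> cube m" using S by blast
      from sum_translate[where z=z and r=r, OF z this N]
      have "(\<Sum>y\<in>cube N. z (y + s)) = (\<Sum>y\<in>cube N. z y)" by blast
      then show ?thesis using True s by (simp add: conv_def fd_def sum_subtractf)
    qed (simp add: conv_def)
  qed
  ultimately show ?thesis by (simp add: hom_zero)
qed

text \<open>
  The first-order term of the homogeneous potential telescopes, so the residual is quadratic in
  the strain away from the core.
\<close>
lemma residual_bound:
  assumes u: "sq u" and crit: "\<And>v. fs v \<Longrightarrow> dE u v = 0"
  shows "\<exists>K\<ge>0. \<exists>q. \<forall>z. finite {y. z y \<noteq> 0} \<longrightarrow>
    \<bar>\<Sum>\<^sub>\<infinity>y. e2 (\<lambda>_. 0) (conv (fd z y)) (conv (fd (restr u) y))\<bar> \<le>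
      (\<Sum>\<^sub>\<infinity>y. K * ((DZ (restr u) y)\<^sup>2 + (if y \<in> cube q then 1 else 0)) * DZ z y)"
proof -
  obtain m where m: "0 < m" "S \<subseteq> cube m" using S_cube by blast
  define U where "U = DZ (restr u)"
  have U0: "0 \<le> U y" for y by (simp add: U_def)
  define M where "M = nD u + sqrt (\<Sum>\<^sub>\<infinity>y. (U y)\<^sup>2)"
  have M0: "0 \<le> M" by (simp add: M_def infsum_nonneg)
  have U: "U y \<le> M" for y
  proof -
    have "(U y)\<^sup>2 \<le> (\<Sum>\<^sub>\<infinity>y. (U y)\<^sup>2)"
      using finite_sum_le_infsum[OF restr_sq[OF u], of "{y}"] by (simp add: U_def)
    then have "U y \<le> sqrt (\<Sum>\<^sub>\<infinity>y. (U y)\<^sup>2)" by (rule real_le_rsqrt)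
    then show ?thesis unfolding M_def using nD_nonneg[of u] by linarith
  qed
  obtain K1 where K1: "0 \<le> K1" "\<And>l. l \<in> \<Lambda> \<Longrightarrow> C2_bound M K1 (\<R> l) (V l) (d1 l) (d2 l)"
    using C2_uniform by blast
  obtain K2 where K2: "0 \<le> K2" "C2_bound M K2 \<R>hom Vhom e1 e2" using hom_forms unfolding C2_forms_def by blast
  obtain K3 q1 where K3: "0 \<le> K3" "\<And>l e. l \<in> core \<Longrightarrow> Dn (extend e) l \<le> K3 * (\<Sum>z\<in>cube q1. DZ e z)"
    using core_bound by blast
  obtain q2 where q2: "- far \<subseteq> cube q2" using far_cofinite by blast
  \<comment> \<open>Covers the cube from \<open>core_bound\<close> and all sites that are not
    far.\<close>
  define q where "q = max q1 q2"
  define Kc where "Kc = real (card core) * (K1 * K3)"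
  define K where "K = K2 * (M + 1) + K2 + Kc"
  have Kc0: "0 \<le> Kc" using K1 K3 by (simp add: Kc_def)
  have zs: "(\<lambda>_. 0) \<in> stencil_space X" for X :: "(real^'d) set" by (simp add: stencil_space_def)
  have hom: "\<bar>e1 (conv (fd (restr u) y)) k - e1 (\<lambda>_. 0) k - e2 (\<lambda>_. 0) k (conv (fd (restr u) y))\<bar> \<le> K2 * (U y)\<^sup>2 * stencil_norm \<R>hom k"
    "\<bar>e1 (\<lambda>_. 0) k\<bar> \<le> K2 * stencil_norm \<R>hom k"
    "\<bar>e2 (\<lambda>_. 0) k (conv (fd (restr u) y))\<bar> \<le> K2 * stencil_norm \<R>hom k * U y"
    if k: "k \<in> stencil_space \<R>hom" for y k
  proof -
    have "stencil_norm \<R>hom (conv (fd (restr u) y)) \<le> M" unfolding conv_norm using U[of y] by (simp add: U_def)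
    then have *: "stencil_norm \<R>hom (\<lambda>_. 0 :: real^'d) \<le> M" "stencil_norm \<R>hom (\<lambda>\<rho>. 0 + conv (fd (restr u) y) \<rho>) \<le> M"
      using M0 by simp_all
    note b = K2(2)[unfolded C2_bound_def, rule_format, OF zs conv_space *]
    then have "\<bar>e2 (\<lambda>_. 0) k (conv (fd (restr u) y))\<bar> \<le> K2 * stencil_norm \<R>hom k * stencil_norm \<R>hom (conv (fd (restr u) y))"
      using k conv_space by blast
    then show "\<bar>e2 (\<lambda>_. 0) k (conv (fd (restr u) y))\<bar> \<le> K2 * stencil_norm \<R>hom k * U y"
      by (simp add: conv_norm U_def)
    from b show "\<bar>e1 (conv (fd (restr u) y)) k - e1 (\<lambda>_. 0) k - e2 (\<lambda>_. 0) k (conv (fd (restr u) y))\<bar> \<le> K2 * (U y)\<^sup>2 * stencil_norm \<R>hom k"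
      "\<bar>e1 (\<lambda>_. 0) k\<bar> \<le> K2 * stencil_norm \<R>hom k"
      using k by (simp_all add: conv_norm U_def)
  qed
  have core: "\<bar>d1 l (st u l) (st (extend z) l)\<bar> \<le> K1 * K3 * (\<Sum>y\<in>cube q1. DZ z y)" if l: "l \<in> core" for l z
  proof -
    have lL: "l \<in> \<Lambda>" using l by (simp add: core_def)
    have "stencil_norm (\<R> l) (st u l) \<le> M"
      unfolding st_norm M_def using Dn_le_nD[OF u lL] infsum_nonneg[of UNIV "\<lambda>y. (U y)\<^sup>2"] by (simp add: add_increasing2)
    then have *: "stencil_norm (\<R> l) (st u l) \<le> M" "stencil_norm (\<R> l) (\<lambda>\<rho>. st u l \<rho> + 0) \<le> M" by simp_all
    have "\<bar>d1 l (st u l) (st (extend z) l)\<bar> \<le> K1 * stencil_norm (\<R> l) (st (extend z) l)"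
      using K1(2)[OF lL, unfolded C2_bound_def, rule_format, OF st_space zs *] st_space by blast
    then have "\<bar>d1 l (st u l) (st (extend z) l)\<bar> \<le> K1 * Dn (extend z) l" unfolding st_norm .
    also have "\<dots> \<le> K1 * (K3 * (\<Sum>y\<in>cube q1. DZ z y))" using K3(2)[OF l] K1(1) by (rule mult_left_mono)
    finally show ?thesis by (simp add: mult.assoc)
  qed
  have "\<bar>\<Sum>\<^sub>\<infinity>y. e2 (\<lambda>_. 0) (conv (fd z y)) (conv (fd (restr u) y))\<bar> \<le>
      (\<Sum>\<^sub>\<infinity>y. K * ((U y)\<^sup>2 + (if y \<in> cube q then 1 else 0)) * DZ z y)"
    if z: "finite {y. z y \<noteq> 0}" for z
  proof -
    obtain r where "{y. z y \<noteq> 0} \<subseteq> cube r" using finite_subset_cube[OF z] by blast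
    then have zr: "\<And>y. y \<notin> cube r \<Longrightarrow> z y = 0" by blast
    define N where "N = r + m + q"
    have N: "r + m \<le> N" "q \<le> N" by (auto simp: N_def)
    have Y0: "conv (fd z y) = (\<lambda>_. 0)" "DZ z y = 0" if "y \<notin> cube N" for y
      using fd_outside_support[where z=z and r=r and m=m and y=y, OF zr m(2)] that cube_mono[OF N(1)] by blast+
    define k where "k y = conv (fd z y)" for y
    define h where "h y = conv (fd (restr u) y)" for y
    \<comment> \<open>The added first-order term sums to 0 by \<open>first_order_telescope\<close>;
      with it, \<open>a y\<close> is the first-order expansion at zero strain of the first
      derivative, tested with \<open>k y\<close>.\<close>
    define a where "a y = e2 (\<lambda>_. 0) (k y) (h y) + e1 (\<lambda>_. 0) (k y)" for y
    have ks: "k y \<in> stencil_space \<R>hom" and kn: "stencil_norm \<R>hom (k y) = DZ z y" for y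
      by (simp_all add: k_def conv_norm)
    have "(\<Sum>\<^sub>\<infinity>y. e2 (\<lambda>_. 0) (k y) (h y)) = (\<Sum>y\<in>cube N. e2 (\<lambda>_. 0) (k y) (h y))"
      by (rule infsum_finite_support) (simp_all add: k_def Y0 hom_zero)
    also have "\<dots> = (\<Sum>y\<in>cube N. a y)"
    proof -
      have "(\<Sum>y\<in>cube N. e1 (\<lambda>_. 0) (k y)) = 0"
        unfolding k_def using zr m(2) N(1) by (rule first_order_telescope)
      then show ?thesis by (simp add: a_def sum.distrib)
    qed
    \<comment> \<open>At far sites the actual first derivative is subtracted, which leaves a Taylor
      remainder, and its sum is added back separately; the equation for \<open>u\<close> tested with
      \<open>extend z\<close> then turns that sum into one over the core.\<close>
    also have "\<dots> = (\<Sum>y\<in>cube N. if y \<in> far then a y - e1 (h y) (k y) else a y) + (\<Sum>y\<in>cube N \<inter> far. e1 (h y) (k y))"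
    proof -
      have "(\<Sum>y\<in>cube N \<inter> far. e1 (h y) (k y)) = (\<Sum>y\<in>cube N. if y \<in> far then e1 (h y) (k y) else 0)"
        by (rule sum.inter_restrict) simp
      then show ?thesis unfolding sum.distrib[symmetric] by (simp add: sum.distrib[symmetric] if_distrib cong: sum.cong if_cong)
    qed
    also have "(\<Sum>y\<in>cube N \<inter> far. e1 (h y) (k y)) = - (\<Sum>l\<in>core. d1 l (st u l) (st (extend z) l))"
    proof -
      have "dE u (extend z) = (\<Sum>l\<in>core. d1 l (st u l) (st (extend z) l)) + (\<Sum>y\<in>cube N \<inter> far. e1 (h y) (k y))"
        unfolding h_def k_def by (rule dE_extend) (simp_all add: Y0)
      then show ?thesis using crit[OF fs_extend[OF z]] by simp
    qed
    finally have eq: "(\<Sum>\<^sub>\<infinity>y. e2 (\<lambda>_. 0) (k y) (h y)) =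
      (\<Sum>y\<in>cube N. if y \<in> far then a y - e1 (h y) (k y) else a y) + - (\<Sum>l\<in>core. d1 l (st u l) (st (extend z) l))" .
    have "\<bar>\<Sum>l\<in>core. d1 l (st u l) (st (extend z) l)\<bar> \<le> (\<Sum>l\<in>core. K1 * K3 * (\<Sum>y\<in>cube q1. DZ z y))"
      by (rule order_trans[OF sum_abs sum_mono]) (rule core)
    also have "\<dots> = Kc * (\<Sum>y\<in>cube q1. DZ z y)" by (simp add: Kc_def)
    also have "\<dots> \<le> Kc * (\<Sum>y\<in>cube q. DZ z y)"
      using Kc0 cube_mono[of q1 q] by (intro mult_left_mono sum_mono2) (auto simp: q_def)
    also have "(\<Sum>y\<in>cube q. DZ z y) = (\<Sum>y\<in>cube N. if y \<in> cube q then DZ z y else 0)"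
    proof -
      have "cube q = cube N \<inter> (cube q :: (int^'d) set)" using cube_mono[OF N(2)] by blast
      then show ?thesis using sum.inter_restrict[of "cube N" "DZ z" "cube q"] by simp
    qed
    finally have 1: "\<bar>\<Sum>l\<in>core. d1 l (st u l) (st (extend z) l)\<bar> \<le> (\<Sum>y\<in>cube N. Kc * (if y \<in> cube q then DZ z y else 0))"
      by (simp add: sum_distrib_left)
    have "\<bar>\<Sum>y\<in>cube N. if y \<in> far then a y - e1 (h y) (k y) else a y\<bar> \<le>
      (\<Sum>y\<in>cube N. \<bar>if y \<in> far then a y - e1 (h y) (k y) else a y\<bar>)" by (rule sum_abs)
    then have "\<bar>\<Sum>\<^sub>\<infinity>y. e2 (\<lambda>_. 0) (k y) (h y)\<bar> \<le>
      (\<Sum>y\<in>cube N. \<bar>if y \<in> far then a y - e1 (h y) (k y) else a y\<bar>) + (\<Sum>y\<in>cube N. Kc * (if y \<in> cube q then DZ z y else 0))"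
      using 1 unfolding eq by linarith
    also have "\<dots> = (\<Sum>y\<in>cube N. \<bar>if y \<in> far then a y - e1 (h y) (k y) else a y\<bar> + Kc * (if y \<in> cube q then DZ z y else 0))"
      by (simp add: sum.distrib)
    also have "\<dots> \<le> (\<Sum>y\<in>cube N. K * ((U y)\<^sup>2 + (if y \<in> cube q then 1 else 0)) * DZ z y)"
    proof (rule sum_mono)
      fix y :: "int^'d"
      have D0: "0 \<le> DZ z y" by simp
      have "0 \<le> M * K2 * DZ z y" "0 \<le> K2 * DZ z y" "0 \<le> Kc * DZ z y"
        "0 \<le> (M * K2 + K2 + Kc) * (U y)\<^sup>2 * DZ z y"
        "0 \<le> (M * K2 + K2 + K2 + Kc) * (U y)\<^sup>2 * DZ z y" using M0 K2 Kc0 by auto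
      note pos = this
      show "\<bar>if y \<in> far then a y - e1 (h y) (k y) else a y\<bar> + Kc * (if y \<in> cube q then DZ z y else 0)
        \<le> K * ((U y)\<^sup>2 + (if y \<in> cube q then 1 else 0)) * DZ z y"
      proof (cases "y \<in> far")
        case True
        have "\<bar>a y - e1 (h y) (k y)\<bar> \<le> K2 * (U y)\<^sup>2 * DZ z y"
          using hom(1)[OF ks[of y], of y] unfolding kn a_def h_def by linarith
        then show ?thesis using True pos by (auto simp: K_def algebra_simps)
      next
        case False
        then have yq: "y \<in> cube q" using q2 cube_mono[of q2 q] by (auto simp: q_def)
        have "K2 * DZ z y * U y \<le> K2 * DZ z y * M" using U K2(1) by (intro mult_left_mono) auto
        then have "\<bar>a y\<bar> \<le> K2 * DZ z y * M + K2 * DZ z y"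
          using hom(2,3)[OF ks[of y]] hom(3)[OF ks[of y], of y] unfolding kn a_def h_def by (smt (verit))
        then show ?thesis using False yq pos by (auto simp: K_def algebra_simps)
      qed
    qed
    also have "\<dots> = (\<Sum>\<^sub>\<infinity>y. K * ((U y)\<^sup>2 + (if y \<in> cube q then 1 else 0)) * DZ z y)"
      by (rule infsum_finite_support[symmetric]) (simp_all add: Y0)
    finally show ?thesis unfolding k_def h_def .
  qed
  moreover have "0 \<le> K" using K2 Kc0 M0 by (simp add: K_def)
  ultimately show ?thesis unfolding U_def by blast
qed

theorem defect_decay:
  assumes u: "sq u" and crit: "\<And>v. fs v \<Longrightarrow> dE u v = 0"
    and c0: "0 < c0" "\<And>v. fs v \<Longrightarrow> c0 * (nD v)\<^sup>2 \<le> ddE u v"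
  shows "\<exists>K\<ge>0. \<exists>s0. \<forall>s\<ge>s0. \<exists>w. (\<forall>y. y \<notin> cube ((CARD('d) + 3) * s) \<longrightarrow> w y = 0) \<and>
    (nD (extend (\<lambda>y. restr u y - w y)))\<^sup>2 \<le> K / real s ^ CARD('d)"
proof -
  obtain m where m: "0 < m" "S \<subseteq> cube m" using S_cube by blast
  \<comment> \<open>Radius 0 is enough, as the form is taken at zero strain.\<close>
  obtain K2 where K2: "0 \<le> K2" "C2_bound 0 K2 \<R>hom Vhom e1 e2" using hom_forms unfolding C2_forms_def by blast
  \<comment> \<open>The arguments are swapped so that \<open>B u z\<close> is the sum estimated by
    \<open>residual_bound\<close>, with \<open>u\<close> in the first slot as
    \<open>galerkin_decay\<close> requires; \<open>e2\<close> is not claimed to be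
    symmetric.\<close>
  interpret hom: lattice_form S "\<lambda>g h. e2 (\<lambda>_. 0) (conv h) (conv g)" m K2 c0
  proof
    fix g h :: "int^'d \<Rightarrow> real^'d"
    have zs: "(\<lambda>_. 0) \<in> stencil_space \<R>hom" by (simp add: stencil_space_def)
    have n: "stencil_norm \<R>hom (\<lambda>_. 0::real^'d) \<le> 0" "stencil_norm \<R>hom (\<lambda>_. 0 + 0::real^'d) \<le> 0" by simp_all
    have "\<bar>e2 (\<lambda>_. 0) (conv h) (conv g)\<bar> \<le> K2 * stencil_norm \<R>hom (conv h) * stencil_norm \<R>hom (conv g)"
      using K2(2)[unfolded C2_bound_def, rule_format, OF zs zs n] conv_space by blast
    then show "\<bar>e2 (\<lambda>_. 0) (conv h) (conv g)\<bar> \<le> K2 * stencil_norm S g * stencil_norm S h"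
      by (simp add: conv_norm mult_ac)
  qed (use m axis_in_S K2(1) c0 hom_coercive[OF u c0(2)] in \<open>auto simp: conv_lin hom_linear\<close>)
  obtain K q where K: "0 \<le> K" "\<And>z. finite {y. z y \<noteq> 0} \<Longrightarrow>
    \<bar>\<Sum>\<^sub>\<infinity>y. e2 (\<lambda>_. 0) (conv (fd z y)) (conv (fd (restr u) y))\<bar> \<le>
      (\<Sum>\<^sub>\<infinity>y. K * ((DZ (restr u) y)\<^sup>2 + (if y \<in> cube q then 1 else 0)) * DZ z y)"
    using residual_bound[OF u crit] by blast
  obtain K4 s0 where K4: "0 \<le> K4" "\<And>s. s \<ge> s0 \<Longrightarrow> \<exists>w. hom.supp_in ((CARD('d) + 3) * s) w \<and>
    (\<lambda>l. (DZ (\<lambda>l. restr u l - w l) l)\<^sup>2) summable_on UNIV \<and>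
    (\<Sum>\<^sub>\<infinity>l. (DZ (\<lambda>l. restr u l - w l) l)\<^sup>2) \<le> K4 / real s ^ CARD('d)"
    using hom.galerkin_decay[where u="restr u", unfolded hom.D_def hom.B_def, OF restr_sq[OF u] K] by blast
  obtain K5 where K5: "0 \<le> K5" "\<And>e. (\<lambda>z. (DZ e z)\<^sup>2) summable_on UNIV \<Longrightarrow> (nD (extend e))\<^sup>2 \<le> K5 * (\<Sum>\<^sub>\<infinity>z. (DZ e z)\<^sup>2)"
    using extend_sq by blast
  have "\<exists>w. (\<forall>y. y \<notin> cube ((CARD('d) + 3) * s) \<longrightarrow> w y = 0) \<and>
    (nD (extend (\<lambda>y. restr u y - w y)))\<^sup>2 \<le> K5 * K4 / real s ^ CARD('d)" if s: "s \<ge> s0" for s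
  proof -
    obtain w where w: "hom.supp_in ((CARD('d) + 3) * s) w" "(\<lambda>l. (DZ (\<lambda>l. restr u l - w l) l)\<^sup>2) summable_on UNIV"
      "(\<Sum>\<^sub>\<infinity>l. (DZ (\<lambda>l. restr u l - w l) l)\<^sup>2) \<le> K4 / real s ^ CARD('d)" using K4(2)[OF s] by blast
    have "(nD (extend (\<lambda>y. restr u y - w y)))\<^sup>2 \<le> K5 * (K4 / real s ^ CARD('d))"
      by (rule order_trans[OF K5(2)[OF w(2)] mult_left_mono[OF w(3) K5(1)]])
    then show ?thesis using w(1) unfolding hom.supp_in_def by auto
  qed
  moreover have "0 \<le> K5 * K4" using K4 K5 by simp
  ultimately show ?thesis by blast
qed

theorem convergence:
  assumes stable: "strongly_stable_solution \<Lambda> \<T> E (W_12 \<Lambda> \<T>) (W_c \<Lambda> \<T>) ubar"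
    and domains: "\<And>r. r > 0 \<Longrightarrow> finite (\<Omega> r) \<and> ball 0 r \<inter> \<Lambda> \<subseteq> \<Omega> r \<and> \<Omega> r \<subseteq> \<Lambda>"
  shows "\<exists>C>0. \<exists>R0>0. \<forall>r\<ge>R0. \<exists>uR.
    strongly_stable_solution \<Lambda> \<T> E (W_0 \<Lambda> \<T> (\<Omega> r)) (W_0 \<Lambda> \<T> (\<Omega> r)) uR \<and>
    uR \<in> local_minimisers \<Lambda> \<T> E (W_0 \<Lambda> \<T> (\<Omega> r)) \<and>
    L2_norm (\<lambda>x. grad \<Lambda> \<T> uR x - grad \<Lambda> \<T> ubar x) \<le> C * r powr (- (real CARD('d) / 2)) \<and>
    \<bar>E uR - E ubar\<bar> \<le> C * r powr (- real CARD('d))"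
proof -
  have sq: "sq ubar" using stable W_12_iff_sq by (simp add: strongly_stable_solution_def)
  have ap: "approx ubar" by (rule sq_approx[OF sq])
  obtain c0 where c0: "0 < c0" "\<And>v. fs v \<Longrightarrow> c0 * (nD v)\<^sup>2 \<le> ddE ubar v"
    using stable_variations(2)[OF ap stable] by blast
  obtain K s0 where K: "0 \<le> K" "\<And>s. s \<ge> s0 \<Longrightarrow> \<exists>w. (\<forall>y. y \<notin> cube ((CARD('d) + 3) * s) \<longrightarrow> w y = 0) \<and>
    (nD (extend (\<lambda>y. restr ubar y - w y)))\<^sup>2 \<le> K / real s ^ CARD('d)"
    using defect_decay[OF sq stable_variations(1)[OF ap stable] c0] by blast
  obtain C \<eta>0 where C: "0 < C" "0 < \<eta>0" and min: "\<And>\<eta> X w. 0 < \<eta> \<Longrightarrow> \<eta> \<le> \<eta>0 \<Longrightarrow> finite X \<Longrightarrow> X \<subseteq> \<Lambda> \<Longrightarrow>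
    (\<forall>l\<in>\<Lambda> - X. w l = 0) \<Longrightarrow> nD (\<lambda>l. w l - ubar l) \<le> \<eta> \<Longrightarrow>
    \<exists>uR. strongly_stable_solution \<Lambda> \<T> E (W_0 \<Lambda> \<T> X) (W_0 \<Lambda> \<T> X) uR \<and> uR \<in> local_minimisers \<Lambda> \<T> E (W_0 \<Lambda> \<T> X) \<and>
      L2_norm (\<lambda>x. G uR x - G ubar x) \<le> C * \<eta> \<and> \<bar>E uR - E ubar\<bar> \<le> C * \<eta>\<^sup>2"
    using minimiser_near_stable_solution[OF ap stable] by blast
  obtain \<beta> where \<beta>: "0 < \<beta>" "\<And>r z. z \<in> cube r \<Longrightarrow> norm (emb z) \<le> \<beta> * real r" using emb_upper by blast
  \<comment> \<open>Images of points of the cube that carries \<open>w\<close> have norm at most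
    \<open>B * real s\<close>.\<close>
  define B where "B = \<beta> * real (CARD('d) + 3)"
  have B: "0 < B" using \<beta> by (simp add: B_def)
  \<comment> \<open>The power of \<open>4 * B\<close> undoes the rescaling from \<open>s\<close> to
    \<open>r\<close>; the summand 1 keeps the constant positive when \<open>K = 0\<close>.\<close>
  define C1 where "C1 = sqrt (K * (4 * B) ^ CARD('d)) + 1"
  have C1: "0 < C1" "K * (4 * B) ^ CARD('d) \<le> C1\<^sup>2"
  proof -
    have nn: "0 \<le> K * (4 * B) ^ CARD('d)" using K B by simp
    then show "0 < C1" unfolding C1_def by (simp add: add_nonneg_pos)
    have "(sqrt (K * (4 * B) ^ CARD('d)))\<^sup>2 \<le> C1\<^sup>2" unfolding C1_def using nn by (intro power_mono) auto
    then show "K * (4 * B) ^ CARD('d) \<le> C1\<^sup>2" using nn by simp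
  qed
  define \<eta> where "\<eta> r = C1 * r powr (- (real CARD('d) / 2))" for r
  have "(\<eta> \<longlongrightarrow> C1 * 0) at_top"
    unfolding \<eta>_def by (intro tendsto_mult tendsto_const tendsto_neg_powr filterlim_ident) simp
  then have "\<forall>\<^sub>F r in at_top. \<eta> r < \<eta>0" using C(2) by (intro order_tendstoD(2)[of \<eta> "C1 * 0"]) auto
  then obtain R1 where R1: "\<And>r. R1 \<le> r \<Longrightarrow> \<eta> r < \<eta>0" unfolding eventually_at_top_linorder by blast
  \<comment> \<open>Large enough that \<open>\<eta> r < \<eta>0\<close>, that every node outside
    \<open>\<Omega> r\<close> is a lattice point, and that the rounded size \<open>s\<close> below
    is at least \<open>s0\<close>.\<close>
  define R0 where "R0 = \<bar>R1\<bar> + Rdef + 1 + 4 * B * (real s0 + 1)"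
  have "\<exists>uR. strongly_stable_solution \<Lambda> \<T> E (W_0 \<Lambda> \<T> (\<Omega> r)) (W_0 \<Lambda> \<T> (\<Omega> r)) uR \<and>
      uR \<in> local_minimisers \<Lambda> \<T> E (W_0 \<Lambda> \<T> (\<Omega> r)) \<and>
      L2_norm (\<lambda>x. G uR x - G ubar x) \<le> (C * C1 + C * C1\<^sup>2) * r powr (- (real CARD('d) / 2)) \<and>
      \<bar>E uR - E ubar\<bar> \<le> (C * C1 + C * C1\<^sup>2) * r powr (- real CARD('d))" if r: "R0 \<le> r" for r
  proof -
    have r1: "R1 \<le> r" "Rdef < r" "4 * B * (real s0 + 1) \<le> r" "0 < r"
    proof -
      have "0 \<le> 4 * B * (real s0 + 1)" using B by simp
      then show "R1 \<le> r" "Rdef < r" "4 * B * (real s0 + 1) \<le> r" "0 < r"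
        using r Rdef_pos unfolding R0_def by linarith+
    qed
    \<comment> \<open>The support of \<open>w\<close> then stays within radius \<open>r / 2\<close>,
      while rounding down still leaves \<open>r / (4 * B) \<le> s\<close>.\<close>
    define s where "s = nat \<lfloor>r / (2 * B)\<rfloor>"
    define x where "x = r / (4 * B)"
    have x: "r / (2 * B) = 2 * x" "real s0 + 1 \<le> x" "0 \<le> x"
      using r1(3,4) B by (simp_all add: x_def field_simps)
    then have s: "real s \<le> 2 * x" "2 * x < real s + 1" unfolding s_def x(1) by linarith+
    have "real s0 \<le> real s" using s(2) x(2) by linarith
    then have s0s: "s0 \<le> s" by simp
    have "0 < real s" using s(2) x(2) by linarith
    then have spos: "0 < s" by simp
    have sr: "r / (4 * B) \<le> real s" using s(2) x(2) unfolding x_def[symmetric] by linarith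
    obtain w where w: "\<And>y. y \<notin> cube ((CARD('d) + 3) * s) \<Longrightarrow> w y = 0"
      "(nD (extend (\<lambda>y. restr ubar y - w y)))\<^sup>2 \<le> K / real s ^ CARD('d)" using K(2)[OF s0s] by blast
    define W where "W = (\<lambda>l. ubar l - extend (\<lambda>z. restr ubar z - w z) l)"
    have W0: "W l = 0" if l: "l \<in> \<Lambda> - \<Omega> r" for l
    proof -
      have "r \<le> norm l" using l domains[OF r1(4)] by (force simp: not_less)
      then have ln: "Rdef \<le> norm l" using r1 by linarith
      then obtain y where y: "l = emb y" using node_emb l by blast
      have Wl: "W l = w y" using ln unfolding y by (simp add: W_def extend_emb restr_def)
      have "y \<notin> cube ((CARD('d) + 3) * s)"
      proof
        assume "y \<in> cube ((CARD('d) + 3) * s)"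
        from \<beta>(2)[OF this] have "norm l \<le> B * real s" by (simp add: y B_def mult_ac)
        also have "\<dots> \<le> B * (r / (2 * B))" using s(1) B unfolding x(1) by (intro mult_left_mono) auto
        also have "\<dots> = r / 2" using B by simp
        finally show False using \<open>r \<le> norm l\<close> r1(4) by linarith
      qed
      then show ?thesis using w(1) Wl by simp
    qed
    have pw: "r powr (- real CARD('d)) = 1 / r ^ CARD('d)"
      using r1(4) by (simp add: powr_minus powr_realpow divide_inverse)
    have \<eta>2: "(\<eta> r)\<^sup>2 = C1\<^sup>2 * r powr (- real CARD('d))"
      by (simp add: \<eta>_def power_mult_distrib power2_eq_square[of "r powr _"] powr_add[symmetric])
    have \<eta>0: "0 < \<eta> r" using C1 r1 by (simp add: \<eta>_def)
    have "nD (\<lambda>l. W l - ubar l) \<le> \<eta> r"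
    proof (rule power2_le_imp_le)
      have "nD (\<lambda>l. W l - ubar l) = nD (extend (\<lambda>z. restr ubar z - w z))"
        using sq_nD_scaleR(2)[where a="-1" and v="extend (\<lambda>z. restr ubar z - w z)"] by (simp add: W_def)
      then have "(nD (\<lambda>l. W l - ubar l))\<^sup>2 \<le> K / real s ^ CARD('d)" using w(2) by simp
      also have "\<dots> \<le> K / (r / (4 * B)) ^ CARD('d)"
        using sr K(1) r1(4) B spos by (intro divide_left_mono power_mono mult_pos_pos zero_less_power) auto
      also have "\<dots> = K * (4 * B) ^ CARD('d) * (1 / r ^ CARD('d))" by (simp add: power_divide)
      also have "\<dots> \<le> C1\<^sup>2 * (1 / r ^ CARD('d))" using C1(2) r1(4) by (intro mult_right_mono) auto
      finally show "(nD (\<lambda>l. W l - ubar l))\<^sup>2 \<le> (\<eta> r)\<^sup>2" unfolding \<eta>2 pw .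
    qed (use \<eta>0 in simp)
    then obtain uR where uR: "strongly_stable_solution \<Lambda> \<T> E (W_0 \<Lambda> \<T> (\<Omega> r)) (W_0 \<Lambda> \<T> (\<Omega> r)) uR"
      "uR \<in> local_minimisers \<Lambda> \<T> E (W_0 \<Lambda> \<T> (\<Omega> r))"
      "L2_norm (\<lambda>x. G uR x - G ubar x) \<le> C * \<eta> r" "\<bar>E uR - E ubar\<bar> \<le> C * (\<eta> r)\<^sup>2"
      using min[OF \<eta>0 less_imp_le[OF R1[OF r1(1)]], of "\<Omega> r" W] domains[OF r1(4)] W0 by blast
    have "C * \<eta> r \<le> (C * C1 + C * C1\<^sup>2) * r powr (- (real CARD('d) / 2))"
      using C C1 by (simp add: \<eta>_def algebra_simps)
    moreover have "C * (\<eta> r)\<^sup>2 \<le> (C * C1 + C * C1\<^sup>2) * r powr (- real CARD('d))"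
      unfolding \<eta>2 using C C1 by (simp add: algebra_simps)
    ultimately show ?thesis using uR by (meson order_trans)
  qed
  moreover have "0 < R0" using Rdef_pos B by (simp add: R0_def add_nonneg_pos add_pos_nonneg)
  moreover have "0 < C * C1 + C * C1\<^sup>2" using C C1 by (simp add: add_pos_pos)
  ultimately show ?thesis by blast
qed

end

theorem theorem2p4:
  fixes A :: "real^'d^'d"
    and Rdef :: real
    and \<Lambda> :: "(real^'d) set"
    and \<T> :: "(real^'d) set set"
    and rcut :: real
    and \<R> :: "real^'d \<Rightarrow> (real^'d) set"
    and \<R>hom :: "(real^'d) set"
    and V :: "real^'d \<Rightarrow> (real^'d \<Rightarrow> real^'d) \<Rightarrow> real"
    and Vhom :: "(real^'d \<Rightarrow> real^'d) \<Rightarrow> real"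
    and k :: nat
    and E :: "(real^'d \<Rightarrow> real^'d) \<Rightarrow> real"
    and ubar :: "real^'d \<Rightarrow> real^'d"
    and \<Omega> :: "real \<Rightarrow> (real^'d) set"
  assumes setting: "point_defect A Rdef \<Lambda> \<T> rcut \<R> \<R>hom V Vhom k"
    and energy: "continuous_extension \<Lambda> \<T> (energy_c \<Lambda> \<R> V) E"
    and stable: "strongly_stable_solution \<Lambda> \<T> E (W_12 \<Lambda> \<T>) (W_c \<Lambda> \<T>) ubar"
    and domains: "\<And>R. R > 0 \<Longrightarrow> finite (\<Omega> R) \<and> ball 0 R \<inter> \<Lambda> \<subseteq> \<Omega> R \<and> \<Omega> R \<subseteq> \<Lambda>"
  shows "\<exists>C>0. \<exists>R0>0. \<forall>R\<ge>R0. \<exists>uR.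
           strongly_stable_solution \<Lambda> \<T> E (W_0 \<Lambda> \<T> (\<Omega> R)) (W_0 \<Lambda> \<T> (\<Omega> R)) uR \<and>
           uR \<in> local_minimisers \<Lambda> \<T> E (W_0 \<Lambda> \<T> (\<Omega> R)) \<and>
           L2_norm (\<lambda>x. grad \<Lambda> \<T> uR x - grad \<Lambda> \<T> ubar x) \<le> C * R powr (- (real CARD('d) / 2)) \<and>
           \<bar>E uR - E ubar\<bar> \<le> C * R powr (- real CARD('d))"
proof -
  interpret point_defect A Rdef \<Lambda> \<T> rcut \<R> \<R>hom V Vhom k by (rule setting)
  obtain d1 d2 e1 e2 where forms: "energy_model \<Lambda> \<T> \<R> rcut V d1 d2 E" "C2_forms \<R>hom Vhom e1 e2"
    "\<And>l. l \<in> \<Lambda> \<Longrightarrow> Rdef \<le> norm l \<Longrightarrow> d1 l = e1 \<and> d2 l = e2"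
    using energy_model_forms[OF energy] by blast
  have "defect_energy A Rdef \<Lambda> \<T> rcut \<R> \<R>hom V Vhom k d1 d2 E e1 e2"
    by (intro defect_energy.intro setting forms(1) defect_energy_axioms.intro forms(2,3))
  then show ?thesis using stable domains by (rule defect_energy.convergence)
qed

end
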